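(* Let $h\in\mathcal H$ be continuous and not identically zero with $\|h'\|_2<\infty$, and let $\rho\ne0$. Let $a,c_2\in\mathbb R$ and $c_1>0$, and let $\Pi^0(u;t,x,w)=\widehat\Pi^0(u;t,x,w)$ be the feedback control with quantile function $$Q_{\Pi^0}(p)=Q_{\widehat\Pi^0}(p)=a(x-w)+c_1e^{c_2(T-t)}h'(1-p).$$ Let $\{\Pi^n(u;t,x,w)\}$ and $\{\widehat\Pi^n(u;t,x,w)\}$ be the sequences of feedback controls obtained by the updates, for $n\ge0$, $$Q_{\Pi^{n+1}}(p)=-\frac{\rho}{\sigma}\frac{V_x^{\Pi^n}}{V_{xx}^{\Pi^n}}+\frac{\lambda}{\sigma^2V_{xx}^{\Pi^n}}h'(1-p),\qquad Q_{\widehat\Pi^{n+1}}(p)=-\frac{\rho}{\sigma}\frac{\widehat V_x^{\widehat\Pi^n}}{\widehat V_{xx}^{\widehat\Pi^n}}+\sqrt{\frac{\lambda}{\sigma^2\|h'\|_2^2\widehat V_{xx}^{\widehat\Pi^n}}}\;h'(1-p),$$ where $\{V^{\Pi^n}(t,x;w)\}$ and $\{\widehat V^{\widehat\Pi^n}(t,x;w)\}$ are the corresponding value functions under the regularizers $\Phi_h$ and $\log\Phi_h$, respectively. Then for any $(t,x,w)\in[0,T]\times\mathbb R\times\mathbb R$, $$\lim_{n\to\infty}\Pi^n(\cdot;t,x,w)=\Pi^*(\cdot;t,x,w)\quad\text{and}\quad \lim_{n\to\infty}\widehat\Pi^n(\cdot;t,x,w)=\widehat\Pi^*(\cdot;t,x,w)\quad\text{weakly},$$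 and, for any $(t,x)\in[0,T)\times\mathbb R$ and $w\in\mathbb R$, $$\lim_{n\to\infty}V^{\Pi^n}(t,x;w)=V(t,x;w)\quad\text{and}\quad \lim_{n\to\infty}\widehat V^{\widehat\Pi^n}(t,x;w)=\widehat V(t,x;w).$$ Here $\Pi^*$ and $\widehat\Pi^*$ are the optimal controls, with quantile functions $$Q_{\Pi^*}(p)=-\frac{\rho}{\sigma}(x-w)+\frac{\lambda h'(1-p)}{2\sigma^2}e^{\rho^2(T-t)},\qquad Q_{\widehat\Pi^*}(p)=-\frac{\rho}{\sigma}(x-w)+\sqrt{\frac{\lambda}{2\sigma^2\|h'\|_2^2}}\,e^{\frac12\rho^2(T-t)}h'(1-p),$$ and $V$, $\widehat V$ are the (optimal) value functions $$V(t,x;w)=(x-w)^2e^{-\rho^2(T-t)}-\frac{\lambda^2\|h'\|_2^2}{4\rho^2\sigma^2}\left(e^{\rho^2(T-t)}-1\right)-(w-z)^2,$$ $$\widehat V(t,x;w)=(x-w)^2e^{-\rho^2(T-t)}+\frac{\lambda\rho^2}{4}(T^2-t^2)-\frac{\lambda}{2}\left(\rho^2T+\log\frac{\lambda\|h'\|_2^2}{2e\sigma^2}\right)(T-t)-(w-z)^2.$$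
   Context: Choquet regularizers. $\mathcal H$ is the set of concave functions $h:[0,1]\to\mathbb R$ of bounded variation with $h(0)=h(1)=0$. $h'$ is the right-derivative of $h$ and $\|h'\|_2=\left(\int_0^1 (h'(p))^2dp\right)^{1/2}$. For a probability distribution $\Pi$ on $\mathbb R$, $\Phi_h(\Pi)=\int_{-\infty}^0 [h(\Pi([x,\infty)))-h(1)]dx+\int_0^\infty h(\Pi([x,\infty)))dx\ (\ge0)$, with $\log0=-\infty$; $Q_\Pi(p)=\inf\{x\in\mathbb R:\Pi((-\infty,x])\ge p\}$ is the left-quantile function (identities for a.e. $p\in(0,1)$). Market and exploratory dynamics. Fix $T>0$, $z\in\mathbb R$, exploration weight $\lambda>0$, and a standard Brownian motion $W$ on a filtered probability space satisfying the usual conditions. The risky asset has appreciation rate $\mu_S\in\mathbb R$ and volatility $\sigma>0$, the riskless rate is $r>0$, and $\rho=(\mu_S-r)/\sigma$. A distributional control is a process $\Pi=\{\Pi_s\}$ of probability distributions on $\mathbb R$ with mean process $\mu_s=\int u\,d\Pi_s(u)$ and variance process $\sigma_s^2=\int u^2d\Pi_s(u)-\mu_s^2$; the wealth is $dX_s^\Pi=\rho\sigma\mu_s\,ds+\sigma\sqrt{\mu_s^2+\sigma_s^2}\,dW_s$. Values. For $R=\Phi_h$ (resp. $R=\log\Phi_h$), the value function under $\Pi$ is $$\mathbb E\Big[(X_T^\Pi-w)^2-\lambda\int_t^TR(\Pi_s)ds\,\Big|\,X_t^\Pi=x\Big]-(w-z)^2,$$ denoted $V^\Pi(t,x;w)$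 (resp. $\widehat V^\Pi(t,x;w)$). A feedback control is a deterministic map assigning to each $(t,x)$ a distribution $\Pi(\cdot;t,x,w)$ on $\mathbb R$; it generates the open-loop control $\Pi_s=\Pi(\cdot;s,X_s,w)$, where $X$ solves the wealth SDE with this control and $X_t=x$, and its value function is that of the generated open-loop control. In the update formulas the derivatives of the value functions are evaluated at $(t,x;w)$ and the quantile function is that of the distribution assigned to $(t,x)$. The optimal value functions are the infima of these values over admissible controls: each $\Pi_s$ is a.s. a probability distribution, $\{\Pi_s(A)\}$ is progressively measurable for every Borel $A$, $\mathbb E[\int_t^T(\mu_s^2+\sigma_s^2)ds]<\infty$, and $\mathbb E[(X_T^\Pi-w)^2-\lambda\int_t^TR(\Pi_s)ds\mid X_t^\Pi=x]<\infty$. *)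

theory Defs
  imports "HOL-Probability.Probability"
begin

section \<open>Extended-valued integrals\<close>

text \<open>
  The integral of an extended-real function, positive part minus negative part.  A plain Bochner
  integral would silently return 0 for a function whose integral is infinite, e.g. for the running
  reward of a Dirac control under the logarithmic regularizer (\<open>log 0 = -\<infinity>\<close>).
  The convention \<open>\<infinity> - \<infinity> = \<infinity>\<close> for \<^typ>\<open>ereal\<close> is
  never used in an essential way: under the square-integrability required of a control below, the
  positive part of the running reward is integrable.
\<close>

definition ext_integral :: "'a measure \<Rightarrow> ('a \<Rightarrow> ereal) \<Rightarrow> ereal" where
  "ext_integral M f =
     enn2ereal (\<integral>\<^sup>+ x. e2ennreal (f x) \<partial>M) - enn2ereal (\<integral>\<^sup>+ x. e2ennreal (- f x) \<partial>M)"

definition ext_log :: "ereal \<Rightarrow> ereal" where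
  "ext_log y = (if y \<le> 0 then - \<infinity> else if y = \<infinity> then \<infinity> else ereal (ln (real_of_ereal y)))"


section \<open>Choquet regularizers\<close>

definition bounded_variation_on :: "real \<Rightarrow> real \<Rightarrow> (real \<Rightarrow> real) \<Rightarrow> bool" where
  "bounded_variation_on a b f \<longleftrightarrow>
     (\<exists>B. \<forall>(n::nat) p. a \<le> p 0 \<longrightarrow> p n \<le> b \<longrightarrow> (\<forall>i<n. p i \<le> p (Suc i)) \<longrightarrow>
        (\<Sum>i<n. \<bar>f (p (Suc i)) - f (p i)\<bar>) \<le> B)"

text \<open>Values of \<open>h\<close> outside \<open>[0,1]\<close> are irrelevant.\<close>

definition distortions :: "(real \<Rightarrow> real) set" where
  "distortions = {h. concave_on {0..1} h \<and> bounded_variation_on 0 1 h \<and> h 0 = 0 \<and> h 1 = 0}"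

definition right_deriv :: "(real \<Rightarrow> real) \<Rightarrow> real \<Rightarrow> real" where
  "right_deriv h p = vector_derivative h (at_right p)"

definition deriv_square_integrable :: "(real \<Rightarrow> real) \<Rightarrow> bool" where
  "deriv_square_integrable h \<longleftrightarrow> set_integrable lborel {0..1} (\<lambda>p. (right_deriv h p)\<^sup>2)"

definition deriv_norm2 :: "(real \<Rightarrow> real) \<Rightarrow> real" where
  "deriv_norm2 h = sqrt (LBINT p:{0..1}. (right_deriv h p)\<^sup>2)"

definition choquet :: "(real \<Rightarrow> real) \<Rightarrow> real measure \<Rightarrow> ereal" where
  "choquet h P =
     ext_integral (restrict_space lborel {..0}) (\<lambda>x. ereal (h (measure P {x..}) - h 1)) +
     ext_integral (restrict_space lborel {0..}) (\<lambda>x. ereal (h (measure P {x..})))"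

definition log_choquet :: "(real \<Rightarrow> real) \<Rightarrow> real measure \<Rightarrow> ereal" where
  "log_choquet h P = ext_log (choquet h P)"

definition quantile :: "real measure \<Rightarrow> real \<Rightarrow> real" where
  "quantile P p = Inf {x. p \<le> cdf P x}"

definition has_quantile_function :: "real measure \<Rightarrow> (real \<Rightarrow> real) \<Rightarrow> bool" where
  "has_quantile_function P q \<longleftrightarrow> (AE p in lborel. 0 < p \<and> p < 1 \<longrightarrow> quantile P p = q p)"


section \<open>Brownian motion and the Ito integral\<close>

locale filtered_prob_space = prob_space M + complete_measure M
  for M :: "'a measure" and F :: "real \<Rightarrow> 'a measure" and T :: real +
  assumes subalgebra_F: "\<And>s. 0 \<le> s \<Longrightarrow> s \<le> T \<Longrightarrow> subalgebra M (F s)"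
    and mono_F: "\<And>s u. 0 \<le> s \<Longrightarrow> s \<le> u \<Longrightarrow> u \<le> T \<Longrightarrow> sets (F s) \<subseteq> sets (F u)"
    and null_sets_F: "null_sets M \<subseteq> sets (F 0)"
    and right_continuous_F: "\<And>s. 0 \<le> s \<Longrightarrow> s < T \<Longrightarrow> sets (F s) = (\<Inter>u\<in>{s<..T}. sets (F u))"

locale brownian_motion = filtered_prob_space M F T
  for M :: "'a measure" and F :: "real \<Rightarrow> 'a measure" and T :: real +
  fixes W :: "real \<Rightarrow> 'a \<Rightarrow> real"
  assumes adapted_W: "\<And>s. 0 \<le> s \<Longrightarrow> s \<le> T \<Longrightarrow> W s \<in> borel_measurable (F s)"
    and start_W: "AE \<omega> in M. W 0 \<omega> = 0"
    and continuous_W: "AE \<omega> in M. continuous_on {0..T} (\<lambda>s. W s \<omega>)"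
    and independent_W: "\<And>s u. 0 \<le> s \<Longrightarrow> s < u \<Longrightarrow> u \<le> T \<Longrightarrow>
          indep_set (sets (F s)) {(\<lambda>\<omega>. W u \<omega> - W s \<omega>) -` A \<inter> space M | A. A \<in> sets borel}"
    and normal_W: "\<And>s u. 0 \<le> s \<Longrightarrow> s < u \<Longrightarrow> u \<le> T \<Longrightarrow>
          distributed M lborel (\<lambda>\<omega>. W u \<omega> - W s \<omega>) (normal_density 0 (sqrt (u - s)))"

definition progressive ::
    "(real \<Rightarrow> 'a measure) \<Rightarrow> real \<Rightarrow> real \<Rightarrow> (real \<Rightarrow> 'a \<Rightarrow> real) \<Rightarrow> bool" where
  "progressive F t T Y \<longleftrightarrow>
     (\<forall>u\<in>{t..T}. (\<lambda>(s, \<omega>). Y s \<omega>) \<in> borel_measurable (restrict_space borel {t..u} \<Otimes>\<^sub>M F u))"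

text \<open>
  Simple integrands on \<open>[t,u]\<close> have the form
  \<open>(\<Sum>i<n. \<xi> i * indicator {\<tau> i<..\<tau> (i + 1)})\<close>, for a partition \<open>\<tau>\<close> of \<open>[t,u]\<close>
  into \<open>n\<close> pieces and bounded \<open>\<xi> i\<close> measurable at time \<open>\<tau> i\<close>.
\<close>

definition simple_integrand ::
    "'a measure \<Rightarrow> (real \<Rightarrow> 'a measure) \<Rightarrow> real \<Rightarrow> real \<Rightarrow>
      nat \<Rightarrow> (nat \<Rightarrow> real) \<Rightarrow> (nat \<Rightarrow> 'a \<Rightarrow> real) \<Rightarrow> bool" where
  "simple_integrand M F t u n \<tau> \<xi> \<longleftrightarrow>
     \<tau> 0 = t \<and> \<tau> n = u \<and> (\<forall>i<n. \<tau> i \<le> \<tau> (Suc i)) \<and>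
     (\<forall>i<n. \<xi> i \<in> borel_measurable (F (\<tau> i)) \<and> (\<exists>C. \<forall>\<omega>\<in>space M. \<bar>\<xi> i \<omega>\<bar> \<le> C))"

definition simple_process ::
    "nat \<Rightarrow> (nat \<Rightarrow> real) \<Rightarrow> (nat \<Rightarrow> 'a \<Rightarrow> real) \<Rightarrow> real \<Rightarrow> 'a \<Rightarrow> real" where
  "simple_process n \<tau> \<xi> s \<omega> = (\<Sum>i<n. \<xi> i \<omega> * indicator {\<tau> i<..\<tau> (Suc i)} s)"

definition simple_integral ::
    "(real \<Rightarrow> 'a \<Rightarrow> real) \<Rightarrow> nat \<Rightarrow> (nat \<Rightarrow> real) \<Rightarrow> (nat \<Rightarrow> 'a \<Rightarrow> real) \<Rightarrow> 'a \<Rightarrow> real" where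
  "simple_integral W n \<tau> \<xi> \<omega> = (\<Sum>i<n. \<xi> i \<omega> * (W (\<tau> (Suc i)) \<omega> - W (\<tau> i) \<omega>))"

text \<open>
  \<open>J\<close> is (a version of) the Ito integral of the square-integrable integrand \<open>H\<close> over
  \<open>[t,u]\<close>.  The integrands used below agree almost everywhere on \<open>[t,u] \<times> \<Omega>\<close> with a
  progressively measurable process, so the nonnegative integrals below are genuine integrals.
\<close>

definition has_Ito_integral ::
    "'a measure \<Rightarrow> (real \<Rightarrow> 'a measure) \<Rightarrow> (real \<Rightarrow> 'a \<Rightarrow> real) \<Rightarrow> real \<Rightarrow> real \<Rightarrow>
      (real \<Rightarrow> 'a \<Rightarrow> real) \<Rightarrow> ('a \<Rightarrow> real) \<Rightarrow> bool" where
  "has_Ito_integral M F W t u H J \<longleftrightarrow>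
     J \<in> borel_measurable M \<and>
     (\<exists>n \<tau> \<xi>.
        (\<forall>k::nat. simple_integrand M F t u (n k) (\<tau> k) (\<xi> k)) \<and>
        (\<lambda>k. \<integral>\<^sup>+ \<omega>. (\<integral>\<^sup>+ s\<in>{t..u}. ennreal ((H s \<omega> - simple_process (n k) (\<tau> k) (\<xi> k) s \<omega>)\<^sup>2) \<partial>lborel) \<partial>M)
          \<longlonglongrightarrow> 0 \<and>
        (\<lambda>k. \<integral>\<^sup>+ \<omega>. ennreal ((J \<omega> - simple_integral W (n k) (\<tau> k) (\<xi> k) \<omega>)\<^sup>2) \<partial>M) \<longlonglongrightarrow> 0)"


section \<open>Distributional controls, wealth and values\<close>

definition dist_mean :: "real measure \<Rightarrow> real" where
  "dist_mean P = (\<integral>u. u \<partial>P)"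

definition dist_var :: "real measure \<Rightarrow> real" where
  "dist_var P = (\<integral>u. u\<^sup>2 \<partial>P) - (dist_mean P)\<^sup>2"

text \<open>
  Distributional controls on \<open>[t,T]\<close>.  Since \<open>\<mu>\<^sub>s\<^sup>2 + \<sigma>\<^sub>s\<^sup>2\<close> is the second moment of
  \<open>\<P>\<^sub>s\<close>, its integrability is expressed by nonnegative integrals; this also ensures that
  the Bochner integrals in \<^const>\<open>dist_mean\<close> and \<^const>\<open>dist_var\<close> exist almost everywhere.
\<close>

definition distributional_control ::
    "'a measure \<Rightarrow> (real \<Rightarrow> 'a measure) \<Rightarrow> real \<Rightarrow> real \<Rightarrow> (real \<Rightarrow> 'a \<Rightarrow> real measure) \<Rightarrow> bool" where
  "distributional_control M F T t U \<longleftrightarrow>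
     (\<forall>s\<in>{t..T}. \<forall>\<omega>\<in>space M. sets (U s \<omega>) = sets borel) \<and>
     (\<forall>s\<in>{t..T}. AE \<omega> in M. prob_space (U s \<omega>)) \<and>
     (\<forall>A\<in>sets borel. progressive F t T (\<lambda>s \<omega>. measure (U s \<omega>) A)) \<and>
     (\<integral>\<^sup>+ \<omega>. (\<integral>\<^sup>+ s\<in>{t..T}. (\<integral>\<^sup>+ u. ennreal (u\<^sup>2) \<partial>U s \<omega>) \<partial>lborel) \<partial>M) < \<infinity>"

text \<open>
  \<open>X\<close> is a (continuous, adapted) wealth process on \<open>[t,T]\<close> under the control \<open>U\<close>,
  started from \<open>x\<close> at time \<open>t\<close>.
\<close>

definition wealth_process ::
    "'a measure \<Rightarrow> (real \<Rightarrow> 'a measure) \<Rightarrow> (real \<Rightarrow> 'a \<Rightarrow> real) \<Rightarrow> real \<Rightarrow> real \<Rightarrow> real \<Rightarrow>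
      real \<Rightarrow> real \<Rightarrow> (real \<Rightarrow> 'a \<Rightarrow> real measure) \<Rightarrow> (real \<Rightarrow> 'a \<Rightarrow> real) \<Rightarrow> bool" where
  "wealth_process M F W T \<rho> \<sigma> t x U X \<longleftrightarrow>
     (\<forall>s\<in>{t..T}. X s \<in> borel_measurable (F s)) \<and>
     (\<forall>\<omega>\<in>space M. continuous_on {t..T} (\<lambda>s. X s \<omega>)) \<and>
     (\<forall>u\<in>{t..T}. has_Ito_integral M F W t u
        (\<lambda>s \<omega>. \<sigma> * sqrt ((dist_mean (U s \<omega>))\<^sup>2 + dist_var (U s \<omega>)))
        (\<lambda>\<omega>. X u \<omega> - x - (LBINT s:{t..u}. \<rho> * \<sigma> * dist_mean (U s \<omega>))))"

text \<open>
  \<open>R\<close> is the regularizer: \<^term>\<open>choquet h\<close> or \<^term>\<open>log_choquet h\<close>.  Conditioning on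
  \<open>X\<^sub>t = x\<close> means that the wealth process is started from \<open>x\<close> at time \<open>t\<close>.
\<close>

definition expected_cost ::
    "'a measure \<Rightarrow> real \<Rightarrow> real \<Rightarrow> (real measure \<Rightarrow> ereal) \<Rightarrow> real \<Rightarrow> real \<Rightarrow>
      (real \<Rightarrow> 'a \<Rightarrow> real measure) \<Rightarrow> (real \<Rightarrow> 'a \<Rightarrow> real) \<Rightarrow> ereal" where
  "expected_cost M T lam R t w U X =
     ext_integral M (\<lambda>\<omega>. ereal ((X T \<omega> - w)\<^sup>2) -
       ereal lam * ext_integral (restrict_space lborel {t..T}) (\<lambda>s. R (U s \<omega>)))"

definition control_value ::
    "'a measure \<Rightarrow> real \<Rightarrow> real \<Rightarrow> real \<Rightarrow> (real measure \<Rightarrow> ereal) \<Rightarrow> real \<Rightarrow> real \<Rightarrow>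
      (real \<Rightarrow> 'a \<Rightarrow> real measure) \<Rightarrow> (real \<Rightarrow> 'a \<Rightarrow> real) \<Rightarrow> ereal" where
  "control_value M T lam z R t w U X = expected_cost M T lam R t w U X - ereal ((w - z)\<^sup>2)"

definition admissible ::
    "'a measure \<Rightarrow> (real \<Rightarrow> 'a measure) \<Rightarrow> (real \<Rightarrow> 'a \<Rightarrow> real) \<Rightarrow> real \<Rightarrow> real \<Rightarrow> real \<Rightarrow> real \<Rightarrow>
      (real measure \<Rightarrow> ereal) \<Rightarrow> real \<Rightarrow> real \<Rightarrow> real \<Rightarrow>
      (real \<Rightarrow> 'a \<Rightarrow> real measure) \<Rightarrow> (real \<Rightarrow> 'a \<Rightarrow> real) \<Rightarrow> bool" where
  "admissible M F W T \<rho> \<sigma> lam R t x w U X \<longleftrightarrow>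
     distributional_control M F T t U \<and> wealth_process M F W T \<rho> \<sigma> t x U X \<and>
     expected_cost M T lam R t w U X < \<infinity>"

definition optimal_value ::
    "'a measure \<Rightarrow> (real \<Rightarrow> 'a measure) \<Rightarrow> (real \<Rightarrow> 'a \<Rightarrow> real) \<Rightarrow> real \<Rightarrow> real \<Rightarrow> real \<Rightarrow> real \<Rightarrow> real \<Rightarrow>
      (real measure \<Rightarrow> ereal) \<Rightarrow> real \<Rightarrow> real \<Rightarrow> real \<Rightarrow> ereal" where
  "optimal_value M F W T \<rho> \<sigma> lam z R t x w =
     Inf {control_value M T lam z R t w U X | U X. admissible M F W T \<rho> \<sigma> lam R t x w U X}"


section \<open>Feedback controls\<close>

text \<open>A feedback control maps \<open>t\<close>, \<open>x\<close>, \<open>w\<close> to a distribution.\<close>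

definition feedback_control :: "real \<Rightarrow> (real \<Rightarrow> real \<Rightarrow> real \<Rightarrow> real measure) \<Rightarrow> bool" where
  "feedback_control T P \<longleftrightarrow> (\<forall>t\<in>{0..T}. \<forall>x w. real_distribution (P t x w))"

definition generated_control ::
    "(real \<Rightarrow> real \<Rightarrow> real \<Rightarrow> real measure) \<Rightarrow> real \<Rightarrow> (real \<Rightarrow> 'a \<Rightarrow> real) \<Rightarrow>
      real \<Rightarrow> 'a \<Rightarrow> real measure" where
  "generated_control P w X s \<omega> = P s (X s \<omega>) w"

text \<open>
  The description operator expresses that the value is that of the generated open-loop control;
  it denotes a meaningful value only if the closed-loop wealth equation has a solution and all
  solutions yield the same value.
\<close>

definition feedback_value ::
    "'a measure \<Rightarrow> (real \<Rightarrow> 'a measure) \<Rightarrow> (real \<Rightarrow> 'a \<Rightarrow> real) \<Rightarrow> real \<Rightarrow> real \<Rightarrow> real \<Rightarrow> real \<Rightarrow> real \<Rightarrow>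
      (real measure \<Rightarrow> ereal) \<Rightarrow> (real \<Rightarrow> real \<Rightarrow> real \<Rightarrow> real measure) \<Rightarrow> real \<Rightarrow> real \<Rightarrow> real \<Rightarrow> ereal" where
  "feedback_value M F W T \<rho> \<sigma> lam z R P t x w =
     (THE v. \<exists>X. distributional_control M F T t (generated_control P w X) \<and>
        wealth_process M F W T \<rho> \<sigma> t x (generated_control P w X) X \<and>
        v = control_value M T lam z R t w (generated_control P w X) X)"

definition optimal_feedback ::
    "'a measure \<Rightarrow> (real \<Rightarrow> 'a measure) \<Rightarrow> (real \<Rightarrow> 'a \<Rightarrow> real) \<Rightarrow> real \<Rightarrow> real \<Rightarrow> real \<Rightarrow> real \<Rightarrow> real \<Rightarrow>
      (real measure \<Rightarrow> ereal) \<Rightarrow> (real \<Rightarrow> real \<Rightarrow> real \<Rightarrow> real measure) \<Rightarrow> real \<Rightarrow> real \<Rightarrow> real \<Rightarrow> bool" where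
  "optimal_feedback M F W T \<rho> \<sigma> lam z R P t x w \<longleftrightarrow>
     (\<exists>X. admissible M F W T \<rho> \<sigma> lam R t x w (generated_control P w X) X \<and>
        control_value M T lam z R t w (generated_control P w X) X =
          optimal_value M F W T \<rho> \<sigma> lam z R t x w)"

text \<open>First and second derivative of an extended-real function where it is finite.\<close>

definition dx :: "(real \<Rightarrow> ereal) \<Rightarrow> real \<Rightarrow> real" where
  "dx v = deriv (\<lambda>y. real_of_ereal (v y))"

definition dxx :: "(real \<Rightarrow> ereal) \<Rightarrow> real \<Rightarrow> real" where
  "dxx v = deriv (dx v)"

end

theory Submission
  imports Defs
begin

text \<open>
  For any control, the second moment of \<open>X\<^sub>T - w\<close> is \<open>exp (- \<rho>\<^sup>2 (T - t)) (x - w)\<^sup>2\<close> plus the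
  expected integral of \<open>exp (- \<rho>\<^sup>2 (T - s)) ((\<rho> (X\<^sub>s - w) + \<sigma> \<mu>\<^sub>s)\<^sup>2 + \<sigma>\<^sup>2 \<sigma>\<^sub>s\<^sup>2)\<close>.  The square is
  minimized by \<open>\<mu>\<^sub>s = - (\<rho> / \<sigma>) (X\<^sub>s - w)\<close>.  Since \<open>\<Phi>\<^sub>h\<close> is the integral of the quantile function
  against \<open>h' (1 - p)\<close> and \<open>h'\<close> has mean zero, Cauchy-Schwarz bounds \<open>\<Phi>\<^sub>h\<close> by \<open>\<parallel>h'\<parallel>\<^sub>2 \<sigma>\<^sub>s\<close>, with
  equality for quantile functions \<open>m + c h' (1 - p)\<close>, and the remaining minimization over
  \<open>\<sigma>\<^sub>s\<close> is pointwise in \<open>s\<close>.  This gives the optimal value and the optimal control.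

  The value of a control of the form \<open>\<alpha> (x - w) + c(t) h' (1 - p)\<close> is
  \<open>exp ((2 \<rho> \<sigma> \<alpha> + \<sigma>\<^sup>2 \<alpha>\<^sup>2) (T - t)) (x - w)\<^sup>2\<close> plus a term independent of \<open>x\<close>.  One update therefore
  makes \<open>\<alpha> = - \<rho> / \<sigma>\<close>, the second one also makes \<open>c\<close> optimal, and the iteration is stationary from
  then on.  The closed-loop wealth equation has Lipschitz coefficients and is solved as the uniform
  limit of Euler schemes on dyadic grids.
\<close>

section \<open>Square-integrable functions\<close>

text \<open>The value of a feedback control is a definite description over all solutions of the
  closed-loop equation. It is resolved by one solution together with a cost formula valid for every
  solution: with \<open>\<kappa> = 2 * \<rho> * \<sigma> * \<alpha> + \<sigma>\<^sup>2 *
  \<alpha>\<^sup>2\<close> the weight \<open>exp (\<kappa> * (T - s))\<close> cancels all terms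
  quadratic in the wealth and leaves a deterministic integral. Write k for
  \<open>exp (- \<rho>\<^sup>2 * (T - s))\<close>, n for the norm of h' and v for a variance. At
  time s one minimizes \<open>k * \<sigma>\<^sup>2 * v - lam * n * sqrt v\<close>, respectively
  \<open>k * \<sigma>\<^sup>2 * v - lam * ln (n * sqrt v)\<close>. The minimizers have
  \<open>sqrt v = lam * n / (2 * k * \<sigma>\<^sup>2)\<close> and
  \<open>v = lam / (2 * k * \<sigma>\<^sup>2)\<close>; the optimal scale is
  \<open>sqrt v / n\<close>. An update reads its scale off the second derivative
  \<open>2 * exp (\<kappa> * (T - t))\<close>, and \<kappa> comes from the slope \<alpha> of the
  previous iterate; hence \<alpha> settles one step before the scale. Two mismatches shape the
  measure theory: simple integrands are bounded while Euler coefficients are not, and a control is a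
  probability measure only almost surely at each time.\<close>

definition L2 :: "'a measure \<Rightarrow> ('a \<Rightarrow> real) \<Rightarrow> bool" where
  "L2 M f \<longleftrightarrow> f \<in> borel_measurable M \<and> integrable M (\<lambda>x. (f x)\<^sup>2)"

lemma L2_measurable: "L2 M f \<Longrightarrow> f \<in> borel_measurable M"
  by (simp add: L2_def)

lemma L2_square: "L2 M f \<Longrightarrow> integrable M (\<lambda>x. (f x)\<^sup>2)"
  by (simp add: L2_def)

lemma abs_mult_le_squares: "\<bar>x * y\<bar> \<le> x\<^sup>2 + (y::real)\<^sup>2"
proof -
  have "0 \<le> (\<bar>x\<bar> - \<bar>y\<bar>)\<^sup>2" by simp
  then have "2 * \<bar>x * y\<bar> \<le> x\<^sup>2 + y\<^sup>2"
    by (simp add: power2_diff abs_mult)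
  then show ?thesis
    using abs_ge_zero[of "x * y"] by linarith
qed

lemma L2_mult: "L2 M f \<Longrightarrow> L2 M g \<Longrightarrow> integrable M (\<lambda>x. f x * g x)"
  by (rule Bochner_Integration.integrable_bound[of M "\<lambda>x. (f x)\<^sup>2 + (g x)\<^sup>2"])
     (auto simp: L2_def intro: abs_mult_le_squares)

lemma L2_bound:
  assumes "L2 M g" "f \<in> borel_measurable M" "AE x in M. \<bar>f x\<bar> \<le> \<bar>g x\<bar>"
  shows "L2 M f"
proof -
  have "AE x in M. norm ((f x)\<^sup>2) \<le> norm ((g x)\<^sup>2)"
    using assms(3) by eventually_elim (simp add: abs_le_square_iff)
  then show ?thesis
    using assms Bochner_Integration.integrable_bound[of M "\<lambda>x. (g x)\<^sup>2" "\<lambda>x. (f x)\<^sup>2"]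
    by (simp add: L2_def)
qed

lemma L2_cmult: "L2 M f \<Longrightarrow> L2 M (\<lambda>x. c * f x)"
  by (auto simp: L2_def power_mult_distrib)

lemma L2_minus: "L2 M f \<Longrightarrow> L2 M (\<lambda>x. - f x)"
  by (auto simp: L2_def)

lemma L2_add:
  assumes "L2 M f" "L2 M g" shows "L2 M (\<lambda>x. f x + g x)"
proof -
  have "(\<lambda>x. (f x + g x)\<^sup>2) = (\<lambda>x. (f x)\<^sup>2 + (g x)\<^sup>2 + 2 * (f x * g x))"
    by (simp add: power2_sum mult.assoc)
  then show ?thesis
    using assms L2_mult[OF assms] by (auto simp: L2_def)
qed

lemma L2_diff: "L2 M f \<Longrightarrow> L2 M g \<Longrightarrow> L2 M (\<lambda>x. f x - g x)"
  using L2_add[OF _ L2_minus, of M f g] by simp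

lemma L2_zero: "L2 M (\<lambda>_. 0)"
  by (simp add: L2_def)

lemma L2_sum: "(\<And>i. i \<in> I \<Longrightarrow> L2 M (f i)) \<Longrightarrow> L2 M (\<lambda>x. \<Sum>i\<in>I. f i x)"
  by (induction I rule: infinite_finite_induct) (auto intro: L2_add L2_zero)

lemma (in finite_measure) L2_const: "L2 M (\<lambda>_. c)"
  by (simp add: L2_def)

lemma (in finite_measure) L2_bounded:
  "f \<in> borel_measurable M \<Longrightarrow> (\<And>x. x \<in> space M \<Longrightarrow> \<bar>f x\<bar> \<le> c) \<Longrightarrow> L2 M f"
  by (rule L2_bound[OF L2_const[of c]]) (auto intro!: AE_I2 order.trans[OF _ abs_ge_self])

lemma (in finite_measure) L2_integrable: "L2 M f \<Longrightarrow> integrable M f"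
  using L2_mult[OF _ L2_const[of 1], of f] by simp

lemma L2_nn_integral:
  "L2 M f \<Longrightarrow> (\<integral>\<^sup>+x. ennreal ((f x)\<^sup>2) \<partial>M) = ennreal (\<integral>x. (f x)\<^sup>2 \<partial>M)"
  by (rule nn_integral_eq_integral) (auto simp: L2_def)

lemma L2I:
  assumes "f \<in> borel_measurable M" "(\<integral>\<^sup>+x. ennreal ((f x)\<^sup>2) \<partial>M) < \<infinity>"
  shows "L2 M f"
  using assms unfolding L2_def by (auto intro!: integrableI_bounded)

lemma L2_Cauchy_Schwarz:
  assumes "L2 M f" "L2 M g"
  shows "(\<integral>x. f x * g x \<partial>M)\<^sup>2 \<le> (\<integral>x. (f x)\<^sup>2 \<partial>M) * (\<integral>x. (g x)\<^sup>2 \<partial>M)"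
proof -
  have [measurable]: "f \<in> borel_measurable M" "g \<in> borel_measurable M"
    using assms by (auto simp: L2_def)
  \<comment> \<open>The inequality is taken for nonnegative integrals of absolute values;
    square-integrability keeps both sides finite, so it carries over to real numbers.\<close>
  have "(\<integral>\<^sup>+x. ennreal \<bar>f x\<bar> * ennreal \<bar>g x\<bar> \<partial>M) = ennreal (\<integral>x. \<bar>f x * g x\<bar> \<partial>M)"
    using integrable_abs[OF L2_mult[OF assms]]
    by (subst nn_integral_eq_integral[symmetric]) (auto simp: abs_mult ennreal_mult)
  moreover have "(\<integral>\<^sup>+x. (ennreal \<bar>f x\<bar>)\<^sup>2 \<partial>M) = ennreal (\<integral>x. (f x)\<^sup>2 \<partial>M)"
    using L2_nn_integral[OF assms(1)] by (simp add: ennreal_power)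
  moreover have "(\<integral>\<^sup>+x. (ennreal \<bar>g x\<bar>)\<^sup>2 \<partial>M) = ennreal (\<integral>x. (g x)\<^sup>2 \<partial>M)"
    using L2_nn_integral[OF assms(2)] by (simp add: ennreal_power)
  ultimately have "ennreal ((\<integral>x. \<bar>f x * g x\<bar> \<partial>M)\<^sup>2) \<le> ennreal ((\<integral>x. (f x)\<^sup>2 \<partial>M) * (\<integral>x. (g x)\<^sup>2 \<partial>M))"
    using Cauchy_Schwarz_nn_integral[of "\<lambda>x. ennreal \<bar>f x\<bar>" M "\<lambda>x. ennreal \<bar>g x\<bar>"]
    by (simp add: ennreal_power ennreal_mult)
  then have "(\<integral>x. \<bar>f x * g x\<bar> \<partial>M)\<^sup>2 \<le> (\<integral>x. (f x)\<^sup>2 \<partial>M) * (\<integral>x. (g x)\<^sup>2 \<partial>M)"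
    by (simp add: ennreal_le_iff)
  moreover have "\<bar>\<integral>x. f x * g x \<partial>M\<bar> \<le> (\<integral>x. \<bar>f x * g x\<bar> \<partial>M)"
    by (rule integral_abs_bound)
  then have "(\<integral>x. f x * g x \<partial>M)\<^sup>2 \<le> (\<integral>x. \<bar>f x * g x\<bar> \<partial>M)\<^sup>2"
    using power_mono[of "\<bar>\<integral>x. f x * g x \<partial>M\<bar>" _ 2] by simp
  ultimately show ?thesis by linarith
qed

lemma L2_add_bound:
  assumes "L2 M f" "L2 M g"
  shows "(\<integral>x. (f x + g x)\<^sup>2 \<partial>M) \<le> 2 * (\<integral>x. (f x)\<^sup>2 \<partial>M) + 2 * (\<integral>x. (g x)\<^sup>2 \<partial>M)"
proof -
  have "(\<integral>x. (f x + g x)\<^sup>2 \<partial>M) \<le> (\<integral>x. 2 * (f x)\<^sup>2 + 2 * (g x)\<^sup>2 \<partial>M)"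
  proof (intro integral_mono)
    show "(f x + g x)\<^sup>2 \<le> 2 * (f x)\<^sup>2 + 2 * (g x)\<^sup>2" for x
      using sum_squares_bound[of "f x" "g x"] by (simp add: power2_sum)
  qed (use assms L2_add[OF assms] in \<open>auto simp: L2_def\<close>)
  also have "\<dots> = 2 * (\<integral>x. (f x)\<^sup>2 \<partial>M) + 2 * (\<integral>x. (g x)\<^sup>2 \<partial>M)"
    using assms by (subst Bochner_Integration.integral_add) (auto simp: L2_def)
  finally show ?thesis .
qed

text \<open>Membership of all terms and of the limit is part of the notion: the Bochner integral of
  a non-integrable square is 0, so the convergence alone would say nothing.\<close>

definition L2_lim :: "'a measure \<Rightarrow> (nat \<Rightarrow> 'a \<Rightarrow> real) \<Rightarrow> ('a \<Rightarrow> real) \<Rightarrow> bool" where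
  "L2_lim M f g \<longleftrightarrow> (\<forall>k. L2 M (f k)) \<and> L2 M g \<and> (\<lambda>k. \<integral>x. (f k x - g x)\<^sup>2 \<partial>M) \<longlonglongrightarrow> 0"

text \<open>Bridge from the nonnegative integrals in \<open>has_Ito_integral\<close>. The distance
  is below 1 for some \<open>k\<close>, hence finite, and then \<open>g = f k - (f k - g)\<close> is
  square-integrable.\<close>

lemma L2_limI:
  assumes f: "\<And>k. L2 M (f k)" and g: "g \<in> borel_measurable M"
    and lim: "(\<lambda>k. \<integral>\<^sup>+x. ennreal ((f k x - g x)\<^sup>2) \<partial>M) \<longlonglongrightarrow> 0"
  shows "L2_lim M f g"
proof -
  have "eventually (\<lambda>k. (\<integral>\<^sup>+x. ennreal ((f k x - g x)\<^sup>2) \<partial>M) < 1) sequentially"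
    using lim by (rule order_tendstoD) simp
  then obtain k where k: "(\<integral>\<^sup>+x. ennreal ((f k x - g x)\<^sup>2) \<partial>M) < 1"
    by (auto simp: eventually_sequentially)
  then have "(\<integral>\<^sup>+x. ennreal ((f k x - g x)\<^sup>2) \<partial>M) < \<infinity>"
    using order.strict_trans[of _ 1 "\<infinity> :: ennreal"] by simp
  then have "L2 M (\<lambda>x. f k x - g x)"
    using f g by (intro L2I borel_measurable_diff) (auto simp: L2_def)
  from L2_diff[OF f[of k] this] have gL: "L2 M g" by simp
  have "(\<lambda>k. \<integral>x. (f k x - g x)\<^sup>2 \<partial>M) \<longlonglongrightarrow> 0"
    using tendsto_enn2real[of "\<lambda>k. \<integral>\<^sup>+x. ennreal ((f k x - g x)\<^sup>2) \<partial>M" 0] lim L2_nn_integral[OF L2_diff[OF f gL]] by simp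
  with f gL show ?thesis by (simp add: L2_lim_def)
qed

lemma L2_lim_inner:
  assumes fg: "L2_lim M f g" and h: "L2 M h"
  shows "(\<lambda>k. \<integral>x. f k x * h x \<partial>M) \<longlonglongrightarrow> (\<integral>x. g x * h x \<partial>M)"
proof (rule Lim_null[THEN iffD2], rule tendsto_0_le)
  show "(\<lambda>k. sqrt ((\<integral>x. (f k x - g x)\<^sup>2 \<partial>M) * (\<integral>x. (h x)\<^sup>2 \<partial>M))) \<longlonglongrightarrow> 0"
    using fg by (auto simp: L2_lim_def intro!: tendsto_eq_intros)
  show "\<forall>\<^sub>F k in sequentially. norm ((\<integral>x. f k x * h x \<partial>M) - (\<integral>x. g x * h x \<partial>M))
      \<le> norm (sqrt ((\<integral>x. (f k x - g x)\<^sup>2 \<partial>M) * (\<integral>x. (h x)\<^sup>2 \<partial>M))) * 1"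
  proof (intro always_eventually allI)
    fix k
    have f: "L2 M (f k)" and g: "L2 M g" using fg by (auto simp: L2_lim_def)
    have "(\<integral>x. f k x * h x \<partial>M) - (\<integral>x. g x * h x \<partial>M) = (\<integral>x. (f k x - g x) * h x \<partial>M)"
      using L2_mult[OF f h] L2_mult[OF g h] by (simp add: left_diff_distrib)
    also have "\<bar>\<dots>\<bar> \<le> sqrt ((\<integral>x. (f k x - g x)\<^sup>2 \<partial>M) * (\<integral>x. (h x)\<^sup>2 \<partial>M))"
      using L2_Cauchy_Schwarz[OF L2_diff[OF f g] h] by (rule real_le_rsqrt[OF order.trans, rotated]) simp
    finally show "norm ((\<integral>x. f k x * h x \<partial>M) - (\<integral>x. g x * h x \<partial>M))
      \<le> norm (sqrt ((\<integral>x. (f k x - g x)\<^sup>2 \<partial>M) * (\<integral>x. (h x)\<^sup>2 \<partial>M))) * 1"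
      by simp
  qed
qed

lemma L2_lim_norm:
  assumes fg: "L2_lim M f g"
  shows "(\<lambda>k. \<integral>x. (f k x)\<^sup>2 \<partial>M) \<longlonglongrightarrow> (\<integral>x. (g x)\<^sup>2 \<partial>M)"
proof -
  have f: "L2 M (f k)" for k using fg by (auto simp: L2_lim_def)
  have g: "L2 M g" using fg by (auto simp: L2_lim_def)
  \<comment> \<open>Apart from the distance to \<open>g\<close>, the right-hand side contains only
    inner products with the fixed function \<open>g\<close>, to which \<open>L2_lim_inner\<close>
    applies.\<close>
  have eq: "(\<integral>x. (f k x)\<^sup>2 \<partial>M) =
      (\<integral>x. (f k x - g x)\<^sup>2 \<partial>M) + 2 * (\<integral>x. f k x * g x \<partial>M) - (\<integral>x. g x * g x \<partial>M)" for k
  proof -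
    have "(\<integral>x. (f k x - g x)\<^sup>2 \<partial>M) = (\<integral>x. (f k x)\<^sup>2 - 2 * (f k x * g x) + g x * g x \<partial>M)"
      by (intro Bochner_Integration.integral_cong) (auto simp: power2_eq_square algebra_simps)
    also have "\<dots> = (\<integral>x. (f k x)\<^sup>2 \<partial>M) - 2 * (\<integral>x. f k x * g x \<partial>M) + (\<integral>x. g x * g x \<partial>M)"
      using L2_mult[OF f g] L2_mult[OF g g] L2_square[OF f] by simp
    finally show ?thesis by simp
  qed
  have "(\<lambda>k. (\<integral>x. (f k x - g x)\<^sup>2 \<partial>M) + 2 * (\<integral>x. f k x * g x \<partial>M) - (\<integral>x. g x * g x \<partial>M))
     \<longlonglongrightarrow> 0 + 2 * (\<integral>x. g x * g x \<partial>M) - (\<integral>x. g x * g x \<partial>M)"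
    using fg by (intro tendsto_intros L2_lim_inner[OF fg g]) (simp add: L2_lim_def)
  then show ?thesis
    unfolding eq by (simp add: power2_eq_square)
qed

lemma L2_lim_diff:
  assumes "L2_lim M f g" "L2_lim M f' g'"
  shows "L2_lim M (\<lambda>k x. f k x - f' k x) (\<lambda>x. g x - g' x)"
proof -
  have f: "L2 M (f k)" "L2 M (f' k)" for k
    using assms by (auto simp: L2_lim_def)
  have g: "L2 M g" "L2 M g'"
    using assms by (auto simp: L2_lim_def)
  have "(\<lambda>k. \<integral>x. (f k x - f' k x - (g x - g' x))\<^sup>2 \<partial>M) \<longlonglongrightarrow> 0"
  proof (rule tendsto_sandwich[OF _ _ tendsto_const])
    show "(\<lambda>k. 2 * (\<integral>x. (f k x - g x)\<^sup>2 \<partial>M) + 2 * (\<integral>x. (f' k x - g' x)\<^sup>2 \<partial>M)) \<longlonglongrightarrow> 0"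
      using assms by (auto simp: L2_lim_def intro!: tendsto_eq_intros)
    have "(\<integral>x. (f k x - f' k x - (g x - g' x))\<^sup>2 \<partial>M)
        \<le> 2 * (\<integral>x. (f k x - g x)\<^sup>2 \<partial>M) + 2 * (\<integral>x. (f' k x - g' x)\<^sup>2 \<partial>M)" for k
      using L2_add_bound[OF L2_diff[OF f(1)[of k] g(1)] L2_minus[OF L2_diff[OF f(2)[of k] g(2)]]]
      by (simp add: algebra_simps power2_commute)
    then show "\<forall>\<^sub>F k in sequentially. (\<integral>x. (f k x - f' k x - (g x - g' x))\<^sup>2 \<partial>M)
        \<le> 2 * (\<integral>x. (f k x - g x)\<^sup>2 \<partial>M) + 2 * (\<integral>x. (f' k x - g' x)\<^sup>2 \<partial>M)"
      by simp
  qed auto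
  then show ?thesis
    using f g by (auto simp: L2_lim_def intro: L2_diff)
qed

section \<open>Moments and orthogonality of weighted Brownian increments\<close>

context brownian_motion
begin

lemma space_F: "0 \<le> s \<Longrightarrow> s \<le> T \<Longrightarrow> space (F s) = space M"
  using subalgebra_F by (simp add: subalgebra_def)

lemma measurable_F_M: "0 \<le> s \<Longrightarrow> s \<le> T \<Longrightarrow> f \<in> measurable (F s) N \<Longrightarrow> f \<in> measurable M N"
  by (rule measurable_from_subalg[OF subalgebra_F])

lemma measurable_F_mono:
  "0 \<le> s \<Longrightarrow> s \<le> u \<Longrightarrow> u \<le> T \<Longrightarrow> f \<in> measurable (F s) N \<Longrightarrow> f \<in> measurable (F u) N"
  by (rule measurable_from_subalg[of "F u" "F s"]) (auto simp: subalgebra_def space_F dest: mono_F)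

lemma W_diff_measurable_F:
  "0 \<le> s \<Longrightarrow> s \<le> u \<Longrightarrow> u \<le> T \<Longrightarrow> (\<lambda>\<omega>. W u \<omega> - W s \<omega>) \<in> borel_measurable (F u)"
  by (rule borel_measurable_diff[OF adapted_W measurable_F_mono[OF _ _ _ adapted_W]]) auto

lemma W_diff_measurable:
  "0 \<le> s \<Longrightarrow> s \<le> u \<Longrightarrow> u \<le> T \<Longrightarrow> (\<lambda>\<omega>. W u \<omega> - W s \<omega>) \<in> borel_measurable M"
  by (rule measurable_F_M[OF _ _ W_diff_measurable_F[of s u]]) auto

lemma Int_stable_vimages: "Int_stable {Z -` A \<inter> space M |A. A \<in> sets N}"
proof (rule Int_stableI, clarify)
  fix A B assume "A \<in> sets N" "B \<in> sets N"
  moreover have "(Z -` A \<inter> space M) \<inter> (Z -` B \<inter> space M) = Z -` (A \<inter> B) \<inter> space M"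
    by auto
  ultimately show "\<exists>C. (Z -` A \<inter> space M) \<inter> (Z -` B \<inter> space M) = Z -` C \<inter> space M \<and> C \<in> sets N"
    by (intro exI[of _ "A \<inter> B"]) auto
qed

text \<open>Independence is given for the sets of \<open>F s\<close> and the preimages under the
  increment. Preimages under \<open>Z\<close> lie in \<open>F s\<close>; both families of preimages
  are closed under intersection, so independence extends to the generated sigma-algebras.\<close>

lemma indep_increment:
  assumes "0 \<le> s" "s < u" "u \<le> T" and Z: "Z \<in> borel_measurable (F s)"
  shows "indep_var borel Z borel (\<lambda>\<omega>. W u \<omega> - W s \<omega>)"
  unfolding indep_var_eq
proof (intro conjI)
  let ?D = "\<lambda>\<omega>. W u \<omega> - W s \<omega>"
  show "random_variable borel Z" using measurable_F_M[OF _ _ Z] assms by simp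
  show "random_variable borel ?D" by (rule W_diff_measurable) (use assms in auto)
  have "indep_set (sets (F s)) {?D -` A \<inter> space M |A. A \<in> sets borel}"
    using independent_W assms by auto
  then have "indep_set {Z -` A \<inter> space M |A. A \<in> sets borel} {?D -` A \<inter> space M |A. A \<in> sets borel}"
    unfolding indep_set_def
  proof (rule indep_sets_mono_sets)
    have "Z -` A \<inter> space M \<in> sets (F s)" if "A \<in> sets borel" for A
      using measurable_sets[OF Z that] assms space_F[of s] by simp
    then show "case_bool {Z -` A \<inter> space M |A. A \<in> sets borel} {?D -` A \<inter> space M |A. A \<in> sets borel} i
      \<subseteq> case_bool (sets (F s)) {?D -` A \<inter> space M |A. A \<in> sets borel} i" for i
      by (auto split: bool.split)
  qed
  then show "indep_set (sigma_sets (space M) {Z -` A \<inter> space M |A. A \<in> sets borel})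
     (sigma_sets (space M) {?D -` A \<inter> space M |A. A \<in> sets borel})"
    by (rule indep_set_sigma_sets) (rule Int_stable_vimages)+
qed

lemma increment_moments:
  assumes "0 \<le> s" "s \<le> u" "u \<le> T"
  shows "L2 M (\<lambda>\<omega>. W u \<omega> - W s \<omega>)" "expectation (\<lambda>\<omega>. W u \<omega> - W s \<omega>) = 0"
    "expectation (\<lambda>\<omega>. (W u \<omega> - W s \<omega>)\<^sup>2) = u - s"
proof -
  let ?D = "\<lambda>\<omega>. W u \<omega> - W s \<omega>"
  have "L2 M ?D \<and> expectation ?D = 0 \<and> expectation (\<lambda>\<omega>. (?D \<omega>)\<^sup>2) = u - s"
  \<comment> \<open>The law and the independence of increments are postulated for
    \<open>s < u\<close> only; the degenerate increment is identically 0.\<close>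
  proof (cases "s = u")
    case True
    then show ?thesis by (simp add: L2_def)
  next
    case False
    then have su: "s < u" and pos: "0 < sqrt (u - s)" using assms by auto
    have D: "distributed M lborel ?D (normal_density 0 (sqrt (u - s)))"
      using normal_W assms su by auto
    have e: "expectation ?D = 0" by (rule normal_distributed_expectation[OF pos D])
    have "integrable lborel (\<lambda>x. normal_density 0 (sqrt (u - s)) x * x\<^sup>2)"
      using integrable_normal_moment[OF pos, of 0 2] by simp
    then have "integrable M (\<lambda>\<omega>. (?D \<omega>)\<^sup>2)"
      by (subst distributed_integrable[OF D, symmetric]) auto
    moreover have "expectation (\<lambda>\<omega>. (?D \<omega>)\<^sup>2) = u - s"
      using normal_distributed_variance[OF pos D] e su by simp
    ultimately show ?thesis using e W_diff_measurable[OF assms] by (simp add: L2_def)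
  qed
  then show "L2 M ?D" "expectation ?D = 0" "expectation (\<lambda>\<omega>. (?D \<omega>)\<^sup>2) = u - s" by auto
qed

text \<open>The coefficients that an elementary stochastic integral may carry at time
  \<open>s\<close>. The bounds on \<open>s\<close> are included because the facts about
  \<open>F s\<close> hold on [0,T] only.\<close>

definition L2_at :: "real \<Rightarrow> ('a \<Rightarrow> real) \<Rightarrow> bool" where
  "L2_at s Z \<longleftrightarrow> 0 \<le> s \<and> s \<le> T \<and> Z \<in> borel_measurable (F s) \<and> L2 M Z"

lemma L2_at_mono: "L2_at s Z \<Longrightarrow> s \<le> u \<Longrightarrow> u \<le> T \<Longrightarrow> L2_at u Z"
  unfolding L2_at_def by (auto intro: measurable_F_mono[of s u])

lemma L2_at_add: "L2_at s Z \<Longrightarrow> L2_at s Z' \<Longrightarrow> L2_at s (\<lambda>\<omega>. Z \<omega> + Z' \<omega>)"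
  by (auto simp: L2_at_def intro: L2_add)

lemma L2_at_cmult: "L2_at s Z \<Longrightarrow> L2_at s (\<lambda>\<omega>. c * Z \<omega>)"
  by (auto simp: L2_at_def intro: L2_cmult)

lemma L2_at_minus: "L2_at s Z \<Longrightarrow> L2_at s (\<lambda>\<omega>. - Z \<omega>)"
  by (auto simp: L2_at_def intro: L2_minus)

lemma L2_at_const: "0 \<le> s \<Longrightarrow> s \<le> T \<Longrightarrow> L2_at s (\<lambda>_. c)"
  by (auto simp: L2_at_def intro: L2_const)

lemma L2_at_sum:
  "0 \<le> s \<Longrightarrow> s \<le> T \<Longrightarrow> (\<And>i. i \<in> I \<Longrightarrow> L2_at s (Z i)) \<Longrightarrow> L2_at s (\<lambda>\<omega>. \<Sum>i\<in>I. Z i \<omega>)"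
  by (auto simp: L2_at_def intro!: L2_sum borel_measurable_sum)

lemma L2_at_L2: "L2_at s Z \<Longrightarrow> L2 M Z"
  by (simp add: L2_at_def)

text \<open>\<open>Z\<close> is unbounded, so the integrability of the squared product comes from
  independence: the expectation of a product of independent integrable factors exists and
  factorizes.\<close>

lemma increment_mult:
  assumes Z: "L2_at s Z" and "s \<le> u" "u \<le> T"
  shows "L2_at u (\<lambda>\<omega>. Z \<omega> * (W u \<omega> - W s \<omega>))"
    and "expectation (\<lambda>\<omega>. (Z \<omega> * (W u \<omega> - W s \<omega>))\<^sup>2) = (u - s) * expectation (\<lambda>\<omega>. (Z \<omega>)\<^sup>2)"
proof -
  let ?D = "\<lambda>\<omega>. W u \<omega> - W s \<omega>"
  have s: "0 \<le> s" using Z by (simp add: L2_at_def)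
  have meas: "(\<lambda>\<omega>. Z \<omega> * ?D \<omega>) \<in> borel_measurable (F u)"
    using Z s assms(2,3)
    by (intro borel_measurable_times W_diff_measurable_F measurable_F_mono[of s u Z]) (simp_all add: L2_at_def)
  have "integrable M (\<lambda>\<omega>. (Z \<omega> * ?D \<omega>)\<^sup>2) \<and>
    expectation (\<lambda>\<omega>. (Z \<omega> * ?D \<omega>)\<^sup>2) = (u - s) * expectation (\<lambda>\<omega>. (Z \<omega>)\<^sup>2)"
  proof (cases "s = u")
    case False
    then have "s < u" using assms by simp
    then have "indep_var borel Z borel ?D"
      using Z by (intro indep_increment s \<open>s < u\<close> assms) (simp_all add: L2_at_def)
    from indep_var_compose[OF this, of "\<lambda>x. x\<^sup>2" borel "\<lambda>x. x\<^sup>2" borel]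
    have ind: "indep_var borel (\<lambda>\<omega>. (Z \<omega>)\<^sup>2) borel (\<lambda>\<omega>. (?D \<omega>)\<^sup>2)"
      by (simp add: comp_def)
    have "integrable M (\<lambda>\<omega>. (Z \<omega>)\<^sup>2)" "integrable M (\<lambda>\<omega>. (?D \<omega>)\<^sup>2)"
      using Z increment_moments(1)[of s u] assms s by (auto simp: L2_at_def L2_def)
    then show ?thesis
      using indep_var_integrable[OF ind] indep_var_lebesgue_integral[OF ind]
        increment_moments(3)[of s u] assms s by (simp add: power_mult_distrib)
  qed simp
  then show "L2_at u (\<lambda>\<omega>. Z \<omega> * ?D \<omega>)"
    "expectation (\<lambda>\<omega>. (Z \<omega> * ?D \<omega>)\<^sup>2) = (u - s) * expectation (\<lambda>\<omega>. (Z \<omega>)\<^sup>2)"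
    unfolding L2_at_def L2_def using meas measurable_F_M[OF _ _ meas] assms(2,3) s by simp_all
qed

lemma increment_mult_inner:
  assumes Y: "L2_at s Y" and Z: "L2_at s Z" and "s \<le> u" "u \<le> T"
  shows "expectation (\<lambda>\<omega>. Y \<omega> * (W u \<omega> - W s \<omega>) * (Z \<omega> * (W u \<omega> - W s \<omega>))) =
    (u - s) * expectation (\<lambda>\<omega>. Y \<omega> * Z \<omega>)"
proof (cases "s = u")
  case False
  then have "s < u" using assms by simp
  have s: "0 \<le> s" using Z by (simp add: L2_at_def)
  have "indep_var borel (\<lambda>\<omega>. Y \<omega> * Z \<omega>) borel (\<lambda>\<omega>. W u \<omega> - W s \<omega>)"
    using Y Z by (intro indep_increment s \<open>s < u\<close> assms borel_measurable_times) (simp_all add: L2_at_def)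
  from indep_var_compose[OF this, of "\<lambda>x. x" borel "\<lambda>x. x\<^sup>2" borel]
  have "indep_var borel (\<lambda>\<omega>. Y \<omega> * Z \<omega>) borel (\<lambda>\<omega>. (W u \<omega> - W s \<omega>)\<^sup>2)"
    by (simp add: comp_def)
  moreover have "integrable M (\<lambda>\<omega>. Y \<omega> * Z \<omega>)"
    using L2_mult[of M Y Z] Y Z by (simp add: L2_at_def)
  moreover have "integrable M (\<lambda>\<omega>. (W u \<omega> - W s \<omega>)\<^sup>2)"
    by (intro L2_square increment_moments(1) s assms)
  ultimately have "expectation (\<lambda>\<omega>. Y \<omega> * Z \<omega> * (W u \<omega> - W s \<omega>)\<^sup>2) =
      expectation (\<lambda>\<omega>. Y \<omega> * Z \<omega>) * expectation (\<lambda>\<omega>. (W u \<omega> - W s \<omega>)\<^sup>2)"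
    by (rule indep_var_lebesgue_integral)
  then show ?thesis
    using increment_moments(3)[OF s assms(3,4)] by (simp add: power2_eq_square ac_simps)
qed simp

text \<open>\<open>Y * Z\<close> is independent of the increment, whose mean is 0. This is the seed
  of every martingale identity below.\<close>

lemma increment_orthogonal:
  assumes Y: "L2_at s Y" and Z: "L2_at s Z" and "s \<le> u" "u \<le> T"
  shows "expectation (\<lambda>\<omega>. Y \<omega> * (Z \<omega> * (W u \<omega> - W s \<omega>))) = 0"
proof (cases "s = u")
  case False
  then have "s < u" using assms by simp
  have s: "0 \<le> s" using Z by (simp add: L2_at_def)
  have "indep_var borel (\<lambda>\<omega>. Y \<omega> * Z \<omega>) borel (\<lambda>\<omega>. W u \<omega> - W s \<omega>)"
    using Y Z by (intro indep_increment s \<open>s < u\<close> assms borel_measurable_times) (simp_all add: L2_at_def)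
  moreover have "integrable M (\<lambda>\<omega>. Y \<omega> * Z \<omega>)"
    using L2_mult[of M Y Z] Y Z by (simp add: L2_at_def)
  moreover have "integrable M (\<lambda>\<omega>. W u \<omega> - W s \<omega>)"
    by (intro L2_integrable increment_moments(1) s assms)
  ultimately have "expectation (\<lambda>\<omega>. Y \<omega> * Z \<omega> * (W u \<omega> - W s \<omega>)) =
      expectation (\<lambda>\<omega>. Y \<omega> * Z \<omega>) * expectation (\<lambda>\<omega>. W u \<omega> - W s \<omega>)"
    by (rule indep_var_lebesgue_integral)
  then show ?thesis
    using increment_moments(2)[OF s assms(3,4)] by (simp add: mult.assoc)
qed simp

text \<open>Both increments are cut at \<open>s'\<close> and at \<open>m = min u u'\<close>. The
  pieces over the common interval produce the length of the overlap. In every other pair one factor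
  is known before the increment of the other begins, so the pair is orthogonal, except for
  \<open>C * C'\<close>, which is 0 because \<open>m\<close> equals \<open>u\<close> or
  \<open>u'\<close>.\<close>

lemma expectation_increment_product_aux:
  assumes Y: "L2_at s Y" and Z: "L2_at s' Z" and "s \<le> u" "u \<le> T" "s' \<le> u'" "u' \<le> T" "s \<le> s'"
  shows "expectation (\<lambda>\<omega>. Y \<omega> * (W u \<omega> - W s \<omega>) * (Z \<omega> * (W u' \<omega> - W s' \<omega>))) =
    expectation (\<lambda>\<omega>. Y \<omega> * Z \<omega>) * measure lborel ({s<..u} \<inter> {s'<..u'})"
proof (cases "u \<le> s'")
  case True
  have "L2_at s' (\<lambda>\<omega>. Y \<omega> * (W u \<omega> - W s \<omega>))"
    using Z by (intro L2_at_mono[OF increment_mult(1)[OF Y assms(3,4)] True]) (simp add: L2_at_def)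
  moreover have "{s<..u} \<inter> {s'<..u'} = {}" using True by auto
  ultimately show ?thesis
    using increment_orthogonal[OF _ Z assms(5,6)] by (simp only: measure_empty mult_zero_right)
next
  case False
  define m where "m = min u u'"
  have m: "s' \<le> m" "m \<le> T" "m \<le> u" "m \<le> u'" "m = u \<or> m = u'" using False assms by (auto simp: m_def)
  have seteq: "{s<..u} \<inter> {s'<..u'} = {s'<..m}" using assms by (auto simp: m_def)
  have s: "0 \<le> s" "0 \<le> s'" "s' \<le> T" using Y Z by (auto simp: L2_at_def)
  have Y': "L2_at s' Y" using s(3) assms(7) by (rule L2_at_mono[OF Y, rotated])
  note Ym = L2_at_mono[OF Y' m(1,2)] and Zm = L2_at_mono[OF Z m(1,2)]
  define A where "A = (\<lambda>\<omega>. Y \<omega> * (W s' \<omega> - W s \<omega>))"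
  define B where "B = (\<lambda>\<omega>. Y \<omega> * (W m \<omega> - W s' \<omega>))"
  define C where "C = (\<lambda>\<omega>. Y \<omega> * (W u \<omega> - W m \<omega>))"
  define B' where "B' = (\<lambda>\<omega>. Z \<omega> * (W m \<omega> - W s' \<omega>))"
  define C' where "C' = (\<lambda>\<omega>. Z \<omega> * (W u' \<omega> - W m \<omega>))"
  have A: "L2_at s' A" unfolding A_def using increment_mult(1)[OF Y] assms s by simp
  have B: "L2_at m B" unfolding B_def using increment_mult(1)[OF Y'] m by simp
  have B': "L2_at m B'" unfolding B'_def using increment_mult(1)[OF Z] m by simp
  have C: "L2_at u C" unfolding C_def using increment_mult(1)[OF Ym] m assms by simp
  have C': "L2_at u' C'" unfolding C'_def using increment_mult(1)[OF Zm] m assms by simp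
  note L = A[THEN L2_at_L2] B[THEN L2_at_L2] C[THEN L2_at_L2] B'[THEN L2_at_L2] C'[THEN L2_at_L2]
  have "(\<lambda>\<omega>. Y \<omega> * (W u \<omega> - W s \<omega>) * (Z \<omega> * (W u' \<omega> - W s' \<omega>))) =
     (\<lambda>\<omega>. A \<omega> * B' \<omega> + A \<omega> * C' \<omega> + B \<omega> * B' \<omega> + B \<omega> * C' \<omega> + C \<omega> * B' \<omega>)"
  proof
    fix \<omega>
    have "C \<omega> * C' \<omega> = 0"
      using m(5) by (auto simp: C_def C'_def)
    moreover have "Y \<omega> * (W u \<omega> - W s \<omega>) = A \<omega> + B \<omega> + C \<omega>"
      by (simp add: A_def B_def C_def right_diff_distrib)
    moreover have "Z \<omega> * (W u' \<omega> - W s' \<omega>) = B' \<omega> + C' \<omega>"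
      by (simp add: B'_def C'_def right_diff_distrib)
    ultimately show "Y \<omega> * (W u \<omega> - W s \<omega>) * (Z \<omega> * (W u' \<omega> - W s' \<omega>)) =
       A \<omega> * B' \<omega> + A \<omega> * C' \<omega> + B \<omega> * B' \<omega> + B \<omega> * C' \<omega> + C \<omega> * B' \<omega>"
      by (simp add: distrib_left distrib_right)
  qed
  then have "expectation (\<lambda>\<omega>. Y \<omega> * (W u \<omega> - W s \<omega>) * (Z \<omega> * (W u' \<omega> - W s' \<omega>))) =
     expectation (\<lambda>\<omega>. A \<omega> * B' \<omega>) + expectation (\<lambda>\<omega>. A \<omega> * C' \<omega>) + expectation (\<lambda>\<omega>. B \<omega> * B' \<omega>)
      + expectation (\<lambda>\<omega>. B \<omega> * C' \<omega>) + expectation (\<lambda>\<omega>. C \<omega> * B' \<omega>)"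
    using L by (simp add: L2_mult)
  also have "expectation (\<lambda>\<omega>. A \<omega> * B' \<omega>) = 0"
    unfolding B'_def using increment_orthogonal[OF A Z] m by simp
  also have "expectation (\<lambda>\<omega>. A \<omega> * C' \<omega>) = 0"
    unfolding C'_def using increment_orthogonal[OF L2_at_mono[OF A] Zm] m assms by simp
  also have "expectation (\<lambda>\<omega>. B \<omega> * C' \<omega>) = 0"
    unfolding C'_def using increment_orthogonal[OF B Zm] m assms by simp
  also have "expectation (\<lambda>\<omega>. C \<omega> * B' \<omega>) = 0"
    unfolding C_def using increment_orthogonal[OF B' Ym, of u] m assms by (simp add: mult.commute)
  also have "expectation (\<lambda>\<omega>. B \<omega> * B' \<omega>) = (m - s') * expectation (\<lambda>\<omega>. Y \<omega> * Z \<omega>)"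
    unfolding B_def B'_def by (rule increment_mult_inner[OF Y' Z m(1,2)])
  finally show ?thesis
    using m(1) seteq by (simp only: measure_lborel_Ioc) (simp add: mult.commute)
qed

lemma expectation_increment_product:
  assumes Y: "L2_at s Y" and Z: "L2_at s' Z" and "s \<le> u" "u \<le> T" "s' \<le> u'" "u' \<le> T"
  shows "expectation (\<lambda>\<omega>. Y \<omega> * (W u \<omega> - W s \<omega>) * (Z \<omega> * (W u' \<omega> - W s' \<omega>))) =
    expectation (\<lambda>\<omega>. Y \<omega> * Z \<omega>) * measure lborel ({s<..u} \<inter> {s'<..u'})"
proof (cases "s \<le> s'")
  case True
  from expectation_increment_product_aux[OF assms True] show ?thesis .
next
  case False
  then have "s' \<le> s" by simp
  from expectation_increment_product_aux[OF Z Y assms(5,6,3,4) this] show ?thesis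
    by (simp add: mult.commute Int_commute)
qed

end

section \<open>The Ito integral\<close>

context brownian_motion
begin

text \<open>Indexed by a finite family of possibly overlapping intervals instead of a partition: a
  difference is then formed over the disjoint sum of two index sets, and no common refinement is
  needed.\<close>

definition elem_integral ::
    "'i set \<Rightarrow> ('i \<Rightarrow> real) \<Rightarrow> ('i \<Rightarrow> real) \<Rightarrow> ('i \<Rightarrow> 'a \<Rightarrow> real) \<Rightarrow> 'a \<Rightarrow> real" where
  "elem_integral I s u \<xi> \<omega> = (\<Sum>i\<in>I. \<xi> i \<omega> * (W (u i) \<omega> - W (s i) \<omega>))"

definition elem_process ::
    "'i set \<Rightarrow> ('i \<Rightarrow> real) \<Rightarrow> ('i \<Rightarrow> real) \<Rightarrow> ('i \<Rightarrow> 'a \<Rightarrow> real) \<Rightarrow> 'a \<times> real \<Rightarrow> real" where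
  "elem_process I s u \<xi> p = (\<Sum>i\<in>I. \<xi> i (fst p) * indicator {s i<..u i} (snd p))"

text \<open>Coefficients are merely square-integrable, because those of the Euler schemes are
  unbounded; the bounded coefficients of \<open>simple_integrand\<close> are a special case.\<close>

definition elementary ::
    "real \<Rightarrow> real \<Rightarrow> 'i set \<Rightarrow> ('i \<Rightarrow> real) \<Rightarrow> ('i \<Rightarrow> real) \<Rightarrow> ('i \<Rightarrow> 'a \<Rightarrow> real) \<Rightarrow> bool" where
  "elementary t v I s u \<xi> \<longleftrightarrow> 0 \<le> t \<and> t \<le> v \<and> v \<le> T \<and> finite I \<and>
     (\<forall>i\<in>I. t \<le> s i \<and> s i \<le> u i \<and> u i \<le> v \<and> L2_at (s i) (\<xi> i))"

lemma elem_integral_L2_at: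
  assumes "elementary t v I s u \<xi>"
  shows "L2_at v (elem_integral I s u \<xi>)"
  unfolding elem_integral_def
proof (rule L2_at_sum)
  show "0 \<le> v" "v \<le> T" using assms by (auto simp: elementary_def)
  fix i assume i: "i \<in> I"
  have "L2_at (u i) (\<lambda>\<omega>. \<xi> i \<omega> * (W (u i) \<omega> - W (s i) \<omega>))"
    using assms i by (intro increment_mult(1)) (auto simp: elementary_def)
  then show "L2_at v (\<lambda>\<omega>. \<xi> i \<omega> * (W (u i) \<omega> - W (s i) \<omega>))"
    by (rule L2_at_mono) (use assms i in \<open>auto simp: elementary_def\<close>)
qed

abbreviation (input) N :: "('a \<times> real) measure" where "N \<equiv> M \<Otimes>\<^sub>M lborel"

lemma pair_sigma_finite_N: "pair_sigma_finite M lborel"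
  by (intro pair_sigma_finite.intro sigma_finite_measure_axioms lborel.sigma_finite_measure_axioms)

lemma nn_integral_N:
  "f \<in> borel_measurable N \<Longrightarrow> (\<integral>\<^sup>+p. f p \<partial>N) = (\<integral>\<^sup>+\<omega>. \<integral>\<^sup>+r. f (\<omega>, r) \<partial>lborel \<partial>M)"
  by (rule lborel.nn_integral_fst[symmetric])

lemma L2_indicator_product:
  assumes "L2 M \<xi>"
  shows "L2 N (\<lambda>p. \<xi> (fst p) * indicator {a<..b::real} (snd p))"
proof (rule L2I)
  have [measurable]: "\<xi> \<in> borel_measurable M" using assms by (simp add: L2_def)
  show "(\<lambda>p. \<xi> (fst p) * indicator {a<..b} (snd p)) \<in> borel_measurable N" by measurable
  have "(\<integral>\<^sup>+ p. ennreal ((\<xi> (fst p) * indicator {a<..b} (snd p))\<^sup>2) \<partial>N) =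
      (\<integral>\<^sup>+ \<omega>. \<integral>\<^sup>+ r. ennreal ((\<xi> \<omega>)\<^sup>2) * indicator {a<..b} r \<partial>lborel \<partial>M)"
    by (subst nn_integral_N) (auto intro!: nn_integral_cong simp: indicator_def)
  also have "\<dots> = (\<integral>\<^sup>+ \<omega>. ennreal ((\<xi> \<omega>)\<^sup>2) \<partial>M) * emeasure lborel {a<..b}"
    by (simp add: nn_integral_cmult_indicator nn_integral_multc)
  also have "\<dots> < \<infinity>"
    using L2_nn_integral[OF assms] emeasure_bounded_finite[of "{a<..b}"]
    by (simp add: ennreal_mult_less_top)
  finally show "(\<integral>\<^sup>+ p. ennreal ((\<xi> (fst p) * indicator {a<..b} (snd p))\<^sup>2) \<partial>N) < \<infinity>" .
qed

lemma integral_indicator_product: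
  assumes "L2 M \<xi>" "L2 M \<zeta>"
  shows "(\<integral>p. (\<xi> (fst p) * indicator {a<..b::real} (snd p)) * (\<zeta> (fst p) * indicator {c<..d::real} (snd p)) \<partial>N) =
    expectation (\<lambda>\<omega>. \<xi> \<omega> * \<zeta> \<omega>) * measure lborel ({a<..b} \<inter> {c<..d})"
proof -
  interpret pair_sigma_finite M lborel by (rule pair_sigma_finite_N)
  have int: "integrable N (\<lambda>p. (\<xi> (fst p) * indicator {a<..b} (snd p)) * (\<zeta> (fst p) * indicator {c<..d} (snd p)))"
    by (intro L2_mult L2_indicator_product assms)
  have "(\<integral>p. (\<xi> (fst p) * indicator {a<..b} (snd p)) * (\<zeta> (fst p) * indicator {c<..d} (snd p)) \<partial>N) =
    (\<integral>\<omega>. \<integral>r. (\<xi> \<omega> * indicator {a<..b} r) * (\<zeta> \<omega> * indicator {c<..d} r) \<partial>lborel \<partial>M)"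
    using integral_fst'[OF int] by simp
  also have "\<dots> = (\<integral>\<omega>. \<integral>r. (\<xi> \<omega> * \<zeta> \<omega>) * indicator ({a<..b} \<inter> {c<..d}) r \<partial>lborel \<partial>M)"
    by (intro Bochner_Integration.integral_cong refl) (auto simp: indicator_def)
  also have "\<dots> = expectation (\<lambda>\<omega>. \<xi> \<omega> * \<zeta> \<omega>) * measure lborel ({a<..b} \<inter> {c<..d})"
    by simp
  finally show ?thesis .
qed

lemma elem_process_L2:
  "elementary t v I s u \<xi> \<Longrightarrow> L2 N (elem_process I s u \<xi>)"
  unfolding elem_process_def
  by (intro L2_sum L2_indicator_product) (auto simp: elementary_def L2_at_def)

text \<open>Both sides are double sums over pairs of indices. The terms agree pair by pair through
  \<open>expectation_increment_product\<close>, which also covers overlapping intervals.\<close>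

lemma elem_isometry:
  assumes el: "elementary t v I s u \<xi>"
  shows "(\<integral>p. (elem_process I s u \<xi> p)\<^sup>2 \<partial>N) = expectation (\<lambda>\<omega>. (elem_integral I s u \<xi> \<omega>)\<^sup>2)"
proof -
  have L: "L2 M (\<xi> i)" if "i \<in> I" for i
    using el that by (auto simp: elementary_def L2_at_def)
  have LD: "L2 M (\<lambda>\<omega>. \<xi> i \<omega> * (W (u i) \<omega> - W (s i) \<omega>))" if "i \<in> I" for i
    using el that by (intro L2_at_L2[of "u i"] increment_mult(1)) (auto simp: elementary_def)
  have "(\<integral>p. (elem_process I s u \<xi> p)\<^sup>2 \<partial>N) =
     (\<integral>p. (\<Sum>i\<in>I. \<Sum>j\<in>I. (\<xi> i (fst p) * indicator {s i<..u i} (snd p)) *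
        (\<xi> j (fst p) * indicator {s j<..u j} (snd p))) \<partial>N)"
    by (simp only: elem_process_def power2_eq_square sum_product)
  also have "\<dots> = (\<Sum>i\<in>I. \<Sum>j\<in>I. (\<integral>p. (\<xi> i (fst p) * indicator {s i<..u i} (snd p)) *
        (\<xi> j (fst p) * indicator {s j<..u j} (snd p)) \<partial>N))"
    by (subst Bochner_Integration.integral_sum, (intro Bochner_Integration.integrable_sum L2_mult L2_indicator_product L; assumption),
        intro sum.cong refl Bochner_Integration.integral_sum L2_mult L2_indicator_product L; assumption)
  also have "\<dots> = (\<Sum>i\<in>I. \<Sum>j\<in>I. expectation (\<lambda>\<omega>. (\<xi> i \<omega> * (W (u i) \<omega> - W (s i) \<omega>)) *
      (\<xi> j \<omega> * (W (u j) \<omega> - W (s j) \<omega>))))"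
  proof (intro sum.cong refl)
    fix i j assume ij: "i \<in> I" "j \<in> I"
    show "(\<integral>p. (\<xi> i (fst p) * indicator {s i<..u i} (snd p)) *
        (\<xi> j (fst p) * indicator {s j<..u j} (snd p)) \<partial>N) = expectation (\<lambda>\<omega>. (\<xi> i \<omega> * (W (u i) \<omega> - W (s i) \<omega>)) *
      (\<xi> j \<omega> * (W (u j) \<omega> - W (s j) \<omega>)))"
      unfolding integral_indicator_product[OF L[OF ij(1)] L[OF ij(2)]]
      using el ij by (intro expectation_increment_product[symmetric]) (auto simp: elementary_def)
  qed
  also have "\<dots> = expectation (\<lambda>\<omega>. (elem_integral I s u \<xi> \<omega>)\<^sup>2)"
    unfolding elem_integral_def power2_eq_square sum_product
    by (subst Bochner_Integration.integral_sum, (intro Bochner_Integration.integrable_sum L2_mult LD; assumption),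
        intro sum.cong refl Bochner_Integration.integral_sum[symmetric] L2_mult LD; assumption)
  finally show ?thesis .
qed

lemma elementary_diff:
  assumes "elementary t v I s u \<xi>" "elementary t v I' s' u' \<xi>'"
  shows "elementary t v (I <+> I') (case_sum s s') (case_sum u u') (case_sum \<xi> (\<lambda>i \<omega>. - \<xi>' i \<omega>))"
    and "elem_integral (I <+> I') (case_sum s s') (case_sum u u') (case_sum \<xi> (\<lambda>i \<omega>. - \<xi>' i \<omega>)) \<omega>
      = elem_integral I s u \<xi> \<omega> - elem_integral I' s' u' \<xi>' \<omega>"
    and "elem_process (I <+> I') (case_sum s s') (case_sum u u') (case_sum \<xi> (\<lambda>i \<omega>. - \<xi>' i \<omega>)) p
      = elem_process I s u \<xi> p - elem_process I' s' u' \<xi>' p"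
proof -
  have fin: "finite I" "finite I'" using assms by (auto simp: elementary_def)
  show "elementary t v (I <+> I') (case_sum s s') (case_sum u u') (case_sum \<xi> (\<lambda>i \<omega>. - \<xi>' i \<omega>))"
    using assms by (auto simp: elementary_def L2_at_minus)
  show "elem_integral (I <+> I') (case_sum s s') (case_sum u u') (case_sum \<xi> (\<lambda>i \<omega>. - \<xi>' i \<omega>)) \<omega>
      = elem_integral I s u \<xi> \<omega> - elem_integral I' s' u' \<xi>' \<omega>"
    unfolding elem_integral_def by (subst sum.Plus[OF fin]) (simp add: sum_negf)
  show "elem_process (I <+> I') (case_sum s s') (case_sum u u') (case_sum \<xi> (\<lambda>i \<omega>. - \<xi>' i \<omega>)) p
      = elem_process I s u \<xi> p - elem_process I' s' u' \<xi>' p"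
    unfolding elem_process_def
    by (subst sum.Plus[OF fin]) (simp only: sum.case comp_def sum_negf mult_minus_left diff_conv_add_uminus)
qed

lemma elem_isometry_diff:
  assumes "elementary t v I s u \<xi>" "elementary t v I' s' u' \<xi>'"
  shows "(\<integral>p. (elem_process I s u \<xi> p - elem_process I' s' u' \<xi>' p)\<^sup>2 \<partial>N) =
    expectation (\<lambda>\<omega>. (elem_integral I s u \<xi> \<omega> - elem_integral I' s' u' \<xi>' \<omega>)\<^sup>2)"
  using elem_isometry[OF elementary_diff(1)[OF assms]]
  by (simp only: elementary_diff(2,3)[OF assms])

lemma elem_process_outside:
  "elementary t v I s u \<xi> \<Longrightarrow> snd p \<notin> {t..v} \<Longrightarrow> elem_process I s u \<xi> p = 0"
  unfolding elem_process_def elementary_def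
  by (intro sum.neutral) (force simp: indicator_def)

text \<open>Under \<open>min\<close> with \<open>v\<close>, an interval that starts after
  \<open>v\<close> collapses to an empty one at \<open>v\<close>. Its coefficient is not known at
  time \<open>v\<close>, so it is replaced by 0 to keep the stopped family elementary.\<close>

definition stop_coeff :: "real \<Rightarrow> ('i \<Rightarrow> real) \<Rightarrow> ('i \<Rightarrow> 'a \<Rightarrow> real) \<Rightarrow> 'i \<Rightarrow> 'a \<Rightarrow> real" where
  "stop_coeff v s \<xi> i \<omega> = (if s i \<le> v then \<xi> i \<omega> else 0)"

text \<open>The third claim is the martingale property in weak form, tested against every
  \<open>Z\<close> known at \<open>v\<close>. An interval before \<open>v\<close> is untouched, one
  after \<open>v\<close> contributes 0 by orthogonality, and one that contains \<open>v\<close> is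
  split there, its later part being orthogonal to \<open>Z\<close>.\<close>

lemma elementary_stop:
  assumes el: "elementary t v' I s u \<xi>" and "t \<le> v" "v \<le> v'"
  shows "elementary t v I (\<lambda>i. min (s i) v) (\<lambda>i. min (u i) v) (stop_coeff v s \<xi>)"
    and "elem_process I (\<lambda>i. min (s i) v) (\<lambda>i. min (u i) v) (stop_coeff v s \<xi>) p =
      indicator {..v} (snd p) * elem_process I s u \<xi> p"
    and "L2_at v Z \<Longrightarrow> expectation (\<lambda>\<omega>. elem_integral I s u \<xi> \<omega> * Z \<omega>) =
      expectation (\<lambda>\<omega>. elem_integral I (\<lambda>i. min (s i) v) (\<lambda>i. min (u i) v) (stop_coeff v s \<xi>) \<omega> * Z \<omega>)"
proof -
  have L: "L2_at (min (s i) v) (stop_coeff v s \<xi> i)" if "i \<in> I" for i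
  proof (cases "s i \<le> v")
    case True
    then show ?thesis using el that by (simp add: elementary_def stop_coeff_def[abs_def] min_def)
  next
    case False
    then show ?thesis
      using el assms L2_at_const[of v 0] by (simp add: elementary_def stop_coeff_def[abs_def] min_def)
  qed
  show el': "elementary t v I (\<lambda>i. min (s i) v) (\<lambda>i. min (u i) v) (stop_coeff v s \<xi>)"
    using el assms L by (auto simp: elementary_def)
  show "elem_process I (\<lambda>i. min (s i) v) (\<lambda>i. min (u i) v) (stop_coeff v s \<xi>) p =
      indicator {..v} (snd p) * elem_process I s u \<xi> p"
    unfolding elem_process_def sum_distrib_left
    by (intro sum.cong refl) (auto simp: stop_coeff_def indicator_def min_def)
  assume Z: "L2_at v Z"
  have zero: "expectation (\<lambda>\<omega>. (\<xi> i \<omega> * (W (u i) \<omega> - W (s i) \<omega>)) * Z \<omega>) =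
     expectation (\<lambda>\<omega>. (stop_coeff v s \<xi> i \<omega> * (W (min (u i) v) \<omega> - W (min (s i) v) \<omega>)) * Z \<omega>)" if i: "i \<in> I" for i
  proof -
    have si: "t \<le> s i" "s i \<le> u i" "u i \<le> T" "L2_at (s i) (\<xi> i)"
      using el i by (auto simp: elementary_def)
    consider "u i \<le> v" | "v < s i" | "s i \<le> v" "v < u i" by linarith
    then show ?thesis
    proof cases
      case 1
      then show ?thesis using si by (simp add: stop_coeff_def min_def)
    next
      case 2
      then have "L2_at (s i) Z" using Z si by (intro L2_at_mono[OF Z]) auto
      from increment_orthogonal[OF this si(4,2,3)] show ?thesis
        using 2 by (simp add: stop_coeff_def mult.commute)
    next
      case 3
      have "v \<le> T" using Z by (simp add: L2_at_def)
      have \<xi>v: "L2_at v (\<xi> i)" using L2_at_mono[OF si(4) 3(1) \<open>v \<le> T\<close>] .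
      have eq: "expectation (\<lambda>\<omega>. (\<xi> i \<omega> * (W (u i) \<omega> - W v \<omega>)) * Z \<omega>) = 0"
        using increment_orthogonal[OF Z \<xi>v, of "u i"] 3 si by (simp add: mult.commute)
      have "expectation (\<lambda>\<omega>. (\<xi> i \<omega> * (W (u i) \<omega> - W (s i) \<omega>)) * Z \<omega>) =
        expectation (\<lambda>\<omega>. (\<xi> i \<omega> * (W (u i) \<omega> - W v \<omega>)) * Z \<omega> + (\<xi> i \<omega> * (W v \<omega> - W (s i) \<omega>)) * Z \<omega>)"
        by (simp only: distrib_right[symmetric] distrib_left[symmetric]) simp
      also have "\<dots> = expectation (\<lambda>\<omega>. (\<xi> i \<omega> * (W v \<omega> - W (s i) \<omega>)) * Z \<omega>)"
        using eq L2_mult[OF increment_mult(1)[OF \<xi>v, of "u i", THEN L2_at_L2] L2_at_L2[OF Z]]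
          L2_mult[OF increment_mult(1)[OF si(4), of v, THEN L2_at_L2] L2_at_L2[OF Z]] 3 si \<open>v \<le> T\<close>
        by simp
      finally show ?thesis using 3 by (simp add: stop_coeff_def min_def)
    qed
  qed
  have i1: "integrable M (\<lambda>\<omega>. (\<xi> i \<omega> * (W (u i) \<omega> - W (s i) \<omega>)) * Z \<omega>)" if "i \<in> I" for i
    using el that by (intro L2_mult L2_at_L2[of "u i"] increment_mult(1) L2_at_L2[OF Z]) (auto simp: elementary_def)
  have i2: "integrable M (\<lambda>\<omega>. (stop_coeff v s \<xi> i \<omega> * (W (min (u i) v) \<omega> - W (min (s i) v) \<omega>)) * Z \<omega>)" if "i \<in> I" for i
    using el' that by (intro L2_mult L2_at_L2[of "min (u i) v"] increment_mult(1) L2_at_L2[OF Z]) (auto simp: elementary_def)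
  show "expectation (\<lambda>\<omega>. elem_integral I s u \<xi> \<omega> * Z \<omega>) =
      expectation (\<lambda>\<omega>. elem_integral I (\<lambda>i. min (s i) v) (\<lambda>i. min (u i) v) (stop_coeff v s \<xi>) \<omega> * Z \<omega>)"
    unfolding elem_integral_def sum_distrib_right
    by (simp add: Bochner_Integration.integral_sum i1 i2 zero cong: sum.cong)
qed

text \<open>Working form of the Ito integral: the integrand is extended by 0 to an element of the
  product space \<open>N\<close>, and the approximating coefficients may be unbounded.\<close>

definition ito :: "real \<Rightarrow> real \<Rightarrow> (real \<Rightarrow> 'a \<Rightarrow> real) \<Rightarrow> ('a \<Rightarrow> real) \<Rightarrow> bool" where
  "ito t v H J \<longleftrightarrow> (\<exists>(n :: nat \<Rightarrow> nat) s u \<xi>. (\<forall>k. elementary t v {..<n k} (s k) (u k) (\<xi> k)) \<and>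
     L2_lim N (\<lambda>k. elem_process {..<n k} (s k) (u k) (\<xi> k)) (\<lambda>p. indicator {t..v} (snd p) * H (snd p) (fst p)) \<and>
     L2_lim M (\<lambda>k. elem_integral {..<n k} (s k) (u k) (\<xi> k)) J)"

lemma ito_isometry:
  assumes "ito t v H J"
  shows "L2 N (\<lambda>p. indicator {t..v} (snd p) * H (snd p) (fst p))" "L2 M J"
    "expectation (\<lambda>\<omega>. (J \<omega>)\<^sup>2) = (\<integral>p. (indicator {t..v} (snd p) * H (snd p) (fst p))\<^sup>2 \<partial>N)"
proof -
  obtain n s u \<xi> where el: "\<And>k. elementary t v {..<n k::nat} (s k) (u k) (\<xi> k)"
    and P: "L2_lim N (\<lambda>k. elem_process {..<n k} (s k) (u k) (\<xi> k)) (\<lambda>p. indicator {t..v} (snd p) * H (snd p) (fst p))"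
    and I: "L2_lim M (\<lambda>k. elem_integral {..<n k} (s k) (u k) (\<xi> k)) J"
    using assms unfolding ito_def by blast
  show "L2 N (\<lambda>p. indicator {t..v} (snd p) * H (snd p) (fst p))" "L2 M J"
    using P I by (auto simp: L2_lim_def)
  show "expectation (\<lambda>\<omega>. (J \<omega>)\<^sup>2) = (\<integral>p. (indicator {t..v} (snd p) * H (snd p) (fst p))\<^sup>2 \<partial>N)"
    using LIMSEQ_unique[OF L2_lim_norm[OF I]] L2_lim_norm[OF P]
    by (simp only: elem_isometry[OF el])
qed

text \<open>The approximations of \<open>J'\<close> are stopped at \<open>v\<close>, which does not
  change their expectations against \<open>Z\<close>. Their processes then have the same limit as
  those of \<open>J\<close>, so by the isometry the two sequences of integrals become arbitrarily
  close.\<close>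

lemma ito_martingale:
  assumes J: "ito t v H J" and J': "ito t v' H J'" and "t \<le> v" "v \<le> v'" and Z: "L2_at v Z"
  shows "expectation (\<lambda>\<omega>. J' \<omega> * Z \<omega>) = expectation (\<lambda>\<omega>. J \<omega> * Z \<omega>)"
proof -
  obtain n s u \<xi> where el: "\<And>k. elementary t v {..<n k::nat} (s k) (u k) (\<xi> k)"
    and P: "L2_lim N (\<lambda>k. elem_process {..<n k} (s k) (u k) (\<xi> k)) (\<lambda>p. indicator {t..v} (snd p) * H (snd p) (fst p))"
    and I: "L2_lim M (\<lambda>k. elem_integral {..<n k} (s k) (u k) (\<xi> k)) J"
    using J unfolding ito_def by blast
  obtain n' s' u' \<xi>' where el': "\<And>k. elementary t v' {..<n' k::nat} (s' k) (u' k) (\<xi>' k)"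
    and P': "L2_lim N (\<lambda>k. elem_process {..<n' k} (s' k) (u' k) (\<xi>' k)) (\<lambda>p. indicator {t..v'} (snd p) * H (snd p) (fst p))"
    and I': "L2_lim M (\<lambda>k. elem_integral {..<n' k} (s' k) (u' k) (\<xi>' k)) J'"
    using J' unfolding ito_def by blast
  note st = elementary_stop[OF el' assms(3,4)]
  define Iv where "Iv = (\<lambda>k. elem_integral {..<n' k} (\<lambda>i. min (s' k i) v) (\<lambda>i. min (u' k i) v) (stop_coeff v (s' k) (\<xi>' k)))"
  define Pv where "Pv = (\<lambda>k. elem_process {..<n' k} (\<lambda>i. min (s' k i) v) (\<lambda>i. min (u' k i) v) (stop_coeff v (s' k) (\<xi>' k)))"
  have LPv: "L2 N (Pv k)" and LIv: "L2 M (Iv k)" for k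
    using elem_process_L2[OF st(1)] L2_at_L2[OF elem_integral_L2_at[OF st(1)]] by (auto simp: Pv_def Iv_def)
  have Pv: "L2_lim N Pv (\<lambda>p. indicator {t..v} (snd p) * H (snd p) (fst p))"
    unfolding L2_lim_def
  proof (intro conjI allI LPv)
    show H: "L2 N (\<lambda>p. indicator {t..v} (snd p) * H (snd p) (fst p))" using P by (simp add: L2_lim_def)
    show "(\<lambda>k. \<integral>p. (Pv k p - indicator {t..v} (snd p) * H (snd p) (fst p))\<^sup>2 \<partial>N) \<longlonglongrightarrow> 0"
    proof (rule tendsto_sandwich[OF _ _ tendsto_const])
      show "(\<lambda>k. \<integral>p. (elem_process {..<n' k} (s' k) (u' k) (\<xi>' k) p - indicator {t..v'} (snd p) * H (snd p) (fst p))\<^sup>2 \<partial>N) \<longlonglongrightarrow> 0"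
        using P' by (simp add: L2_lim_def)
      show "\<forall>\<^sub>F k in sequentially. (\<integral>p. (Pv k p - indicator {t..v} (snd p) * H (snd p) (fst p))\<^sup>2 \<partial>N)
        \<le> (\<integral>p. (elem_process {..<n' k} (s' k) (u' k) (\<xi>' k) p - indicator {t..v'} (snd p) * H (snd p) (fst p))\<^sup>2 \<partial>N)"
      proof (intro always_eventually allI integral_mono)
        fix k
        show "integrable N (\<lambda>p. (Pv k p - indicator {t..v} (snd p) * H (snd p) (fst p))\<^sup>2)"
          by (intro L2_square L2_diff LPv H)
        show "integrable N (\<lambda>p. (elem_process {..<n' k} (s' k) (u' k) (\<xi>' k) p - indicator {t..v'} (snd p) * H (snd p) (fst p))\<^sup>2)"
          using P' by (intro L2_square L2_diff) (auto simp: L2_lim_def)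
        fix p :: "'a \<times> real"
        \<comment> \<open>Stopping multiplies the approximation error by an indicator, so the error
          can only shrink.\<close>
        have "Pv k p - indicator {t..v} (snd p) * H (snd p) (fst p) = indicator {..v} (snd p) *
          (elem_process {..<n' k} (s' k) (u' k) (\<xi>' k) p - indicator {t..v'} (snd p) * H (snd p) (fst p))"
          unfolding Pv_def st(2) using assms by (auto simp: indicator_def algebra_simps)
        then show "(Pv k p - indicator {t..v} (snd p) * H (snd p) (fst p))\<^sup>2 \<le>
          (elem_process {..<n' k} (s' k) (u' k) (\<xi>' k) p - indicator {t..v'} (snd p) * H (snd p) (fst p))\<^sup>2"
          by (simp add: indicator_def)
      qed
    qed simp
  qed
  have "L2_lim M (\<lambda>k \<omega>. Iv k \<omega> - elem_integral {..<n k} (s k) (u k) (\<xi> k) \<omega>) (\<lambda>_. 0)"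
    using L2_lim_diff[OF Pv P] elem_isometry_diff[OF st(1) el] LIv I
    by (auto simp: L2_lim_def Iv_def Pv_def intro!: L2_diff L2_zero)
  from L2_lim_inner[OF this L2_at_L2[OF Z]]
  have "(\<lambda>k. expectation (\<lambda>\<omega>. (Iv k \<omega> - elem_integral {..<n k} (s k) (u k) (\<xi> k) \<omega>) * Z \<omega>)) \<longlonglongrightarrow> 0"
    by simp
  moreover have "expectation (\<lambda>\<omega>. (Iv k \<omega> - elem_integral {..<n k} (s k) (u k) (\<xi> k) \<omega>) * Z \<omega>) =
     expectation (\<lambda>\<omega>. elem_integral {..<n' k} (s' k) (u' k) (\<xi>' k) \<omega> * Z \<omega>) -
     expectation (\<lambda>\<omega>. elem_integral {..<n k} (s k) (u k) (\<xi> k) \<omega> * Z \<omega>)" for k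
    using L2_mult[OF LIv L2_at_L2[OF Z], of k] L2_mult[OF _ L2_at_L2[OF Z], of "elem_integral {..<n k} (s k) (u k) (\<xi> k)"] I
    unfolding st(3)[OF Z] by (simp add: L2_lim_def left_diff_distrib Iv_def)
  ultimately have "(\<lambda>k. expectation (\<lambda>\<omega>. elem_integral {..<n' k} (s' k) (u' k) (\<xi>' k) \<omega> * Z \<omega>) -
     expectation (\<lambda>\<omega>. elem_integral {..<n k} (s k) (u k) (\<xi> k) \<omega> * Z \<omega>)) \<longlonglongrightarrow> 0"
    by simp
  from LIMSEQ_unique[OF this tendsto_diff[OF L2_lim_inner[OF I' L2_at_L2[OF Z]] L2_lim_inner[OF I L2_at_L2[OF Z]]]]
  show ?thesis by simp
qed

text \<open>The integrand may be exchanged for \<open>H'\<close> off a null set of pairs. The wealth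
  equation is written with \<open>dist_mean\<close> and \<open>dist_var\<close>, whose joint
  measurability is unknown where the control fails to be a probability measure, whereas
  \<open>H'\<close> is jointly measurable.\<close>

lemma ito_of_has_Ito_integral:
  assumes J: "has_Ito_integral M F W t v H J" and tv: "0 \<le> t" "t \<le> v" "v \<le> T"
    and meas: "(\<lambda>p. indicator {t..v} (snd p) * H' (snd p) (fst p)) \<in> borel_measurable N"
    and eq: "AE \<omega> in M. AE r in lborel. r \<in> {t..v} \<longrightarrow> H r \<omega> = H' r \<omega>"
  shows "ito t v H' J"
proof -
  obtain n \<tau> \<xi> where si: "\<And>k. simple_integrand M F t v (n k) (\<tau> k) (\<xi> k)" and
    P: "(\<lambda>k. \<integral>\<^sup>+ \<omega>. (\<integral>\<^sup>+ s\<in>{t..v}. ennreal ((H s \<omega> - simple_process (n k) (\<tau> k) (\<xi> k) s \<omega>)\<^sup>2) \<partial>lborel) \<partial>M) \<longlonglongrightarrow> 0"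
    and I: "(\<lambda>k. \<integral>\<^sup>+ \<omega>. ennreal ((J \<omega> - simple_integral W (n k) (\<tau> k) (\<xi> k) \<omega>)\<^sup>2) \<partial>M) \<longlonglongrightarrow> 0"
    and Jm: "J \<in> borel_measurable M"
    using J unfolding has_Ito_integral_def by blast
  define s where "s = (\<lambda>k i. \<tau> k i)"
  define u where "u = (\<lambda>k i. \<tau> k (Suc i))"
  have el: "elementary t v {..<n k} (s k) (u k) (\<xi> k)" for k
    unfolding elementary_def
  proof (intro conjI tv ballI)
    fix i assume i: "i \<in> {..<n k}"
    have mono: "a \<le> b \<Longrightarrow> b \<le> n k \<Longrightarrow> \<tau> k a \<le> \<tau> k b" for a b
      by (induction b rule: dec_induct)
         (use si[of k] in \<open>auto simp: simple_integrand_def intro: order.trans\<close>)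
    have e: "\<tau> k 0 = t" "\<tau> k (n k) = v" using si[of k] by (auto simp: simple_integrand_def)
    show *: "t \<le> s k i" "s k i \<le> u k i" "u k i \<le> v"
      using mono[of 0 i] mono[of i "Suc i"] mono[of "Suc i" "n k"] e i by (auto simp: s_def u_def)
    have m: "\<xi> k i \<in> borel_measurable (F (s k i))" and b: "\<exists>C. \<forall>\<omega>\<in>space M. \<bar>\<xi> k i \<omega>\<bar> \<le> C"
      using si[of k] i by (auto simp: simple_integrand_def s_def)
    have "\<xi> k i \<in> borel_measurable M"
      using m by (rule measurable_F_M[rotated 2]) (use * tv in auto)
    with b m show "L2_at (s k i) (\<xi> k i)"
      using * tv by (auto simp: L2_at_def intro: L2_bounded)
  qed simp
  have Pe: "simple_process (n k) (\<tau> k) (\<xi> k) r \<omega> = elem_process {..<n k} (s k) (u k) (\<xi> k) (\<omega>, r)" for k r \<omega>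
    by (simp add: simple_process_def elem_process_def s_def u_def)
  have Ie: "simple_integral W (n k) (\<tau> k) (\<xi> k) = elem_integral {..<n k} (s k) (u k) (\<xi> k)" for k
    by (simp add: simple_integral_def elem_integral_def s_def u_def fun_eq_iff)
  have "L2_lim M (\<lambda>k. elem_integral {..<n k} (s k) (u k) (\<xi> k)) J"
    using I by (intro L2_limI Jm L2_at_L2[OF elem_integral_L2_at[OF el]]) (simp add: Ie power2_commute)
  moreover have "L2_lim N (\<lambda>k. elem_process {..<n k} (s k) (u k) (\<xi> k)) (\<lambda>p. indicator {t..v} (snd p) * H' (snd p) (fst p))"
  proof (intro L2_limI meas elem_process_L2[OF el])
    have "(\<integral>\<^sup>+p. ennreal ((elem_process {..<n k} (s k) (u k) (\<xi> k) p - indicator {t..v} (snd p) * H' (snd p) (fst p))\<^sup>2) \<partial>N) =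
      (\<integral>\<^sup>+ \<omega>. (\<integral>\<^sup>+ s\<in>{t..v}. ennreal ((H s \<omega> - simple_process (n k) (\<tau> k) (\<xi> k) s \<omega>)\<^sup>2) \<partial>lborel) \<partial>M)" for k
    proof -
      have m: "(\<lambda>p. ennreal ((elem_process {..<n k} (s k) (u k) (\<xi> k) p - indicator {t..v} (snd p) * H' (snd p) (fst p))\<^sup>2)) \<in> borel_measurable N"
        using L2_measurable[OF elem_process_L2[OF el]] meas by (intro measurable_compose[OF _ measurable_ennreal] borel_measurable_power borel_measurable_diff)
      show ?thesis unfolding nn_integral_N[OF m]
      proof (rule nn_integral_cong_AE)
        show "AE \<omega> in M. (\<integral>\<^sup>+ r. ennreal ((elem_process {..<n k} (s k) (u k) (\<xi> k) (\<omega>, r) - indicator {t..v} (snd (\<omega>, r)) * H' (snd (\<omega>, r)) (fst (\<omega>, r)))\<^sup>2) \<partial>lborel)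
          = (\<integral>\<^sup>+ s\<in>{t..v}. ennreal ((H s \<omega> - simple_process (n k) (\<tau> k) (\<xi> k) s \<omega>)\<^sup>2) \<partial>lborel)"
          using eq
        proof eventually_elim
          case (elim \<omega>)
          show ?case
            by (rule nn_integral_cong_AE, use elim in eventually_elim)
               (use elem_process_outside[OF el, of _ k] in \<open>auto simp: Pe indicator_def power2_commute\<close>)
        qed
      qed
    qed
    then show "(\<lambda>k. \<integral>\<^sup>+p. ennreal ((elem_process {..<n k} (s k) (u k) (\<xi> k) p - indicator {t..v} (snd p) * H' (snd p) (fst p))\<^sup>2) \<partial>N) \<longlonglongrightarrow> 0"
      using P by simp
  qed
  ultimately show ?thesis unfolding ito_def using el by blast
qed

end

section \<open>The uniform law on the unit interval\<close>

abbreviation (input) unif :: "real measure" where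
  "unif \<equiv> restrict_space lborel {0<..<1}"

lemma prob_space_unif: "prob_space unif"
  by (auto simp add: emeasure_restrict_space space_restrict_space intro!: prob_spaceI)

lemma sets_unif_borel: "f \<in> borel_measurable (restrict_space borel {0<..<1::real}) \<Longrightarrow> f \<in> borel_measurable unif"
  by (simp add: measurable_def space_restrict_space sets_restrict_space)

lemma reflect_measurable: "(\<lambda>p. 1 - p) \<in> measurable unif unif"
  by (intro measurable_restrict_space3) auto

lemma distr_unif_reflect: "distr unif unif (\<lambda>p. 1 - p) = unif"
proof (rule measure_eqI)
  fix A assume "A \<in> sets (distr unif unif (\<lambda>p. 1 - p))"
  then have A: "A \<in> sets borel" "A \<subseteq> {0<..<1}"
    by (auto simp: sets_restrict_space)
  have "emeasure (distr unif unif (\<lambda>p. 1 - p)) A = emeasure unif ((\<lambda>p. 1 - p) -` A \<inter> {0<..<1})"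
    using A by (subst emeasure_distr[OF reflect_measurable]) (auto simp: sets_restrict_space space_restrict_space)
  also have "\<dots> = emeasure lborel ((\<lambda>p. 1 - p) -` A \<inter> {0<..<1})"
    by (subst emeasure_restrict_space) auto
  also have "(\<lambda>p. 1 - p) -` A \<inter> {0<..<1} = (\<lambda>p. 1 + (-1) * p) -` A \<inter> space lborel"
    using A by auto
  also have "emeasure lborel \<dots> = emeasure (distr lborel borel (\<lambda>p. 1 + (-1) * p)) A"
    using A by (subst emeasure_distr) auto
  also have "distr lborel borel (\<lambda>p. 1 + (-1) * p) = (lborel :: real measure)"
    using lborel_real_affine[of "-1 :: real" 1] by (simp add: density_1 flip: one_ennreal_def)
  also have "emeasure lborel A = emeasure unif A"
    using A by (subst emeasure_restrict_space) auto
  finally show "emeasure (distr unif unif (\<lambda>p. 1 - p)) A = emeasure unif A" .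
qed simp

lemma integral_unif_reflect:
  fixes f :: "real \<Rightarrow> real"
  assumes "f \<in> borel_measurable unif"
  shows "(\<integral>p. f (1 - p) \<partial>unif) = (\<integral>p. f p \<partial>unif)"
  using integral_distr[OF reflect_measurable assms] by (simp add: distr_unif_reflect)

lemma L2_unif_reflect: "L2 unif f \<Longrightarrow> L2 unif (\<lambda>p. f (1 - p))"
  unfolding L2_def
  using measurable_compose[OF reflect_measurable, of f borel]
    integrable_distr_eq[OF reflect_measurable, of "\<lambda>p. (f p)\<^sup>2"]
  by (auto simp: distr_unif_reflect)

section \<open>Concave distortions\<close>

locale distortion =
  fixes h :: "real \<Rightarrow> real"
  assumes distortion: "h \<in> distortions" and continuous: "continuous_on {0..1} h"
    and square_integrable: "deriv_square_integrable h"
begin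

abbreviation D :: "real \<Rightarrow> real" where "D \<equiv> right_deriv h"

lemma h_0: "h 0 = 0" and h_1: "h 1 = 0" and h_concave: "concave_on {0..1} h"
  using distortion by (auto simp: distortions_def)

lemma h_nonneg: "0 \<le> p \<Longrightarrow> p \<le> 1 \<Longrightarrow> 0 \<le> h p"
  using concave_onD[OF h_concave, of p 0 1] by (simp add: h_0 h_1)

lemma slope_antimono:
  assumes "0 \<le> x" "x < y" "y < z" "z \<le> 1"
  shows "(h z - h x) / (z - x) \<le> (h y - h x) / (y - x)"
    and "(h z - h y) / (z - y) \<le> (h z - h x) / (z - x)"
proof -
  have c: "convex_on {0..1} (\<lambda>x. - h x)" using h_concave by (simp add: concave_on_def)
  have flip: "(- a - - b) / (x - y) = - ((b - a) / (y - x))" for a b x y :: real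
    by (metis add.commute diff_minus_eq_add minus_diff_eq minus_divide_right uminus_add_conv_diff)
  show "(h z - h x) / (z - x) \<le> (h y - h x) / (y - x)"
    using convex_on_slope_le(1)[OF c, of x z y] assms unfolding flip neg_le_iff_le by auto
  show "(h z - h y) / (z - y) \<le> (h z - h x) / (z - x)"
    using convex_on_slope_le(2)[OF c, of x z y] assms unfolding flip neg_le_iff_le by auto
qed

text \<open>The difference quotients at \<open>p\<close> increase as \<open>y\<close> decreases to
  \<open>p\<close> and stay below every slope to the left of \<open>p\<close>. Hence the right
  derivative exists and is their supremum: as an upper bound it gives the first claim, as the least
  one the second.\<close>

lemma right_deriv_supergradient:
  assumes p: "0 < p" "p < 1"
  shows "p < y \<Longrightarrow> y \<le> 1 \<Longrightarrow> h y - h p \<le> D p * (y - p)"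
    and "0 \<le> x \<Longrightarrow> x < p \<Longrightarrow> D p * (p - x) \<le> h p - h x"
proof -
  define q where "q = (\<lambda>y. (h y - h p) / (y - p))"
  define L where "L = (SUP y\<in>{p<..1}. q y)"
  have left: "q y \<le> (h p - h x) / (p - x)" if "0 \<le> x" "x < p" "p < y" "y \<le> 1" for x y
    using slope_antimono[of x p y] that by (simp add: q_def)
  have bdd: "bdd_above (q ` {p<..1})"
    using left[of 0] p by (intro bdd_aboveI2[of _ _ "(h p - h 0) / (p - 0)"]) auto
  have le_L: "q y \<le> L" if "p < y" "y \<le> 1" for y
    unfolding L_def using that by (intro cSUP_upper bdd) auto
  have lim: "(q \<longlongrightarrow> L) (at_right p)"
  proof (rule increasing_tendsto)
    show "eventually (\<lambda>y. q y \<le> L) (at_right p)"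
      using eventually_at_right_less[of p] eventually_at_right_field[of "\<lambda>y. y \<le> 1" p] p(2)
      by (auto simp: eventually_at_right_field intro!: exI[of _ 1] le_L)
    fix c assume "c < L"
    then obtain y0 where y0: "p < y0" "y0 \<le> 1" "c < q y0"
      unfolding L_def using p less_cSUP_iff[OF _ bdd, of c] by auto
    have "c < q y" if "p < y" "y < y0" for y
      using slope_antimono(1)[of p y y0] that y0 p by (simp add: q_def)
    with y0 show "eventually (\<lambda>y. c < q y) (at_right p)"
      by (auto simp: eventually_at_right_field intro!: exI[of _ y0])
  qed
  have "(h has_field_derivative L) (at_right p)"
    unfolding has_field_derivative_iff using lim by (simp add: q_def)
  then have "(h has_vector_derivative L) (at_right p)"
    by (simp add: has_real_derivative_iff_has_vector_derivative)
  then have L: "D p = L"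
    unfolding right_deriv_def by (intro vector_derivative_within) auto
  show "h y - h p \<le> D p * (y - p)" if "p < y" "y \<le> 1"
    using le_L[OF that] that by (simp add: L q_def field_simps)
  show "D p * (p - x) \<le> h p - h x" if x: "0 \<le> x" "x < p"
  proof -
    have "L \<le> (h p - h x) / (p - x)"
      unfolding L_def using p left[OF x] by (intro cSUP_least) auto
    then show ?thesis using x by (simp add: L field_simps)
  qed
qed

lemma D_antimono: assumes "0 < x" "x \<le> y" "y < 1" shows "D y \<le> D x"
proof (cases "x = y")
  case False
  then have "D y * (y - x) \<le> D x * (y - x)"
    using right_deriv_supergradient(1)[of x y] right_deriv_supergradient(2)[of y x] assms by linarith
  then show ?thesis using False assms by simp
qed simp

lemma D_measurable: "D \<in> borel_measurable unif"
proof -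
  have "mono_on {0<..<1} (\<lambda>x. - D x)" by (auto simp: mono_on_def intro: D_antimono)
  from borel_measurable_mono_on_fnc[OF this]
  have "(\<lambda>x. - (- D x)) \<in> borel_measurable (restrict_space borel {0<..<1})"
    by (rule borel_measurable_uminus)
  then show ?thesis using sets_unif_borel by simp
qed

lemma D_L2: "L2 unif D"
  unfolding L2_def
proof (intro conjI D_measurable)
  have "set_integrable lborel {0..1} (\<lambda>p. (D p)\<^sup>2)"
    using square_integrable by (simp add: deriv_square_integrable_def)
  then have "set_integrable lborel {0<..<1} (\<lambda>p. (D p)\<^sup>2)"
    by (rule set_integrable_subset) auto
  then show "integrable unif (\<lambda>p. (D p)\<^sup>2)"
    by (simp add: integrable_restrict_space set_integrable_def)
qed

lemma D_norm: "(\<integral>p. (D p)\<^sup>2 \<partial>unif) = (deriv_norm2 h)\<^sup>2"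
proof -
  have i: "set_integrable lborel {0..1} (\<lambda>p. (D p)\<^sup>2)"
    using square_integrable by (simp add: deriv_square_integrable_def)
  \<comment> \<open>At 1 the right derivative depends on values of \<open>h\<close> outside the
    interval, and at 0 it need not exist; both points are null.\<close>
  have "(LBINT p:{0..1}. (D p)\<^sup>2) = (LBINT p:{0<..<1}. (D p)\<^sup>2)"
    unfolding set_lebesgue_integral_def
  proof (rule integral_cong_AE)
    show "(\<lambda>p. indicator {0..1} p *\<^sub>R (D p)\<^sup>2) \<in> borel_measurable lborel"
      using i unfolding set_integrable_def by (rule borel_measurable_integrable)
    show "(\<lambda>p. indicator {0<..<1} p *\<^sub>R (D p)\<^sup>2) \<in> borel_measurable lborel"
      using set_integrable_subset[OF i, of "{0<..<1}"]
      by (intro borel_measurable_integrable) (auto simp: set_integrable_def subset_eq)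
    show "AE p in lborel. indicat_real {0..1} p *\<^sub>R (D p)\<^sup>2 = indicat_real {0<..<1} p *\<^sub>R (D p)\<^sup>2"
      using AE_lborel_singleton[of "0::real"] AE_lborel_singleton[of "1::real"]
      by eventually_elim (auto simp: indicator_def)
  qed
  also have "\<dots> = (\<integral>p. (D p)\<^sup>2 \<partial>unif)"
    by (simp add: integral_restrict_space set_lebesgue_integral_def)
  finally show ?thesis
    by (simp add: deriv_norm2_def)
qed

lemma set_integrable_D: "set_integrable lborel {0<..<1} D"
  using finite_measure.L2_integrable[OF _ D_L2] prob_space_unif
  by (simp add: prob_space_def integrable_restrict_space set_integrable_def)

text \<open>Since \<open>D\<close> is antitone, the increment of \<open>h\<close> and the integral
  of \<open>D\<close> both lie between \<open>D y * (y - x)\<close> and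
  \<open>D x * (y - x)\<close>.\<close>

lemma FTC_aux:
  assumes xy: "0 < x" "x \<le> y" "y < 1"
  shows "\<bar>h y - h x - (LBINT p:{x<..y}. D p)\<bar> \<le> (D x - D y) * (y - x)"
proof -
  have int: "set_integrable lborel {x<..y} D"
    by (rule set_integrable_subset[OF set_integrable_D]) (use xy in auto)
  have c: "(LBINT p:{x<..y}. c) = c * (y - x)" for c :: real
    using xy by (simp add: set_lebesgue_integral_def)
  have ci: "set_integrable lborel {x<..y} (\<lambda>_. c)" for c :: real
    using xy by (simp add: set_integrable_def)
  have "(LBINT p:{x<..y}. D p) \<le> (LBINT p:{x<..y}. D x)"
    by (rule set_integral_mono[OF int ci]) (use xy in \<open>auto intro: D_antimono\<close>)
  moreover have "(LBINT p:{x<..y}. D y) \<le> (LBINT p:{x<..y}. D p)"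
    by (rule set_integral_mono[OF ci int]) (use xy in \<open>auto intro: D_antimono\<close>)
  moreover have "D y * (y - x) \<le> h y - h x" "h y - h x \<le> D x * (y - x)"
    using right_deriv_supergradient(1)[of x y] right_deriv_supergradient(2)[of y x] xy
    by (cases "x = y"; simp; fail)+
  ultimately show ?thesis
    by (simp add: c left_diff_distrib abs_le_iff)
qed

text \<open>The estimate of the previous lemma, summed over \<open>n\<close> equal pieces, telescopes to
  \<open>(D x - D y) (y - x) / n\<close>.\<close>

lemma FTC_interior:
  assumes xy: "0 < x" "x \<le> y" "y < 1"
  shows "(LBINT p:{x<..y}. D p) = h y - h x"
proof -
  define E where "E = (\<lambda>u v. h v - h u - (LBINT p:{u<..v}. D p))"
  have bound: "\<bar>E x y\<bar> \<le> (D x - D y) * (y - x) / real n" if n: "n > 0" for n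
  proof -
    define u where "u = (\<lambda>i. x + real i * ((y - x) / real n))"
    have u0: "u 0 = x" "u n = y" using n by (auto simp: u_def)
    have umono: "u i \<le> u j" if "i \<le> j" for i j
      proof -
      have "real i * ((y - x) / real n) \<le> real j * ((y - x) / real n)"
        by (rule mult_right_mono) (use that xy in simp_all)
      then show ?thesis unfolding u_def by linarith
    qed
    have step: "u (Suc i) - u i = (y - x) / real n" for i
      unfolding u_def by (simp only: of_nat_Suc distrib_right)
    have "E x (u k) = (\<Sum>i<k. E (u i) (u (Suc i)))" if "k \<le> n" for k
      using that
    proof (induction k)
      case 0
      then show ?case by (simp add: E_def u0 set_lebesgue_integral_def)
    next
      case (Suc k)
      have r: "x \<le> u k" "u k \<le> u (Suc k)" "u (Suc k) \<le> y"
        using umono[of 0 k] umono[of k "Suc k"] umono[of "Suc k" n] Suc.prems by (auto simp: u0)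
      have "(LBINT p:{x<..u k} \<union> {u k<..u (Suc k)}. D p) =
          (LBINT p:{x<..u k}. D p) + (LBINT p:{u k<..u (Suc k)}. D p)"
        by (intro set_integral_Un set_integrable_subset[OF set_integrable_D]) (use r xy in auto)
      moreover have "{x<..u k} \<union> {u k<..u (Suc k)} = {x<..u (Suc k)}" using r by auto
      ultimately show ?case using Suc by (simp add: E_def)
    qed
    from this[of n] have "\<bar>E x y\<bar> = \<bar>\<Sum>i<n. E (u i) (u (Suc i))\<bar>" by (simp add: u0)
    also have "\<dots> \<le> (\<Sum>i<n. \<bar>E (u i) (u (Suc i))\<bar>)" by (rule sum_abs)
    also have "\<dots> \<le> (\<Sum>i<n. (D (u i) - D (u (Suc i))) * ((y - x) / real n))"
    proof (rule sum_mono)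
      fix i assume "i \<in> {..<n}"
      then have "x \<le> u i" "u i \<le> u (Suc i)" "u (Suc i) \<le> y"
        using umono[of 0 i] umono[of i "Suc i"] umono[of "Suc i" n] by (auto simp: u0)
      then show "\<bar>E (u i) (u (Suc i))\<bar> \<le> (D (u i) - D (u (Suc i))) * ((y - x) / real n)"
        using FTC_aux[of "u i" "u (Suc i)"] xy by (simp add: E_def step)
    qed
    also have "\<dots> = (D x - D y) * ((y - x) / real n)"
      unfolding sum_distrib_right[symmetric] sum_lessThan_telescope'[of "\<lambda>i. D (u i)"] by (simp add: u0)
    finally show ?thesis by simp
  qed
  have "(\<lambda>n. (D x - D y) * (y - x) / real (Suc n)) \<longlonglongrightarrow> 0"
    by (rule LIMSEQ_Suc[OF lim_const_over_n])
  then have "\<bar>E x y\<bar> \<le> 0"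
    by (rule LIMSEQ_le_const) (use bound[OF zero_less_Suc] in blast)
  then show ?thesis by (simp add: E_def)
qed

text \<open>The continuity of \<open>h\<close> enters here. The interior formula is applied on
  intervals that exhaust \<open>{0<..<G}\<close>; the integrals converge by domination with
  \<open>D\<close> itself, the values of \<open>h\<close> by continuity at both ends.\<close>

lemma D_integral:
  assumes G: "0 \<le> G" "G \<le> 1"
  shows "(\<integral>p. indicator {0<..<G} p * D p \<partial>unif) = h G"
proof (cases "G = 0")
  case True
  then show ?thesis by (simp add: h_0)
next
  case False
  \<comment> \<open>The shift by 2 makes the margin at most one half, which keeps \<open>x n\<close>
    below \<open>y n\<close> from \<open>n = 0\<close> on.\<close>
  define x where "x = (\<lambda>n. G * inverse (real n + 2))"
  define y where "y = (\<lambda>n. G * (1 - inverse (real n + 2)))"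
  have inv: "0 < inverse (real n + 2)" "inverse (real n + 2) \<le> 1/2" for n
    by (auto simp: field_simps)
  have xy: "0 < x n" "x n \<le> y n" "y n < 1" "y n < G" for n
  proof -
    show "0 < x n" using inv False G by (simp add: x_def)
    show "x n \<le> y n" unfolding x_def y_def using inv[of n] G by (intro mult_left_mono) auto
    have "y n < G * 1" unfolding y_def using inv[of n] G False by (intro mult_strict_left_mono) auto
    then show "y n < 1" "y n < G" using G by auto
  qed
  have i0: "(\<lambda>n. inverse (real n + 2)) \<longlonglongrightarrow> 0" by real_asymp
  have xl: "x \<longlonglongrightarrow> 0"
    unfolding x_def using tendsto_mult_left[OF i0, of G] by simp
  have yl: "y \<longlonglongrightarrow> G"
    unfolding y_def using tendsto_mult_left[OF tendsto_diff[OF tendsto_const[of 1] i0], of G] by simp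
  have "(\<lambda>n. LBINT p:{x n<..y n}. D p) \<longlonglongrightarrow> (LBINT p:{0<..<G}. D p)"
    unfolding set_lebesgue_integral_def
  proof (rule integral_dominated_convergence)
    have si: "set_integrable lborel {0<..<G} D" "set_integrable lborel {x n<..y n} D" for n
      using xy[of n] G by (auto intro!: set_integrable_subset[OF set_integrable_D])
    show "(\<lambda>p. indicat_real {0<..<G} p *\<^sub>R D p) \<in> borel_measurable lborel"
       "\<And>n. (\<lambda>p. indicat_real {x n<..y n} p *\<^sub>R D p) \<in> borel_measurable lborel"
      using si by (auto simp: set_integrable_def)
    show "integrable lborel (\<lambda>p. \<bar>indicat_real {0<..<G} p *\<^sub>R D p\<bar>)"
      using si by (intro integrable_abs) (auto simp: set_integrable_def)
    show "AE p in lborel. norm (indicat_real {x n<..y n} p *\<^sub>R D p) \<le> \<bar>indicat_real {0<..<G} p *\<^sub>R D p\<bar>" for n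
      using xy[of n] by (auto simp: indicator_def)
    show "AE p in lborel. (\<lambda>n. indicat_real {x n<..y n} p *\<^sub>R D p) \<longlonglongrightarrow> indicat_real {0<..<G} p *\<^sub>R D p"
    proof (intro AE_I2 tendsto_scaleR tendsto_const tendsto_eventually)
      fix p :: real
      show "\<forall>\<^sub>F n in sequentially. indicat_real {x n<..y n} p = indicator {0<..<G} p"
      proof (cases "p \<in> {0<..<G}")
        case True
        then have "\<forall>\<^sub>F n in sequentially. x n < p" "\<forall>\<^sub>F n in sequentially. p < y n"
          using order_tendstoD(2)[OF xl, of p] order_tendstoD(1)[OF yl, of p] by auto
        then show ?thesis by eventually_elim (use True in auto)
      next
        case False
        have "p \<notin> {x n<..y n}" for n using False xy[of n] by auto
        then show ?thesis using False by simp
      qed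
    qed
  qed
  then have "(\<lambda>n. h (y n) - h (x n)) \<longlonglongrightarrow> (LBINT p:{0<..<G}. D p)"
    by (simp add: FTC_interior[OF xy(1-3)])
  moreover have "(\<lambda>n. h (y n)) \<longlonglongrightarrow> h G"
  proof (rule continuous_on_tendsto_compose[OF continuous yl])
    show "\<forall>\<^sub>F n in sequentially. y n \<in> {0..1}"
      using order.trans[OF less_imp_le[OF xy(1)] xy(2)] less_imp_le[OF xy(3)] by simp
  qed (use G in simp)
  moreover have "(\<lambda>n. h (x n)) \<longlonglongrightarrow> h 0"
  proof (rule continuous_on_tendsto_compose[OF continuous xl])
    show "\<forall>\<^sub>F n in sequentially. x n \<in> {0..1}"
      using order.trans[OF xy(2) less_imp_le[OF xy(3)]] less_imp_le[OF xy(1)] by simp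
  qed simp
  ultimately have "(LBINT p:{0<..<G}. D p) = h G - h 0"
    by (rule LIMSEQ_unique[OF _ tendsto_diff])
  then have "(LBINT p:{0<..<G}. D p) = h G"
    by (simp add: h_0)
  moreover have "(LBINT p:{0<..<G}. D p) = (\<integral>p. indicator {0<..<G} p * D p \<partial>unif)"
    unfolding set_lebesgue_integral_def using G
    by (subst integral_restrict_space) (auto intro!: Bochner_Integration.integral_cong simp: indicator_def)
  ultimately show ?thesis by simp
qed

lemma D_integral_0: "(\<integral>p. D p \<partial>unif) = 0"
proof -
  have "(\<integral>p. D p \<partial>unif) = (\<integral>p. indicator {0<..<1} p * D p \<partial>unif)"
    by (intro Bochner_Integration.integral_cong) (auto simp: space_restrict_space)
  then show ?thesis using D_integral[of 1] h_1 by simp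
qed

text \<open>A vanishing norm forces \<open>D\<close> to be 0 almost everywhere, and \<open>h\<close>
  is the integral of \<open>D\<close>.\<close>

lemma deriv_norm2_pos:
  assumes "\<exists>p\<in>{0..1}. h p \<noteq> 0"
  shows "0 < deriv_norm2 h"
proof (rule ccontr)
  assume "\<not> 0 < deriv_norm2 h"
  moreover have "0 \<le> deriv_norm2 h"
    by (simp add: deriv_norm2_def set_lebesgue_integral_def)
  ultimately have "(\<integral>p. (D p)\<^sup>2 \<partial>unif) = 0" by (simp add: D_norm)
  then have "AE p in unif. D p = 0"
    using integral_nonneg_eq_0_iff_AE[OF L2_square[OF D_L2]] by simp
  then have "(\<integral>p. indicator {0<..<G} p * D p \<partial>unif) = (\<integral>p. 0 \<partial>unif)" for G
    by (intro integral_cong_AE borel_measurable_times D_measurable)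
       (auto intro!: sets_unif_borel measurable_restrict_space1)
  then have "h G = 0" if "0 \<le> G" "G \<le> 1" for G
    using D_integral[OF that] by simp
  then show False using assms by auto
qed

end

section \<open>Quantile functions and the Choquet integral\<close>

lemma measure_unif: "measure unif {0<..<1} = 1"
  using prob_space.prob_space[OF prob_space_unif] by (simp add: space_restrict_space)

text \<open>Skorohod's construction: \<open>quantile P\<close> is the pseudo-inverse of the
  distribution function and transports the uniform law to \<open>P\<close>.\<close>

lemma quantile_distr:
  assumes "real_distribution P"
  shows "quantile P \<in> borel_measurable unif" and "distr unif borel (quantile P) = P"
    and "0 < p \<Longrightarrow> p < 1 \<Longrightarrow> p \<le> cdf P x \<longleftrightarrow> quantile P p \<le> x"
proof -
  interpret cdf_distribution P by (simp add: cdf_distribution_def assms)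
  have q: "quantile P = I" by (simp add: quantile_def fun_eq_iff)
  show "quantile P \<in> borel_measurable unif"
    unfolding q by (intro sets_unif_borel measurable_CI)
  show "distr unif borel (quantile P) = P"
    unfolding q by (rule distr_I_eq_M)
  show "0 < p \<Longrightarrow> p < 1 \<Longrightarrow> p \<le> cdf P x \<longleftrightarrow> quantile P p \<le> x"
    unfolding q by (rule pseudoinverse)
qed

lemma has_quantile_function_distr:
  assumes P: "real_distribution P" and q: "has_quantile_function P q" and m: "q \<in> borel_measurable unif"
  shows "P = distr unif borel q"
proof -
  have "AE p in unif. quantile P p = q p"
    using q unfolding has_quantile_function_def by (subst AE_restrict_space_iff) auto
  then have "distr unif borel (quantile P) = distr unif borel q"
    by (intro distr_cong_AE quantile_distr(1)[OF P] m refl)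
  then show ?thesis using quantile_distr(2)[OF P] by simp
qed

lemma quantile_integral:
  fixes f :: "real \<Rightarrow> real"
  assumes P: "real_distribution P" and f: "f \<in> borel_measurable borel"
  shows "(\<integral>p. f (quantile P p) \<partial>unif) = (\<integral>u. f u \<partial>P)"
    and "integrable unif (\<lambda>p. f (quantile P p)) \<longleftrightarrow> integrable P f"
  using integral_distr[OF quantile_distr(1)[OF P] f] integrable_distr_eq[OF quantile_distr(1)[OF P] f]
  by (simp_all add: quantile_distr(2)[OF P])

lemma quantile_L2:
  assumes P: "real_distribution P" and i: "integrable P (\<lambda>u. u\<^sup>2)"
  shows "L2 unif (quantile P)"
  using quantile_integral(2)[OF P, of "\<lambda>u. u\<^sup>2"] i by (simp add: L2_def quantile_distr(1)[OF P])

text \<open>The signed indicator of the interval between 0 and \<open>y\<close>, which makes the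
  layer-cake formula valid for real \<open>y\<close> of either sign.\<close>

definition layer :: "real \<Rightarrow> real \<Rightarrow> real" where
  "layer x y = (if 0 \<le> x \<and> x < y then 1 else if y \<le> x \<and> x < 0 then - 1 else 0)"

lemma layer_measurable: "(\<lambda>(x, y). layer x y) \<in> borel_measurable (borel \<Otimes>\<^sub>M borel)"
  unfolding layer_def[abs_def] case_prod_beta by measurable

lemma layer_integral:
  "integrable lborel (\<lambda>x. layer x y)" "(\<integral>x. layer x y \<partial>lborel) = y" "(\<integral>x. \<bar>layer x y\<bar> \<partial>lborel) = \<bar>y\<bar>"
proof -
  have e: "(\<lambda>x. layer x y) = (\<lambda>x. indicator {0..<y} x - indicator {y..<0} x)"
    "(\<lambda>x. \<bar>layer x y\<bar>) = (\<lambda>x. indicator {0..<y} x + indicator {y..<0} x)"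
    by (auto simp: layer_def fun_eq_iff indicator_def)
  have i: "integrable lborel (indicator {0..<y} :: real \<Rightarrow> real)" "integrable lborel (indicator {y..<0} :: real \<Rightarrow> real)"
    using emeasure_bounded_finite[of "{0..<y}"] emeasure_bounded_finite[of "{y..<0}"] by auto
  show "integrable lborel (\<lambda>x. layer x y)" unfolding e using i by simp
  show "(\<integral>x. layer x y \<partial>lborel) = y" unfolding e using i by (cases "0 \<le> y") auto
  show "(\<integral>x. \<bar>layer x y\<bar> \<partial>lborel) = \<bar>y\<bar>" unfolding e using i by (cases "0 \<le> y") auto
qed

lemma ext_integral_nonneg:
  assumes "\<And>x. x \<in> space M \<Longrightarrow> 0 \<le> f x" "integrable M f"
  shows "ext_integral M (\<lambda>x. ereal (f x)) = ereal (\<integral>x. f x \<partial>M)"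
proof -
  have "(\<integral>\<^sup>+x. e2ennreal (ereal (f x)) \<partial>M) = ennreal (\<integral>x. f x \<partial>M)"
    using assms by (subst nn_integral_eq_integral[symmetric]) (auto intro!: nn_integral_cong simp: ennreal_def)
  moreover have "(\<integral>\<^sup>+x. e2ennreal (- ereal (f x)) \<partial>M) = (\<integral>\<^sup>+x. 0 \<partial>M)"
    using assms by (intro nn_integral_cong) (simp add: ennreal_neg)
  moreover have "0 \<le> (\<integral>x. f x \<partial>M)" using assms(1) by (rule Bochner_Integration.integral_nonneg)
  ultimately show ?thesis by (simp add: ext_integral_def zero_ennreal.rep_eq)
qed

lemma (in prob_space) square_integral_ge:
  assumes "L2 M f" shows "(\<integral>x. f x \<partial>M)\<^sup>2 \<le> (\<integral>x. (f x)\<^sup>2 \<partial>M)"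
  using L2_Cauchy_Schwarz[OF assms L2_const[of 1]] by (simp add: prob_space)

context distortion
begin

lemma D_reflect_L2: "L2 unif (\<lambda>p. D (1 - p))"
  by (rule L2_unif_reflect[OF D_L2])

lemma D_reflect_integral: "(\<integral>p. D (1 - p) \<partial>unif) = 0"
  using integral_unif_reflect[OF D_measurable] D_integral_0 by simp

lemma D_reflect_norm: "(\<integral>p. (D (1 - p))\<^sup>2 \<partial>unif) = (deriv_norm2 h)\<^sup>2"
  using integral_unif_reflect[OF borel_measurable_power[OF D_measurable], of 2] D_norm by simp

lemma D_reflect_integral_tail:
  assumes G: "0 \<le> G" "G \<le> 1"
  shows "(\<integral>p. D (1 - p) * indicator {1 - G<..} p \<partial>unif) = h G"
proof -
  have "(\<integral>p. D (1 - p) * indicator {1 - G<..} p \<partial>unif) = (\<integral>p. (\<lambda>p. indicator {0<..<G} p * D p) (1 - p) \<partial>unif)"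
    by (intro Bochner_Integration.integral_cong) (auto simp: indicator_def space_restrict_space)
  also have "\<dots> = (\<integral>p. indicator {0<..<G} p * D p \<partial>unif)"
    by (intro integral_unif_reflect borel_measurable_times D_measurable)
       (auto intro!: sets_unif_borel measurable_restrict_space1)
  finally show ?thesis using D_integral[OF G] by simp
qed

text \<open>The layer-cake decomposition \<open>y = \<integral> layer x y dx\<close> and Fubini turn the Choquet integral into
  a weighted integral of the quantile function.\<close>

lemma choquet_eq_quantile_integral:
  assumes P: "real_distribution P" and sq: "integrable P (\<lambda>u. u\<^sup>2)"
  shows "choquet h P = ereal (\<integral>p. D (1 - p) * quantile P p \<partial>unif)"
proof -
  interpret P: real_distribution P by (rule P)
  interpret U: prob_space unif by (rule prob_space_unif)
  interpret pair_sigma_finite unif lborel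
    by (intro pair_sigma_finite.intro U.sigma_finite_measure_axioms lborel.sigma_finite_measure_axioms)
  define q where "q = quantile P"
  have qm: "q \<in> borel_measurable unif" unfolding q_def by (rule quantile_distr(1)[OF P])
  have qL: "L2 unif q" unfolding q_def by (rule quantile_L2[OF P sq])
  note Dm = L2_measurable[OF D_reflect_L2]
  define f where "f = (\<lambda>(p, x). D (1 - p) * layer x (q p))"
  have sm: "snd \<in> borel_measurable (unif \<Otimes>\<^sub>M lborel)"
    using measurable_snd[of unif lborel] by simp
  have "(\<lambda>z. layer (snd z) (q (fst z))) \<in> borel_measurable (unif \<Otimes>\<^sub>M lborel)"
    using measurable_compose[OF measurable_Pair[OF sm measurable_compose[OF measurable_fst qm]] layer_measurable]
    by simp
  then have fm: "f \<in> borel_measurable (unif \<Otimes>\<^sub>M lborel)"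
    unfolding f_def case_prod_beta by (intro borel_measurable_times measurable_compose[OF measurable_fst Dm])
  have int: "integrable (unif \<Otimes>\<^sub>M lborel) f"
  proof (rule Fubini_integrable[OF fm])
    \<comment> \<open>Integrating over \<open>x\<close> first gives
      \<open>\<bar>D (1 - p) * q p\<bar>\<close>, a product of two square-integrable
      functions.\<close>
    have "(\<lambda>p. \<integral>x. norm (f (p, x)) \<partial>lborel) = (\<lambda>p. \<bar>D (1 - p) * q p\<bar>)"
      by (simp add: f_def abs_mult layer_integral)
    then show "integrable unif (\<lambda>p. \<integral>x. norm (f (p, x)) \<partial>lborel)"
      using integrable_abs[OF L2_mult[OF D_reflect_L2 qL]] by simp
    show "AE p in unif. integrable lborel (\<lambda>x. f (p, x))"
      by (simp add: f_def layer_integral)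
  qed
  define \<phi> where "\<phi> = (\<lambda>x. h (measure P {x..}))"
  \<comment> \<open>Where \<open>P\<close> has no atom, the closed tail has mass
    \<open>G = 1 - cdf P x\<close>, and the quantile exceeds \<open>x\<close> exactly for levels
    above \<open>1 - G\<close>.\<close>
  have inner: "(\<integral>p. f (p, x) \<partial>unif) = \<phi> x" if x: "measure P {x} = 0" for x
  proof -
    define G where "G = 1 - cdf P x"
    have G: "0 \<le> G" "G \<le> 1"
      using P.cdf_nonneg[of x] P.cdf_bounded_prob[of x] by (auto simp: G_def)
    have "measure P {x..} = measure P ({x} \<union> {x<..})" by (rule arg_cong[of _ _ "measure P"]) auto
    also have "\<dots> = measure P {x} + measure P {x<..}"
      by (subst P.finite_measure_Union) auto
    also have "measure P {x<..} = 1 - measure P {..x}"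
      using P.prob_compl[of "{..x}"] by (simp add: Compl_eq_Diff_UNIV[symmetric])
    finally have \<phi>: "\<phi> x = h G" using x by (simp add: \<phi>_def G_def cdf_def)
    have q: "q p \<le> x \<longleftrightarrow> p \<notin> {1 - G<..}" if "p \<in> space unif" for p
      using that quantile_distr(3)[OF P, of p x] by (auto simp: q_def G_def space_restrict_space not_less)
    have tail_int: "integrable unif (\<lambda>p. D (1 - p) * indicator {1 - G<..} p)"
      by (intro L2_mult D_reflect_L2 U.L2_bounded[of _ 1])
         (auto intro!: sets_unif_borel measurable_restrict_space1 simp: indicator_def)
    show ?thesis
    proof (cases "0 \<le> x")
      case True
      have "(\<integral>p. f (p, x) \<partial>unif) = (\<integral>p. D (1 - p) * indicator {1 - G<..} p \<partial>unif)"
        by (intro Bochner_Integration.integral_cong refl)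
           (use q True in \<open>auto simp: f_def layer_def indicator_def not_le[symmetric]\<close>)
      then show ?thesis by (simp add: \<phi> D_reflect_integral_tail[OF G])
    next
      case False
      \<comment> \<open>For negative \<open>x\<close> the layer is the tail indicator minus 1. The
        extra term integrates to 0, in accordance with \<open>h 1 = 0\<close> in the negative part
        of the Choquet integral.\<close>
      have "(\<integral>p. f (p, x) \<partial>unif) = (\<integral>p. D (1 - p) * indicator {1 - G<..} p - D (1 - p) \<partial>unif)"
        by (intro Bochner_Integration.integral_cong refl)
           (use q False in \<open>auto simp: f_def layer_def indicator_def\<close>)
      also have "\<dots> = h G"
        using tail_int U.L2_integrable[OF D_reflect_L2]
        by (simp add: D_reflect_integral_tail[OF G] D_reflect_integral)
      finally show ?thesis by (simp add: \<phi>)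
    qed
  qed
  \<comment> \<open>The atoms of a distribution are countable, hence null for the integration over
    \<open>x\<close>.\<close>
  have AE: "AE x in lborel. (\<integral>p. f (p, x) \<partial>unif) = \<phi> x"
  proof (rule AE_I')
    show "{x. measure P {x} > 0} \<in> null_sets lborel"
      using P.countable_atoms by (rule countable_imp_null_set_lborel)
    show "{x \<in> space lborel. (\<integral>p. f (p, x) \<partial>unif) \<noteq> \<phi> x} \<subseteq> {x. measure P {x} > 0}"
      using inner by (auto simp: less_le)
  qed
  have "antimono (\<lambda>x. measure P {x..})"
    by (intro antimonoI P.finite_measure_mono) auto
  then have "(\<lambda>x. measure P {x..}) \<in> borel_measurable borel"
    using borel_measurable_mono[of "\<lambda>x. - measure P {x..}"] by (auto simp: mono_def antimono_def)
  then have "(\<lambda>x. measure P {x..}) \<in> measurable borel (restrict_space borel {0..1})"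
    by (intro measurable_restrict_space2) auto
  from measurable_compose[OF this borel_measurable_continuous_on_restrict[OF continuous]]
  have \<phi>m: "\<phi> \<in> borel_measurable borel" by (simp add: \<phi>_def)
  have i2: "integrable lborel (\<lambda>x. \<integral>p. f (p, x) \<partial>unif)" and e2: "(\<integral>x. \<integral>p. f (p, x) \<partial>unif \<partial>lborel) = (\<integral>p. \<integral>x. f (p, x) \<partial>lborel \<partial>unif)"
    using integrable_snd[of "\<lambda>p x. f (p, x)"] Fubini_integral[of "\<lambda>p x. f (p, x)"] int by simp_all
  have \<phi>i: "integrable lborel \<phi>"
    using i2 AE \<phi>m borel_measurable_integrable[OF i2] by (subst (asm) integrable_cong_AE) auto
  have "(\<integral>x. \<phi> x \<partial>lborel) = (\<integral>x. \<integral>p. f (p, x) \<partial>unif \<partial>lborel)"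
    using AE \<phi>m borel_measurable_integrable[OF i2] by (intro integral_cong_AE) auto
  also have "\<dots> = (\<integral>p. D (1 - p) * q p \<partial>unif)"
    unfolding e2 by (simp add: f_def layer_integral)
  finally have val: "(\<integral>x. \<phi> x \<partial>lborel) = (\<integral>p. D (1 - p) * q p \<partial>unif)" .
  have \<phi>0: "0 \<le> \<phi> x" for x unfolding \<phi>_def by (intro h_nonneg) auto
  have si: "set_integrable lborel {..0} \<phi>" "set_integrable lborel {0..} \<phi>"
    unfolding set_integrable_def using integrable_mult_indicator[OF _ \<phi>i] by auto
  have ri: "integrable (restrict_space lborel {..0}) \<phi>" "integrable (restrict_space lborel {0..}) \<phi>"
    using si by (simp_all add: integrable_restrict_space set_integrable_def)
  have "choquet h P = ereal (\<integral>x. \<phi> x \<partial>restrict_space lborel {..0}) + ereal (\<integral>x. \<phi> x \<partial>restrict_space lborel {0..})"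
    unfolding choquet_def using ext_integral_nonneg[OF \<phi>0 ri(1)] ext_integral_nonneg[OF \<phi>0 ri(2)]
    by (simp add: h_1 \<phi>_def)
  also have "\<dots> = ereal ((LBINT x:{..0}. \<phi> x) + (LBINT x:{0..}. \<phi> x))"
    by (simp add: integral_restrict_space set_lebesgue_integral_def)
  \<comment> \<open>Both half-lines are closed, so 0 is counted twice; a single point does not
    matter.\<close>
  also have "(LBINT x:{..0}. \<phi> x) + (LBINT x:{0..}. \<phi> x) = (\<integral>x. \<phi> x \<partial>lborel)"
  proof -
    have "(\<integral>x. \<phi> x \<partial>lborel) = (\<integral>x. indicator {..0} x *\<^sub>R \<phi> x + indicator {0..} x *\<^sub>R \<phi> x \<partial>lborel)"
      using AE_lborel_singleton[of "0::real"] \<phi>m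
      by (intro integral_cong_AE) (auto simp: indicator_def elim!: eventually_mono)
    then show ?thesis using si by (simp add: set_integrable_def set_lebesgue_integral_def)
  qed
  finally show ?thesis using val by (simp add: q_def)
qed

lemma choquet_le:
  assumes P: "real_distribution P" and sq: "integrable P (\<lambda>u. u\<^sup>2)"
  shows "choquet h P \<le> ereal (deriv_norm2 h * sqrt (dist_var P))" "0 \<le> dist_var P"
proof -
  interpret U: prob_space unif by (rule prob_space_unif)
  define q where "q = quantile P"
  define m where "m = dist_mean P"
  have qL: "L2 unif q" unfolding q_def by (rule quantile_L2[OF P sq])
  have qi: "integrable unif q" by (rule U.L2_integrable[OF qL])
  have m: "(\<integral>p. q p \<partial>unif) = m"
    using quantile_integral(1)[OF P, of "\<lambda>u. u"] by (simp add: q_def m_def dist_mean_def)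
  have q2: "(\<integral>p. (q p)\<^sup>2 \<partial>unif) = (\<integral>u. u\<^sup>2 \<partial>P)"
    using quantile_integral(1)[OF P, of "\<lambda>u. u\<^sup>2"] by (simp add: q_def)
  have cL: "L2 unif (\<lambda>p. q p - m)" by (intro L2_diff qL U.L2_const)
  have "(\<integral>p. (q p - m)\<^sup>2 \<partial>unif) = (\<integral>p. (q p)\<^sup>2 - 2 * m * q p + m\<^sup>2 \<partial>unif)"
    by (intro Bochner_Integration.integral_cong) (auto simp: power2_diff)
  also have "\<dots> = (\<integral>u. u\<^sup>2 \<partial>P) - 2 * m * m + m\<^sup>2"
    using qi L2_square[OF qL] by (simp add: m q2 measure_unif)
  finally have v: "(\<integral>p. (q p - m)\<^sup>2 \<partial>unif) = dist_var P"
    by (simp add: dist_var_def m_def power2_eq_square)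
  show v0: "0 \<le> dist_var P" unfolding v[symmetric] by simp
  have "(\<integral>p. D (1 - p) * q p \<partial>unif) = (\<integral>p. D (1 - p) * (q p - m) \<partial>unif)"
    using L2_mult[OF D_reflect_L2 qL] U.L2_integrable[OF D_reflect_L2]
    by (simp add: right_diff_distrib D_reflect_integral)
  also have "\<dots> \<le> sqrt ((\<integral>p. (D (1 - p))\<^sup>2 \<partial>unif) * (\<integral>p. (q p - m)\<^sup>2 \<partial>unif))"
    by (rule real_le_rsqrt[OF L2_Cauchy_Schwarz[OF D_reflect_L2 cL]])
  also have "\<dots> = deriv_norm2 h * sqrt (dist_var P)"
    by (simp add: D_reflect_norm v real_sqrt_mult deriv_norm2_def set_lebesgue_integral_def)
  finally show "choquet h P \<le> ereal (deriv_norm2 h * sqrt (dist_var P))"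
    by (simp add: choquet_eq_quantile_integral[OF P sq] q_def)
qed

lemma location_scale:
  assumes P: "real_distribution P" and q: "has_quantile_function P (\<lambda>p. m + c * D (1 - p))"
  shows "P = distr unif borel (\<lambda>p. m + c * D (1 - p))"
    "integrable P (\<lambda>u. u\<^sup>2)" "dist_mean P = m" "dist_var P = c\<^sup>2 * (deriv_norm2 h)\<^sup>2"
    "choquet h P = ereal (c * (deriv_norm2 h)\<^sup>2)"
proof -
  interpret U: prob_space unif by (rule prob_space_unif)
  define g where "g = (\<lambda>p. m + c * D (1 - p))"
  have gL: "L2 unif g" unfolding g_def by (intro L2_add U.L2_const L2_cmult D_reflect_L2)
  note gm = L2_measurable[OF gL]
  show Pg: "P = distr unif borel (\<lambda>p. m + c * D (1 - p))"
    using has_quantile_function_distr[OF P q] gm by (simp add: g_def)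
  have int: "(\<integral>u. f u \<partial>P) = (\<integral>p. f (g p) \<partial>unif)" if "f \<in> borel_measurable borel" for f :: "real \<Rightarrow> real"
    unfolding Pg g_def[symmetric] by (rule integral_distr[OF gm that])
  show sq: "integrable P (\<lambda>u. u\<^sup>2)"
    unfolding Pg g_def[symmetric] using L2_square[OF gL] by (subst integrable_distr_eq[OF gm]) auto
  note Di = U.L2_integrable[OF D_reflect_L2]
  show mean: "dist_mean P = m"
    unfolding dist_mean_def using Di by (subst int) (simp_all add: g_def D_reflect_integral measure_unif)
  have "(\<integral>p. (g p)\<^sup>2 \<partial>unif) = (\<integral>p. m\<^sup>2 + 2 * m * c * D (1 - p) + c\<^sup>2 * (D (1 - p))\<^sup>2 \<partial>unif)"
    by (intro Bochner_Integration.integral_cong) (auto simp: g_def power2_sum power_mult_distrib)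
  also have "\<dots> = m\<^sup>2 + c\<^sup>2 * (deriv_norm2 h)\<^sup>2"
    using Di L2_square[OF D_reflect_L2] by (simp add: D_reflect_integral D_reflect_norm measure_unif)
  finally show "dist_var P = c\<^sup>2 * (deriv_norm2 h)\<^sup>2"
    unfolding dist_var_def mean by (subst int) simp_all
  have "AE p in unif. quantile P p = g p"
    using q unfolding has_quantile_function_def g_def by (subst AE_restrict_space_iff) auto
  then have "(\<integral>p. D (1 - p) * quantile P p \<partial>unif) = (\<integral>p. D (1 - p) * g p \<partial>unif)"
    by (intro integral_cong_AE borel_measurable_times L2_measurable[OF D_reflect_L2] quantile_distr(1)[OF P] gm)
       (auto elim!: eventually_mono)
  also have "\<dots> = (\<integral>p. m * D (1 - p) + c * (D (1 - p))\<^sup>2 \<partial>unif)"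
    by (intro Bochner_Integration.integral_cong) (auto simp: g_def power2_eq_square algebra_simps)
  also have "\<dots> = c * (deriv_norm2 h)\<^sup>2"
    using Di L2_square[OF D_reflect_L2] by (simp add: D_reflect_integral D_reflect_norm)
  finally show "choquet h P = ereal (c * (deriv_norm2 h)\<^sup>2)"
    by (simp add: choquet_eq_quantile_integral[OF P sq])
qed

end

section \<open>Second moments of Ito processes\<close>

text \<open>Fubini: the product of the integrals is the integral of \<open>f r * g s\<close> over
  the plane, which is split along the diagonal. The diagonal is null, so both halves can be written
  with closed half-lines.\<close>

lemma integral_product_by_parts:
  fixes f g :: "real \<Rightarrow> real"
  assumes f: "integrable lborel f" and g: "integrable lborel g"
  defines "F \<equiv> \<lambda>r. \<integral>s. indicator {..r} s * f s \<partial>lborel"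
    and "G \<equiv> \<lambda>r. \<integral>s. indicator {..r} s * g s \<partial>lborel"
  shows "integrable lborel (\<lambda>r. f r * G r)" "integrable lborel (\<lambda>r. g r * F r)"
    "(\<integral>r. f r \<partial>lborel) * (\<integral>r. g r \<partial>lborel) = (\<integral>r. f r * G r \<partial>lborel) + (\<integral>r. g r * F r \<partial>lborel)"
proof -
  have [measurable]: "f \<in> borel_measurable borel" "g \<in> borel_measurable borel"
    using f g by (auto dest: borel_measurable_integrable)
  have prod: "integrable (lborel \<Otimes>\<^sub>M lborel) (\<lambda>(r, s). f r * g s)"
  proof (rule lborel_pair.Fubini_integrable)
    show "integrable lborel (\<lambda>r. \<integral>s. norm (case (r, s) of (r, s) \<Rightarrow> f r * g s) \<partial>lborel)"
      using f by (simp add: abs_mult)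
    show "AE r in lborel. integrable lborel (\<lambda>s. case (r, s) of (r, s) \<Rightarrow> f r * g s)"
      using g by simp
  qed measurable
  have int: "integrable (lborel \<Otimes>\<^sub>M lborel) (\<lambda>(r, s). indicator {..r} s * (f r * g s))"
    "integrable (lborel \<Otimes>\<^sub>M lborel) (\<lambda>(r, s). indicator {r<..} s * (f r * g s))"
    by (rule Bochner_Integration.integrable_bound[OF prod], measurable, auto simp: indicator_def)+
  have e: "(\<integral>s. indicator {..r} s * (f r * g s) \<partial>lborel) = f r * G r" for r
    unfolding G_def by (subst integral_mult_right_zero[symmetric]) (simp add: ac_simps)
  have e': "(\<integral>r. indicator {r<..} s * (f r * g s) \<partial>lborel) = g s * F s" for s
  proof -
    have "(\<integral>r. indicator {r<..} s * (f r * g s) \<partial>lborel) = (\<integral>r. g s * (indicator {..s} r * f r) \<partial>lborel)"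
      using AE_lborel_singleton[of s]
      by (intro integral_cong_AE) (auto elim!: eventually_mono simp: indicator_def)
    then show ?thesis by (simp add: F_def)
  qed
  show "integrable lborel (\<lambda>r. f r * G r)"
    using lborel_pair.integrable_fst[OF int(1)] by (simp add: e)
  show "integrable lborel (\<lambda>r. g r * F r)"
    using lborel_pair.integrable_snd[OF int(2)] by (simp add: e')
  have "(\<integral>r. f r \<partial>lborel) * (\<integral>r. g r \<partial>lborel) = (\<integral>r. \<integral>s. f r * g s \<partial>lborel \<partial>lborel)"
    by simp
  also have "\<dots> = (\<integral>(r, s). f r * g s \<partial>(lborel \<Otimes>\<^sub>M lborel))"
    using lborel_pair.integral_fst[OF prod] by simp
  also have "\<dots> = (\<integral>z. (case z of (r, s) \<Rightarrow> indicator {..r} s * (f r * g s)) +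
      (case z of (r, s) \<Rightarrow> indicator {r<..} s * (f r * g s)) \<partial>(lborel \<Otimes>\<^sub>M lborel))"
    by (intro Bochner_Integration.integral_cong) (auto simp: indicator_def)
  also have "\<dots> = (\<integral>r. \<integral>s. indicator {..r} s * (f r * g s) \<partial>lborel \<partial>lborel) +
      (\<integral>s. \<integral>r. indicator {r<..} s * (f r * g s) \<partial>lborel \<partial>lborel)"
    by (simp only: Bochner_Integration.integral_add[OF int] lborel_pair.integral_fst[OF int(1)] lborel_pair.integral_snd[OF int(2)])
  finally show "(\<integral>r. f r \<partial>lborel) * (\<integral>r. g r \<partial>lborel) = (\<integral>r. f r * G r \<partial>lborel) + (\<integral>r. g r * F r \<partial>lborel)"
    by (simp only: e e')
qed

text \<open>Time is rounded down to dyadic numbers. At each level the value depends on time through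
  countably many times only, hence measurably, and path continuity gives the limit. Clamping keeps
  the rounded times in \<open>{t..u}\<close>, where \<open>X\<close> is measurable.\<close>

lemma jointly_measurable_continuous:
  fixes X :: "real \<Rightarrow> 'a \<Rightarrow> real"
  assumes meas: "\<And>s. s \<in> {t..u} \<Longrightarrow> X s \<in> borel_measurable A"
    and cont: "\<And>\<omega>. \<omega> \<in> space A \<Longrightarrow> continuous_on {t..u} (\<lambda>s. X s \<omega>)"
  shows "(\<lambda>p. indicator {t..u} (snd p) * X (snd p) (fst p)) \<in> borel_measurable (A \<Otimes>\<^sub>M borel)"
proof (cases "t \<le> u")
  case False
  then show ?thesis by simp
next
  case tu: True
  define clamp where "clamp = (\<lambda>s. max t (min u s))"
  have clamp: "clamp s \<in> {t..u}" for s using tu by (auto simp: clamp_def)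
  define \<eta> where "\<eta> = (\<lambda>n (s::real). real_of_int \<lfloor>s * 2 ^ n\<rfloor> / 2 ^ n)"
  show ?thesis
  proof (rule borel_measurable_LIMSEQ_real)
    fix n :: nat
    show "(\<lambda>p. indicator {t..u} (snd p) * X (clamp (\<eta> n (snd p))) (fst p)) \<in> borel_measurable (A \<Otimes>\<^sub>M borel)"
    proof (rule borel_measurable_times)
      have "(\<lambda>p. X (clamp (real_of_int \<lfloor>snd p * (2::real) ^ n\<rfloor> / 2 ^ n)) (fst p)) \<in> borel_measurable (A \<Otimes>\<^sub>M borel)"
      proof (rule measurable_compose_countable[where f="\<lambda>i p. X (clamp (real_of_int i / 2 ^ n)) (fst p)" and g="\<lambda>p. \<lfloor>snd p * (2::real) ^ n\<rfloor>"])
        show "(\<lambda>p. X (clamp (real_of_int i / 2 ^ n)) (fst p)) \<in> borel_measurable (A \<Otimes>\<^sub>M borel)" for i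
          by (rule measurable_compose[OF measurable_fst meas[OF clamp]])
        show "(\<lambda>p. \<lfloor>snd p * (2::real) ^ n\<rfloor>) \<in> A \<Otimes>\<^sub>M borel \<rightarrow>\<^sub>M count_space UNIV"
          by measurable
      qed
      then show "(\<lambda>p. X (clamp (\<eta> n (snd p))) (fst p)) \<in> borel_measurable (A \<Otimes>\<^sub>M borel)"
        by (simp add: \<eta>_def)
    qed measurable
  next
    fix p assume p: "p \<in> space (A \<Otimes>\<^sub>M (borel :: real measure))"
    show "(\<lambda>n. indicator {t..u} (snd p) * X (clamp (\<eta> n (snd p))) (fst p)) \<longlonglongrightarrow> indicator {t..u} (snd p) * X (snd p) (fst p)"
    proof (cases "snd p \<in> {t..u}")
      case True
      have eta: "(\<lambda>n. \<eta> n (snd p)) \<longlonglongrightarrow> snd p"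
      proof (rule tendsto_sandwich)
        have "snd p - 1 / 2 ^ n \<le> \<eta> n (snd p)" "\<eta> n (snd p) \<le> snd p" for n
        proof -
          have "(snd p * 2 ^ n - 1) / 2 ^ n \<le> \<eta> n (snd p)"
            unfolding \<eta>_def by (intro divide_right_mono) (linarith, simp)
          then show "snd p - 1 / 2 ^ n \<le> \<eta> n (snd p)" by (simp add: diff_divide_distrib)
          have "\<eta> n (snd p) \<le> snd p * 2 ^ n / 2 ^ n"
            unfolding \<eta>_def by (intro divide_right_mono) (linarith, simp)
          then show "\<eta> n (snd p) \<le> snd p" by simp
        qed
        then show "\<forall>\<^sub>F n in sequentially. snd p - 1 / 2 ^ n \<le> \<eta> n (snd p)"
          "\<forall>\<^sub>F n in sequentially. \<eta> n (snd p) \<le> snd p" by auto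
        have "(\<lambda>n. snd p - (1 / 2) ^ n) \<longlonglongrightarrow> snd p - 0"
          by (intro tendsto_intros) auto
        then show "(\<lambda>n. snd p - 1 / 2 ^ n) \<longlonglongrightarrow> snd p" by (simp add: power_one_over)
      qed auto
      have "(\<lambda>n. clamp (\<eta> n (snd p))) \<longlonglongrightarrow> clamp (snd p)"
        unfolding clamp_def by (intro tendsto_intros eta)
      moreover have "clamp (snd p) = snd p" using True by (auto simp: clamp_def)
      ultimately have "(\<lambda>n. X (clamp (\<eta> n (snd p))) (fst p)) \<longlonglongrightarrow> X (snd p) (fst p)"
        using continuous_on_tendsto_compose[OF cont[of "fst p"], of "\<lambda>n. clamp (\<eta> n (snd p))" "snd p" sequentially]
          clamp True p by (auto simp: space_pair_measure)
      then show ?thesis by (intro tendsto_intros)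
    qed simp
  qed
qed

lemma L2_cong_AE:
  "L2 M f \<Longrightarrow> g \<in> borel_measurable M \<Longrightarrow> AE x in M. f x = g x \<Longrightarrow> L2 M g"
  by (rule L2_bound[of M f]) (auto elim: eventually_mono)

lemma L2_indicator_mult: "L2 M f \<Longrightarrow> A \<in> sets M \<Longrightarrow> L2 M (\<lambda>x. indicator A x * f x)"
  by (rule L2_bound[of M f]) (auto simp: indicator_def dest: L2_measurable)

context brownian_motion
begin

lemma ito_cong_AE:
  assumes "ito t v H J" "J' \<in> borel_measurable M" "AE \<omega> in M. J \<omega> = J' \<omega>"
  shows "ito t v H J'"
proof -
  have "L2_lim M f J'" if "L2_lim M f J" for f
  proof -
    have "L2 M J'" using L2_cong_AE[OF _ assms(2,3)] that by (simp add: L2_lim_def)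
    moreover have "(\<integral>x. (f k x - J x)\<^sup>2 \<partial>M) = (\<integral>x. (f k x - J' x)\<^sup>2 \<partial>M)" for k
      using assms(2,3) that
      by (intro integral_cong_AE borel_measurable_power borel_measurable_diff) (auto simp: L2_lim_def L2_def elim: eventually_mono)
    ultimately show ?thesis using that by (simp add: L2_lim_def)
  qed
  then show ?thesis using assms(1) unfolding ito_def by meson
qed

lemma measurable_N_section: "f \<in> borel_measurable N \<Longrightarrow> (\<lambda>\<omega>. f (\<omega>, r)) \<in> borel_measurable M"
  by (rule measurable_compose[OF measurable_Pair2']) simp_all

lemma integral_N:
  fixes f :: "'a \<times> real \<Rightarrow> real"
  assumes "integrable N f"
  shows "(\<integral>p. f p \<partial>N) = (\<integral>\<omega>. \<integral>r. f (\<omega>, r) \<partial>lborel \<partial>M)" "(\<integral>p. f p \<partial>N) = (\<integral>r. \<integral>\<omega>. f (\<omega>, r) \<partial>M \<partial>lborel)"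
    "integrable M (\<lambda>\<omega>. \<integral>r. f (\<omega>, r) \<partial>lborel)" "integrable lborel (\<lambda>r. \<integral>\<omega>. f (\<omega>, r) \<partial>M)"
    "AE \<omega> in M. integrable lborel (\<lambda>r. f (\<omega>, r))" "AE r in lborel. integrable M (\<lambda>\<omega>. f (\<omega>, r))"
proof -
  interpret pair_sigma_finite M lborel by (rule pair_sigma_finite_N)
  note i = integrable_fst[of "\<lambda>\<omega> r. f (\<omega>, r)"] integrable_snd[of "\<lambda>\<omega> r. f (\<omega>, r)"]
    integral_fst[of "\<lambda>\<omega> r. f (\<omega>, r)"] integral_snd[of "\<lambda>\<omega> r. f (\<omega>, r)"]
    AE_integrable_fst[of "\<lambda>\<omega> r. f (\<omega>, r)"] AE_integrable_snd[of "\<lambda>\<omega> r. f (\<omega>, r)"]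
  show "(\<integral>p. f p \<partial>N) = (\<integral>\<omega>. \<integral>r. f (\<omega>, r) \<partial>lborel \<partial>M)" "(\<integral>p. f p \<partial>N) = (\<integral>r. \<integral>\<omega>. f (\<omega>, r) \<partial>M \<partial>lborel)"
    "integrable M (\<lambda>\<omega>. \<integral>r. f (\<omega>, r) \<partial>lborel)" "integrable lborel (\<lambda>r. \<integral>\<omega>. f (\<omega>, r) \<partial>M)"
    "AE \<omega> in M. integrable lborel (\<lambda>r. f (\<omega>, r))" "AE r in lborel. integrable M (\<lambda>\<omega>. f (\<omega>, r))"
    using i assms by simp_all
qed

text \<open>Tonelli with time outside: second moments bounded uniformly over a bounded time interval
  have a finite integral.\<close>

lemma L2_N_bounded:
  assumes m: "f \<in> borel_measurable N" and out: "\<And>\<omega> r. r \<notin> {t..v} \<Longrightarrow> f (\<omega>, r) = 0"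
    and L: "\<And>r. r \<in> {t..v} \<Longrightarrow> L2 M (\<lambda>\<omega>. f (\<omega>, r))"
    and b: "\<And>r. r \<in> {t..v} \<Longrightarrow> expectation (\<lambda>\<omega>. (f (\<omega>, r))\<^sup>2) \<le> C"
  shows "L2 N f"
proof (rule L2I[OF m])
  interpret pair_sigma_finite M lborel by (rule pair_sigma_finite_N)
  have "(\<integral>\<^sup>+p. ennreal ((f p)\<^sup>2) \<partial>N) = (\<integral>\<^sup>+r. \<integral>\<^sup>+\<omega>. ennreal ((f (\<omega>, r))\<^sup>2) \<partial>M \<partial>lborel)"
    using m by (subst nn_integral_snd[symmetric]) auto
  also have "\<dots> \<le> (\<integral>\<^sup>+r. ennreal C * indicator {t..v} r \<partial>lborel)"
  proof (rule nn_integral_mono)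
    fix r :: real
    show "(\<integral>\<^sup>+\<omega>. ennreal ((f (\<omega>, r))\<^sup>2) \<partial>M) \<le> ennreal C * indicator {t..v} r"
      using out[of r] L2_nn_integral[OF L, of r] b[of r] by (cases "r \<in> {t..v}") (auto intro: ennreal_leI)
  qed
  also have "\<dots> < \<infinity>"
    using emeasure_bounded_finite[of "{t..v}"] by (simp add: nn_integral_cmult_indicator ennreal_mult_less_top)
  finally show "(\<integral>\<^sup>+p. ennreal ((f p)\<^sup>2) \<partial>N) < \<infinity>" .
qed

text \<open>Ito's formula is avoided: writing \<open>X - w = x - w + A + J\<close> with drift part \<open>A\<close> and Ito integral \<open>J\<close>,
  the second moment follows from the Ito isometry, the martingale property of \<open>J\<close> and Fubini; the weight
  \<open>exp (\<kappa> (T - s))\<close> is then introduced by integration by parts in time.\<close>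

lemma energy_identity:
  assumes t: "0 \<le> t" "t \<le> T"
    and X: "\<And>s. s \<in> {t..T} \<Longrightarrow> X s \<in> borel_measurable (F s)"
    and cont: "\<And>\<omega>. \<omega> \<in> space M \<Longrightarrow> continuous_on {t..T} (\<lambda>s. X s \<omega>)"
    and d: "L2 N (\<lambda>p. indicator {t..T} (snd p) * d (snd p) (fst p))"
    and dF: "\<And>s. s \<in> {t..T} \<Longrightarrow> d s \<in> borel_measurable (F s)"
    and ito: "\<And>u. u \<in> {t..T} \<Longrightarrow> ito t u H (\<lambda>\<omega>. X u \<omega> - x - (\<integral>s. indicator {t..u} s * d s \<omega> \<partial>lborel))"
  shows "integrable N (\<lambda>p. indicator {t..T} (snd p) * (exp (\<kappa> * (T - snd p)) *
        (- \<kappa> * (X (snd p) (fst p) - w)\<^sup>2 + 2 * d (snd p) (fst p) * (X (snd p) (fst p) - w) + (H (snd p) (fst p))\<^sup>2)))"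
    and "L2 M (\<lambda>\<omega>. X T \<omega> - w)"
    and "expectation (\<lambda>\<omega>. (X T \<omega> - w)\<^sup>2) = exp (\<kappa> * (T - t)) * (x - w)\<^sup>2 +
      (\<integral>p. indicator {t..T} (snd p) * (exp (\<kappa> * (T - snd p)) *
        (- \<kappa> * (X (snd p) (fst p) - w)\<^sup>2 + 2 * d (snd p) (fst p) * (X (snd p) (fst p) - w) + (H (snd p) (fst p))\<^sup>2)) \<partial>N)"
proof -
  define ii :: "'a \<times> real \<Rightarrow> real" where "ii = (\<lambda>p. indicator {t..T} (snd p))"
  define dd where "dd = (\<lambda>p. indicator {t..T} (snd p) * d (snd p) (fst p))"
  define HH where "HH = (\<lambda>p. indicator {t..T} (snd p) * H (snd p) (fst p))"
  define y where "y = x - w"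
  define A where "A = (\<lambda>u \<omega>. \<integral>s. indicator {..u} s * dd (\<omega>, s) \<partial>lborel)"
  define J where "J = (\<lambda>u \<omega>. X u \<omega> - x - A u \<omega>)"
  define AA where "AA = (\<lambda>p. indicator {t..T} (snd p) * A (snd p) (fst p))"
  define JJ where "JJ = (\<lambda>p. indicator {t..T} (snd p) * J (snd p) (fst p))"
  define YY where "YY = (\<lambda>p. indicator {t..T} (snd p) * (X (snd p) (fst p) - w))"
  have ddL: "L2 N dd" using d by (simp add: dd_def)
  note ddm = L2_measurable[OF ddL]
  have A: "(\<integral>s. indicator {t..u} s * d s \<omega> \<partial>lborel) = A u \<omega>" if "u \<in> {t..T}" for u \<omega>
    unfolding A_def using that
    by (intro Bochner_Integration.integral_cong refl) (auto simp: dd_def indicator_def)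
  have itoJ: "ito t u H (J u)" if "u \<in> {t..T}" for u
    using ito[OF that] unfolding A[OF that] by (simp add: J_def[abs_def])
  have HHL: "L2 N HH" using ito_isometry(1)[OF itoJ[of T]] t by (simp add: HH_def)
  have iiL: "L2 N ii"
    by (rule L2_N_bounded[of _ t T 1]) (auto simp: ii_def L2_const prob_space)
  have Xm: "(\<lambda>p. indicator {t..T} (snd p) * X (snd p) (fst p)) \<in> borel_measurable N"
    using jointly_measurable_continuous[of t T X M, OF _ cont] measurable_F_M[OF _ _ X] t
    by (simp cong: measurable_cong_sets)
  have Am': "(\<lambda>p. A (snd p) (fst p)) \<in> borel_measurable N"
    unfolding A_def
  proof (rule lborel.borel_measurable_lebesgue_integral)
    have "(\<lambda>z. indicator {..snd (fst z)} (snd z) * dd (fst (fst z), snd z)) \<in> borel_measurable (N \<Otimes>\<^sub>M (lborel :: real measure))"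
    proof (rule borel_measurable_times)
      show "(\<lambda>z. indicator {..snd (fst z)} (snd z) :: real) \<in> borel_measurable (N \<Otimes>\<^sub>M (lborel :: real measure))"
        unfolding indicator_def atMost_iff by measurable
      show "(\<lambda>z. dd (fst (fst z), snd z)) \<in> borel_measurable (N \<Otimes>\<^sub>M (lborel :: real measure))"
        by (rule measurable_compose[OF _ ddm]) measurable
    qed
    then show "(\<lambda>(p, s). indicator {..snd p} s * dd (fst p, s)) \<in> borel_measurable (N \<Otimes>\<^sub>M lborel)"
      by (simp add: case_prod_beta)
  qed
  have iim: "(\<lambda>p. indicator {t..T} (snd p) :: real) \<in> borel_measurable N"
    by measurable
  have AAm: "AA \<in> borel_measurable N"
    unfolding AA_def by (intro borel_measurable_times Am' iim)
  have Am: "A u \<in> borel_measurable M" for u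
    using measurable_N_section[OF Am', of u] by simp
  have ddr: "integrable lborel (\<lambda>s. dd (\<omega>, s)) \<and> (A u \<omega>)\<^sup>2 \<le> (T - t) * (\<integral>s. (dd (\<omega>, s))\<^sup>2 \<partial>lborel)"
    if i: "integrable lborel (\<lambda>s. (dd (\<omega>, s))\<^sup>2)" "\<omega> \<in> space M" and u: "u \<in> {t..T}" for \<omega> u
  proof -
    have dl: "L2 lborel (\<lambda>s. dd (\<omega>, s))"
      using i measurable_compose[OF measurable_Pair1' ddm] by (simp add: L2_def)
    have il: "L2 lborel (\<lambda>s. indicator {t..b} s :: real)" for b
    proof -
      have "(\<lambda>s. (indicator {t..b} s :: real)\<^sup>2) = indicator {t..b}" by (auto simp: indicator_def)
      then show ?thesis using emeasure_bounded_finite[of "{t..b}"] by (simp add: L2_def)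
    qed
    have e: "indicator {..u} s * dd (\<omega>, s) = indicator {t..u} s * dd (\<omega>, s)" for s
      by (auto simp: dd_def indicator_def)
    have "(A u \<omega>)\<^sup>2 \<le> (\<integral>s. (indicator {t..u} s)\<^sup>2 \<partial>lborel) * (\<integral>s. (dd (\<omega>, s))\<^sup>2 \<partial>lborel)"
      unfolding A_def e by (rule L2_Cauchy_Schwarz[OF il dl])
    also have "(\<integral>s. (indicator {t..u} s)\<^sup>2 \<partial>lborel) = (u - t)"
    proof -
      have "(\<lambda>s. (indicator {t..u} s :: real)\<^sup>2) = indicator {t..u}" by (auto simp: indicator_def)
      then show ?thesis using u by simp
    qed
    also have "(u - t) * (\<integral>s. (dd (\<omega>, s))\<^sup>2 \<partial>lborel) \<le> (T - t) * (\<integral>s. (dd (\<omega>, s))\<^sup>2 \<partial>lborel)"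
      using u by (intro mult_right_mono) auto
    finally have "(A u \<omega>)\<^sup>2 \<le> (T - t) * (\<integral>s. (dd (\<omega>, s))\<^sup>2 \<partial>lborel)" .
    moreover have "(\<lambda>s. dd (\<omega>, s)) = (\<lambda>s. indicator {t..T} s * dd (\<omega>, s))"
      by (auto simp: dd_def indicator_def)
    then have "integrable lborel (\<lambda>s. dd (\<omega>, s))"
      using L2_mult[OF il dl, of T] by simp
    ultimately show ?thesis by simp
  qed
  note dd2 = integral_N[OF L2_square[OF ddL]]
  have ddAE: "AE \<omega> in M. integrable lborel (\<lambda>s. dd (\<omega>, s)) \<and>
      (\<forall>u\<in>{t..T}. (A u \<omega>)\<^sup>2 \<le> (T - t) * (\<integral>s. (dd (\<omega>, s))\<^sup>2 \<partial>lborel))"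
    using dd2(5) AE_space by eventually_elim (use ddr t in auto)
  have AL: "L2 M (A u)" and Ab: "expectation (\<lambda>\<omega>. (A u \<omega>)\<^sup>2) \<le> (T - t) * (\<integral>p. (dd p)\<^sup>2 \<partial>N)" if u: "u \<in> {t..T}" for u
  proof -
    have i: "integrable M (\<lambda>\<omega>. (T - t) * (\<integral>s. (dd (\<omega>, s))\<^sup>2 \<partial>lborel))"
      using dd2(3) by simp
    have "AE \<omega> in M. norm ((A u \<omega>)\<^sup>2) \<le> norm ((T - t) * (\<integral>s. (dd (\<omega>, s))\<^sup>2 \<partial>lborel))"
      using ddAE by eventually_elim (use u in auto)
    then show L: "L2 M (A u)"
      unfolding L2_def using Am by (auto intro!: Bochner_Integration.integrable_bound[OF i] borel_measurable_power)
    have "expectation (\<lambda>\<omega>. (A u \<omega>)\<^sup>2) \<le> expectation (\<lambda>\<omega>. (T - t) * (\<integral>s. (dd (\<omega>, s))\<^sup>2 \<partial>lborel))"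
    proof (rule integral_mono_AE[OF L2_square[OF L] i])
      show "AE \<omega> in M. (A u \<omega>)\<^sup>2 \<le> (T - t) * (\<integral>s. (dd (\<omega>, s))\<^sup>2 \<partial>lborel)"
        using ddAE by eventually_elim (use u in auto)
    qed
    then show "expectation (\<lambda>\<omega>. (A u \<omega>)\<^sup>2) \<le> (T - t) * (\<integral>p. (dd p)\<^sup>2 \<partial>N)"
      by (simp add: dd2(1))
  qed
  have JL: "L2 M (J u)" and Jq: "expectation (\<lambda>\<omega>. (J u \<omega>)\<^sup>2) = (\<integral>p. indicator {..u} (snd p) * (HH p)\<^sup>2 \<partial>N)"
    if u: "u \<in> {t..T}" for u
  proof -
    show "L2 M (J u)" by (rule ito_isometry(2)[OF itoJ[OF u]])
    have "expectation (\<lambda>\<omega>. (J u \<omega>)\<^sup>2) = (\<integral>p. (indicator {t..u} (snd p) * H (snd p) (fst p))\<^sup>2 \<partial>N)"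
      by (rule ito_isometry(3)[OF itoJ[OF u]])
    also have "\<dots> = (\<integral>p. indicator {..u} (snd p) * (HH p)\<^sup>2 \<partial>N)"
      using u by (intro Bochner_Integration.integral_cong) (auto simp: HH_def indicator_def)
    finally show "expectation (\<lambda>\<omega>. (J u \<omega>)\<^sup>2) = (\<integral>p. indicator {..u} (snd p) * (HH p)\<^sup>2 \<partial>N)" .
  qed
  have cut: "integrable N (\<lambda>p. indicator {..u} (snd p) * f p)" if "integrable N f" for u and f :: "'a \<times> real \<Rightarrow> real"
    by (rule Bochner_Integration.integrable_bound[OF that])
       (use that in \<open>auto simp: indicator_def dest: borel_measurable_integrable\<close>)
  have Jb: "expectation (\<lambda>\<omega>. (J u \<omega>)\<^sup>2) \<le> (\<integral>p. (HH p)\<^sup>2 \<partial>N)" if u: "u \<in> {t..T}" for u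
    unfolding Jq[OF u]
    by (intro integral_mono cut L2_square[OF HHL]) (auto simp: indicator_def)
  have AAL: "L2 N AA"
    by (rule L2_N_bounded[OF AAm _ _ , of t T "(T - t) * (\<integral>p. (dd p)\<^sup>2 \<partial>N)"])
       (use AL Ab in \<open>auto simp: AA_def\<close>)
  have JJe: "JJ = (\<lambda>p. indicator {t..T} (snd p) * X (snd p) (fst p) - x * ii p - AA p)"
    by (auto simp: JJ_def J_def AA_def ii_def fun_eq_iff algebra_simps)
  have JJm: "JJ \<in> borel_measurable N"
    unfolding JJe by (intro borel_measurable_diff borel_measurable_times Xm AAm L2_measurable[OF iiL] borel_measurable_const)
  have JJL: "L2 N JJ"
    by (rule L2_N_bounded[OF JJm _ _ , of t T "(\<integral>p. (HH p)\<^sup>2 \<partial>N)"])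
       (use JL Jb in \<open>auto simp: JJ_def\<close>)
  have YYe: "YY p = y * ii p + AA p + JJ p" for p
    by (simp add: JJe YY_def ii_def y_def algebra_simps)
  have YYL: "L2 N YY"
    unfolding YYe[abs_def] by (intro L2_add L2_cmult iiL AAL JJL)
  \<comment> \<open>The martingale property reduces the claim to the initial time, where the
    isometry integrates over the null set of times \<open>{t}\<close> and makes the second moment
    0.\<close>
  have EJ: "expectation (J u) = 0" if u: "u \<in> {t..T}" for u
  proof -
    have tt: "t \<in> {t..T}" using t by simp
    have "expectation (J u) = expectation (J t)"
      using ito_martingale[OF itoJ[OF tt] itoJ[OF u] _ _ L2_at_const[of t 1]] t u by simp
    also have "expectation (\<lambda>\<omega>. (J t \<omega>)\<^sup>2) = 0"
    proof -
      have i: "integrable N (\<lambda>p. indicator {..t} (snd p) * (HH p)\<^sup>2)" by (rule cut[OF L2_square[OF HHL]])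
      have "(\<integral>\<omega>. indicator {..t} r * (HH (\<omega>, r))\<^sup>2 \<partial>M) = 0" if "r \<noteq> t" for r
        using that by (auto simp: HH_def indicator_def)
      then have "AE r in lborel. (\<integral>\<omega>. indicator {..t} r * (HH (\<omega>, r))\<^sup>2 \<partial>M) = 0"
        using AE_lborel_singleton[of t] by (auto elim: eventually_mono)
      then show ?thesis
        unfolding Jq[OF tt] integral_N(2)[OF i] by (simp add: integral_eq_zero_AE)
    qed
    then have "expectation (J t) = 0"
      using square_integral_ge[OF JL[OF tt]] by simp
    finally show ?thesis .
  qed
  define G where "G = (\<lambda>p. 2 * (dd p * YY p) + (HH p)\<^sup>2)"
  have Gi: "integrable N G"
    unfolding G_def by (intro Bochner_Integration.integrable_add integrable_mult_right L2_mult L2_square ddL YYL HHL)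
  have m: "expectation (\<lambda>\<omega>. (X u \<omega> - w)\<^sup>2) = y\<^sup>2 + (\<integral>p. indicator {..u} (snd p) * G p \<partial>N)" if u: "u \<in> {t..T}" for u
  proof -
    have ddi: "integrable N dd"
    proof -
      have "(\<lambda>p. ii p * dd p) = dd" by (auto simp: ii_def dd_def indicator_def)
      then show ?thesis using L2_mult[OF iiL ddL] by simp
    qed
    note ci = cut[OF ddi, of u] cut[OF L2_mult[OF ddL AAL], of u] cut[OF L2_mult[OF ddL JJL], of u] cut[OF L2_square[OF HHL], of u]
    have E1: "expectation (A u) = (\<integral>p. indicator {..u} (snd p) * dd p \<partial>N)"
      using integral_N(1)[OF ci(1)] by (simp add: A_def)
    \<comment> \<open>Along almost every path \<open>A\<close> is an indefinite integral, so its
      square is integrated by parts with itself; this accounts for the factor 2.\<close>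
    have E4: "expectation (\<lambda>\<omega>. (A u \<omega>)\<^sup>2) = 2 * (\<integral>p. indicator {..u} (snd p) * (dd p * AA p) \<partial>N)"
    proof -
      have "expectation (\<lambda>\<omega>. (A u \<omega>)\<^sup>2) = expectation (\<lambda>\<omega>. 2 * (\<integral>r. indicator {..u} r * (dd (\<omega>, r) * AA (\<omega>, r)) \<partial>lborel))"
      proof (rule integral_cong_AE)
        show "(\<lambda>\<omega>. (A u \<omega>)\<^sup>2) \<in> borel_measurable M" using Am by simp
        show "(\<lambda>\<omega>. 2 * (\<integral>r. indicator {..u} r * (dd (\<omega>, r) * AA (\<omega>, r)) \<partial>lborel)) \<in> borel_measurable M"
          using integral_N(3)[OF ci(2)] by auto
        show "AE \<omega> in M. (A u \<omega>)\<^sup>2 = 2 * (\<integral>r. indicator {..u} r * (dd (\<omega>, r) * AA (\<omega>, r)) \<partial>lborel)"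
          using ddAE
        proof eventually_elim
          case (elim \<omega>)
          define f where "f = (\<lambda>s. indicator {..u} s * dd (\<omega>, s))"
          have f: "integrable lborel f"
            unfolding f_def using elim integrable_mult_indicator[of "{..u}" lborel "\<lambda>s. dd (\<omega>, s)"] by simp
          have fr: "f r * (\<integral>s. indicator {..r} s * f s \<partial>lborel) = indicator {..u} r * (dd (\<omega>, r) * AA (\<omega>, r))" for r
          proof (cases "r \<le> u \<and> r \<in> {t..T}")
            case True
            have "(\<integral>s. indicator {..r} s * f s \<partial>lborel) = A r \<omega>"
              unfolding A_def f_def using True
              by (intro Bochner_Integration.integral_cong) (auto simp: indicator_def)
            then show ?thesis using True by (simp add: f_def AA_def)
          qed (auto simp: f_def dd_def indicator_def)
          then show ?case
            using integral_product_by_parts(3)[OF f f] unfolding fr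
            by (simp add: A_def f_def power2_eq_square)
        qed
      qed
      then show ?thesis using integral_N(1)[OF ci(2)] by simp
    qed
    have E5: "expectation (\<lambda>\<omega>. A u \<omega> * J u \<omega>) = (\<integral>p. indicator {..u} (snd p) * (dd p * JJ p) \<partial>N)"
    proof -
      \<comment> \<open>\<open>J u\<close> does not depend on the integration time. Cut off outside
        \<open>{t..T}\<close> it becomes square-integrable on the product space, which justifies the
        exchange of integrals.\<close>
      have "L2 N (\<lambda>p. indicator {t..T} (snd p) * J u (fst p))"
      proof (rule L2_N_bounded[of _ t T "expectation (\<lambda>\<omega>. (J u \<omega>)\<^sup>2)"])
        show "(\<lambda>p. indicator {t..T} (snd p) * J u (fst p)) \<in> borel_measurable N"
          using L2_measurable[OF JL[OF u]] by (intro borel_measurable_times iim measurable_compose[OF measurable_fst])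
      qed (use JL[OF u] in auto)
      from cut[OF L2_mult[OF ddL this], of u]
      have i: "integrable N (\<lambda>p. indicator {..u} (snd p) * (dd p * (indicator {t..T} (snd p) * J u (fst p))))" .
      have "expectation (\<lambda>\<omega>. A u \<omega> * J u \<omega>) =
         expectation (\<lambda>\<omega>. \<integral>r. indicator {..u} r * (dd (\<omega>, r) * (indicator {t..T} r * J u \<omega>)) \<partial>lborel)"
      proof (intro Bochner_Integration.integral_cong refl)
        fix \<omega>
        have "A u \<omega> * J u \<omega> = (\<integral>r. indicator {..u} r * dd (\<omega>, r) * J u \<omega> \<partial>lborel)"
          unfolding A_def by simp
        also have "\<dots> = (\<integral>r. indicator {..u} r * (dd (\<omega>, r) * (indicator {t..T} r * J u \<omega>)) \<partial>lborel)"
          by (intro Bochner_Integration.integral_cong) (auto simp: dd_def indicator_def)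
        finally show "A u \<omega> * J u \<omega> = \<dots>" .
      qed
      also have "\<dots> = (\<integral>r. \<integral>\<omega>. indicator {..u} r * (dd (\<omega>, r) * (indicator {t..T} r * J u \<omega>)) \<partial>M \<partial>lborel)"
        using integral_N(1,2)[OF i] by simp
      also have "\<dots> = (\<integral>r. \<integral>\<omega>. indicator {..u} r * (dd (\<omega>, r) * JJ (\<omega>, r)) \<partial>M \<partial>lborel)"
      proof (rule integral_cong_AE)
        show "(\<lambda>r. \<integral>\<omega>. indicator {..u} r * (dd (\<omega>, r) * (indicator {t..T} r * J u \<omega>)) \<partial>M) \<in> borel_measurable lborel"
          using integral_N(4)[OF i] by auto
        show "(\<lambda>r. \<integral>\<omega>. indicator {..u} r * (dd (\<omega>, r) * JJ (\<omega>, r)) \<partial>M) \<in> borel_measurable lborel"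
          using integral_N(4)[OF ci(3)] by auto
        show "AE r in lborel. (\<integral>\<omega>. indicator {..u} r * (dd (\<omega>, r) * (indicator {t..T} r * J u \<omega>)) \<partial>M)
          = (\<integral>\<omega>. indicator {..u} r * (dd (\<omega>, r) * JJ (\<omega>, r)) \<partial>M)"
          using dd2(6)
        proof eventually_elim
          case (elim r)
          show ?case
          proof (cases "r \<le> u \<and> r \<in> {t..T}")
            case True
            \<comment> \<open>For almost every \<open>r\<close> the drift at \<open>r\<close> is
              square-integrable and known at time \<open>r\<close>, so the martingale property
              tested with it replaces \<open>J u\<close> by \<open>J r\<close>.\<close>
            have "L2_at r (d r)"
              unfolding L2_at_def L2_def using True t dF[of r] measurable_F_M[OF _ _ dF[of r]] elim by (simp add: dd_def)
            then have "expectation (\<lambda>\<omega>. J u \<omega> * d r \<omega>) = expectation (\<lambda>\<omega>. J r \<omega> * d r \<omega>)"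
              using True u by (intro ito_martingale[OF itoJ itoJ]) auto
            then show ?thesis using True by (simp add: dd_def JJ_def mult.commute)
          qed (auto simp: dd_def indicator_def)
        qed
      qed
      also have "\<dots> = (\<integral>p. indicator {..u} (snd p) * (dd p * JJ p) \<partial>N)"
        using integral_N(2)[OF ci(3)] by simp
      finally show ?thesis .
    qed
    have "expectation (\<lambda>\<omega>. (X u \<omega> - w)\<^sup>2) = expectation (\<lambda>\<omega>. y\<^sup>2 + 2 * y * A u \<omega> + 2 * y * J u \<omega> + (A u \<omega>)\<^sup>2 + (J u \<omega>)\<^sup>2 + 2 * (A u \<omega> * J u \<omega>))"
    proof (intro Bochner_Integration.integral_cong refl)
      fix \<omega>
      have "X u \<omega> - w = y + A u \<omega> + J u \<omega>" by (simp add: J_def y_def)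
      then show "(X u \<omega> - w)\<^sup>2 = y\<^sup>2 + 2 * y * A u \<omega> + 2 * y * J u \<omega> + (A u \<omega>)\<^sup>2 + (J u \<omega>)\<^sup>2 + 2 * (A u \<omega> * J u \<omega>)"
        by (simp add: power2_eq_square algebra_simps)
    qed
    also have "\<dots> = y\<^sup>2 + 2 * y * expectation (A u) + 2 * y * expectation (J u) + expectation (\<lambda>\<omega>. (A u \<omega>)\<^sup>2)
        + expectation (\<lambda>\<omega>. (J u \<omega>)\<^sup>2) + 2 * expectation (\<lambda>\<omega>. A u \<omega> * J u \<omega>)"
      using L2_integrable[OF AL[OF u]] L2_integrable[OF JL[OF u]] L2_square[OF AL[OF u]] L2_square[OF JL[OF u]]
        L2_mult[OF AL[OF u] JL[OF u]] by (simp add: prob_space)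
    also have "\<dots> = y\<^sup>2 + (2 * y * (\<integral>p. indicator {..u} (snd p) * dd p \<partial>N) + 2 * (\<integral>p. indicator {..u} (snd p) * (dd p * AA p) \<partial>N)
        + (\<integral>p. indicator {..u} (snd p) * (HH p)\<^sup>2 \<partial>N) + 2 * (\<integral>p. indicator {..u} (snd p) * (dd p * JJ p) \<partial>N))"
      by (simp add: EJ[OF u] E1 E4 E5 Jq[OF u])
    also have "\<dots> = y\<^sup>2 + (\<integral>p. 2 * y * (indicator {..u} (snd p) * dd p) + 2 * (indicator {..u} (snd p) * (dd p * AA p))
        + indicator {..u} (snd p) * (HH p)\<^sup>2 + 2 * (indicator {..u} (snd p) * (dd p * JJ p)) \<partial>N)"
      using ci by simp
    also have "\<dots> = y\<^sup>2 + (\<integral>p. indicator {..u} (snd p) * G p \<partial>N)"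
    proof -
      have "2 * y * (indicator {..u} (snd p) * dd p) + 2 * (indicator {..u} (snd p) * (dd p * AA p))
        + indicator {..u} (snd p) * (HH p)\<^sup>2 + 2 * (indicator {..u} (snd p) * (dd p * JJ p)) = indicator {..u} (snd p) * G p" for p
      proof -
        have "ii p * dd p = dd p" by (simp add: ii_def dd_def indicator_def)
        then show ?thesis by (auto simp: G_def YYe algebra_simps)
      qed
      then show ?thesis by simp
    qed
    finally show ?thesis .
  qed
  define k where "k = (\<lambda>s. exp (\<kappa> * (T - s)))"
  define g where "g = (\<lambda>s. \<integral>\<omega>. G (\<omega>, s) \<partial>M)"
  \<comment> \<open>The derivative of the weight \<open>k\<close> on \<open>{t..T}\<close>. Its
    running integral is \<open>k r - k t\<close>, and that of \<open>g\<close> is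
    \<open>m' r - y\<^sup>2\<close>; the weighted identity is the integration by parts of this
    pair.\<close>
  define f where "f = (\<lambda>s. indicator {t..T} s * (- \<kappa> * k s))"
  define m' where "m' = (\<lambda>u. expectation (\<lambda>\<omega>. (X u \<omega> - w)\<^sup>2))"
  have gi: "integrable lborel g" unfolding g_def by (rule integral_N(4)[OF Gi])
  have kb: "integrable lborel (\<lambda>s. indicator {t..T} s * (c * k s))" for c
  proof -
    have "continuous_on {t..T} (\<lambda>s. c * k s)" unfolding k_def by (intro continuous_intros)
    from borel_integrable_compact[OF compact_Icc this] show ?thesis by simp
  qed
  have fi: "integrable lborel f" unfolding f_def by (rule kb)
  have G0: "G (\<omega>, r) = 0" if "r \<notin> {t..T}" for \<omega> r using that by (simp add: G_def dd_def HH_def)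
  have mg: "m' u = y\<^sup>2 + (\<integral>s. indicator {..u} s * g s \<partial>lborel)" if "u \<in> {t..T}" for u
    unfolding m'_def m[OF that] integral_N(2)[OF cut[OF Gi]] by (simp add: g_def)
  have Fr: "(\<integral>s. indicator {..r} s * f s \<partial>lborel) = k r - k t" if r: "r \<in> {t..T}" for r
  proof -
    have "(\<integral>s. indicator {..r} s * f s \<partial>lborel) = (\<integral>s. indicator {t..r} s *\<^sub>R (- \<kappa> * k s) \<partial>lborel)"
      using r by (intro Bochner_Integration.integral_cong) (auto simp: f_def indicator_def)
    also have "\<dots> = k r - k t"
    proof (rule integral_FTC_Icc)
      show "t \<le> r" using r by simp
      show "(k has_vector_derivative - \<kappa> * k s) (at s within {t..r})" for s
        unfolding k_def has_real_derivative_iff_has_vector_derivative[symmetric]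
        by (auto intro!: derivative_eq_intros)
      show "continuous_on {t..r} (\<lambda>s. - \<kappa> * k s)" unfolding k_def by (intro continuous_intros)
    qed
    finally show ?thesis .
  qed
  have F_all: "(\<integral>s. f s \<partial>lborel) = 1 - k t"
  proof -
    have "(\<integral>s. f s \<partial>lborel) = (\<integral>s. indicator {..T} s * f s \<partial>lborel)"
      by (intro Bochner_Integration.integral_cong) (auto simp: f_def indicator_def)
    then show ?thesis using Fr[of T] t by (simp add: k_def)
  qed
  have g_all: "(\<integral>s. g s \<partial>lborel) = m' T - y\<^sup>2"
  proof -
    have "(\<integral>s. g s \<partial>lborel) = (\<integral>s. indicator {..T} s * g s \<partial>lborel)"
      by (intro Bochner_Integration.integral_cong) (auto simp: g_def G0 indicator_def)
    then show ?thesis using mg[of T] t by simp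
  qed
  note bp = integral_product_by_parts[OF fi gi]
  have e1: "f r * (\<integral>s. indicator {..r} s * g s \<partial>lborel) = f r * m' r - y\<^sup>2 * f r" for r
  proof (cases "r \<in> {t..T}")
    case True
    show ?thesis by (simp only: mg[OF True] distrib_left) (simp add: mult.commute)
  qed (simp add: f_def)
  have e2: "g r * (\<integral>s. indicator {..r} s * f s \<partial>lborel) = g r * k r - k t * g r" for r
  proof (cases "r \<in> {t..T}")
    case True
    show ?thesis by (simp only: Fr[OF True] right_diff_distrib) (simp add: mult.commute)
  qed (simp add: g_def G0)
  have fmi: "integrable lborel (\<lambda>r. f r * m' r)"
    using Bochner_Integration.integrable_add[OF bp(1)[unfolded e1] integrable_mult_right[OF fi, of "y\<^sup>2"]] by simp
  have gki: "integrable lborel (\<lambda>r. g r * k r)"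
    using Bochner_Integration.integrable_add[OF bp(2)[unfolded e2] integrable_mult_right[OF gi, of "k t"]] by simp
  \<comment> \<open>Since \<open>k T = 1\<close>, the products with \<open>k t\<close> and
    \<open>y\<^sup>2\<close> cancel and the identity can be solved for \<open>m' T\<close>.\<close>
  have "(1 - k t) * (m' T - y\<^sup>2) = ((\<integral>r. f r * m' r \<partial>lborel) - y\<^sup>2 * (1 - k t)) + ((\<integral>r. g r * k r \<partial>lborel) - k t * (m' T - y\<^sup>2))"
    using bp(3) unfolding e1 e2 using fmi gki fi gi by (simp add: F_all g_all)
  then have mT: "m' T = k t * y\<^sup>2 + ((\<integral>r. f r * m' r \<partial>lborel) + (\<integral>r. g r * k r \<partial>lborel))"
    by (simp add: algebra_simps)
  \<comment> \<open>\<kappa> may have either sign, so the weight is bounded over the interval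
    through its absolute value.\<close>
  define K where "K = exp (\<bar>\<kappa>\<bar> * (T - t))"
  have kK: "\<bar>k s\<bar> \<le> K" if "s \<in> {t..T}" for s
  proof -
    have "\<kappa> * (T - s) \<le> \<bar>\<kappa>\<bar> * (T - t)" using that by (intro mult_mono) auto
    then show ?thesis by (simp add: k_def K_def)
  qed
  have weight: "integrable N (\<lambda>p. k (snd p) * q p)" if q: "integrable N q" and q0: "\<And>\<omega> r. r \<notin> {t..T} \<Longrightarrow> q (\<omega>, r) = 0" for q :: "'a \<times> real \<Rightarrow> real"
  proof (rule Bochner_Integration.integrable_bound[OF integrable_mult_right[OF q, of K]])
    show "(\<lambda>p. k (snd p) * q p) \<in> borel_measurable N"
    proof (rule borel_measurable_times)
      show "(\<lambda>p. k (snd p)) \<in> borel_measurable N" unfolding k_def by measurable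
    qed (rule borel_measurable_integrable[OF q])
    show "AE p in N. norm (k (snd p) * q p) \<le> norm (K * q p)"
    proof (rule AE_I2)
      fix p :: "'a \<times> real"
      show "norm (k (snd p) * q p) \<le> norm (K * q p)"
        using kK[of "snd p"] q0[of "snd p" "fst p"] by (cases "snd p \<in> {t..T}") (auto simp: abs_mult K_def intro: mult_right_mono)
    qed
  qed
  have w1: "integrable N (\<lambda>p. k (snd p) * (YY p)\<^sup>2)"
    by (rule weight[OF L2_square[OF YYL]]) (simp add: YY_def)
  have w2: "integrable N (\<lambda>p. k (snd p) * G p)" by (rule weight[OF Gi G0])
  have i1: "(\<integral>r. f r * m' r \<partial>lborel) = - \<kappa> * (\<integral>p. k (snd p) * (YY p)\<^sup>2 \<partial>N)"
  proof -
    have "f r * m' r = - \<kappa> * (\<integral>\<omega>. k r * (YY (\<omega>, r))\<^sup>2 \<partial>M)" for r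
      by (simp add: f_def m'_def YY_def indicator_def)
    then show ?thesis unfolding integral_N(2)[OF w1] by simp
  qed
  have i2: "(\<integral>r. g r * k r \<partial>lborel) = (\<integral>p. k (snd p) * G p \<partial>N)"
    unfolding integral_N(2)[OF w2] by (simp add: g_def mult.commute)
  have e: "indicator {t..T} (snd p) * (exp (\<kappa> * (T - snd p)) *
        (- \<kappa> * (X (snd p) (fst p) - w)\<^sup>2 + 2 * d (snd p) (fst p) * (X (snd p) (fst p) - w) + (H (snd p) (fst p))\<^sup>2))
      = - \<kappa> * (k (snd p) * (YY p)\<^sup>2) + k (snd p) * G p" for p
    by (cases "snd p \<in> {t..T}") (simp_all add: k_def G_def dd_def YY_def HH_def algebra_simps)
  show "integrable N (\<lambda>p. indicator {t..T} (snd p) * (exp (\<kappa> * (T - snd p)) *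
        (- \<kappa> * (X (snd p) (fst p) - w)\<^sup>2 + 2 * d (snd p) (fst p) * (X (snd p) (fst p) - w) + (H (snd p) (fst p))\<^sup>2)))"
    unfolding e by (intro Bochner_Integration.integrable_add integrable_mult_right w1 w2)
  have "(\<lambda>\<omega>. X T \<omega> - w) = (\<lambda>\<omega>. y + A T \<omega> + J T \<omega>)" by (auto simp: J_def y_def)
  then show "L2 M (\<lambda>\<omega>. X T \<omega> - w)"
    using AL[of T] JL[of T] t by (auto intro!: L2_add L2_const)
  show "expectation (\<lambda>\<omega>. (X T \<omega> - w)\<^sup>2) = exp (\<kappa> * (T - t)) * (x - w)\<^sup>2 +
      (\<integral>p. indicator {t..T} (snd p) * (exp (\<kappa> * (T - snd p)) *
        (- \<kappa> * (X (snd p) (fst p) - w)\<^sup>2 + 2 * d (snd p) (fst p) * (X (snd p) (fst p) - w) + (H (snd p) (fst p))\<^sup>2)) \<partial>N)"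
  proof -
    have "(\<integral>p. - \<kappa> * (k (snd p) * (YY p)\<^sup>2) + k (snd p) * G p \<partial>N) =
        - \<kappa> * (\<integral>p. k (snd p) * (YY p)\<^sup>2 \<partial>N) + (\<integral>p. k (snd p) * G p \<partial>N)"
      using w1 w2 by simp
    then have "m' T = k t * y\<^sup>2 + (\<integral>p. - \<kappa> * (k (snd p) * (YY p)\<^sup>2) + k (snd p) * G p \<partial>N)"
      using mT i1 i2 by simp
    then show ?thesis unfolding e by (simp add: m'_def y_def k_def)
  qed
qed

end

section \<open>Stochastic differential equations with Lipschitz coefficients\<close>

lemma square_sum4: "(a + b + c + d)\<^sup>2 \<le> 4 * (a\<^sup>2 + b\<^sup>2 + c\<^sup>2 + (d::real)\<^sup>2)"
proof -
  have "0 \<le> (a - b)\<^sup>2 + (a - c)\<^sup>2 + (a - d)\<^sup>2 + (b - c)\<^sup>2 + (b - d)\<^sup>2 + (c - d)\<^sup>2"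
    by simp
  then show ?thesis by (simp add: power2_eq_square algebra_simps)
qed

text \<open>Iterating the contraction \<open>S \<mapsto> \<epsilon> + S / 2\<close> in the norm weighted by \<open>e\<close> replaces Gronwall's inequality
  and requires no regularity of \<open>D\<close>.\<close>

lemma halving_bound:
  fixes D :: "real \<Rightarrow> real"
  assumes B: "\<And>r. r \<in> A \<Longrightarrow> D r \<le> B" and e: "\<And>r. r \<in> A \<Longrightarrow> 1 \<le> e r" and "0 \<le> B" "0 \<le> \<epsilon>"
    and step: "\<And>S. 0 \<le> S \<Longrightarrow> (\<And>r. r \<in> A \<Longrightarrow> D r \<le> S * e r) \<Longrightarrow> (\<And>r. r \<in> A \<Longrightarrow> D r \<le> (\<epsilon> + S / 2) * e r)"
    and r: "r \<in> A"
  shows "D r \<le> 2 * \<epsilon> * e r"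
proof -
  \<comment> \<open>The map \<open>S \<mapsto> \<epsilon> + S / 2\<close> has the fixed point
    \<open>2 * \<epsilon>\<close>; the initial surplus \<open>B\<close> is halved in every
    round.\<close>
  have bound: "\<And>r. r \<in> A \<Longrightarrow> D r \<le> (2 * \<epsilon> + B / 2 ^ n) * e r" for n :: nat
  proof (induction n)
    case 0
    fix r assume r: "r \<in> A"
    have "B * 1 \<le> (2 * \<epsilon> + B) * e r" using e[OF r] assms(3,4) by (intro mult_mono) auto
    then show "D r \<le> (2 * \<epsilon> + B / 2 ^ 0) * e r" using B[OF r] by simp
  next
    case (Suc n)
    fix r assume r: "r \<in> A"
    have "D r \<le> (\<epsilon> + (2 * \<epsilon> + B / 2 ^ n) / 2) * e r"
      using assms(3,4) by (intro step[OF _ Suc.IH r]) auto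
    then show "D r \<le> (2 * \<epsilon> + B / 2 ^ Suc n) * e r" by (simp add: field_simps)
  qed
  have "(\<lambda>n. (2 * \<epsilon> + B * (1 / 2) ^ n) * e r) \<longlonglongrightarrow> (2 * \<epsilon> + B * 0) * e r"
    by (intro tendsto_intros) auto
  then have "(\<lambda>n. (2 * \<epsilon> + B / 2 ^ n) * e r) \<longlonglongrightarrow> 2 * \<epsilon> * e r" by (simp add: power_one_over)
  then show ?thesis
    by (rule LIMSEQ_le_const) (use bound[OF r] in auto)
qed

text \<open>The coefficients are Lipschitz in time as well as in the state, so that freezing them at
  grid times costs no more than moving the state.\<close>

locale lipschitz_sde = brownian_motion M F T W
  for M :: "'a measure" and F :: "real \<Rightarrow> 'a measure" and T :: real and W :: "real \<Rightarrow> 'a \<Rightarrow> real" +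
  fixes b g :: "real \<Rightarrow> real \<Rightarrow> real" and t x L :: real
  assumes t: "0 \<le> t" "t \<le> T" and L: "0 \<le> L"
    and b_lipschitz: "\<And>s s' y y'. \<bar>b s y - b s' y'\<bar> \<le> L * (\<bar>s - s'\<bar> + \<bar>y - y'\<bar>)"
    and g_lipschitz: "\<And>s s' y y'. \<bar>g s y - g s' y'\<bar> \<le> L * (\<bar>s - s'\<bar> + \<bar>y - y'\<bar>)"
begin

definition step :: "nat \<Rightarrow> real" where "step k = (T - t) / 2 ^ k"

definition grid :: "nat \<Rightarrow> nat \<Rightarrow> real" where "grid k i = t + real i * step k"

primrec euler :: "nat \<Rightarrow> nat \<Rightarrow> 'a \<Rightarrow> real" where
  "euler k 0 = (\<lambda>\<omega>. x)"
| "euler k (Suc i) = (\<lambda>\<omega>. euler k i \<omega> + b (grid k i) (euler k i \<omega>) * step k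
    + g (grid k i) (euler k i \<omega>) * (W (grid k (Suc i)) \<omega> - W (grid k i) \<omega>))"

definition b_euler :: "nat \<Rightarrow> nat \<Rightarrow> 'a \<Rightarrow> real" where "b_euler k i \<omega> = b (grid k i) (euler k i \<omega>)"

definition g_euler :: "nat \<Rightarrow> nat \<Rightarrow> 'a \<Rightarrow> real" where "g_euler k i \<omega> = g (grid k i) (euler k i \<omega>)"

text \<open>The \<open>min\<close> stops every increment at time \<open>s\<close>, so one formula
  serves all times. Between grid points the interpolation follows \<open>W\<close> itself, which
  keeps the path adapted and its noise an exact stochastic integral.\<close>

definition euler_path :: "nat \<Rightarrow> real \<Rightarrow> 'a \<Rightarrow> real" where
  "euler_path k s \<omega> = x + (\<Sum>i<2^k. b_euler k i \<omega> * (min (grid k (Suc i)) s - min (grid k i) s))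
    + (\<Sum>i<2^k. g_euler k i \<omega> * (W (min (grid k (Suc i)) s) \<omega> - W (min (grid k i) s) \<omega>))"

lemma step_nonneg: "0 \<le> step k" using t by (simp add: step_def)

lemma step_le: "k \<le> l \<Longrightarrow> step l \<le> step k"
  using t by (auto simp: step_def intro!: divide_left_mono)

lemma step_le_T: "step k \<le> T - t"
  using step_le[of 0 k] by (simp add: step_def)

lemma step_tendsto: "step \<longlonglongrightarrow> 0"
proof -
  have "(\<lambda>k. (T - t) * (1 / 2) ^ k) \<longlonglongrightarrow> (T - t) * 0" by (intro tendsto_intros) auto
  then show ?thesis by (simp add: step_def[abs_def] power_one_over)
qed

lemma grid_mono: "i \<le> j \<Longrightarrow> grid k i \<le> grid k j"
  using step_nonneg by (auto simp: grid_def intro: mult_right_mono)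

lemma grid_0: "grid k 0 = t" by (simp add: grid_def)

lemma grid_end: "grid k (2 ^ k) = T" by (simp add: grid_def step_def)

lemma grid_Suc: "grid k (Suc i) - grid k i = step k" by (simp add: grid_def algebra_simps)

lemma grid_bounds: "i \<le> 2 ^ k \<Longrightarrow> t \<le> grid k i \<and> grid k i \<le> T \<and> 0 \<le> grid k i"
  using grid_mono[of 0 i k] grid_mono[of i "2 ^ k" k] t by (simp add: grid_0 grid_end)

lemma grid_cell:
  assumes "t < s" "s \<le> T"
  obtains i where "i < 2 ^ k" "grid k i < s" "s \<le> grid k (Suc i)"
proof -
  define i where "i = (LEAST i. s \<le> grid k i)"
  have ex: "s \<le> grid k (2 ^ k)" using assms by (simp add: grid_end)
  then have le: "s \<le> grid k i" "i \<le> 2 ^ k"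
    unfolding i_def by (rule LeastI, rule Least_le)
  have "i \<noteq> 0" using le assms by (auto simp: grid_0 intro: ccontr)
  then obtain j where j: "i = Suc j" by (cases i) auto
  have "\<not> s \<le> grid k j" using not_less_Least[of j "\<lambda>i. s \<le> grid k i"] j by (simp add: i_def)
  then show ?thesis using that[of j] le j by auto
qed

lemma lipschitz_measurable:
  assumes "\<And>s s' y y'. \<bar>f s y - f s' y'\<bar> \<le> L * (\<bar>s - s'\<bar> + \<bar>y - y' :: real\<bar>)"
  shows "(\<lambda>z. f (fst z) (snd z)) \<in> borel_measurable (borel :: (real \<times> real) measure)"
    and "f s \<in> borel_measurable borel"
proof -
  have "continuous_on UNIV (\<lambda>z. f (fst z) (snd z))"
  proof (rule lipschitz_on_continuous_on[of "2 * L"], rule lipschitz_onI)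
    fix z z' :: "real \<times> real"
    have d: "\<bar>fst z - fst z'\<bar> \<le> dist z z'" "\<bar>snd z - snd z'\<bar> \<le> dist z z'"
      using dist_fst_le[of z z'] dist_snd_le[of z z'] by (auto simp: dist_real_def)
    have "\<bar>f (fst z) (snd z) - f (fst z') (snd z')\<bar> \<le> L * (\<bar>fst z - fst z'\<bar> + \<bar>snd z - snd z'\<bar>)"
      by (rule assms)
    also have "\<dots> \<le> L * (dist z z' + dist z z')" using L d by (intro mult_left_mono) auto
    finally show "dist (f (fst z) (snd z)) (f (fst z') (snd z')) \<le> 2 * L * dist z z'"
      by (simp add: dist_real_def)
  qed (use L in simp)
  then show m: "(\<lambda>z. f (fst z) (snd z)) \<in> borel_measurable borel"
    by (rule borel_measurable_continuous_onI)
  have "(\<lambda>y. (s, y)) \<in> borel_measurable borel"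
    by (intro borel_measurable_continuous_onI continuous_intros)
  from measurable_compose[OF this m] show "f s \<in> borel_measurable borel" by simp
qed

text \<open>From \<open>(K + L * \<bar>y\<bar>)\<^sup>2 \<le> 2 * K\<^sup>2 + 2 * L\<^sup>2 *
  y\<^sup>2\<close>, where \<open>K\<close> dominates both coefficients at state 0 throughout
  \<open>{t..T}\<close>; one constant serves \<open>b\<close> and \<open>g\<close>.\<close>

definition growth :: real where
  "growth = 2 * ((\<bar>b t 0\<bar> + \<bar>g t 0\<bar> + L * (T - t))\<^sup>2 + L\<^sup>2)"

lemma growth_nonneg: "0 \<le> growth" by (simp add: growth_def)

lemma linear_growth:
  assumes lip: "\<And>s s' y y'. \<bar>f s y - f s' y'\<bar> \<le> L * (\<bar>s - s'\<bar> + \<bar>y - y' :: real\<bar>)"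
    and f: "\<bar>f t 0\<bar> \<le> \<bar>b t 0\<bar> + \<bar>g t 0\<bar>" and s: "s \<in> {t..T}"
  shows "(f s y)\<^sup>2 \<le> growth * (1 + y\<^sup>2)"
proof -
  define K where "K = \<bar>b t 0\<bar> + \<bar>g t 0\<bar> + L * (T - t)"
  have "\<bar>f s y\<bar> \<le> \<bar>f t 0\<bar> + L * (\<bar>s - t\<bar> + \<bar>y - 0\<bar>)"
    using lip[of s y t 0] by linarith
  also have "\<dots> \<le> K + L * \<bar>y\<bar>"
    using f s mult_left_mono[of "\<bar>s - t\<bar>" "T - t" L] L by (simp add: K_def distrib_left)
  finally have "(f s y)\<^sup>2 \<le> (K + L * \<bar>y\<bar>)\<^sup>2"
    by (rule power2_le_iff_abs_le[THEN iffD2, rotated]) (use L t in \<open>auto simp: K_def\<close>)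
  also have "\<dots> \<le> 2 * K\<^sup>2 + 2 * (L * \<bar>y\<bar>)\<^sup>2"
    using sum_squares_bound[of K "L * \<bar>y\<bar>"] by (simp add: power2_sum)
  also have "\<dots> \<le> 2 * (K\<^sup>2 + L\<^sup>2) * (1 + y\<^sup>2)"
    by (simp add: power_mult_distrib algebra_simps)
  finally show ?thesis by (simp add: growth_def K_def)
qed

lemmas b_growth = linear_growth[of b, OF b_lipschitz]
  and g_growth = linear_growth[of g, OF g_lipschitz]

lemma L2_at_growth:
  assumes "L2_at s Z" "f \<in> borel_measurable borel" "\<And>y. (f y)\<^sup>2 \<le> growth * (1 + y\<^sup>2)"
  shows "L2_at s (\<lambda>\<omega>. f (Z \<omega>))" "expectation (\<lambda>\<omega>. (f (Z \<omega>))\<^sup>2) \<le> growth * (1 + expectation (\<lambda>\<omega>. (Z \<omega>)\<^sup>2))"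
proof -
  have Z: "Z \<in> borel_measurable M" "integrable M (\<lambda>\<omega>. (Z \<omega>)\<^sup>2)"
    using assms(1) by (auto simp: L2_at_def L2_def)
  have i: "integrable M (\<lambda>\<omega>. growth * (1 + (Z \<omega>)\<^sup>2))"
    using Z by simp
  have fi: "integrable M (\<lambda>\<omega>. (f (Z \<omega>))\<^sup>2)"
    by (rule Bochner_Integration.integrable_bound[OF i])
       (use assms(2,3) Z growth_nonneg in \<open>auto intro!: borel_measurable_power measurable_compose[OF Z(1)]\<close>)
  then show "L2_at s (\<lambda>\<omega>. f (Z \<omega>))"
    using assms(1,2) measurable_compose[OF Z(1) assms(2)] by (auto simp: L2_at_def L2_def intro: measurable_compose)
  have "expectation (\<lambda>\<omega>. (f (Z \<omega>))\<^sup>2) \<le> expectation (\<lambda>\<omega>. growth * (1 + (Z \<omega>)\<^sup>2))"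
    by (rule integral_mono[OF fi i]) (rule assms(3))
  then show "expectation (\<lambda>\<omega>. (f (Z \<omega>))\<^sup>2) \<le> growth * (1 + expectation (\<lambda>\<omega>. (Z \<omega>)\<^sup>2))"
    using Z by (simp add: prob_space)
qed

lemma b_euler_L2:
  assumes "L2_at (grid k i) (euler k i)" "i \<le> 2 ^ k"
  shows "L2_at (grid k i) (b_euler k i)" "expectation (\<lambda>\<omega>. (b_euler k i \<omega>)\<^sup>2) \<le> growth * (1 + expectation (\<lambda>\<omega>. (euler k i \<omega>)\<^sup>2))"
  using L2_at_growth[OF assms(1) lipschitz_measurable(2)[OF b_lipschitz] b_growth, of "grid k i"] grid_bounds[OF assms(2)]
  by (simp_all add: b_euler_def[abs_def])

lemma g_euler_L2:
  assumes "L2_at (grid k i) (euler k i)" "i \<le> 2 ^ k"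
  shows "L2_at (grid k i) (g_euler k i)" "expectation (\<lambda>\<omega>. (g_euler k i \<omega>)\<^sup>2) \<le> growth * (1 + expectation (\<lambda>\<omega>. (euler k i \<omega>)\<^sup>2))"
  using L2_at_growth[OF assms(1) lipschitz_measurable(2)[OF g_lipschitz] g_growth, of "grid k i"] grid_bounds[OF assms(2)]
  by (simp_all add: g_euler_def[abs_def])

lemma euler_L2_at: "i \<le> 2 ^ k \<Longrightarrow> L2_at (grid k i) (euler k i)"
proof (induction i)
  case 0
  then show ?case using t by (simp add: grid_0 L2_at_const)
next
  case (Suc i)
  then have IH: "L2_at (grid k i) (euler k i)" by simp
  have g: "grid k i \<le> grid k (Suc i)" "grid k (Suc i) \<le> T"
    using grid_mono[of i "Suc i" k] grid_bounds[OF Suc.prems] by auto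
  have "L2_at (grid k (Suc i)) (\<lambda>\<omega>. euler k i \<omega> + step k * b_euler k i \<omega> + g_euler k i \<omega> * (W (grid k (Suc i)) \<omega> - W (grid k i) \<omega>))"
    using Suc.prems
    by (intro L2_at_add L2_at_cmult L2_at_mono[OF IH g] L2_at_mono[OF b_euler_L2(1)[OF IH] g] increment_mult(1)[OF g_euler_L2(1)[OF IH] g]) auto
  then show ?case by (simp add: b_euler_def g_euler_def mult.commute)
qed

definition moment_bound :: real where
  "moment_bound = (1 + x\<^sup>2) * exp ((1 + growth * (T - t + 2)) * (T - t))"

text \<open>The part \<open>P\<close> known at the old grid point is orthogonal to the noise
  \<open>Q\<close>, so second moments add and one step costs a factor \<open>1 + c * step k\<close>.
  The bound of a factor by the exponential makes the product independent of the grid.\<close>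

lemma euler_moment:
  assumes "i \<le> 2 ^ k" shows "1 + expectation (\<lambda>\<omega>. (euler k i \<omega>)\<^sup>2) \<le> moment_bound"
proof -
  \<comment> \<open>The cost of one step: 1 from the cross term of state and drift,
    \<open>growth\<close> times \<open>1 + step k\<close> from the drift and \<open>growth\<close>
    from the noise, with \<open>step k \<le> T - t\<close>.\<close>
  define c where "c = 1 + growth * (T - t + 2)"
  have c: "0 \<le> c" using growth_nonneg t by (simp add: c_def)
  have "1 + expectation (\<lambda>\<omega>. (euler k i \<omega>)\<^sup>2) \<le> (1 + x\<^sup>2) * (1 + c * step k) ^ i"
    using assms
  proof (induction i)
    case 0
    then show ?case by (simp add: prob_space)
  next
    case (Suc i)
    then have i: "i \<le> 2 ^ k" by simp
    note E = euler_L2_at[OF i]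
    have g: "grid k i \<le> grid k (Suc i)" "grid k (Suc i) \<le> T"
      using grid_mono[of i "Suc i" k] grid_bounds[OF Suc.prems] by auto
    define e where "e = expectation (\<lambda>\<omega>. (euler k i \<omega>)\<^sup>2)"
    define P where "P = (\<lambda>\<omega>. euler k i \<omega> + step k * b_euler k i \<omega>)"
    define Q where "Q = (\<lambda>\<omega>. g_euler k i \<omega> * (W (grid k (Suc i)) \<omega> - W (grid k i) \<omega>))"
    have P: "L2_at (grid k i) P" unfolding P_def by (intro L2_at_add E L2_at_cmult b_euler_L2(1)[OF E i])
    have Q: "L2_at (grid k (Suc i)) Q" unfolding Q_def by (rule increment_mult(1)[OF g_euler_L2(1)[OF E i] g])
    have PQ: "expectation (\<lambda>\<omega>. P \<omega> * Q \<omega>) = 0"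
      unfolding Q_def by (rule increment_orthogonal[OF P g_euler_L2(1)[OF E i] g])
    have Q2: "expectation (\<lambda>\<omega>. (Q \<omega>)\<^sup>2) \<le> step k * (growth * (1 + e))"
      unfolding Q_def increment_mult(2)[OF g_euler_L2(1)[OF E i] g] grid_Suc e_def
      by (intro mult_left_mono g_euler_L2(2)[OF E i] step_nonneg)
    have P2: "expectation (\<lambda>\<omega>. (P \<omega>)\<^sup>2) \<le> (1 + step k) * e + (step k + (step k)\<^sup>2) * (growth * (1 + e))"
    proof -
      have "expectation (\<lambda>\<omega>. (P \<omega>)\<^sup>2) \<le> expectation (\<lambda>\<omega>. (1 + step k) * (euler k i \<omega>)\<^sup>2 + (step k + (step k)\<^sup>2) * (b_euler k i \<omega>)\<^sup>2)"
      proof (rule integral_mono)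
        fix \<omega>
        \<comment> \<open>Multiplied by the step, this keeps the cross term of first order in
          \<open>step k\<close>, as the discrete growth estimate requires.\<close>
        have "2 * (euler k i \<omega> * b_euler k i \<omega>) \<le> (euler k i \<omega>)\<^sup>2 + (b_euler k i \<omega>)\<^sup>2"
          using sum_squares_bound[of "euler k i \<omega>" "b_euler k i \<omega>"] by simp
        from mult_left_mono[OF this step_nonneg[of k]]
        show "(P \<omega>)\<^sup>2 \<le> (1 + step k) * (euler k i \<omega>)\<^sup>2 + (step k + (step k)\<^sup>2) * (b_euler k i \<omega>)\<^sup>2"
          by (simp add: P_def power2_eq_square algebra_simps)
      qed (use P L2_at_L2[OF E] L2_at_L2[OF b_euler_L2(1)[OF E i]] in \<open>auto simp: L2_at_def L2_def\<close>)
      also have "\<dots> = (1 + step k) * e + (step k + (step k)\<^sup>2) * expectation (\<lambda>\<omega>. (b_euler k i \<omega>)\<^sup>2)"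
        using L2_at_L2[OF E] L2_at_L2[OF b_euler_L2(1)[OF E i]] by (simp add: L2_def e_def)
      also have "\<dots> \<le> (1 + step k) * e + (step k + (step k)\<^sup>2) * (growth * (1 + e))"
        using b_euler_L2(2)[OF E i] step_nonneg[of k] by (intro add_left_mono mult_left_mono) (auto simp: e_def)
      finally show ?thesis .
    qed
    have "euler k (Suc i) = (\<lambda>\<omega>. P \<omega> + Q \<omega>)"
      by (simp add: P_def Q_def b_euler_def g_euler_def fun_eq_iff mult.commute)
    then have "expectation (\<lambda>\<omega>. (euler k (Suc i) \<omega>)\<^sup>2) = expectation (\<lambda>\<omega>. (P \<omega>)\<^sup>2 + (Q \<omega>)\<^sup>2 + 2 * (P \<omega> * Q \<omega>))"
      by (simp add: power2_sum algebra_simps)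
    also have "\<dots> = expectation (\<lambda>\<omega>. (P \<omega>)\<^sup>2) + expectation (\<lambda>\<omega>. (Q \<omega>)\<^sup>2)"
      using P Q PQ L2_mult[OF L2_at_L2[OF P] L2_at_L2[OF Q]] by (simp add: L2_at_def L2_def)
    finally have "1 + expectation (\<lambda>\<omega>. (euler k (Suc i) \<omega>)\<^sup>2) \<le> 1 + (1 + step k) * e + (step k + (step k)\<^sup>2) * (growth * (1 + e)) + step k * (growth * (1 + e))"
      using P2 Q2 by linarith
    also have "\<dots> \<le> (1 + e) * (1 + c * step k)"
    proof -
      have e0: "0 \<le> e" by (simp add: e_def)
      have "(step k)\<^sup>2 \<le> (T - t) * step k"
        using step_le_T[of k] step_nonneg[of k] by (simp add: power2_eq_square mult_right_mono)
      from mult_right_mono[OF this, of "growth * (1 + e)"] e0 growth_nonneg step_nonneg[of k]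
      show ?thesis by (simp add: c_def algebra_simps)
    qed
    also have "\<dots> \<le> ((1 + x\<^sup>2) * (1 + c * step k) ^ i) * (1 + c * step k)"
      using Suc.IH[OF i] c step_nonneg[of k] by (intro mult_right_mono) (auto simp: e_def)
    finally show ?case by (simp add: mult.commute mult.left_commute)
  qed
  also have "(1 + c * step k) ^ i \<le> exp (c * step k) ^ i"
    using c step_nonneg[of k] by (intro power_mono exp_ge_add_one_self) auto
  also have "exp (c * step k) ^ i = exp (c * (real i * step k))"
    by (simp add: exp_of_nat_mult[symmetric] algebra_simps)
  also have "\<dots> \<le> exp (c * (T - t))"
    using grid_bounds[OF assms] c by (auto simp: grid_def intro!: mult_left_mono)
  finally show ?thesis by (simp add: moment_bound_def c_def mult_left_mono)
qed

end

context brownian_motion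
begin

text \<open>Cauchy-Schwarz in time along almost every path, against the indicator of
  \<open>{t..T}\<close>, whose squared norm is \<open>T - t\<close>.\<close>

lemma time_integral_bound:
  assumes f: "L2 N f" and f0: "\<And>\<omega> r. r \<notin> {t..T} \<Longrightarrow> f (\<omega>, r) = 0" and t: "t \<le> T"
  shows "L2 M (\<lambda>\<omega>. \<integral>r. indicator {..s} r * f (\<omega>, r) \<partial>lborel)"
    and "expectation (\<lambda>\<omega>. (\<integral>r. indicator {..s} r * f (\<omega>, r) \<partial>lborel)\<^sup>2) \<le>
      (T - t) * (\<integral>p. indicator {..s} (snd p) * (f p)\<^sup>2 \<partial>N)"
proof -
  note fm = L2_measurable[OF f]
  have cut: "integrable N (\<lambda>p. indicator {..s} (snd p) * (f p)\<^sup>2)"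
    by (rule Bochner_Integration.integrable_bound[OF L2_square[OF f]])
       (use fm in \<open>auto simp: indicator_def\<close>)
  note c = integral_N[OF cut]
  have "(\<lambda>(\<omega>, r). indicator {..s} r * f (\<omega>, r)) \<in> borel_measurable N"
    using fm by (auto simp: case_prod_beta)
  then have m: "(\<lambda>\<omega>. \<integral>r. indicator {..s} r * f (\<omega>, r) \<partial>lborel) \<in> borel_measurable M"
    by (rule lborel.borel_measurable_lebesgue_integral)
  have i: "integrable M (\<lambda>\<omega>. (T - t) * (\<integral>r. indicator {..s} r * (f (\<omega>, r))\<^sup>2 \<partial>lborel))"
    using c(3) by simp
  have AE: "AE \<omega> in M. (\<integral>r. indicator {..s} r * f (\<omega>, r) \<partial>lborel)\<^sup>2 \<le> (T - t) * (\<integral>r. indicator {..s} r * (f (\<omega>, r))\<^sup>2 \<partial>lborel)"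
    using c(5) AE_space
  proof eventually_elim
    case (elim \<omega>)
    have sq: "(indicator A r * v)\<^sup>2 = indicator A r * v\<^sup>2" for A and r v :: real by (auto simp: indicator_def)
    have l1: "L2 lborel (\<lambda>r. indicator {..s} r * f (\<omega>, r))"
      unfolding L2_def sq using elim measurable_compose[OF measurable_Pair1' fm] by auto
    have "(\<lambda>r. (indicator {t..T} r :: real)\<^sup>2) = indicator {t..T}" by (auto simp: indicator_def)
    then have l2: "L2 lborel (\<lambda>r. indicator {t..T} r :: real)" "(\<integral>r. (indicator {t..T} r)\<^sup>2 \<partial>lborel) = T - t"
      using t by (auto simp: L2_def)
    have "(\<integral>r. indicator {..s} r * f (\<omega>, r) \<partial>lborel) = (\<integral>r. indicator {t..T} r * (indicator {..s} r * f (\<omega>, r)) \<partial>lborel)"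
    proof (intro Bochner_Integration.integral_cong refl)
      fix r
      show "indicator {..s} r * f (\<omega>, r) = indicator {t..T} r * (indicator {..s} r * f (\<omega>, r))"
        using f0[of r \<omega>] by (cases "r \<in> {t..T}") auto
    qed
    then show ?case
      using L2_Cauchy_Schwarz[OF l2(1) l1] by (simp add: l2(2) sq)
  qed
  have "AE \<omega> in M. norm ((\<integral>r. indicator {..s} r * f (\<omega>, r) \<partial>lborel)\<^sup>2) \<le> norm ((T - t) * (\<integral>r. indicator {..s} r * (f (\<omega>, r))\<^sup>2 \<partial>lborel))"
    using AE by eventually_elim auto
  then show L: "L2 M (\<lambda>\<omega>. \<integral>r. indicator {..s} r * f (\<omega>, r) \<partial>lborel)"
    unfolding L2_def using m by (auto intro!: Bochner_Integration.integrable_bound[OF i] borel_measurable_power)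
  have "expectation (\<lambda>\<omega>. (\<integral>r. indicator {..s} r * f (\<omega>, r) \<partial>lborel)\<^sup>2) \<le> expectation (\<lambda>\<omega>. (T - t) * (\<integral>r. indicator {..s} r * (f (\<omega>, r))\<^sup>2 \<partial>lborel))"
    by (rule integral_mono_AE[OF L2_square[OF L] i AE])
  then show "expectation (\<lambda>\<omega>. (\<integral>r. indicator {..s} r * f (\<omega>, r) \<partial>lborel)\<^sup>2) \<le>
      (T - t) * (\<integral>p. indicator {..s} (snd p) * (f p)\<^sup>2 \<partial>N)"
    by (simp add: c(1))
qed

lemma elem_process_time_integral:
  assumes "finite I" "\<And>i. i \<in> I \<Longrightarrow> s i \<le> u i"
  shows "(\<integral>r. indicator {..v} r * elem_process I s u \<xi> (\<omega>, r) \<partial>lborel) = (\<Sum>i\<in>I. \<xi> i \<omega> * (min (u i) v - min (s i) v))"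
proof -
  have e: "indicator {..v} r * (\<xi> i \<omega> * indicator {s i<..u i} r) = \<xi> i \<omega> * indicator {s i<..min (u i) v} r" for r i
    by (auto simp: indicator_def)
  have m: "measure lborel {s i<..min (u i) v} = min (u i) v - min (s i) v" if "i \<in> I" for i
    using assms(2)[OF that] by (cases "s i \<le> v") (auto simp: min_def)
  have fin: "emeasure lborel {s i<..min (u i) v} < \<infinity>" for i by (intro emeasure_bounded_finite) simp
  have "(\<integral>r. indicator {..v} r * elem_process I s u \<xi> (\<omega>, r) \<partial>lborel) = (\<integral>r. (\<Sum>i\<in>I. \<xi> i \<omega> * indicator {s i<..min (u i) v} r) \<partial>lborel)"
    by (simp only: elem_process_def fst_conv snd_conv sum_distrib_left e)
  also have "\<dots> = (\<Sum>i\<in>I. \<xi> i \<omega> * measure lborel {s i<..min (u i) v})"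
    using fin by (subst Bochner_Integration.integral_sum) auto
  also have "\<dots> = (\<Sum>i\<in>I. \<xi> i \<omega> * (min (u i) v - min (s i) v))"
    by (simp add: m cong: sum.cong)
  finally show ?thesis .
qed

end

section \<open>Mean-square distance between Euler paths\<close>

context lipschitz_sde
begin

definition freeze :: "nat \<Rightarrow> (nat \<Rightarrow> 'a \<Rightarrow> real) \<Rightarrow> 'a \<times> real \<Rightarrow> real" where
  "freeze k \<xi> = elem_process {..<2 ^ k} (grid k) (\<lambda>i. grid k (Suc i)) \<xi>"

definition noise :: "nat \<Rightarrow> real \<Rightarrow> 'a \<Rightarrow> real" where
  "noise k s = elem_integral {..<2 ^ k} (\<lambda>i. min (grid k i) s) (\<lambda>i. min (grid k (Suc i)) s) (stop_coeff s (grid k) (g_euler k))"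

lemma elementary_grid:
  assumes "\<And>i. i < 2 ^ k \<Longrightarrow> L2_at (grid k i) (\<xi> i)"
  shows "elementary t T {..<2 ^ k} (grid k) (\<lambda>i. grid k (Suc i)) \<xi>"
  unfolding elementary_def using assms t grid_bounds[of _ k] grid_mono[of _ _ k] by (auto simp: Suc_leI)

lemma elementary_b: "elementary t T {..<2 ^ k} (grid k) (\<lambda>i. grid k (Suc i)) (b_euler k)"
  by (intro elementary_grid b_euler_L2(1) euler_L2_at) auto

lemma elementary_g: "elementary t T {..<2 ^ k} (grid k) (\<lambda>i. grid k (Suc i)) (g_euler k)"
  by (intro elementary_grid g_euler_L2(1) euler_L2_at) auto

lemma freeze_cell:
  assumes i: "i < 2 ^ k" "grid k i < s" "s \<le> grid k (Suc i)"
  shows "freeze k \<xi> (\<omega>, s) = \<xi> i \<omega>"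
proof -
  have "indicator {grid k j<..grid k (Suc j)} s = (if j = i then 1 else 0 :: real)" for j
  proof -
    have "j < i \<Longrightarrow> grid k (Suc j) \<le> grid k i" "i < j \<Longrightarrow> grid k (Suc i) \<le> grid k j"
      by (auto intro: grid_mono)
    then show ?thesis using i by (cases j i rule: linorder_cases) (auto simp: indicator_def)
  qed
  then have "freeze k \<xi> (\<omega>, s) = (\<Sum>j<2 ^ k. \<xi> j \<omega> * (if j = i then 1 else 0))"
    by (simp only: freeze_def elem_process_def fst_conv snd_conv)
  then show ?thesis using i(1) by (simp add: if_distrib cong: if_cong)
qed

lemma freeze_outside: "r \<notin> {t<..T} \<Longrightarrow> freeze k \<xi> (\<omega>, r) = 0"
  unfolding freeze_def elem_process_def
proof (intro sum.neutral ballI)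
  fix i assume "i \<in> {..<(2::nat) ^ k}" and r: "r \<notin> {t<..T}"
  then have "t \<le> grid k i" "grid k (Suc i) \<le> T"
    using grid_bounds[of i k] grid_bounds[of "Suc i" k] by auto
  then show "\<xi> i (fst (\<omega>, r)) * indicator {grid k i<..grid k (Suc i)} (snd (\<omega>, r)) = 0"
    using r by (auto simp: indicator_def)
qed

lemma integrable_freeze: "integrable lborel (\<lambda>r. indicator {..s} r * freeze k \<xi> (\<omega>, r))"
proof -
  have "indicator {..s} r * freeze k \<xi> (\<omega>, r) = (\<Sum>i<2 ^ k. \<xi> i \<omega> * indicator ({..s} \<inter> {grid k i<..grid k (Suc i)}) r)" for r
    unfolding freeze_def elem_process_def sum_distrib_left by (intro sum.cong) (auto simp: indicator_def)
  moreover have "emeasure lborel ({..s} \<inter> {grid k i<..grid k (Suc i)}) < \<infinity>" for i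
    by (intro emeasure_bounded_finite bounded_Int) simp
  ultimately show ?thesis
    by (simp only:) (intro Bochner_Integration.integrable_sum integrable_mult_right integrable_real_indicator; simp)
qed

text \<open>The coefficients that \<open>stop_coeff\<close> sets to 0 belong to cells after
  \<open>s\<close>, whose stopped increments vanish anyway.\<close>

lemma noise_sum:
  "noise k s \<omega> = (\<Sum>i<2 ^ k. g_euler k i \<omega> * (W (min (grid k (Suc i)) s) \<omega> - W (min (grid k i) s) \<omega>))"
  unfolding noise_def elem_integral_def
  proof (intro sum.cong refl)
  fix i
  show "stop_coeff s (grid k) (g_euler k) i \<omega> * (W (min (grid k (Suc i)) s) \<omega> - W (min (grid k i) s) \<omega>) =
    g_euler k i \<omega> * (W (min (grid k (Suc i)) s) \<omega> - W (min (grid k i) s) \<omega>)"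
    using grid_mono[of i "Suc i" k] by (auto simp: stop_coeff_def min_def)
  qed

text \<open>An Euler path solves the equation exactly with frozen coefficients. Differences of paths
  are thereby differences of frozen coefficients, to which Cauchy-Schwarz in time and the isometry
  apply.\<close>

lemma euler_path_eq:
  "euler_path k s \<omega> = x + (\<integral>r. indicator {..s} r * freeze k (b_euler k) (\<omega>, r) \<partial>lborel) + noise k s \<omega>"
proof -
  have "(\<integral>r. indicator {..s} r * freeze k (b_euler k) (\<omega>, r) \<partial>lborel) = (\<Sum>i<2 ^ k. b_euler k i \<omega> * (min (grid k (Suc i)) s - min (grid k i) s))"
    unfolding freeze_def by (rule elem_process_time_integral) (auto intro: grid_mono)
  then show ?thesis by (simp add: euler_path_def noise_sum)
qed

lemma euler_sum: "euler k i \<omega> = x + (\<Sum>j<i. b_euler k j \<omega> * (grid k (Suc j) - grid k j))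
    + (\<Sum>j<i. g_euler k j \<omega> * (W (grid k (Suc j)) \<omega> - W (grid k j) \<omega>))"
  by (induction i) (simp_all add: b_euler_def g_euler_def grid_Suc)

lemma euler_path_cell:
  assumes i: "i < 2 ^ k" "grid k i \<le> s" "s \<le> grid k (Suc i)"
  shows "euler_path k s \<omega> = euler k i \<omega> + (s - grid k i) * b_euler k i \<omega> + g_euler k i \<omega> * (W s \<omega> - W (grid k i) \<omega>)"
proof -
  have lo: "grid k (Suc j) \<le> s" "grid k j \<le> s" if "j < i" for j
    using that grid_mono[of "Suc j" i k] grid_mono[of j i k] i by auto
  have hi: "s \<le> grid k j" "s \<le> grid k (Suc j)" if "i < j" for j
    using that grid_mono[of "Suc i" j k] grid_mono[of j "Suc j" k] i by auto
  have split: "(\<Sum>j<2 ^ k. f j) = (\<Sum>j<i. f j) + f i" if "\<And>j. i < j \<Longrightarrow> f j = 0" for f :: "nat \<Rightarrow> real"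
  proof -
    have "(\<Sum>j<2 ^ k. f j) = (\<Sum>j<Suc i. f j)"
      by (rule sum.mono_neutral_right) (use i that in \<open>auto simp: not_less_eq\<close>)
    then show ?thesis by simp
  qed
  have "(\<Sum>j<2 ^ k. b_euler k j \<omega> * (min (grid k (Suc j)) s - min (grid k j) s)) =
      (\<Sum>j<i. b_euler k j \<omega> * (grid k (Suc j) - grid k j)) + b_euler k i \<omega> * (s - grid k i)"
    by (subst split) (use lo hi i in \<open>auto simp: min_absorb1 min_absorb2 intro!: sum.cong\<close>)
  moreover have "(\<Sum>j<2 ^ k. g_euler k j \<omega> * (W (min (grid k (Suc j)) s) \<omega> - W (min (grid k j) s) \<omega>)) =
      (\<Sum>j<i. g_euler k j \<omega> * (W (grid k (Suc j)) \<omega> - W (grid k j) \<omega>)) + g_euler k i \<omega> * (W s \<omega> - W (grid k i) \<omega>)"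
    by (subst split) (use lo hi i in \<open>auto simp: min_absorb1 min_absorb2 intro!: sum.cong\<close>)
  ultimately show ?thesis
    by (simp add: euler_path_def euler_sum[of k i] mult.commute)
qed

lemma grid_cell_closed:
  assumes "t \<le> s" "s \<le> T"
  obtains i where "i < 2 ^ k" "grid k i \<le> s" "s \<le> grid k (Suc i)"
proof (cases "t < s")
  case True
  then show ?thesis using grid_cell[of s k] that assms by (metis less_imp_le)
next
  case False
  then have "s = t" using assms by simp
  then show ?thesis using that[of 0] grid_mono[of 0 1 k] by (simp add: grid_0)
qed

text \<open>Within a cell the squared drift part is of order \<open>(step k)\<^sup>2\<close>, at
  most \<open>(T - t) * step k\<close>, and the noise part of order \<open>step k\<close>; the 2
  comes from squaring their sum.\<close>

definition error_const :: real where "error_const = 2 * (T - t + 1) * (growth * moment_bound)"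

lemma moment_bound_nonneg: "1 \<le> moment_bound"
  using euler_moment[of 0 0] by (simp add: prob_space) (smt (verit) zero_le_power2)

lemma error_const_nonneg: "0 \<le> error_const"
  using growth_nonneg moment_bound_nonneg t by (simp add: error_const_def)

lemma euler_path_local:
  assumes i: "i < 2 ^ k" "grid k i \<le> s" "s \<le> grid k (Suc i)"
  shows "L2_at s (euler_path k s)"
    and "expectation (\<lambda>\<omega>. (euler_path k s \<omega> - euler k i \<omega>)\<^sup>2) \<le> error_const * step k"
proof -
  have i': "i \<le> 2 ^ k" using i by simp
  have sT: "s \<le> T" using grid_bounds[of "Suc i" k] i by simp
  note E = euler_L2_at[OF i']
  note B = b_euler_L2[OF E i'] and G = g_euler_L2[OF E i']
  have mb: "growth * (1 + expectation (\<lambda>\<omega>. (euler k i \<omega>)\<^sup>2)) \<le> growth * moment_bound"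
    by (intro mult_left_mono euler_moment i' growth_nonneg)
  define P where "P = (\<lambda>\<omega>. (s - grid k i) * b_euler k i \<omega>)"
  define Q where "Q = (\<lambda>\<omega>. g_euler k i \<omega> * (W s \<omega> - W (grid k i) \<omega>))"
  have P: "L2_at s P" unfolding P_def by (intro L2_at_cmult L2_at_mono[OF B(1) i(2) sT])
  have Q: "L2_at s Q" unfolding Q_def by (rule increment_mult(1)[OF G(1) i(2) sT])
  have e: "euler_path k s = (\<lambda>\<omega>. euler k i \<omega> + P \<omega> + Q \<omega>)"
    using euler_path_cell[OF i] by (simp add: P_def Q_def fun_eq_iff)
  show "L2_at s (euler_path k s)"
    unfolding e by (intro L2_at_add P Q L2_at_mono[OF E i(2) sT])
  have d: "0 \<le> s - grid k i" "s - grid k i \<le> step k" using i grid_Suc[of k i] by auto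
  have "expectation (\<lambda>\<omega>. (euler_path k s \<omega> - euler k i \<omega>)\<^sup>2) = expectation (\<lambda>\<omega>. (P \<omega> + Q \<omega>)\<^sup>2)"
    unfolding e by simp
  also have "\<dots> \<le> 2 * expectation (\<lambda>\<omega>. (P \<omega>)\<^sup>2) + 2 * expectation (\<lambda>\<omega>. (Q \<omega>)\<^sup>2)"
    by (rule L2_add_bound[OF L2_at_L2[OF P] L2_at_L2[OF Q]])
  also have "expectation (\<lambda>\<omega>. (P \<omega>)\<^sup>2) \<le> ((T - t) * step k) * (growth * moment_bound)"
  proof -
    have "expectation (\<lambda>\<omega>. (P \<omega>)\<^sup>2) = (s - grid k i)\<^sup>2 * expectation (\<lambda>\<omega>. (b_euler k i \<omega>)\<^sup>2)"
      by (simp add: P_def power_mult_distrib)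
    also have "\<dots> \<le> ((T - t) * step k) * (growth * moment_bound)"
    proof (rule mult_mono)
      have "(s - grid k i) * (s - grid k i) \<le> (T - t) * step k"
        using d step_le_T[of k] t by (intro mult_mono) auto
      then show "(s - grid k i)\<^sup>2 \<le> (T - t) * step k" by (simp add: power2_eq_square)
    qed (use B(2) mb step_nonneg[of k] t in auto)
    finally show ?thesis .
  qed
  also have "expectation (\<lambda>\<omega>. (Q \<omega>)\<^sup>2) \<le> step k * (growth * moment_bound)"
    unfolding Q_def increment_mult(2)[OF G(1) i(2) sT]
    by (rule mult_mono) (use d G(2) mb step_nonneg[of k] in auto)
  finally show "expectation (\<lambda>\<omega>. (euler_path k s \<omega> - euler k i \<omega>)\<^sup>2) \<le> error_const * step k"
    by (simp add: error_const_def algebra_simps)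
qed

lemma euler_path_L2_at: "t \<le> s \<Longrightarrow> s \<le> T \<Longrightarrow> L2_at s (euler_path k s)"
  using grid_cell_closed[of s k] euler_path_local(1) by metis

lemma euler_path_moment:
  assumes "t \<le> s" "s \<le> T"
  shows "expectation (\<lambda>\<omega>. (euler_path k s \<omega>)\<^sup>2) \<le> 2 * moment_bound + 2 * (error_const * (T - t))"
proof -
  obtain i where i: "i < 2 ^ k" "grid k i \<le> s" "s \<le> grid k (Suc i)" using grid_cell_closed[OF assms, of k] .
  have E: "L2 M (euler k i)" using euler_L2_at[of i k] i by (auto intro: L2_at_L2)
  have P: "L2 M (euler_path k s)" using euler_path_L2_at[OF assms] by (rule L2_at_L2)
  have "expectation (\<lambda>\<omega>. (euler_path k s \<omega>)\<^sup>2) \<le> 2 * expectation (\<lambda>\<omega>. (euler k i \<omega>)\<^sup>2) + 2 * expectation (\<lambda>\<omega>. (euler_path k s \<omega> - euler k i \<omega>)\<^sup>2)"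
    using L2_add_bound[OF E L2_diff[OF P E]] by simp
  moreover have "error_const * step k \<le> error_const * (T - t)"
    by (intro mult_left_mono step_le_T error_const_nonneg)
  ultimately show ?thesis
    using euler_path_local(2)[OF i] euler_moment[of i k] i by simp
qed

definition gap :: "nat \<Rightarrow> nat \<Rightarrow> real \<Rightarrow> real" where
  "gap k l s = expectation (\<lambda>\<omega>. (euler_path k s \<omega> - euler_path l s \<omega>)\<^sup>2)"

text \<open>Four error sources, hence \<open>square_sum4\<close>: the distance \<delta> of the grid
  times, two local errors and the gap of the paths. The first is made linear by
  \<open>\<delta>\<^sup>2 \<le> 2 * (T - t) * \<delta>\<close>.\<close>

definition coeff_const :: real where "coeff_const = 4 * L\<^sup>2 * (2 * (T - t) + error_const)"

lemma coeff_const_nonneg: "0 \<le> coeff_const"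
  using error_const_nonneg t by (simp add: coeff_const_def)

text \<open>The states frozen in the two cells around \<open>s\<close> are compared by way of the
  two Euler paths at \<open>s\<close>; the Lipschitz condition turns this chain into an estimate for
  the coefficients.\<close>

lemma coeff_gap:
  assumes lip: "\<And>s s' y y'. \<bar>f s y - f s' y'\<bar> \<le> L * (\<bar>s - s'\<bar> + \<bar>y - y' :: real\<bar>)"
    and f\<xi>: "\<And>k i \<omega>. \<xi> k i \<omega> = f (grid k i) (euler k i \<omega>)"
    and el: "\<And>k. elementary t T {..<2 ^ k} (grid k) (\<lambda>i. grid k (Suc i)) (\<xi> k)"
    and s: "t < s" "s \<le> T"
  shows "expectation (\<lambda>\<omega>. (freeze k (\<xi> k) (\<omega>, s) - freeze l (\<xi> l) (\<omega>, s))\<^sup>2) \<le> coeff_const * (step k + step l) + 4 * L\<^sup>2 * gap k l s"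
proof -
  obtain i where i: "i < 2 ^ k" "grid k i < s" "s \<le> grid k (Suc i)" using grid_cell[OF s, of k] .
  obtain j where j: "j < 2 ^ l" "grid l j < s" "s \<le> grid l (Suc j)" using grid_cell[OF s, of l] .
  note fc = freeze_cell[OF i, of "\<xi> k"] freeze_cell[OF j, of "\<xi> l"]
  have Li: "L2 M (euler k i)" "L2 M (\<xi> k i)" "L2 M (euler l j)" "L2 M (\<xi> l j)"
    using euler_L2_at[of i k] euler_L2_at[of j l] i j el[of k] el[of l] by (auto simp: elementary_def intro: L2_at_L2)
  have Lp: "L2 M (euler_path k s)" for k using euler_path_L2_at[of s k] s by (auto intro: L2_at_L2)
  define \<delta> where "\<delta> = step k + step l"
  have tau: "\<bar>grid k i - grid l j\<bar> \<le> \<delta>"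
    using i j grid_Suc[of k i] grid_Suc[of l j] step_nonneg[of k] step_nonneg[of l] by (auto simp: \<delta>_def)
  have ei: "expectation (\<lambda>\<omega>. (euler_path k s \<omega> - euler k i \<omega>)\<^sup>2) \<le> error_const * step k"
    using i by (intro euler_path_local(2)) auto
  have ej: "expectation (\<lambda>\<omega>. (euler_path l s \<omega> - euler l j \<omega>)\<^sup>2) \<le> error_const * step l"
    using j by (intro euler_path_local(2)) auto
  have "expectation (\<lambda>\<omega>. (\<xi> k i \<omega> - \<xi> l j \<omega>)\<^sup>2) \<le> expectation (\<lambda>\<omega>. L\<^sup>2 * (4 * (\<delta>\<^sup>2 + (euler_path k s \<omega> - euler k i \<omega>)\<^sup>2
      + (euler_path k s \<omega> - euler_path l s \<omega>)\<^sup>2 + (euler_path l s \<omega> - euler l j \<omega>)\<^sup>2)))"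
  proof (rule integral_mono)
    show "integrable M (\<lambda>\<omega>. (\<xi> k i \<omega> - \<xi> l j \<omega>)\<^sup>2)" by (intro L2_square L2_diff Li)
    show "integrable M (\<lambda>\<omega>. L\<^sup>2 * (4 * (\<delta>\<^sup>2 + (euler_path k s \<omega> - euler k i \<omega>)\<^sup>2
      + (euler_path k s \<omega> - euler_path l s \<omega>)\<^sup>2 + (euler_path l s \<omega> - euler l j \<omega>)\<^sup>2)))"
      by (intro integrable_mult_right Bochner_Integration.integrable_add L2_square L2_diff L2_const Li Lp)
    fix \<omega>
    have "\<bar>\<xi> k i \<omega> - \<xi> l j \<omega>\<bar> \<le> L * (\<bar>grid k i - grid l j\<bar> + \<bar>euler k i \<omega> - euler l j \<omega>\<bar>)"
      unfolding f\<xi> by (rule lip)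
    also have "\<dots> \<le> L * (\<delta> + \<bar>euler_path k s \<omega> - euler k i \<omega>\<bar> + \<bar>euler_path k s \<omega> - euler_path l s \<omega>\<bar> + \<bar>euler_path l s \<omega> - euler l j \<omega>\<bar>)"
      using tau L by (intro mult_left_mono) auto
    finally have "\<bar>\<xi> k i \<omega> - \<xi> l j \<omega>\<bar>\<^sup>2 \<le> (L * (\<delta> + \<bar>euler_path k s \<omega> - euler k i \<omega>\<bar> + \<bar>euler_path k s \<omega> - euler_path l s \<omega>\<bar> + \<bar>euler_path l s \<omega> - euler l j \<omega>\<bar>))\<^sup>2"
      by (intro power_mono) auto
    also have "\<dots> \<le> L\<^sup>2 * (4 * (\<delta>\<^sup>2 + \<bar>euler_path k s \<omega> - euler k i \<omega>\<bar>\<^sup>2 + \<bar>euler_path k s \<omega> - euler_path l s \<omega>\<bar>\<^sup>2 + \<bar>euler_path l s \<omega> - euler l j \<omega>\<bar>\<^sup>2))"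
      unfolding power_mult_distrib by (intro mult_left_mono square_sum4) auto
    finally show "(\<xi> k i \<omega> - \<xi> l j \<omega>)\<^sup>2 \<le> L\<^sup>2 * (4 * (\<delta>\<^sup>2 + (euler_path k s \<omega> - euler k i \<omega>)\<^sup>2
      + (euler_path k s \<omega> - euler_path l s \<omega>)\<^sup>2 + (euler_path l s \<omega> - euler l j \<omega>)\<^sup>2))"
      by simp
  qed
  also have "\<dots> = L\<^sup>2 * (4 * (\<delta>\<^sup>2 + expectation (\<lambda>\<omega>. (euler_path k s \<omega> - euler k i \<omega>)\<^sup>2)
      + gap k l s + expectation (\<lambda>\<omega>. (euler_path l s \<omega> - euler l j \<omega>)\<^sup>2)))"
    using L2_square[OF L2_diff[OF Lp Li(1)]] L2_square[OF L2_diff[OF Lp Li(3)]] L2_square[OF L2_diff[OF Lp Lp]]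
    by (simp add: prob_space gap_def)
  also have "\<dots> \<le> L\<^sup>2 * (4 * (2 * (T - t) * \<delta> + error_const * step k + gap k l s + error_const * step l))"
  proof -
    have "\<delta> * \<delta> \<le> (2 * (T - t)) * \<delta>"
      using step_le_T[of k] step_le_T[of l] step_nonneg[of k] step_nonneg[of l] by (intro mult_right_mono) (auto simp: \<delta>_def)
    then show ?thesis using ei ej by (intro mult_left_mono add_mono) (auto simp: power2_eq_square)
  qed
  also have "\<dots> = coeff_const * (step k + step l) + 4 * L\<^sup>2 * gap k l s"
    by (simp add: coeff_const_def \<delta>_def algebra_simps)
  finally show ?thesis by (simp add: fc)
qed

text \<open>A continuous majorant \<open>Q\<close> stands in for \<open>gap k l\<close>, about whose
  regularity in time nothing is claimed; the right-hand side is then integrable.\<close>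

lemma freeze_gap:
  assumes lip: "\<And>s s' y y'. \<bar>f s y - f s' y'\<bar> \<le> L * (\<bar>s - s'\<bar> + \<bar>y - y' :: real\<bar>)"
    and f\<xi>: "\<And>k i \<omega>. \<xi> k i \<omega> = f (grid k i) (euler k i \<omega>)"
    and el: "\<And>k. elementary t T {..<2 ^ k} (grid k) (\<lambda>i. grid k (Suc i)) (\<xi> k)"
    and Q: "continuous_on {t..T} Q" "\<And>r. r \<in> {t..T} \<Longrightarrow> gap k l r \<le> Q r" and s: "t \<le> s" "s \<le> T"
  shows "(\<integral>p. indicator {..s} (snd p) * (freeze k (\<xi> k) p - freeze l (\<xi> l) p)\<^sup>2 \<partial>N) \<le>
    (\<integral>r. indicator {t..s} r * (coeff_const * (step k + step l) + 4 * L\<^sup>2 * Q r) \<partial>lborel)"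
proof -
  have fL: "L2 N (freeze k (\<xi> k))" for k unfolding freeze_def by (rule elem_process_L2[OF el])
  have i: "integrable N (\<lambda>p. indicator {..s} (snd p) * (freeze k (\<xi> k) p - freeze l (\<xi> l) p)\<^sup>2)"
    by (rule Bochner_Integration.integrable_bound[OF L2_square[OF L2_diff[OF fL[of k] fL[of l]]]])
       (use L2_measurable[OF fL] in \<open>auto simp: indicator_def\<close>)
  have "continuous_on {t..s} (\<lambda>r. coeff_const * (step k + step l) + 4 * L\<^sup>2 * Q r)"
    using s by (intro continuous_intros continuous_on_subset[OF Q(1)]) auto
  from borel_integrable_compact[OF compact_Icc this]
  have i2: "integrable lborel (\<lambda>r. indicator {t..s} r * (coeff_const * (step k + step l) + 4 * L\<^sup>2 * Q r))"
    by simp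
  have Q0: "0 \<le> Q r" if "r \<in> {t..T}" for r
    using Q(2)[OF that] by (rule order.trans[rotated]) (simp add: gap_def)
  show ?thesis
    unfolding integral_N(2)[OF i]
  proof (rule integral_mono[OF integral_N(4)[OF i] i2])
    fix r
    show "(\<integral>\<omega>. indicator {..s} (snd (\<omega>, r)) * (freeze k (\<xi> k) (\<omega>, r) - freeze l (\<xi> l) (\<omega>, r))\<^sup>2 \<partial>M) \<le>
      indicator {t..s} r * (coeff_const * (step k + step l) + 4 * L\<^sup>2 * Q r)"
    proof (cases "r \<in> {t<..s}")
      case True
      have "expectation (\<lambda>\<omega>. (freeze k (\<xi> k) (\<omega>, r) - freeze l (\<xi> l) (\<omega>, r))\<^sup>2) \<le> coeff_const * (step k + step l) + 4 * L\<^sup>2 * gap k l r"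
        using True s by (intro coeff_gap[OF lip f\<xi> el]) auto
      also have "\<dots> \<le> coeff_const * (step k + step l) + 4 * L\<^sup>2 * Q r"
        using Q(2)[of r] True s by (intro add_left_mono mult_left_mono) auto
      finally show ?thesis using True by simp
    next
      case False
      then have "indicator {..s} r * (freeze k (\<xi> k) (\<omega>, r) - freeze l (\<xi> l) (\<omega>, r))\<^sup>2 = 0" for \<omega>
        using freeze_outside[of r] by (auto simp: indicator_def)
      then show ?thesis
        using Q0[of r] s coeff_const_nonneg step_nonneg[of k] step_nonneg[of l]
        by (auto simp: indicator_def intro!: add_nonneg_nonneg mult_nonneg_nonneg)
    qed
  qed
qed

lemmas freeze_gap_b = freeze_gap[OF b_lipschitz b_euler_def elementary_b]
  and freeze_gap_g = freeze_gap[OF g_lipschitz g_euler_def elementary_g]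

lemma noise_isometry:
  assumes s: "t \<le> s" "s \<le> T"
  shows "L2_at s (noise k s)"
    and "expectation (\<lambda>\<omega>. (noise k s \<omega> - noise l s \<omega>)\<^sup>2) =
      (\<integral>p. indicator {..s} (snd p) * (freeze k (g_euler k) p - freeze l (g_euler l) p)\<^sup>2 \<partial>N)"
proof -
  note st = elementary_stop[OF elementary_g s]
  show "L2_at s (noise k s)" unfolding noise_def by (rule elem_integral_L2_at[OF st(1)])
  have "expectation (\<lambda>\<omega>. (noise k s \<omega> - noise l s \<omega>)\<^sup>2) =
     (\<integral>p. (indicator {..s} (snd p) * freeze k (g_euler k) p - indicator {..s} (snd p) * freeze l (g_euler l) p)\<^sup>2 \<partial>N)"
    unfolding noise_def elem_isometry_diff[OF st(1) st(1), symmetric] st(2) freeze_def ..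
  also have "\<dots> = (\<integral>p. indicator {..s} (snd p) * (freeze k (g_euler k) p - freeze l (g_euler l) p)\<^sup>2 \<partial>N)"
    by (intro Bochner_Integration.integral_cong) (auto simp: indicator_def)
  finally show "expectation (\<lambda>\<omega>. (noise k s \<omega> - noise l s \<omega>)\<^sup>2) =
      (\<integral>p. indicator {..s} (snd p) * (freeze k (g_euler k) p - freeze l (g_euler l) p)\<^sup>2 \<partial>N)" .
qed

text \<open>The drift is estimated by Cauchy-Schwarz in time and the noise by the isometry; the
  factors 2 come from the square of their sum.\<close>

lemma gap_le_freeze:
  assumes s: "t \<le> s" "s \<le> T"
  shows "gap k l s \<le> 2 * (T - t) * (\<integral>p. indicator {..s} (snd p) * (freeze k (b_euler k) p - freeze l (b_euler l) p)\<^sup>2 \<partial>N)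
    + 2 * (\<integral>p. indicator {..s} (snd p) * (freeze k (g_euler k) p - freeze l (g_euler l) p)\<^sup>2 \<partial>N)"
proof -
  define f where "f = (\<lambda>p. freeze k (b_euler k) p - freeze l (b_euler l) p)"
  have fL: "L2 N (freeze k (b_euler k))" for k unfolding freeze_def by (rule elem_process_L2[OF elementary_b])
  have f: "L2 N f" unfolding f_def by (intro L2_diff fL)
  have f0: "f (\<omega>, r) = 0" if "r \<notin> {t..T}" for \<omega> r
    using that freeze_outside[of r] by (simp add: f_def)
  define P where "P = (\<lambda>\<omega>. \<integral>r. indicator {..s} r * f (\<omega>, r) \<partial>lborel)"
  have P: "L2 M P" unfolding P_def by (rule time_integral_bound(1)[OF f f0 t(2)])
  have P2: "expectation (\<lambda>\<omega>. (P \<omega>)\<^sup>2) \<le> (T - t) * (\<integral>p. indicator {..s} (snd p) * (f p)\<^sup>2 \<partial>N)"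
    unfolding P_def by (rule time_integral_bound(2)[OF f f0 t(2)])
  have Q: "L2 M (\<lambda>\<omega>. noise k s \<omega> - noise l s \<omega>)"
    by (intro L2_diff L2_at_L2[OF noise_isometry(1)[OF s]])
  have "euler_path k s \<omega> - euler_path l s \<omega> = P \<omega> + (noise k s \<omega> - noise l s \<omega>)" for \<omega>
    unfolding euler_path_eq P_def f_def right_diff_distrib
    by (subst Bochner_Integration.integral_diff[OF integrable_freeze integrable_freeze]) simp
  then have "gap k l s = expectation (\<lambda>\<omega>. (P \<omega> + (noise k s \<omega> - noise l s \<omega>))\<^sup>2)"
    by (simp add: gap_def)
  also have "\<dots> \<le> 2 * expectation (\<lambda>\<omega>. (P \<omega>)\<^sup>2) + 2 * expectation (\<lambda>\<omega>. (noise k s \<omega> - noise l s \<omega>)\<^sup>2)"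
    by (rule L2_add_bound[OF P Q])
  also have "\<dots> \<le> 2 * (T - t) * (\<integral>p. indicator {..s} (snd p) * (f p)\<^sup>2 \<partial>N) + 2 * expectation (\<lambda>\<omega>. (noise k s \<omega> - noise l s \<omega>)\<^sup>2)"
    unfolding mult.assoc by (intro add_right_mono mult_left_mono P2) simp
  finally show ?thesis by (simp only: noise_isometry(2)[OF s] f_def)
qed

text \<open>The exponent of the weight. Integrating the weight divides by this rate, which is large
  enough to leave at most half of \<open>S\<close> after the factors \<open>2 * (T - t + 1)\<close>
  and \<open>4 * L\<^sup>2\<close>; the final 1 keeps it positive when \<open>L = 0\<close>.\<close>

definition growth_rate :: real where "growth_rate = 16 * L\<^sup>2 * (T - t + 1) + 1"

text \<open>The fixed point \<open>2 * \<epsilon>\<close> of the halving, per unit of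
  \<open>step k + step l\<close>, times the largest weight on \<open>{t..T}\<close>.\<close>

definition gap_const :: real where
  "gap_const = 4 * (T - t + 1) * (coeff_const * (T - t)) * exp (growth_rate * (T - t))"

lemma gap_bound:
  assumes s: "s \<in> {t..T}"
  shows "gap k l s \<le> gap_const * (step k + step l)"
proof -
  define \<delta> where "\<delta> = step k + step l"
  define K where "K = growth_rate"
  have K: "0 < K" "16 * L\<^sup>2 * (T - t + 1) \<le> K" using t by (auto simp: K_def growth_rate_def add_nonneg_pos)
  have \<delta>: "0 \<le> \<delta>" using step_nonneg by (simp add: \<delta>_def)
  define \<epsilon> where "\<epsilon> = 2 * (T - t + 1) * (coeff_const * \<delta> * (T - t))"
  have \<epsilon>: "0 \<le> \<epsilon>" using t \<delta> coeff_const_nonneg by (simp add: \<epsilon>_def)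
  have "gap k l s \<le> 2 * \<epsilon> * exp (K * (s - t))"
  proof (rule halving_bound[where A="{t..T}" and D="gap k l" and e="\<lambda>r. exp (K * (r - t))" and \<epsilon>=\<epsilon> and r=s and B="4 * (2 * moment_bound + 2 * (error_const * (T - t)))"])
    fix r assume r: "r \<in> {t..T}"
    show "1 \<le> exp (K * (r - t))" using K r by simp
    have "gap k l r \<le> 2 * expectation (\<lambda>\<omega>. (euler_path k r \<omega>)\<^sup>2) + 2 * expectation (\<lambda>\<omega>. (- euler_path l r \<omega>)\<^sup>2)"
      using L2_add_bound[OF L2_at_L2[OF euler_path_L2_at] L2_minus[OF L2_at_L2[OF euler_path_L2_at]], of r r k l] r
      by (simp add: gap_def)
    then show "gap k l r \<le> 4 * (2 * moment_bound + 2 * (error_const * (T - t)))"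
      using euler_path_moment[of r k] euler_path_moment[of r l] r by simp
  next
    show "0 \<le> 4 * (2 * moment_bound + 2 * (error_const * (T - t)))"
      using moment_bound_nonneg error_const_nonneg t by simp
  next
    fix S r assume S: "0 \<le> S" "\<And>r. r \<in> {t..T} \<Longrightarrow> gap k l r \<le> S * exp (K * (r - t))" and r: "r \<in> {t..T}"
    have c: "continuous_on {t..T} (\<lambda>r. S * exp (K * (r - t)))" by (intro continuous_intros)
    have tr: "t \<le> r" "r \<le> T" using r by auto
    define I where "I = (\<integral>q. indicator {t..r} q * (coeff_const * \<delta> + 4 * L\<^sup>2 * (S * exp (K * (q - t)))) \<partial>lborel)"
    have "I = coeff_const * \<delta> * (r - t) + 4 * L\<^sup>2 * S * ((exp (K * (r - t)) - 1) / K)"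
    proof -
      have "(\<integral>q. indicator {t..r} q *\<^sub>R (coeff_const * \<delta> + 4 * L\<^sup>2 * (S * exp (K * (q - t)))) \<partial>lborel) =
        (coeff_const * \<delta> * (r - t) + 4 * L\<^sup>2 * S * (exp (K * (r - t)) / K)) - (coeff_const * \<delta> * (t - t) + 4 * L\<^sup>2 * S * (exp (K * (t - t)) / K))"
      proof (rule integral_FTC_Icc[OF tr(1)])
        fix q
        show "((\<lambda>q. coeff_const * \<delta> * (q - t) + 4 * L\<^sup>2 * S * (exp (K * (q - t)) / K)) has_vector_derivative
          coeff_const * \<delta> + 4 * L\<^sup>2 * (S * exp (K * (q - t)))) (at q within {t..r})"
          unfolding has_real_derivative_iff_has_vector_derivative[symmetric]
          using K by (auto intro!: derivative_eq_intros)
      qed (intro continuous_intros)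
      then show ?thesis by (simp add: I_def diff_divide_distrib algebra_simps)
    qed
    also have "\<dots> \<le> coeff_const * \<delta> * (T - t) + 4 * L\<^sup>2 * S * (exp (K * (r - t)) / K)"
      using tr coeff_const_nonneg \<delta> K S(1)
      by (intro add_mono mult_left_mono divide_right_mono) auto
    finally have I: "I \<le> coeff_const * \<delta> * (T - t) + 4 * L\<^sup>2 * S * (exp (K * (r - t)) / K)" .
    have "gap k l r \<le> 2 * (T - t) * I + 2 * I"
      using gap_le_freeze[OF tr, of k l] freeze_gap_b[OF c S(2) tr] freeze_gap_g[OF c S(2) tr]
        mult_left_mono[OF freeze_gap_b[OF c S(2) tr], of "2 * (T - t)"] t by (simp add: I_def \<delta>_def)
    also have "\<dots> = 2 * (T - t + 1) * I" by (simp add: algebra_simps)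
    also have "\<dots> \<le> 2 * (T - t + 1) * (coeff_const * \<delta> * (T - t) + 4 * L\<^sup>2 * S * (exp (K * (r - t)) / K))"
      using I t by (intro mult_left_mono) auto
    also have "\<dots> = \<epsilon> + (16 * L\<^sup>2 * (T - t + 1)) / K * (S / 2 * exp (K * (r - t)))"
    proof -
      have "2 * \<tau> * (A + 4 * L\<^sup>2 * S * (E / K)) = 2 * \<tau> * A + (16 * L\<^sup>2 * \<tau>) / K * (S / 2 * E)" for \<tau> A E
        using K by (simp add: field_simps)
      then show ?thesis unfolding \<epsilon>_def .
    qed
    also have "\<dots> \<le> \<epsilon> * exp (K * (r - t)) + 1 * (S / 2 * exp (K * (r - t)))"
    proof (intro add_mono mult_right_mono)
      have "\<epsilon> * 1 \<le> \<epsilon> * exp (K * (r - t))" using K tr \<epsilon> by (intro mult_left_mono) auto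
      then show "\<epsilon> \<le> \<epsilon> * exp (K * (r - t))" by simp
      show "(16 * L\<^sup>2 * (T - t + 1)) / K \<le> 1" using K by simp
    qed (use S in simp)
    also have "\<dots> = (\<epsilon> + S / 2) * exp (K * (r - t))" by (simp add: algebra_simps)
    finally show "gap k l r \<le> (\<epsilon> + S / 2) * exp (K * (r - t))" .
  qed (use \<epsilon> s in auto)
  also have "\<dots> \<le> 2 * \<epsilon> * exp (K * (T - t))"
    using \<epsilon> K s by (intro mult_left_mono) auto
  finally show ?thesis by (simp add: gap_const_def \<epsilon>_def K_def \<delta>_def algebra_simps)
qed

lemma gap_const_nonneg: "0 \<le> gap_const"
  using t coeff_const_nonneg by (simp add: gap_const_def)

definition freeze_const :: real where
  "freeze_const = (coeff_const + 4 * L\<^sup>2 * gap_const) * (T - t)"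

lemma freeze_const_nonneg: "0 \<le> freeze_const"
  using t coeff_const_nonneg gap_const_nonneg by (simp add: freeze_const_def)

lemma freeze_gap_const:
  fixes k l
  defines "q \<equiv> freeze_const * (step k + step l)"
  shows "(\<integral>p. (freeze k (b_euler k) p - freeze l (b_euler l) p)\<^sup>2 \<partial>N) \<le> q"
    and "(\<integral>p. (freeze k (g_euler k) p - freeze l (g_euler l) p)\<^sup>2 \<partial>N) \<le> q"
proof -
  have e: "(\<integral>p. indicator {..T} (snd p) * (freeze k \<xi> p - freeze l \<zeta> p)\<^sup>2 \<partial>N) = (\<integral>p. (freeze k \<xi> p - freeze l \<zeta> p)\<^sup>2 \<partial>N)" for \<xi> \<zeta>
  proof (intro Bochner_Integration.integral_cong refl)
    fix p :: "'a \<times> real"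
    show "indicator {..T} (snd p) * (freeze k \<xi> p - freeze l \<zeta> p)\<^sup>2 = (freeze k \<xi> p - freeze l \<zeta> p)\<^sup>2"
      using freeze_outside[of "snd p" _ _ "fst p"] by (cases "snd p \<le> T") auto
  qed
  have c: "continuous_on {t..T} (\<lambda>_. gap_const * (step k + step l))" by simp
  have "(\<integral>r. indicator {t..T} r * (coeff_const * (step k + step l) + 4 * L\<^sup>2 * (gap_const * (step k + step l))) \<partial>lborel) = q"
    using t by (simp add: q_def freeze_const_def algebra_simps)
  then show "(\<integral>p. (freeze k (b_euler k) p - freeze l (b_euler l) p)\<^sup>2 \<partial>N) \<le> q"
    "(\<integral>p. (freeze k (g_euler k) p - freeze l (g_euler l) p)\<^sup>2 \<partial>N) \<le> q"
    using freeze_gap_b[OF c gap_bound t(2) order_refl] freeze_gap_g[OF c gap_bound t(2) order_refl] by (simp_all add: e)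
qed

end

lemma L2_Fatou:
  assumes f: "\<And>l. L2 M (f l)" and b: "\<And>l. (\<integral>x. (f l x)\<^sup>2 \<partial>M) \<le> C"
    and lim: "AE x in M. (\<lambda>l. f l x) \<longlonglongrightarrow> h x" and h: "h \<in> borel_measurable M"
  shows "L2 M h" "(\<integral>x. (h x)\<^sup>2 \<partial>M) \<le> C"
proof -
  have C: "0 \<le> C" using b[of 0] by (rule order.trans[rotated]) simp
  have "AE x in M. ennreal ((h x)\<^sup>2) = liminf (\<lambda>l. ennreal ((f l x)\<^sup>2))"
    using lim
  proof eventually_elim
    case (elim x)
    then have "(\<lambda>l. ennreal ((f l x)\<^sup>2)) \<longlonglongrightarrow> ennreal ((h x)\<^sup>2)"
      by (intro tendsto_ennrealI tendsto_power)
    then show ?case by (rule lim_imp_Liminf[OF trivial_limit_sequentially, symmetric])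
  qed
  then have "(\<integral>\<^sup>+x. ennreal ((h x)\<^sup>2) \<partial>M) = (\<integral>\<^sup>+x. liminf (\<lambda>l. ennreal ((f l x)\<^sup>2)) \<partial>M)"
    by (rule nn_integral_cong_AE)
  also have "\<dots> \<le> liminf (\<lambda>l. \<integral>\<^sup>+x. ennreal ((f l x)\<^sup>2) \<partial>M)"
    using f by (intro nn_integral_liminf) (auto simp: L2_def)
  also have "\<dots> \<le> ennreal C"
    using b by (intro Liminf_le) (auto simp: L2_nn_integral[OF f] intro!: ennreal_leI always_eventually)
  finally have le: "(\<integral>\<^sup>+x. ennreal ((h x)\<^sup>2) \<partial>M) \<le> ennreal C" .
  also have "\<dots> < \<infinity>" by simp
  finally show L: "L2 M h" by (rule L2I[OF h])
  show "(\<integral>x. (h x)\<^sup>2 \<partial>M) \<le> C"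
    using le C by (simp add: L2_nn_integral[OF L])
qed

section \<open>Almost sure uniform convergence of the Euler paths\<close>

context brownian_motion
begin

text \<open>Kolmogorov's inequality: decompose according to the first time in \<open>A\<close> at which the martingale
  is large.\<close>

lemma maximal_inequality:
  assumes A: "finite A" "A \<subseteq> {t..T}" and t: "0 \<le> t" "t \<le> T" and c: "0 < c"
    and S: "\<And>s. s \<in> {t..T} \<Longrightarrow> L2_at s (S s)"
    and mart: "\<And>s Z. s \<in> {t..T} \<Longrightarrow> L2_at s Z \<Longrightarrow> expectation (\<lambda>\<omega>. S T \<omega> * Z \<omega>) = expectation (\<lambda>\<omega>. S s \<omega> * Z \<omega>)"
  shows "{\<omega>\<in>space M. \<exists>s\<in>A. c \<le> \<bar>S s \<omega>\<bar>} \<in> events"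
    and "prob {\<omega>\<in>space M. \<exists>s\<in>A. c \<le> \<bar>S s \<omega>\<bar>} * c\<^sup>2 \<le> expectation (\<lambda>\<omega>. (S T \<omega>)\<^sup>2)"
proof -
  define B where "B = (\<lambda>s. {\<omega>\<in>space M. c \<le> \<bar>S s \<omega>\<bar> \<and> (\<forall>r\<in>{r\<in>A. r < s}. \<bar>S r \<omega>\<bar> < c)})"
  have TT: "T \<in> {t..T}" using t by simp
  have BF: "B s \<in> sets (F s)" if s: "s \<in> A" for s
  proof -
    have s': "0 \<le> s" "s \<le> T" using A s t by auto
    have m: "S r \<in> borel_measurable (F s)" if "r \<in> A" "r \<le> s" for r
    proof (rule measurable_F_mono[of r s])
      show "0 \<le> r" "S r \<in> borel_measurable (F r)" using S[of r] that A by (auto simp: L2_at_def)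
    qed (use that s' in auto)
    have "{\<omega>\<in>space (F s). c \<le> \<bar>S s \<omega>\<bar> \<and> (\<forall>r\<in>{r\<in>A. r < s}. \<bar>S r \<omega>\<bar> < c)} \<in> sets (F s)"
    proof (intro sets.sets_Collect_conj sets.sets_Collect_finite_All)
      show "{\<omega>\<in>space (F s). c \<le> \<bar>S s \<omega>\<bar>} \<in> sets (F s)" using m[OF s] by measurable
      fix r assume "r \<in> {r\<in>A. r < s}"
      then have [measurable]: "S r \<in> borel_measurable (F s)" using m by simp
      show "{\<omega>\<in>space (F s). \<bar>S r \<omega>\<bar> < c} \<in> sets (F s)" by measurable
    qed (use A in simp)
    then show ?thesis by (simp add: B_def space_F[OF s'])
  qed
  have BM: "B s \<in> events" if "s \<in> A" for s
  proof -
    have "0 \<le> s" "s \<le> T" using A(2) t(1) that by auto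
    then show ?thesis using BF[OF that] subalgebra_F[of s] by (auto simp: subalgebra_def)
  qed
  have union: "{\<omega>\<in>space M. \<exists>s\<in>A. c \<le> \<bar>S s \<omega>\<bar>} = (\<Union>s\<in>A. B s)"
  proof safe
    fix \<omega> s assume \<omega>: "\<omega> \<in> space M" and s: "s \<in> A" "c \<le> \<bar>S s \<omega>\<bar>"
    define R where "R = {r\<in>A. c \<le> \<bar>S r \<omega>\<bar>}"
    have R: "finite R" "R \<noteq> {}" using A s by (auto simp: R_def)
    have "Min R \<in> A" "c \<le> \<bar>S (Min R) \<omega>\<bar>" using Min_in[OF R] by (auto simp: R_def)
    moreover have "\<bar>S r \<omega>\<bar> < c" if "r \<in> A" "r < Min R" for r
    proof (rule ccontr)
      assume "\<not> \<bar>S r \<omega>\<bar> < c"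
      then have "r \<in> R" using that(1) by (simp add: R_def)
      then show False using Min_le[OF R(1)] that(2) by (simp add: leD)
    qed
    ultimately show "\<omega> \<in> (\<Union>s\<in>A. B s)" using \<omega> by (auto simp: B_def)
  qed (auto simp: B_def)
  then show "{\<omega>\<in>space M. \<exists>s\<in>A. c \<le> \<bar>S s \<omega>\<bar>} \<in> events" using BM A(1) by auto
  have disj: "disjoint_family_on B A"
    unfolding disjoint_family_on_def B_def
  proof (intro ballI impI)
    fix m n assume "m \<in> A" "n \<in> A" "m \<noteq> n"
    show "{\<omega>\<in>space M. c \<le> \<bar>S m \<omega>\<bar> \<and> (\<forall>r\<in>{r\<in>A. r < m}. \<bar>S r \<omega>\<bar> < c)} \<inter>
      {\<omega>\<in>space M. c \<le> \<bar>S n \<omega>\<bar> \<and> (\<forall>r\<in>{r\<in>A. r < n}. \<bar>S r \<omega>\<bar> < c)} = {}"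
    proof (rule equals0I)
      fix \<omega> assume "\<omega> \<in> {\<omega>\<in>space M. c \<le> \<bar>S m \<omega>\<bar> \<and> (\<forall>r\<in>{r\<in>A. r < m}. \<bar>S r \<omega>\<bar> < c)} \<inter>
        {\<omega>\<in>space M. c \<le> \<bar>S n \<omega>\<bar> \<and> (\<forall>r\<in>{r\<in>A. r < n}. \<bar>S r \<omega>\<bar> < c)}"
      then have "c \<le> \<bar>S m \<omega>\<bar>" "c \<le> \<bar>S n \<omega>\<bar>" "n < m \<longrightarrow> \<bar>S n \<omega>\<bar> < c" "m < n \<longrightarrow> \<bar>S m \<omega>\<bar> < c"
        using \<open>m \<in> A\<close> \<open>n \<in> A\<close> by simp_all
      then show False using \<open>m \<noteq> n\<close> by linarith
    qed
  qed
  have ST: "L2 M (S T)" using S[OF TT] by (rule L2_at_L2)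
  have part: "c\<^sup>2 * prob (B s) \<le> expectation (\<lambda>\<omega>. indicator (B s) \<omega> * (S T \<omega>)\<^sup>2)" if s: "s \<in> A" for s
  proof -
    have sT: "s \<in> {t..T}" using A s by auto
    \<comment> \<open>The event \<open>B s\<close> is decided at time \<open>s\<close>, so
      \<open>Z\<close> is an admissible test variable for the martingale property at
      \<open>s\<close>.\<close>
    define Z where "Z = (\<lambda>\<omega>. indicator (B s) \<omega> * S s \<omega>)"
    have Ss: "L2 M (S s)" using S[OF sT] by (rule L2_at_L2)
    have ZL: "L2 M Z" unfolding Z_def by (rule L2_indicator_mult[OF Ss BM[OF s]])
    have "L2_at s Z"
      using S[OF sT] ZL BF[OF s] unfolding L2_at_def Z_def by (auto intro!: borel_measurable_times borel_measurable_indicator)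
    moreover have "S s \<omega> * Z \<omega> = (Z \<omega>)\<^sup>2" for \<omega>
      by (simp add: Z_def indicator_def power2_eq_square)
    ultimately have m: "expectation (\<lambda>\<omega>. S T \<omega> * Z \<omega>) = expectation (\<lambda>\<omega>. (Z \<omega>)\<^sup>2)"
      using mart[OF sT, of Z] by simp
    have i: "integrable M (\<lambda>\<omega>. indicator (B s) \<omega> * (S T \<omega>)\<^sup>2)"
      using integrable_real_mult_indicator[OF BM[OF s] L2_square[OF ST]] by (simp add: mult.commute)
    have "c\<^sup>2 * prob (B s) = expectation (\<lambda>\<omega>. c\<^sup>2 * indicator (B s) \<omega>)"
      using BM[OF s] by simp
    also have "\<dots> \<le> expectation (\<lambda>\<omega>. (Z \<omega>)\<^sup>2)"
    proof (rule integral_mono)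
      show "integrable M (\<lambda>\<omega>. c\<^sup>2 * indicator (B s) \<omega>)"
        using BM[OF s] by (intro integrable_mult_right integrable_real_indicator) (auto simp: emeasure_eq_measure)
      show "integrable M (\<lambda>\<omega>. (Z \<omega>)\<^sup>2)" by (rule L2_square[OF ZL])
      fix \<omega>
      have "\<omega> \<in> B s \<Longrightarrow> c\<^sup>2 \<le> (S s \<omega>)\<^sup>2"
        using c by (auto simp: B_def abs_le_square_iff[symmetric])
      then show "c\<^sup>2 * indicator (B s) \<omega> \<le> (Z \<omega>)\<^sup>2" by (auto simp: Z_def indicator_def)
    qed
    \<comment> \<open>The martingale identity makes the two expectations equal. On
      \<open>B s\<close> the new integrand is \<open>(S T \<omega>)\<^sup>2 - (S T \<omega> - S s
      \<omega>)\<^sup>2\<close>, which is at most the first square.\<close>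
    also have "expectation (\<lambda>\<omega>. (Z \<omega>)\<^sup>2) = expectation (\<lambda>\<omega>. 2 * (S T \<omega> * Z \<omega>) - (Z \<omega>)\<^sup>2)"
      using L2_mult[OF ST ZL] L2_square[OF ZL] m by simp
    also have "\<dots> \<le> expectation (\<lambda>\<omega>. indicator (B s) \<omega> * (S T \<omega>)\<^sup>2)"
    proof (rule integral_mono[OF _ i])
      show "integrable M (\<lambda>\<omega>. 2 * (S T \<omega> * Z \<omega>) - (Z \<omega>)\<^sup>2)"
        using L2_mult[OF ST ZL] L2_square[OF ZL] by simp
      fix \<omega>
      have "0 \<le> (S T \<omega> - S s \<omega>)\<^sup>2" by simp
      then show "2 * (S T \<omega> * Z \<omega>) - (Z \<omega>)\<^sup>2 \<le> indicator (B s) \<omega> * (S T \<omega>)\<^sup>2"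
        by (auto simp: Z_def indicator_def power2_diff)
    qed
    finally show ?thesis .
  qed
  have "prob {\<omega>\<in>space M. \<exists>s\<in>A. c \<le> \<bar>S s \<omega>\<bar>} * c\<^sup>2 = (\<Sum>s\<in>A. c\<^sup>2 * prob (B s))"
    unfolding union using BM A(1) disj
    by (subst finite_measure_finite_Union) (auto simp: sum_distrib_left mult.commute)
  also have "\<dots> \<le> (\<Sum>s\<in>A. expectation (\<lambda>\<omega>. indicator (B s) \<omega> * (S T \<omega>)\<^sup>2))"
    by (intro sum_mono part)
  also have "\<dots> = expectation (\<lambda>\<omega>. (\<Sum>s\<in>A. indicator (B s) \<omega> * (S T \<omega>)\<^sup>2))"
    using integrable_real_mult_indicator[OF BM L2_square[OF ST]]
    by (subst Bochner_Integration.integral_sum) (auto simp: mult.commute)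
  also have "\<dots> \<le> expectation (\<lambda>\<omega>. (S T \<omega>)\<^sup>2)"
  proof (rule integral_mono[OF _ L2_square[OF ST]])
    show "integrable M (\<lambda>\<omega>. \<Sum>s\<in>A. indicator (B s) \<omega> * (S T \<omega>)\<^sup>2)"
      using integrable_real_mult_indicator[OF BM L2_square[OF ST]]
      by (intro Bochner_Integration.integrable_sum) (auto simp: mult.commute)
    fix \<omega>
    have "(\<Sum>s\<in>A. indicator (B s) \<omega> * (S T \<omega>)\<^sup>2) = indicator (\<Union>s\<in>A. B s) \<omega> * (S T \<omega>)\<^sup>2"
      unfolding sum_distrib_right[symmetric] by (subst indicator_UN_disjoint[OF A(1) disj]) simp
    also have "\<dots> \<le> (S T \<omega>)\<^sup>2" by (auto simp: indicator_def)
    finally show "(\<Sum>s\<in>A. indicator (B s) \<omega> * (S T \<omega>)\<^sup>2) \<le> (S T \<omega>)\<^sup>2" .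
  qed
  finally show "prob {\<omega>\<in>space M. \<exists>s\<in>A. c \<le> \<bar>S s \<omega>\<bar>} * c\<^sup>2 \<le> expectation (\<lambda>\<omega>. (S T \<omega>)\<^sup>2)" .
qed

end

context lipschitz_sde
begin

lemma grid_refine: "i \<le> 2 ^ m \<Longrightarrow> grid m i = grid (Suc m) (2 * i)"
  by (simp add: grid_def step_def)

text \<open>Dyadic grids are nested, so the bad events increase, and the probability of their union
  keeps the bound. Off the union a continuous path is bounded at all grid times, which are
  dense.\<close>

lemma maximal_inequality_path:
  assumes c: "0 < c" and S: "\<And>s. s \<in> {t..T} \<Longrightarrow> L2_at s (S s)"
    and mart: "\<And>s Z. s \<in> {t..T} \<Longrightarrow> L2_at s Z \<Longrightarrow> expectation (\<lambda>\<omega>. S T \<omega> * Z \<omega>) = expectation (\<lambda>\<omega>. S s \<omega> * Z \<omega>)"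
  obtains B where "B \<in> events" "prob B * c\<^sup>2 \<le> expectation (\<lambda>\<omega>. (S T \<omega>)\<^sup>2)"
    "\<And>\<omega> s. \<omega> \<in> space M - B \<Longrightarrow> continuous_on {t..T} (\<lambda>s. S s \<omega>) \<Longrightarrow> s \<in> {t..T} \<Longrightarrow> \<bar>S s \<omega>\<bar> \<le> c"
proof -
  define A where "A = (\<lambda>m. grid m ` {..2 ^ m})"
  define B where "B = (\<lambda>m. {\<omega>\<in>space M. \<exists>s\<in>A m. c \<le> \<bar>S s \<omega>\<bar>})"
  have A: "finite (A m)" "A m \<subseteq> {t..T}" for m using grid_bounds[of _ m] by (auto simp: A_def)
  have mi: "{\<omega>\<in>space M. \<exists>s\<in>A m. c \<le> \<bar>S s \<omega>\<bar>} \<in> events"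
    "prob {\<omega>\<in>space M. \<exists>s\<in>A m. c \<le> \<bar>S s \<omega>\<bar>} * c\<^sup>2 \<le> expectation (\<lambda>\<omega>. (S T \<omega>)\<^sup>2)" for m
    by (rule maximal_inequality(1)[OF A t c S mart], assumption+)
      (rule maximal_inequality(2)[OF A t c S mart])
  have inc: "incseq B"
  proof (rule incseq_SucI)
    fix m
    have "A m \<subseteq> A (Suc m)"
    proof
      fix s assume "s \<in> A m"
      then obtain i where i: "i \<le> 2 ^ m" "s = grid m i" by (auto simp: A_def)
      have "grid (Suc m) (2 * i) \<in> grid (Suc m) ` {..2 ^ Suc m}" by (rule imageI) (use i in simp)
      then show "s \<in> A (Suc m)" using grid_refine[OF i(1)] i(2) by (simp only: A_def)
    qed
    then show "B m \<subseteq> B (Suc m)" by (auto simp: B_def)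
  qed
  have Be: "B m \<in> events" for m unfolding B_def by (rule mi(1))
  have "(\<lambda>m. prob (B m)) \<longlonglongrightarrow> prob (\<Union>m. B m)"
    using inc Be by (intro finite_Lim_measure_incseq) auto
  then have "(\<lambda>m. prob (B m) * c\<^sup>2) \<longlonglongrightarrow> prob (\<Union>m. B m) * c\<^sup>2" by (intro tendsto_intros)
  then have "prob (\<Union>m. B m) * c\<^sup>2 \<le> expectation (\<lambda>\<omega>. (S T \<omega>)\<^sup>2)"
    by (rule LIMSEQ_le_const2) (use mi(2) in \<open>simp add: B_def\<close>)
  moreover have "\<bar>S s \<omega>\<bar> \<le> c" if \<omega>: "\<omega> \<in> space M - (\<Union>m. B m)" and cont: "continuous_on {t..T} (\<lambda>s. S s \<omega>)" and s: "s \<in> {t..T}" for \<omega> s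
  proof -
    have "\<forall>m. \<exists>i. i < 2 ^ m \<and> grid m i \<le> s \<and> s \<le> grid m (Suc i)"
    proof
      fix m
      show "\<exists>i. i < 2 ^ m \<and> grid m i \<le> s \<and> s \<le> grid m (Suc i)"
        by (rule grid_cell_closed[of s m]) (use s in auto)
    qed
    from choice[OF this] obtain i where i: "\<And>m. i m < 2 ^ m" "\<And>m. grid m (i m) \<le> s" "\<And>m. s \<le> grid m (Suc (i m))" by blast
    have g: "grid m (i m) \<in> {t..T}" for m using grid_bounds[of "i m" m] i(1)[of m] by simp
    have "(\<lambda>m. grid m (i m)) \<longlonglongrightarrow> s"
    proof (rule tendsto_sandwich[OF _ _ _ tendsto_const])
      show "\<forall>\<^sub>F m in sequentially. s - step m \<le> grid m (i m)"
      proof (intro always_eventually allI)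
        show "s - step m \<le> grid m (i m)" for m using i(3)[of m] grid_Suc[of m "i m"] by linarith
      qed
      show "(\<lambda>m. s - step m) \<longlonglongrightarrow> s" using tendsto_diff[OF tendsto_const step_tendsto, of s] by simp
    qed (use i(2) in simp)
    then have "(\<lambda>m. S (grid m (i m)) \<omega>) \<longlonglongrightarrow> S s \<omega>"
      by (rule continuous_on_tendsto_compose[OF cont _ s]) (intro always_eventually allI g)
    then have "(\<lambda>m. \<bar>S (grid m (i m)) \<omega>\<bar>) \<longlonglongrightarrow> \<bar>S s \<omega>\<bar>" by (rule tendsto_rabs)
    moreover have "\<bar>S (grid m (i m)) \<omega>\<bar> \<le> c" for m
    proof -
      have "\<omega> \<notin> B m" using \<omega> by auto
      moreover have "grid m (i m) \<in> A m" using i(1)[of m] by (auto simp: A_def)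
      ultimately have "\<not> c \<le> \<bar>S (grid m (i m)) \<omega>\<bar>" using \<omega> by (auto simp: B_def)
      then show ?thesis by simp
    qed
    ultimately show ?thesis by (intro LIMSEQ_le_const2) auto
  qed
  moreover have "(\<Union>m. B m) \<in> events" using Be by auto
  ultimately show ?thesis by (rule that[rotated])
qed

text \<open>Both sides are compared with the unstopped integral over the whole grid, whose
  expectation against \<open>Z\<close> survives stopping at \<open>s\<close> as well as at
  \<open>T\<close>.\<close>

lemma noise_martingale:
  assumes s: "s \<in> {t..T}" and Z: "L2_at s Z"
  shows "expectation (\<lambda>\<omega>. noise k T \<omega> * Z \<omega>) = expectation (\<lambda>\<omega>. noise k s \<omega> * Z \<omega>)"
proof -
  have "L2_at T Z" using s by (intro L2_at_mono[OF Z]) auto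
  then have "expectation (\<lambda>\<omega>. noise k T \<omega> * Z \<omega>) =
     expectation (\<lambda>\<omega>. elem_integral {..<2 ^ k} (grid k) (\<lambda>i. grid k (Suc i)) (g_euler k) \<omega> * Z \<omega>)"
    unfolding noise_def using elementary_stop(3)[OF elementary_g t(2) order_refl] by simp
  then show ?thesis
    unfolding noise_def using elementary_stop(3)[OF elementary_g _ _ Z] s by simp
qed

lemma continuous_on_W_min:
  assumes "continuous_on {0..T} (\<lambda>s. W s \<omega>)" "0 \<le> u"
  shows "continuous_on {t..T} (\<lambda>s. W (min u s) \<omega>)"
proof -
  have "continuous_on {t..T} ((\<lambda>s. W s \<omega>) \<circ> (\<lambda>s. min u s))"
    by (rule continuous_on_compose)
       (use assms t in \<open>auto intro!: continuous_intros continuous_on_subset[OF assms(1)]\<close>)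
  then show ?thesis by (simp add: comp_def)
qed

lemma continuous_on_paths:
  assumes W: "continuous_on {0..T} (\<lambda>s. W s \<omega>)"
  shows "continuous_on {t..T} (\<lambda>s. noise k s \<omega>)" "continuous_on {t..T} (\<lambda>s. euler_path k s \<omega>)"
proof -
  have g: "0 \<le> grid k i" for i using grid_mono[of 0 i k] t by (simp add: grid_0)
  show "continuous_on {t..T} (\<lambda>s. noise k s \<omega>)"
    unfolding noise_sum by (intro continuous_intros continuous_on_W_min[OF W g])
  show "continuous_on {t..T} (\<lambda>s. euler_path k s \<omega>)"
    unfolding euler_path_def by (intro continuous_intros continuous_on_W_min[OF W g])
qed

text \<open>The difference of consecutive paths consists of a drift part, dominated at all times by
  one random variable to which Chebyshev's inequality applies, and a martingale part, handled by the
  maximal inequality.\<close>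

lemma euler_path_close:
  obtains B where "B \<in> events" "prob B \<le> 2 * (T - t + 1) * (freeze_const * (step k + step (Suc k))) / ((4 / 5) ^ k)\<^sup>2"
    "\<And>\<omega> s. \<omega> \<in> space M - B \<Longrightarrow> continuous_on {0..T} (\<lambda>s. W s \<omega>) \<Longrightarrow> s \<in> {t..T} \<Longrightarrow>
      \<bar>euler_path (Suc k) s \<omega> - euler_path k s \<omega>\<bar> \<le> 2 * (4 / 5) ^ k"
proof -
  \<comment> \<open>Any ratio strictly between \<open>sqrt (1 / 2)\<close> and 1 serves: the
    thresholds are summable, and the exceptional probabilities are of order
    \<open>(1 / 2) ^ k / ((4 / 5) ^ k)\<^sup>2 = (25 / 32) ^ k\<close>, summable as well.\<close>
  define c :: real where "c = (4 / 5) ^ k"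
  define q where "q = freeze_const * (step k + step (Suc k))"
  have c: "0 < c" by (simp add: c_def)
  have q: "0 \<le> q" using freeze_const_nonneg step_nonneg by (simp add: q_def)
  define f where "f = (\<lambda>p. freeze (Suc k) (b_euler (Suc k)) p - freeze k (b_euler k) p)"
  have fL: "L2 N (freeze k (b_euler k))" for k unfolding freeze_def by (rule elem_process_L2[OF elementary_b])
  have f: "L2 N f" unfolding f_def by (intro L2_diff fL)
  have f2: "(\<integral>p. (f p)\<^sup>2 \<partial>N) \<le> q"
    using freeze_gap_const(1)[of "Suc k" k] by (simp add: f_def q_def add.commute)
  have f0: "f (\<omega>, r) = 0" if "r \<notin> {t..T}" for \<omega> r
    using that freeze_outside[of r] by (simp add: f_def)
  have af: "L2 N (\<lambda>p. \<bar>f p\<bar>)" using f by (auto simp: L2_def)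
  \<comment> \<open>With the absolute value inside, the integral over the whole interval dominates
    the running integrals at all times simultaneously.\<close>
  define V where "V = (\<lambda>\<omega>. \<integral>r. indicator {..T} r * \<bar>f (\<omega>, r)\<bar> \<partial>lborel)"
  have VL: "L2 M V" unfolding V_def using time_integral_bound(1)[OF af _ t(2), of T] f0 by simp
  have V2: "expectation (\<lambda>\<omega>. (V \<omega>)\<^sup>2) \<le> (T - t) * q"
  proof -
    have "expectation (\<lambda>\<omega>. (V \<omega>)\<^sup>2) \<le> (T - t) * (\<integral>p. indicator {..T} (snd p) * \<bar>f p\<bar>\<^sup>2 \<partial>N)"
      unfolding V_def using time_integral_bound(2)[OF af _ t(2), of T] f0 by simp
    also have "(\<integral>p. indicator {..T} (snd p) * \<bar>f p\<bar>\<^sup>2 \<partial>N) = (\<integral>p. (f p)\<^sup>2 \<partial>N)"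
    proof (intro Bochner_Integration.integral_cong refl)
      fix p :: "'a \<times> real"
      show "indicator {..T} (snd p) * \<bar>f p\<bar>\<^sup>2 = (f p)\<^sup>2" using f0[of "snd p" "fst p"] by (cases "snd p \<le> T") auto
    qed
    also have "(T - t) * \<dots> \<le> (T - t) * q" using t f2 by (intro mult_left_mono) auto
    finally show ?thesis .
  qed
  define BV where "BV = {\<omega>\<in>space M. c \<le> \<bar>V \<omega>\<bar>}"
  have BV: "BV \<in> events" using L2_measurable[OF VL] unfolding BV_def by measurable
  have PV: "prob BV * c\<^sup>2 \<le> (T - t) * q"
  proof -
    have "prob BV * c\<^sup>2 = expectation (\<lambda>\<omega>. c\<^sup>2 * indicator BV \<omega>)" using BV by simp
    also have "\<dots> \<le> expectation (\<lambda>\<omega>. (V \<omega>)\<^sup>2)"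
    proof (rule integral_mono)
      show "integrable M (\<lambda>\<omega>. c\<^sup>2 * indicator BV \<omega>)"
        using BV by (intro integrable_mult_right integrable_real_indicator) (auto simp: emeasure_eq_measure)
      show "integrable M (\<lambda>\<omega>. (V \<omega>)\<^sup>2)" by (rule L2_square[OF VL])
      show "c\<^sup>2 * indicator BV \<omega> \<le> (V \<omega>)\<^sup>2" for \<omega>
        using c by (auto simp: BV_def indicator_def abs_le_square_iff[symmetric])
    qed
    finally show ?thesis using V2 by linarith
  qed
  define S where "S = (\<lambda>s \<omega>. noise (Suc k) s \<omega> - noise k s \<omega>)"
  have S: "L2_at s (S s)" if "s \<in> {t..T}" for s
    unfolding S_def using L2_at_add[OF noise_isometry(1) L2_at_minus[OF noise_isometry(1)]] that by simp
  have mart: "expectation (\<lambda>\<omega>. S T \<omega> * Z \<omega>) = expectation (\<lambda>\<omega>. S s \<omega> * Z \<omega>)" if s: "s \<in> {t..T}" and Z: "L2_at s Z" for s Z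
  proof -
    have i: "integrable M (\<lambda>\<omega>. noise k r \<omega> * Z \<omega>)" if "r \<in> {t..T}" for k r
      using that by (intro L2_mult L2_at_L2[OF noise_isometry(1)] L2_at_L2[OF Z]) auto
    show ?thesis using noise_martingale[OF s Z] i s t by (simp add: S_def left_diff_distrib)
  qed
  obtain B where B: "B \<in> events" "prob B * c\<^sup>2 \<le> expectation (\<lambda>\<omega>. (S T \<omega>)\<^sup>2)"
    "\<And>\<omega> s. \<omega> \<in> space M - B \<Longrightarrow> continuous_on {t..T} (\<lambda>s. S s \<omega>) \<Longrightarrow> s \<in> {t..T} \<Longrightarrow> \<bar>S s \<omega>\<bar> \<le> c"
    using maximal_inequality_path[OF c S mart] by blast
  have S2: "expectation (\<lambda>\<omega>. (S T \<omega>)\<^sup>2) \<le> q"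
  proof -
    have "expectation (\<lambda>\<omega>. (S T \<omega>)\<^sup>2) = (\<integral>p. indicator {..T} (snd p) * (freeze (Suc k) (g_euler (Suc k)) p - freeze k (g_euler k) p)\<^sup>2 \<partial>N)"
      unfolding S_def by (rule noise_isometry(2)[OF t(2) order_refl])
    also have "\<dots> = (\<integral>p. (freeze (Suc k) (g_euler (Suc k)) p - freeze k (g_euler k) p)\<^sup>2 \<partial>N)"
    proof (intro Bochner_Integration.integral_cong refl)
      fix p :: "'a \<times> real"
      show "indicator {..T} (snd p) * (freeze (Suc k) (g_euler (Suc k)) p - freeze k (g_euler k) p)\<^sup>2 = (freeze (Suc k) (g_euler (Suc k)) p - freeze k (g_euler k) p)\<^sup>2"
        using freeze_outside[of "snd p" _ _ "fst p"] by (cases "snd p \<le> T") auto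
    qed
    also have "\<dots> \<le> q" using freeze_gap_const(2)[of "Suc k" k] by (simp add: q_def add.commute)
    finally show ?thesis .
  qed
  show ?thesis
  proof (rule that[of "B \<union> BV"])
    show "B \<union> BV \<in> events" using B BV by auto
    have "prob (B \<union> BV) * c\<^sup>2 \<le> (prob B + prob BV) * c\<^sup>2"
      using B BV by (intro mult_right_mono measure_Un_le) auto
    also have "\<dots> \<le> (T - t + 1) * q" using B(2) S2 PV by (simp add: algebra_simps)
    also have "\<dots> \<le> 2 * (T - t + 1) * q" using t q by (intro mult_right_mono) auto
    finally show "prob (B \<union> BV) \<le> 2 * (T - t + 1) * (freeze_const * (step k + step (Suc k))) / ((4 / 5) ^ k)\<^sup>2"
      using c by (simp add: q_def c_def pos_le_divide_eq)
    fix \<omega> s assume \<omega>: "\<omega> \<in> space M - (B \<union> BV)" and W: "continuous_on {0..T} (\<lambda>s. W s \<omega>)" and s: "s \<in> {t..T}"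
    have "\<bar>S s \<omega>\<bar> \<le> c"
      using \<omega> s by (intro B(3)) (auto simp: S_def intro!: continuous_intros continuous_on_paths[OF W])
    moreover have "\<bar>V \<omega>\<bar> \<le> c" using \<omega> by (auto simp: BV_def)
    moreover have fi: "integrable lborel (\<lambda>r. indicator {..v} r * freeze k \<xi> (\<omega>, r))" for v k \<xi>
      by (rule integrable_freeze)
    have "\<bar>\<integral>r. indicator {..s} r * f (\<omega>, r) \<partial>lborel\<bar> \<le> V \<omega>"
    proof -
      have i: "integrable lborel (\<lambda>r. indicator {..v} r * f (\<omega>, r))" for v
        unfolding f_def right_diff_distrib by (intro Bochner_Integration.integrable_diff fi)
      have "\<bar>\<integral>r. indicator {..s} r * f (\<omega>, r) \<partial>lborel\<bar> \<le> (\<integral>r. \<bar>indicator {..s} r * f (\<omega>, r)\<bar> \<partial>lborel)"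
        by (rule integral_abs_bound)
      also have "\<dots> \<le> V \<omega>"
        unfolding V_def
        by (rule integral_mono[OF integrable_abs[OF i]])
           (use integrable_abs[OF i[of T]] s in \<open>auto simp: abs_mult indicator_def\<close>)
      finally show ?thesis .
    qed
    moreover have "euler_path (Suc k) s \<omega> - euler_path k s \<omega> = (\<integral>r. indicator {..s} r * f (\<omega>, r) \<partial>lborel) + S s \<omega>"
      unfolding euler_path_eq f_def S_def right_diff_distrib
      by (subst Bochner_Integration.integral_diff[OF fi fi]) simp
    ultimately show "\<bar>euler_path (Suc k) s \<omega> - euler_path k s \<omega>\<bar> \<le> 2 * (4 / 5) ^ k"
      by (simp add: c_def)
  qed
qed

text \<open>By Borel-Cantelli, almost every outcome lies in finitely many exceptional events. From
  then on the increments are dominated by a geometric series, and Weierstrass's criterion gives a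
  uniform, hence continuous, limit.\<close>

lemma euler_path_uniform:
  "AE \<omega> in M. continuous_on {t..T} (\<lambda>s. lim (\<lambda>k. euler_path k s \<omega>)) \<and>
    (\<forall>s\<in>{t..T}. (\<lambda>k. euler_path k s \<omega>) \<longlonglongrightarrow> lim (\<lambda>k. euler_path k s \<omega>))"
proof -
  define a where "a = (\<lambda>k. 2 * (T - t + 1) * (freeze_const * (step k + step (Suc k))) / ((4 / 5) ^ k)\<^sup>2)"
  have "\<exists>B. B \<in> events \<and> prob B \<le> a k \<and> (\<forall>\<omega> s. \<omega> \<in> space M - B \<longrightarrow> continuous_on {0..T} (\<lambda>s. W s \<omega>) \<longrightarrow> s \<in> {t..T} \<longrightarrow>
      \<bar>euler_path (Suc k) s \<omega> - euler_path k s \<omega>\<bar> \<le> 2 * (4 / 5) ^ k)" for k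
    using euler_path_close[of k] unfolding a_def by metis
  then obtain B where B: "\<And>k. B k \<in> events" "\<And>k. prob (B k) \<le> a k"
    "\<And>k \<omega> s. \<omega> \<in> space M - B k \<Longrightarrow> continuous_on {0..T} (\<lambda>s. W s \<omega>) \<Longrightarrow> s \<in> {t..T} \<Longrightarrow>
      \<bar>euler_path (Suc k) s \<omega> - euler_path k s \<omega>\<bar> \<le> 2 * (4 / 5) ^ k" by metis
  have ak: "a k = (3 * (T - t + 1) * (freeze_const * (T - t))) * (25 / 32) ^ k" for k
  proof -
    have "(25 / 32 :: real) ^ k = (1 / 2) ^ k / ((4 / 5) ^ k)\<^sup>2"
      by (simp add: power2_eq_square power_mult_distrib[symmetric] power_divide[symmetric])
    moreover have e: "step k + step (Suc k) = 3 / 2 * (T - t) * (1 / 2) ^ k"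
      by (simp add: step_def power_one_over field_simps)
    moreover have "2 * A * (f * (3 / 2 * D * p)) / c = (3 * A * (f * D)) * (p / c)" for A f D p c :: real
      by simp
    ultimately show ?thesis unfolding a_def by (simp only:)
  qed
  have "summable a" unfolding ak[abs_def] by (intro summable_mult summable_geometric) simp
  then have "summable (\<lambda>k. prob (B k))"
    by (rule summable_comparison_test') (use B(2) in auto)
  then have "AE \<omega> in M. eventually (\<lambda>k. \<omega> \<in> space M - B k) sequentially"
    using B(1) by (intro borel_cantelli_AE1) (auto simp: emeasure_eq_measure)
  then show ?thesis
    using continuous_W
  proof eventually_elim
    case (elim \<omega>)
    have "eventually (\<lambda>k. \<forall>s\<in>{t..T}. norm (euler_path (Suc k) s \<omega> - euler_path k s \<omega>) \<le> 2 * (4 / 5) ^ k) sequentially"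
      using elim(1) by eventually_elim (use B(3) elim(2) in auto)
    from Weierstrass_m_test_ev[OF this]
    have "uniform_limit {t..T} (\<lambda>n s. \<Sum>k<n. euler_path (Suc k) s \<omega> - euler_path k s \<omega>)
        (\<lambda>s. \<Sum>k. euler_path (Suc k) s \<omega> - euler_path k s \<omega>) sequentially"
      by (simp add: summable_mult summable_geometric)
    then have u: "uniform_limit {t..T} (\<lambda>n s. euler_path n s \<omega> - euler_path 0 s \<omega>)
        (\<lambda>s. \<Sum>k. euler_path (Suc k) s \<omega> - euler_path k s \<omega>) sequentially" (is "uniform_limit _ _ ?S _")
      by (simp only: sum_lessThan_telescope[of "\<lambda>k. euler_path k _ \<omega>"])
    have lim: "(\<lambda>k. euler_path k s \<omega>) \<longlonglongrightarrow> ?S s + euler_path 0 s \<omega>" if "s \<in> {t..T}" for s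
      using tendsto_add[OF tendsto_uniform_limitI[OF u that] tendsto_const[of "euler_path 0 s \<omega>"]] by simp
    have "continuous_on {t..T} ?S"
      by (rule uniform_limit_theorem[OF _ u])
         (auto intro!: always_eventually continuous_intros continuous_on_paths[OF elim(2)])
    then have "continuous_on {t..T} (\<lambda>s. ?S s + euler_path 0 s \<omega>)"
      by (intro continuous_intros continuous_on_paths[OF elim(2)])
    moreover have "lim (\<lambda>k. euler_path k s \<omega>) = ?S s + euler_path 0 s \<omega>" if "s \<in> {t..T}" for s
      using lim[OF that] by (rule limI)
    ultimately have "continuous_on {t..T} (\<lambda>s. lim (\<lambda>k. euler_path k s \<omega>))"
      using continuous_on_cong[OF refl, of "{t..T}" "\<lambda>s. lim (\<lambda>k. euler_path k s \<omega>)" "\<lambda>s. ?S s + euler_path 0 s \<omega>"] by simp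
    moreover have "(\<lambda>k. euler_path k s \<omega>) \<longlonglongrightarrow> lim (\<lambda>k. euler_path k s \<omega>)" if "s \<in> {t..T}" for s
      using lim[OF that] limI[OF lim[OF that]] by simp
    ultimately show ?case by blast
  qed
qed

end

section \<open>The limit of the Euler paths as a solution of the equation\<close>

context brownian_motion
begin

text \<open>The way back to \<open>simple_integrand\<close>, which demands bounded coefficients:
  truncation at level \<open>n\<close> converges by domination, and a late enough level is within
  \<open>e\<close>.\<close>

lemma elementary_truncate:
  assumes el: "elementary t v I s u \<xi>" and e: "0 < e"
  obtains \<zeta> C where "elementary t v I s u \<zeta>" "\<And>i \<omega>. \<bar>\<zeta> i \<omega>\<bar> \<le> C"
    "(\<integral>p. (elem_process I s u \<xi> p - elem_process I s u \<zeta> p)\<^sup>2 \<partial>N) < e"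
proof -
  define \<zeta> where "\<zeta> = (\<lambda>n i \<omega>. max (- real n) (min (real n) (\<xi> i \<omega>)))"
  have le: "\<bar>\<zeta> n i \<omega>\<bar> \<le> \<bar>\<xi> i \<omega>\<bar>" for n i \<omega> by (auto simp: \<zeta>_def)
  have el': "elementary t v I s u (\<zeta> n)" for n
    unfolding elementary_def
  proof (intro conjI ballI)
    fix i assume i: "i \<in> I"
    have \<xi>: "L2_at (s i) (\<xi> i)" using el i by (simp add: elementary_def)
    have "\<zeta> n i \<in> borel_measurable A" if "\<xi> i \<in> borel_measurable A" for A
      unfolding \<zeta>_def using that by measurable
    then show "L2_at (s i) (\<zeta> n i)"
      using \<xi> L2_bound[of M "\<xi> i" "\<zeta> n i"] le by (auto simp: L2_at_def L2_measurable)
  qed (use el in \<open>auto simp: elementary_def\<close>)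
  have abs: "elementary t v I s u (\<lambda>i \<omega>. \<bar>\<xi> i \<omega>\<bar>)"
    using el by (auto simp: elementary_def L2_at_def L2_def)
  \<comment> \<open>Built from the absolute values of \<xi>, it dominates the processes of \<xi> and
    of all its truncations, so \<open>4 * (R p)\<^sup>2\<close> dominates the squared
    differences.\<close>
  define R where "R = elem_process I s u (\<lambda>i \<omega>. \<bar>\<xi> i \<omega>\<bar>)"
  have R: "L2 N R" unfolding R_def by (rule elem_process_L2[OF abs])
  have "(\<lambda>n. \<integral>p. (elem_process I s u \<xi> p - elem_process I s u (\<zeta> n) p)\<^sup>2 \<partial>N) \<longlonglongrightarrow> (\<integral>p. 0 \<partial>N)"
  proof (rule integral_dominated_convergence[where w="\<lambda>p. 4 * (R p)\<^sup>2"])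
    show "(\<lambda>p. (elem_process I s u \<xi> p - elem_process I s u (\<zeta> n) p)\<^sup>2) \<in> borel_measurable N" for n
      by (intro borel_measurable_power borel_measurable_diff
          L2_measurable[OF elem_process_L2[OF el]] L2_measurable[OF elem_process_L2[OF el']])
    show "integrable N (\<lambda>p. 4 * (R p)\<^sup>2)" using L2_square[OF R] by simp
    show "AE p in N. (\<lambda>n. (elem_process I s u \<xi> p - elem_process I s u (\<zeta> n) p)\<^sup>2) \<longlonglongrightarrow> 0"
    proof (rule AE_I2)
      fix p :: "'a \<times> real"
      have "(\<lambda>n. \<zeta> n i \<omega>) \<longlonglongrightarrow> \<xi> i \<omega>" for i \<omega>
      proof (rule tendsto_eventually)
        obtain m :: nat where m: "\<bar>\<xi> i \<omega>\<bar> \<le> real m" using real_arch_simple by blast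
        have "\<zeta> n i \<omega> = \<xi> i \<omega>" if "n \<ge> m" for n
          using m that by (auto simp: \<zeta>_def min_def max_def)
        then show "\<forall>\<^sub>F n in sequentially. \<zeta> n i \<omega> = \<xi> i \<omega>" by (auto simp: eventually_sequentially)
      qed
      then have "(\<lambda>n. elem_process I s u (\<zeta> n) p) \<longlonglongrightarrow> elem_process I s u \<xi> p"
        unfolding elem_process_def by (intro tendsto_sum tendsto_mult tendsto_const)
      from tendsto_power[OF tendsto_diff[OF tendsto_const this], of "elem_process I s u \<xi> p" 2]
      show "(\<lambda>n. (elem_process I s u \<xi> p - elem_process I s u (\<zeta> n) p)\<^sup>2) \<longlonglongrightarrow> 0" by simp
    qed
    show "AE p in N. norm ((elem_process I s u \<xi> p - elem_process I s u (\<zeta> n) p)\<^sup>2) \<le> 4 * (R p)\<^sup>2" for n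
    proof (rule AE_I2)
      fix p :: "'a \<times> real"
      have "\<bar>elem_process I s u \<xi> p\<bar> \<le> R p"
        unfolding elem_process_def R_def by (intro order.trans[OF sum_abs] sum_mono) (simp add: abs_mult)
      moreover have "\<bar>elem_process I s u (\<zeta> n) p\<bar> \<le> R p"
        unfolding elem_process_def R_def
        by (intro order.trans[OF sum_abs] sum_mono) (simp add: abs_mult mult_right_mono le)
      ultimately have "\<bar>elem_process I s u \<xi> p - elem_process I s u (\<zeta> n) p\<bar> \<le> \<bar>2 * R p\<bar>" by linarith
      then have "(elem_process I s u \<xi> p - elem_process I s u (\<zeta> n) p)\<^sup>2 \<le> (2 * R p)\<^sup>2"
        by (simp only: abs_le_square_iff)
      then show "norm ((elem_process I s u \<xi> p - elem_process I s u (\<zeta> n) p)\<^sup>2) \<le> 4 * (R p)\<^sup>2"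
        by (simp add: power_mult_distrib)
    qed
  qed simp
  then have "(\<lambda>n. \<integral>p. (elem_process I s u \<xi> p - elem_process I s u (\<zeta> n) p)\<^sup>2 \<partial>N) \<longlonglongrightarrow> 0" by simp
  from order_tendstoD(2)[OF this e]
  obtain n where n: "(\<integral>p. (elem_process I s u \<xi> p - elem_process I s u (\<zeta> n) p)\<^sup>2 \<partial>N) < e"
    by (auto simp: eventually_sequentially)
  show ?thesis by (rule that[OF el' _ n, of "real n"]) (auto simp: \<zeta>_def)
qed

text \<open>Turns mean-square convergence on the product space into the iterated nonnegative
  integrals that \<open>has_Ito_integral\<close> is stated with.\<close>

lemma nn_iterated_zeroI:
  assumes L: "\<And>k. L2 N (f k)" and lim: "(\<lambda>k. \<integral>p. (f k p)\<^sup>2 \<partial>N) \<longlonglongrightarrow> 0"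
    and eq: "\<And>k \<omega>. \<omega> \<in> space M \<Longrightarrow> (\<integral>\<^sup>+r. G k \<omega> r \<partial>lborel) = (\<integral>\<^sup>+r. ennreal ((f k (\<omega>, r))\<^sup>2) \<partial>lborel)"
  shows "(\<lambda>k. \<integral>\<^sup>+\<omega>. (\<integral>\<^sup>+r. G k \<omega> r \<partial>lborel) \<partial>M) \<longlonglongrightarrow> 0"
proof -
  have "(\<integral>\<^sup>+\<omega>. (\<integral>\<^sup>+r. G k \<omega> r \<partial>lborel) \<partial>M) = ennreal (\<integral>p. (f k p)\<^sup>2 \<partial>N)" for k
  proof -
    have "(\<integral>\<^sup>+\<omega>. (\<integral>\<^sup>+r. G k \<omega> r \<partial>lborel) \<partial>M) = (\<integral>\<^sup>+\<omega>. \<integral>\<^sup>+r. ennreal ((f k (\<omega>, r))\<^sup>2) \<partial>lborel \<partial>M)"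
      by (intro nn_integral_cong eq)
    also have "\<dots> = (\<integral>\<^sup>+p. ennreal ((f k p)\<^sup>2) \<partial>N)"
      using L2_measurable[OF L] by (subst nn_integral_N) auto
    finally show ?thesis by (simp add: L2_nn_integral[OF L])
  qed
  then show ?thesis using tendsto_ennrealI[OF lim] by simp
qed

end

text \<open>Continuity is required of every path, as in \<open>wealth_process\<close>. Convergence
  is required almost surely at each fixed time, which is the form that Fatou's lemma uses.\<close>

locale sde_limit = lipschitz_sde +
  fixes X :: "real \<Rightarrow> 'a \<Rightarrow> real"
  assumes X_adapted: "\<And>s. s \<in> {t..T} \<Longrightarrow> X s \<in> borel_measurable (F s)"
    and X_continuous: "\<And>\<omega>. \<omega> \<in> space M \<Longrightarrow> continuous_on {t..T} (\<lambda>s. X s \<omega>)"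
    and X_limit: "\<And>s. s \<in> {t..T} \<Longrightarrow> AE \<omega> in M. (\<lambda>k. euler_path k s \<omega>) \<longlonglongrightarrow> X s \<omega>"

text \<open>On the exceptional null set the path is replaced by the constant \<open>x\<close>, which
  makes every path continuous. Null sets belong to \<open>F 0\<close>, so the modification stays
  adapted.\<close>

lemma (in lipschitz_sde) sde_limit_exists: "\<exists>X. sde_limit M F T W b g t x L X"
proof -
  from euler_path_uniform obtain N0 where N0: "{\<omega>\<in>space M. \<not> (continuous_on {t..T} (\<lambda>s. lim (\<lambda>k. euler_path k s \<omega>)) \<and>
    (\<forall>s\<in>{t..T}. (\<lambda>k. euler_path k s \<omega>) \<longlonglongrightarrow> lim (\<lambda>k. euler_path k s \<omega>)))} \<subseteq> N0" "emeasure M N0 = 0" "N0 \<in> sets M"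
    by (rule AE_E)
  have null: "N0 \<in> null_sets M" using N0 by auto
  define X where "X = (\<lambda>s \<omega>. if \<omega> \<in> N0 then x else lim (\<lambda>k. euler_path k s \<omega>))"
  have good: "continuous_on {t..T} (\<lambda>s. lim (\<lambda>k. euler_path k s \<omega>)) \<and>
    (\<forall>s\<in>{t..T}. (\<lambda>k. euler_path k s \<omega>) \<longlonglongrightarrow> lim (\<lambda>k. euler_path k s \<omega>))" if "\<omega> \<in> space M" "\<omega> \<notin> N0" for \<omega>
    using N0(1) that by blast
  have lim: "(\<lambda>k. euler_path k s \<omega>) \<longlonglongrightarrow> X s \<omega>" if "\<omega> \<in> space M" "\<omega> \<notin> N0" "s \<in> {t..T}" for \<omega> s
    using good[OF that(1,2)] that by (simp add: X_def)
  have cont: "continuous_on {t..T} (\<lambda>s. X s \<omega>)" if "\<omega> \<in> space M" for \<omega>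
    using good[OF that] by (cases "\<omega> \<in> N0") (simp_all add: X_def)
  have adapted: "X s \<in> borel_measurable (F s)" if s: "s \<in> {t..T}" for s
  proof (rule borel_measurable_LIMSEQ_real)
    have s': "0 \<le> s" "s \<le> T" using s t by auto
    have "N0 \<in> sets (F 0)" using null null_sets_F by auto
    then have N0F: "N0 \<in> sets (F s)" using mono_F[of 0 s] s' by auto
    show "(\<lambda>\<omega>. if \<omega> \<in> N0 then x else euler_path k s \<omega>) \<in> borel_measurable (F s)" for k
    proof (rule measurable_If_set)
      show "euler_path k s \<in> borel_measurable (F s)"
        using euler_path_L2_at[of s k] s by (simp add: L2_at_def)
      show "N0 \<inter> space (F s) \<in> sets (F s)" using N0F by auto
    qed simp
    fix \<omega> assume "\<omega> \<in> space (F s)"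
    then have "\<omega> \<in> space M" using space_F[OF s'] by simp
    then show "(\<lambda>k. if \<omega> \<in> N0 then x else euler_path k s \<omega>) \<longlonglongrightarrow> X s \<omega>"
      using lim[of \<omega> s] s by (cases "\<omega> \<in> N0") (auto simp: X_def)
  qed
  have "AE \<omega> in M. (\<lambda>k. euler_path k s \<omega>) \<longlonglongrightarrow> X s \<omega>" if "s \<in> {t..T}" for s
    using AE_not_in[OF null] AE_space by eventually_elim (use lim that in auto)
  with cont adapted have "sde_limit M F T W b g t x L X"
    by (intro sde_limit.intro lipschitz_sde_axioms sde_limit_axioms.intro)
  then show ?thesis by blast
qed

context lipschitz_sde
begin

lemma L2_at_lipschitz:
  assumes Z: "L2_at s Z"
    and lip: "\<And>s s' y y'. \<bar>f s y - f s' y'\<bar> \<le> L * (\<bar>s - s'\<bar> + \<bar>y - y' :: real\<bar>)"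
  shows "L2_at s (\<lambda>\<omega>. f r (Z \<omega>))"
proof -
  have m: "(\<lambda>\<omega>. f r (Z \<omega>)) \<in> borel_measurable A" if "Z \<in> borel_measurable A" for A
    by (rule measurable_compose[OF that lipschitz_measurable(2)[of f, OF lip]])
  have "L2 M (\<lambda>\<omega>. \<bar>f r 0\<bar> + L * \<bar>Z \<omega>\<bar>)"
    using Z by (intro L2_add L2_const L2_cmult) (auto simp: L2_at_def L2_def)
  then have "L2 M (\<lambda>\<omega>. f r (Z \<omega>))"
  proof (rule L2_bound)
    show "(\<lambda>\<omega>. f r (Z \<omega>)) \<in> borel_measurable M" using Z by (intro m) (auto simp: L2_at_def L2_def)
    have "\<bar>f r (Z \<omega>)\<bar> \<le> \<bar>\<bar>f r 0\<bar> + L * \<bar>Z \<omega>\<bar>\<bar>" for \<omega>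
      using lip[of r "Z \<omega>" r 0] by simp
    then show "AE \<omega> in M. \<bar>f r (Z \<omega>)\<bar> \<le> \<bar>\<bar>f r 0\<bar> + L * \<bar>Z \<omega>\<bar>\<bar>" by simp
  qed
  then show ?thesis using Z m by (simp add: L2_at_def)
qed

end

context sde_limit
begin

text \<open>Fatou's lemma along \<open>euler_path (k + l) s\<close> for growing \<open>l\<close>;
  the factor 2 comes from \<open>step (k + l) \<le> step k\<close>. Square-integrability of the
  limit is a by-product.\<close>

lemma X_L2_at: "s \<in> {t..T} \<Longrightarrow> L2_at s (X s)"
  and X_gap: "s \<in> {t..T} \<Longrightarrow> expectation (\<lambda>\<omega>. (euler_path k s \<omega> - X s \<omega>)\<^sup>2) \<le> 2 * gap_const * step k"
proof -
  have *: "L2 M (\<lambda>\<omega>. euler_path k s \<omega> - X s \<omega>)" "expectation (\<lambda>\<omega>. (euler_path k s \<omega> - X s \<omega>)\<^sup>2) \<le> 2 * gap_const * step k"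
    if s: "s \<in> {t..T}" for k s
  proof -
    have E: "L2 M (euler_path l s)" for l using euler_path_L2_at[of s l] s by (auto intro: L2_at_L2)
    have Xm: "X s \<in> borel_measurable M" using measurable_F_M[OF _ _ X_adapted[OF s]] s t by auto
    have le: "expectation (\<lambda>\<omega>. (euler_path k s \<omega> - euler_path (k + l) s \<omega>)\<^sup>2) \<le> 2 * gap_const * step k" for l
    proof -
      have "gap k (k + l) s \<le> gap_const * (step k + step (k + l))" by (rule gap_bound[OF s])
      also have "\<dots> \<le> gap_const * (2 * step k)"
        using step_le[of k "k + l"] by (intro mult_left_mono gap_const_nonneg) auto
      finally show ?thesis by (simp add: gap_def)
    qed
    have "AE \<omega> in M. (\<lambda>l. euler_path k s \<omega> - euler_path (k + l) s \<omega>) \<longlonglongrightarrow> euler_path k s \<omega> - X s \<omega>"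
      using X_limit[OF s]
    proof eventually_elim
      case (elim \<omega>)
      then show ?case using LIMSEQ_ignore_initial_segment[of "\<lambda>k. euler_path k s \<omega>" "X s \<omega>" k]
        by (intro tendsto_diff tendsto_const) (simp add: add.commute)
    qed
    note L2_Fatou[OF L2_diff[OF E E] le this borel_measurable_diff[OF L2_measurable[OF E] Xm]]
    then show "L2 M (\<lambda>\<omega>. euler_path k s \<omega> - X s \<omega>)" "expectation (\<lambda>\<omega>. (euler_path k s \<omega> - X s \<omega>)\<^sup>2) \<le> 2 * gap_const * step k"
      by auto
  qed
  show "s \<in> {t..T} \<Longrightarrow> expectation (\<lambda>\<omega>. (euler_path k s \<omega> - X s \<omega>)\<^sup>2) \<le> 2 * gap_const * step k" by (rule *(2))
  assume s: "s \<in> {t..T}"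
  have "L2 M (euler_path 0 s)" using euler_path_L2_at[of s 0] s by (auto intro: L2_at_L2)
  from L2_diff[OF this *(1)[OF s, of 0]] have "L2 M (X s)" by simp
  then show "L2_at s (X s)" using X_adapted[OF s] s t by (simp add: L2_at_def)
qed

lemma X_L2: "s \<in> {t..T} \<Longrightarrow> L2 M (X s)"
  using X_L2_at by (rule L2_at_L2)

definition X_moment :: real where
  "X_moment = 2 * (2 * moment_bound + 2 * (error_const * (T - t))) + 2 * (2 * gap_const * (T - t))"

lemma X_second_moment:
  assumes s: "s \<in> {t..T}" shows "expectation (\<lambda>\<omega>. (X s \<omega>)\<^sup>2) \<le> X_moment"
proof -
  have E: "L2 M (euler_path 0 s)" using euler_path_L2_at[of s 0] s by (auto intro: L2_at_L2)
  have "expectation (\<lambda>\<omega>. (X s \<omega>)\<^sup>2) \<le> 2 * expectation (\<lambda>\<omega>. (euler_path 0 s \<omega>)\<^sup>2) + 2 * expectation (\<lambda>\<omega>. (X s \<omega> - euler_path 0 s \<omega>)\<^sup>2)"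
    using L2_add_bound[OF E L2_diff[OF X_L2[OF s] E]] by simp
  then show ?thesis
    using euler_path_moment[of s 0] X_gap[OF s, of 0] s
    by (simp add: X_moment_def step_def power2_commute)
qed

definition path_coeff :: "(real \<Rightarrow> real \<Rightarrow> real) \<Rightarrow> 'a \<times> real \<Rightarrow> real" where
  "path_coeff f p = indicator {t..T} (snd p) * f (snd p) (X (snd p) (fst p))"

lemma X_measurable: "(\<lambda>p. indicator {t..T} (snd p) * X (snd p) (fst p)) \<in> borel_measurable N"
  using jointly_measurable_continuous[of t T X M, OF _ X_continuous] measurable_F_M[OF _ _ X_adapted] t
  by (simp cong: measurable_cong_sets)

lemma coeff_L2:
  assumes lip: "\<And>s s' y y'. \<bar>f s y - f s' y'\<bar> \<le> L * (\<bar>s - s'\<bar> + \<bar>y - y' :: real\<bar>)"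
    and f: "\<bar>f t 0\<bar> \<le> \<bar>b t 0\<bar> + \<bar>g t 0\<bar>"
  shows "L2 N (path_coeff f)"
proof (rule L2_N_bounded[of _ t T "growth * (1 + X_moment)"])
  \<comment> \<open>The indicator is moved inside the argument of \<open>f\<close>: since
    \<open>X\<close> is controlled on \<open>{t..T}\<close> only, it is the cut-off path that is
    jointly measurable.\<close>
  have "(\<lambda>p. (snd p, indicator {t..T} (snd p) * X (snd p) (fst p))) \<in> N \<rightarrow>\<^sub>M borel \<Otimes>\<^sub>M borel"
    using X_measurable by (intro measurable_Pair) auto
  then have "(\<lambda>p. (snd p, indicator {t..T} (snd p) * X (snd p) (fst p))) \<in> N \<rightarrow>\<^sub>M borel"
    unfolding borel_prod .
  from measurable_compose[OF this lipschitz_measurable(1)[of f, OF lip]]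
  have m: "(\<lambda>p. f (snd p) (indicator {t..T} (snd p) * X (snd p) (fst p))) \<in> borel_measurable N" by simp
  have "path_coeff f = (\<lambda>p. indicator {t..T} (snd p) * f (snd p) (indicator {t..T} (snd p) * X (snd p) (fst p)))"
    by (auto simp: path_coeff_def indicator_def fun_eq_iff)
  moreover have "(\<lambda>p. indicator {t..T} (snd p) :: real) \<in> borel_measurable N" by measurable
  ultimately show "path_coeff f \<in> borel_measurable N" using borel_measurable_times[OF _ m] by simp
  show "path_coeff f (\<omega>, r) = 0" if "r \<notin> {t..T}" for \<omega> r using that by (simp add: path_coeff_def)
  fix r assume r: "r \<in> {t..T}"
  note g = L2_at_growth[OF X_L2_at[OF r] lipschitz_measurable(2)[of f, OF lip] linear_growth[of f, OF lip f r]]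
  show "L2 M (\<lambda>\<omega>. path_coeff f (\<omega>, r))" using L2_at_L2[OF g(1)] r by (simp add: path_coeff_def)
  have "growth * (1 + expectation (\<lambda>\<omega>. (X r \<omega>)\<^sup>2)) \<le> growth * (1 + X_moment)"
    using X_second_moment[OF r] growth_nonneg by (intro mult_left_mono) auto
  then show "expectation (\<lambda>\<omega>. (path_coeff f (\<omega>, r))\<^sup>2) \<le> growth * (1 + X_moment)"
    using g(2) r by (simp add: path_coeff_def)
qed

lemma coeff_b_L2: "L2 N (path_coeff b)" by (rule coeff_L2[OF b_lipschitz]) simp
lemma coeff_g_L2: "L2 N (path_coeff g)" by (rule coeff_L2[OF g_lipschitz]) simp

definition limit_const :: real where
  "limit_const = 4 * L\<^sup>2 * ((T - t) + error_const + 2 * gap_const) * (T - t)"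

text \<open>The comparison of \<open>coeff_gap\<close> with the limit in place of the second scheme;
  the limit is not frozen, so one of the two local errors disappears.\<close>

lemma freeze_limit:
  assumes lip: "\<And>s s' y y'. \<bar>f s y - f s' y'\<bar> \<le> L * (\<bar>s - s'\<bar> + \<bar>y - y' :: real\<bar>)"
    and f: "L2 N (path_coeff f)" and f\<xi>: "\<And>k i \<omega>. \<xi> k i \<omega> = f (grid k i) (euler k i \<omega>)"
    and el: "\<And>k. elementary t T {..<2 ^ k} (grid k) (\<lambda>i. grid k (Suc i)) (\<xi> k)"
  shows "(\<integral>p. (freeze k (\<xi> k) p - path_coeff f p)\<^sup>2 \<partial>N) \<le> limit_const * step k"
proof -
  have fL: "L2 N (freeze k (\<xi> k))" unfolding freeze_def by (rule elem_process_L2[OF el])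
  have i: "integrable N (\<lambda>p. (freeze k (\<xi> k) p - path_coeff f p)\<^sup>2)" by (intro L2_square L2_diff fL f)
  define c where "c = 4 * L\<^sup>2 * ((T - t) + error_const + 2 * gap_const) * step k"
  have "integrable lborel (\<lambda>r. indicator {t..T} r * c)"
    by (intro integrable_mult_left integrable_real_indicator emeasure_bounded_finite) auto
  then have "(\<integral>r. \<integral>\<omega>. (freeze k (\<xi> k) (\<omega>, r) - path_coeff f (\<omega>, r))\<^sup>2 \<partial>M \<partial>lborel) \<le> (\<integral>r. indicator {t..T} r * c \<partial>lborel)"
  proof (rule integral_mono_AE[OF integral_N(4)[OF i]])
    have "(\<integral>\<omega>. (freeze k (\<xi> k) (\<omega>, r) - path_coeff f (\<omega>, r))\<^sup>2 \<partial>M) \<le> indicator {t..T} r * c" if rt: "r \<noteq> t" for r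
    proof (cases "r \<in> {t..T}")
      case False
      then have "freeze k (\<xi> k) (\<omega>, r) = 0" "path_coeff f (\<omega>, r) = 0" for \<omega>
        using freeze_outside[of r] by (auto simp: path_coeff_def)
      then show ?thesis using False by simp
    next
      case r: True
      then have r': "t < r" "r \<le> T" using rt by auto
      obtain i where i: "i < 2 ^ k" "grid k i < r" "r \<le> grid k (Suc i)" using grid_cell[OF r', of k] .
      have L': "L2 M (euler k i)" "L2 M (\<xi> k i)" using euler_L2_at[of i k] i el[of k] by (auto simp: elementary_def intro: L2_at_L2)
      have fX: "L2 M (\<lambda>\<omega>. f r (X r \<omega>))"
        by (rule L2_at_L2[OF L2_at_lipschitz[OF X_L2_at[OF r] lip]])
      have E: "L2 M (euler_path k r)" using euler_path_L2_at[of r k] r by (auto intro: L2_at_L2)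
      have "expectation (\<lambda>\<omega>. (\<xi> k i \<omega> - f r (X r \<omega>))\<^sup>2) \<le> expectation (\<lambda>\<omega>. L\<^sup>2 * (4 * ((step k)\<^sup>2 + (euler_path k r \<omega> - euler k i \<omega>)\<^sup>2 + (euler_path k r \<omega> - X r \<omega>)\<^sup>2)))"
      proof (rule integral_mono)
        show "integrable M (\<lambda>\<omega>. (\<xi> k i \<omega> - f r (X r \<omega>))\<^sup>2)" by (intro L2_square L2_diff L' fX)
        show "integrable M (\<lambda>\<omega>. L\<^sup>2 * (4 * ((step k)\<^sup>2 + (euler_path k r \<omega> - euler k i \<omega>)\<^sup>2 + (euler_path k r \<omega> - X r \<omega>)\<^sup>2)))"
          by (intro integrable_mult_right Bochner_Integration.integrable_add L2_square L2_diff L2_const E L' X_L2[OF r])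
        fix \<omega>
        have "\<bar>\<xi> k i \<omega> - f r (X r \<omega>)\<bar> \<le> L * (\<bar>grid k i - r\<bar> + \<bar>euler k i \<omega> - X r \<omega>\<bar>)"
          unfolding f\<xi> by (rule lip)
        \<comment> \<open>The summand 0 fills the fourth slot of \<open>square_sum4\<close>.\<close>
        also have "\<dots> \<le> L * (step k + \<bar>euler_path k r \<omega> - euler k i \<omega>\<bar> + \<bar>euler_path k r \<omega> - X r \<omega>\<bar> + 0)"
          using i grid_Suc[of k i] L by (intro mult_left_mono) auto
        finally have "\<bar>\<xi> k i \<omega> - f r (X r \<omega>)\<bar>\<^sup>2 \<le> (L * (step k + \<bar>euler_path k r \<omega> - euler k i \<omega>\<bar> + \<bar>euler_path k r \<omega> - X r \<omega>\<bar> + 0))\<^sup>2"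
          by (intro power_mono) auto
        also have "\<dots> \<le> L\<^sup>2 * (4 * ((step k)\<^sup>2 + \<bar>euler_path k r \<omega> - euler k i \<omega>\<bar>\<^sup>2 + \<bar>euler_path k r \<omega> - X r \<omega>\<bar>\<^sup>2 + 0\<^sup>2))"
          unfolding power_mult_distrib by (intro mult_left_mono square_sum4) auto
        finally show "(\<xi> k i \<omega> - f r (X r \<omega>))\<^sup>2 \<le> L\<^sup>2 * (4 * ((step k)\<^sup>2 + (euler_path k r \<omega> - euler k i \<omega>)\<^sup>2 + (euler_path k r \<omega> - X r \<omega>)\<^sup>2))"
          by simp
      qed
      also have "\<dots> = L\<^sup>2 * (4 * ((step k)\<^sup>2 + expectation (\<lambda>\<omega>. (euler_path k r \<omega> - euler k i \<omega>)\<^sup>2) + expectation (\<lambda>\<omega>. (euler_path k r \<omega> - X r \<omega>)\<^sup>2)))"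
        using L2_square[OF L2_diff[OF E L'(1)]] L2_square[OF L2_diff[OF E X_L2[OF r]]] by (simp add: prob_space)
      also have "\<dots> \<le> L\<^sup>2 * (4 * ((T - t) * step k + error_const * step k + 2 * gap_const * step k))"
      proof -
        have "(step k)\<^sup>2 \<le> (T - t) * step k"
          using step_le_T[of k] step_nonneg[of k] by (simp add: power2_eq_square mult_right_mono)
        then show ?thesis
          using euler_path_local(2)[of i k r] X_gap[OF r, of k] i by (intro mult_left_mono add_mono) auto
      qed
      also have "\<dots> = c" by (simp add: c_def algebra_simps)
      finally show ?thesis using r freeze_cell[OF i, of "\<xi> k"] by (simp add: path_coeff_def)
    qed
    then show "AE r in lborel. (\<integral>\<omega>. (freeze k (\<xi> k) (\<omega>, r) - path_coeff f (\<omega>, r))\<^sup>2 \<partial>M) \<le> indicator {t..T} r * c"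
      using AE_lborel_singleton[of t] by (auto elim: eventually_mono)
  qed
  then show ?thesis
    unfolding integral_N(2)[OF i] using t by (simp add: c_def limit_const_def algebra_simps)
qed

lemmas freeze_limit_b = freeze_limit[OF b_lipschitz coeff_b_L2 b_euler_def elementary_b]
  and freeze_limit_g = freeze_limit[OF g_lipschitz coeff_g_L2 g_euler_def elementary_g]

text \<open>The distance from \<open>J\<close> to the Euler noise is the error of the path plus that
  of the drift, and its mean square is of order \<open>step k\<close>. The noise is an elementary
  integral with unbounded coefficients, which are then truncated at a cost that tends to 0.\<close>

lemma has_Ito:
  assumes u: "u \<in> {t..T}"
  shows "has_Ito_integral M F W t u (\<lambda>s \<omega>. g s (X s \<omega>)) (\<lambda>\<omega>. X u \<omega> - x - (\<integral>r. indicator {t..u} r * b r (X r \<omega>) \<partial>lborel))"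
proof -
  have tu: "t \<le> u" "u \<le> T" using u by auto
  define J where "J = (\<lambda>\<omega>. X u \<omega> - x - (\<integral>r. indicator {t..u} r * b r (X r \<omega>) \<partial>lborel))"
  have drift: "(\<integral>r. indicator {t..u} r * b r (X r \<omega>) \<partial>lborel) = (\<integral>r. indicator {..u} r * path_coeff b (\<omega>, r) \<partial>lborel)" for \<omega>
    using tu by (intro Bochner_Integration.integral_cong) (auto simp: path_coeff_def indicator_def)
  define D where "D = (\<lambda>k \<omega>. \<integral>r. indicator {..u} r * (freeze k (b_euler k) (\<omega>, r) - path_coeff b (\<omega>, r)) \<partial>lborel)"
  have freezeL: "L2 N (freeze k (b_euler k))" for k unfolding freeze_def by (rule elem_process_L2[OF elementary_b])
  have out: "path_coeff f (\<omega>, r) = 0" "freeze k \<xi> (\<omega>, r) - path_coeff f (\<omega>, r) = 0" if "r \<notin> {t..T}" for f k \<xi> \<omega> r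
    using that freeze_outside[of r] by (auto simp: path_coeff_def)
  note tb = time_integral_bound[where s=u, OF L2_diff[OF freezeL coeff_b_L2] out(2) t(2)]
  have DL: "L2 M (D k)" for k unfolding D_def by (rule tb(1))
  have D2: "expectation (\<lambda>\<omega>. (D k \<omega>)\<^sup>2) \<le> (T - t) * (limit_const * step k)" for k
  proof -
    have "expectation (\<lambda>\<omega>. (D k \<omega>)\<^sup>2) \<le> (T - t) * (\<integral>p. indicator {..u} (snd p) * (freeze k (b_euler k) p - path_coeff b p)\<^sup>2 \<partial>N)"
      unfolding D_def by (rule tb(2))
    also have "\<dots> \<le> (T - t) * (\<integral>p. (freeze k (b_euler k) p - path_coeff b p)\<^sup>2 \<partial>N)"
    proof (intro mult_left_mono integral_mono)
      show i: "integrable N (\<lambda>p. (freeze k (b_euler k) p - path_coeff b p)\<^sup>2)" by (intro L2_square L2_diff freezeL coeff_b_L2)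
      show "integrable N (\<lambda>p. indicator {..u} (snd p) * (freeze k (b_euler k) p - path_coeff b p)\<^sup>2)"
        by (rule Bochner_Integration.integrable_bound[OF i])
           (use L2_measurable[OF L2_diff[OF freezeL coeff_b_L2]] in \<open>auto simp: indicator_def\<close>)
    qed (use t in \<open>auto simp: indicator_def\<close>)
    also have "\<dots> \<le> (T - t) * (limit_const * step k)"
      using freeze_limit_b t by (intro mult_left_mono) auto
    finally show ?thesis .
  qed
  have bi: "AE \<omega> in M. integrable lborel (\<lambda>r. indicator {..u} r * path_coeff b (\<omega>, r))"
  proof -
    have l: "L2 N (\<lambda>p. indicator {t..T} (snd p) :: real)"
      by (rule L2_N_bounded[of _ t T 1]) (auto simp: L2_const prob_space)
    have e: "(\<lambda>p. indicator {t..T} (snd p) * path_coeff b p) = path_coeff b" by (auto simp: path_coeff_def indicator_def)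
    show ?thesis
      using integral_N(5)[OF L2_mult[OF l coeff_b_L2, unfolded e]]
    proof eventually_elim
      case (elim \<omega>)
      from integrable_mult_indicator[OF _ this, of "{..u}"] show ?case by simp
    qed
  qed
  \<comment> \<open>Only almost surely: splitting the drift integral requires the drift of the limit
    to be integrable along the path.\<close>
  have JD: "AE \<omega> in M. J \<omega> - noise k u \<omega> = (X u \<omega> - euler_path k u \<omega>) + D k \<omega>" for k
    using bi
  proof eventually_elim
    case (elim \<omega>)
    show ?case
      unfolding J_def drift D_def euler_path_eq right_diff_distrib
      by (subst Bochner_Integration.integral_diff[OF integrable_freeze elim]) simp
  qed
  have uXL: "L2 M (\<lambda>\<omega>. X u \<omega> - euler_path k u \<omega>)" for k
    using euler_path_L2_at[of u k] tu by (intro L2_diff X_L2[OF u]) (auto intro: L2_at_L2)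
  have JL: "L2 M J"
  proof -
    have "L2 M (\<lambda>\<omega>. \<integral>r. indicator {..u} r * path_coeff b (\<omega>, r) \<partial>lborel)"
      by (rule time_integral_bound(1)[OF coeff_b_L2 out(1) t(2)])
    then show ?thesis unfolding J_def drift by (intro L2_diff X_L2[OF u] L2_const)
  qed
  have nL: "L2 M (noise k u)" for k using noise_isometry(1)[OF tu] by (rule L2_at_L2)
  have Jn: "expectation (\<lambda>\<omega>. (J \<omega> - noise k u \<omega>)\<^sup>2) \<le> 2 * (2 * gap_const * step k) + 2 * ((T - t) * (limit_const * step k))" for k
  proof -
    have "expectation (\<lambda>\<omega>. (J \<omega> - noise k u \<omega>)\<^sup>2) = expectation (\<lambda>\<omega>. ((X u \<omega> - euler_path k u \<omega>) + D k \<omega>)\<^sup>2)"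
      using JD[of k]
      by (intro integral_cong_AE borel_measurable_power L2_measurable[OF L2_diff[OF JL nL]]
          L2_measurable[OF L2_add[OF uXL DL]]) (auto elim: eventually_mono)
    also have "\<dots> \<le> 2 * expectation (\<lambda>\<omega>. (X u \<omega> - euler_path k u \<omega>)\<^sup>2) + 2 * expectation (\<lambda>\<omega>. (D k \<omega>)\<^sup>2)"
      by (rule L2_add_bound[OF uXL DL])
    also have "\<dots> \<le> 2 * (2 * gap_const * step k) + 2 * ((T - t) * (limit_const * step k))"
      using X_gap[OF u, of k] D2[of k] by (intro add_mono mult_left_mono) (auto simp: power2_commute)
    finally show ?thesis .
  qed
  \<comment> \<open>The grid stopped at \<open>u\<close> is a partition of \<open>{t..u}\<close>
    whose last cells may be degenerate, which \<open>simple_integrand\<close> allows.\<close>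
  define s' where "s' = (\<lambda>k i. min (grid k i) u)"
  define P where "P = (\<lambda>k. elem_process {..<2 ^ k} (s' k) (\<lambda>i. s' k (Suc i)))"
  define I where "I = (\<lambda>k. elem_integral {..<2 ^ k} (s' k) (\<lambda>i. s' k (Suc i)))"
  define \<xi> where "\<xi> = (\<lambda>k. stop_coeff u (grid k) (g_euler k))"
  note st = elementary_stop[OF elementary_g tu]
  have el: "elementary t u {..<2 ^ k} (s' k) (\<lambda>i. s' k (Suc i)) (\<xi> k)" for k
    unfolding s'_def \<xi>_def by (rule st(1))
  have noise: "noise k u = I k (\<xi> k)" for k unfolding noise_def I_def s'_def \<xi>_def ..
  have Pf: "P k (\<xi> k) p = indicator {..u} (snd p) * freeze k (g_euler k) p" for k p
    unfolding P_def s'_def \<xi>_def freeze_def by (rule st(2))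
  \<comment> \<open>The truncation level is chosen separately for each \<open>k\<close>; the
    tolerance \<open>inverse (real (Suc k))\<close> is any null sequence of positive
    numbers.\<close>
  have "\<forall>k. \<exists>\<zeta>. elementary t u {..<2 ^ k} (s' k) (\<lambda>i. s' k (Suc i)) \<zeta> \<and> (\<exists>C. \<forall>i \<omega>. \<bar>\<zeta> i \<omega>\<bar> \<le> C) \<and>
      (\<integral>p. (P k (\<xi> k) p - P k \<zeta> p)\<^sup>2 \<partial>N) \<le> inverse (real (Suc k))"
  proof
    fix k
    have pos: "0 < inverse (real (Suc k))" by simp
    obtain \<zeta> C where z: "elementary t u {..<2 ^ k} (s' k) (\<lambda>i. s' k (Suc i)) \<zeta>" "\<And>i \<omega>. \<bar>\<zeta> i \<omega>\<bar> \<le> C"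
      "(\<integral>p. (elem_process {..<2 ^ k} (s' k) (\<lambda>i. s' k (Suc i)) (\<xi> k) p -
          elem_process {..<2 ^ k} (s' k) (\<lambda>i. s' k (Suc i)) \<zeta> p)\<^sup>2 \<partial>N) < inverse (real (Suc k))"
      by (rule elementary_truncate[OF el[of k] pos], rule that)
    have z3: "(\<integral>p. (P k (\<xi> k) p - P k \<zeta> p)\<^sup>2 \<partial>N) < inverse (real (Suc k))"
      unfolding P_def by (rule z(3))
    show "\<exists>\<zeta>. elementary t u {..<2 ^ k} (s' k) (\<lambda>i. s' k (Suc i)) \<zeta> \<and> (\<exists>C. \<forall>i \<omega>. \<bar>\<zeta> i \<omega>\<bar> \<le> C) \<and>
      (\<integral>p. (P k (\<xi> k) p - P k \<zeta> p)\<^sup>2 \<partial>N) \<le> inverse (real (Suc k))"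
      using z(2) by (intro exI[of _ \<zeta>] conjI z(1) less_imp_le[OF z3]) blast
  qed
  from choice[OF this] obtain \<zeta> where \<zeta>': "\<forall>k. elementary t u {..<2 ^ k} (s' k) (\<lambda>i. s' k (Suc i)) (\<zeta> k) \<and> (\<exists>C. \<forall>i \<omega>. \<bar>\<zeta> k i \<omega>\<bar> \<le> C) \<and>
      (\<integral>p. (P k (\<xi> k) p - P k (\<zeta> k) p)\<^sup>2 \<partial>N) \<le> inverse (real (Suc k))" ..
  have \<zeta>: "elementary t u {..<2 ^ k} (s' k) (\<lambda>i. s' k (Suc i)) (\<zeta> k)" "\<exists>C. \<forall>i \<omega>. \<bar>\<zeta> k i \<omega>\<bar> \<le> C"
    "(\<integral>p. (P k (\<xi> k) p - P k (\<zeta> k) p)\<^sup>2 \<partial>N) \<le> inverse (real (Suc k))" for k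
    by (rule \<zeta>'[THEN spec, THEN conjunct1], rule \<zeta>'[THEN spec, THEN conjunct2, THEN conjunct1],
        rule \<zeta>'[THEN spec, THEN conjunct2, THEN conjunct2])
  have inv0: "(\<lambda>k. inverse (real (Suc k))) \<longlonglongrightarrow> 0" by (rule LIMSEQ_inverse_real_of_nat)
  have PL: "L2 N (P k (\<xi> k))" "L2 N (P k (\<zeta> k))" for k
    unfolding P_def by (rule elem_process_L2[OF el], rule elem_process_L2[OF \<zeta>(1)])
  define H where "H = (\<lambda>p. indicator {..u} (snd p) * path_coeff g p)"
  have HL: "L2 N H" unfolding H_def
    by (rule L2_bound[OF coeff_g_L2]) (use L2_measurable[OF coeff_g_L2] in \<open>auto simp: indicator_def\<close>)
  have "has_Ito_integral M F W t u (\<lambda>s \<omega>. g s (X s \<omega>)) J"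
    unfolding has_Ito_integral_def
  proof (intro conjI exI allI)
    show "J \<in> borel_measurable M" by (rule L2_measurable[OF JL])
    show "simple_integrand M F t u (2 ^ k) (s' k) (\<zeta> k)" for k
      unfolding simple_integrand_def
    proof (intro conjI allI impI)
      show "s' k 0 = t" "s' k (2 ^ k) = u" using tu by (auto simp: s'_def grid_0 grid_end)
      fix i :: nat assume i: "i < 2 ^ k"
      show "s' k i \<le> s' k (Suc i)" "\<zeta> k i \<in> borel_measurable (F (s' k i))"
        using \<zeta>(1)[of k] i by (auto simp: elementary_def L2_at_def)
      show "\<exists>C. \<forall>\<omega>\<in>space M. \<bar>\<zeta> k i \<omega>\<bar> \<le> C" using \<zeta>(2)[of k] by auto
    qed
    show "(\<lambda>k. \<integral>\<^sup>+ \<omega>. (\<integral>\<^sup>+ s\<in>{t..u}. ennreal ((g s (X s \<omega>) - simple_process (2 ^ k) (s' k) (\<zeta> k) s \<omega>)\<^sup>2) \<partial>lborel) \<partial>M) \<longlonglongrightarrow> 0"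
    proof (rule nn_iterated_zeroI[where f="\<lambda>k p. H p - P k (\<zeta> k) p"])
      show "L2 N (\<lambda>p. H p - P k (\<zeta> k) p)" for k by (intro L2_diff HL PL)
      show "(\<lambda>k. \<integral>p. (H p - P k (\<zeta> k) p)\<^sup>2 \<partial>N) \<longlonglongrightarrow> 0"
      proof (rule tendsto_sandwich[OF _ _ tendsto_const])
        show "\<forall>\<^sub>F k in sequentially. (\<integral>p. (H p - P k (\<zeta> k) p)\<^sup>2 \<partial>N) \<le> 2 * (limit_const * step k) + 2 * inverse (real (Suc k))"
        proof (intro always_eventually allI)
          fix k
          have "(\<integral>p. (H p - P k (\<zeta> k) p)\<^sup>2 \<partial>N) \<le> 2 * (\<integral>p. (H p - P k (\<xi> k) p)\<^sup>2 \<partial>N) + 2 * (\<integral>p. (P k (\<xi> k) p - P k (\<zeta> k) p)\<^sup>2 \<partial>N)"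
            using L2_add_bound[OF L2_diff[OF HL PL(1)[of k]] L2_diff[OF PL(1)[of k] PL(2)[of k]]] by simp
          also have "(\<integral>p. (H p - P k (\<xi> k) p)\<^sup>2 \<partial>N) \<le> (\<integral>p. (freeze k (g_euler k) p - path_coeff g p)\<^sup>2 \<partial>N)"
          proof (rule integral_mono)
            show "integrable N (\<lambda>p. (H p - P k (\<xi> k) p)\<^sup>2)" by (intro L2_square L2_diff HL PL)
            show "integrable N (\<lambda>p. (freeze k (g_euler k) p - path_coeff g p)\<^sup>2)"
              unfolding freeze_def by (intro L2_square L2_diff coeff_g_L2 elem_process_L2[OF elementary_g])
            show "(H p - P k (\<xi> k) p)\<^sup>2 \<le> (freeze k (g_euler k) p - path_coeff g p)\<^sup>2" for p
              by (simp add: H_def Pf indicator_def power2_commute)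
          qed
          also have "\<dots> \<le> limit_const * step k" by (rule freeze_limit_g)
          finally show "(\<integral>p. (H p - P k (\<zeta> k) p)\<^sup>2 \<partial>N) \<le> 2 * (limit_const * step k) + 2 * inverse (real (Suc k))"
            using \<zeta>(3)[of k] by linarith
        qed
        show "(\<lambda>k. 2 * (limit_const * step k) + 2 * inverse (real (Suc k))) \<longlonglongrightarrow> 0"
          using tendsto_add[OF tendsto_mult_left[OF tendsto_mult_left[OF step_tendsto]] tendsto_mult_left[OF inv0], of 2 limit_const 2] by simp
      qed simp
      fix k \<omega>
      have "ennreal ((g r (X r \<omega>) - simple_process (2 ^ k) (s' k) (\<zeta> k) r \<omega>)\<^sup>2) * indicator {t..u} r = ennreal ((H (\<omega>, r) - P k (\<zeta> k) (\<omega>, r))\<^sup>2)" for r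
      proof (cases "r \<in> {t..u}")
        case True
        have "simple_process (2 ^ k) (s' k) (\<zeta> k) r \<omega> = P k (\<zeta> k) (\<omega>, r)"
          by (simp add: simple_process_def P_def elem_process_def)
        then show ?thesis using True tu by (simp add: H_def path_coeff_def)
      next
        case False
        then have "P k (\<zeta> k) (\<omega>, r) = 0" unfolding P_def by (intro elem_process_outside[OF \<zeta>(1)]) simp
        then show ?thesis using False by (auto simp: H_def path_coeff_def indicator_def)
      qed
      then show "(\<integral>\<^sup>+ s\<in>{t..u}. ennreal ((g s (X s \<omega>) - simple_process (2 ^ k) (s' k) (\<zeta> k) s \<omega>)\<^sup>2) \<partial>lborel) =
        (\<integral>\<^sup>+r. ennreal ((H (\<omega>, r) - P k (\<zeta> k) (\<omega>, r))\<^sup>2) \<partial>lborel)" by simp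
    qed
    have IL: "L2 M (I k (\<zeta> k))" for k unfolding I_def by (rule L2_at_L2[OF elem_integral_L2_at[OF \<zeta>(1)]])
    have Ie: "simple_integral W (2 ^ k) (s' k) (\<zeta> k) = I k (\<zeta> k)" for k
      by (simp add: simple_integral_def I_def elem_integral_def fun_eq_iff)
    have "(\<lambda>k. expectation (\<lambda>\<omega>. (J \<omega> - I k (\<zeta> k) \<omega>)\<^sup>2)) \<longlonglongrightarrow> 0"
    proof (rule tendsto_sandwich[OF _ _ tendsto_const])
      show "\<forall>\<^sub>F k in sequentially. expectation (\<lambda>\<omega>. (J \<omega> - I k (\<zeta> k) \<omega>)\<^sup>2) \<le>
        2 * (2 * (2 * gap_const * step k) + 2 * ((T - t) * (limit_const * step k))) + 2 * inverse (real (Suc k))"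
      proof (intro always_eventually allI)
        fix k
        have "expectation (\<lambda>\<omega>. (J \<omega> - I k (\<zeta> k) \<omega>)\<^sup>2) \<le> 2 * expectation (\<lambda>\<omega>. (J \<omega> - noise k u \<omega>)\<^sup>2) + 2 * expectation (\<lambda>\<omega>. (I k (\<xi> k) \<omega> - I k (\<zeta> k) \<omega>)\<^sup>2)"
          using L2_add_bound[OF L2_diff[OF JL nL[of k]] L2_diff[OF nL[of k] IL[of k]]] by (simp add: noise)
        also have "expectation (\<lambda>\<omega>. (I k (\<xi> k) \<omega> - I k (\<zeta> k) \<omega>)\<^sup>2) = (\<integral>p. (P k (\<xi> k) p - P k (\<zeta> k) p)\<^sup>2 \<partial>N)"
          unfolding I_def P_def by (rule elem_isometry_diff[OF el \<zeta>(1), symmetric])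
        also have "2 * expectation (\<lambda>\<omega>. (J \<omega> - noise k u \<omega>)\<^sup>2) + 2 * (\<integral>p. (P k (\<xi> k) p - P k (\<zeta> k) p)\<^sup>2 \<partial>N) \<le>
          2 * (2 * (2 * gap_const * step k) + 2 * ((T - t) * (limit_const * step k))) + 2 * inverse (real (Suc k))"
          by (intro add_mono mult_left_mono Jn \<zeta>(3)) auto
        finally show "expectation (\<lambda>\<omega>. (J \<omega> - I k (\<zeta> k) \<omega>)\<^sup>2) \<le>
          2 * (2 * (2 * gap_const * step k) + 2 * ((T - t) * (limit_const * step k))) + 2 * inverse (real (Suc k))" .
      qed
      show "(\<lambda>k. 2 * (2 * (2 * gap_const * step k) + 2 * ((T - t) * (limit_const * step k))) + 2 * inverse (real (Suc k))) \<longlonglongrightarrow> 0"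
      proof -
        have "(\<lambda>k. 2 * (2 * (2 * gap_const * step k) + 2 * ((T - t) * (limit_const * step k))) + 2 * inverse (real (Suc k)))
          \<longlonglongrightarrow> 2 * (2 * (2 * gap_const * 0) + 2 * ((T - t) * (limit_const * 0))) + 2 * 0"
          by (intro tendsto_add tendsto_mult tendsto_const step_tendsto inv0)
        then show ?thesis by simp
      qed
    qed simp
    from tendsto_ennrealI[OF this]
    show "(\<lambda>k. \<integral>\<^sup>+ \<omega>. ennreal ((J \<omega> - simple_integral W (2 ^ k) (s' k) (\<zeta> k) \<omega>)\<^sup>2) \<partial>M) \<longlonglongrightarrow> 0"
      by (simp add: Ie L2_nn_integral[OF L2_diff[OF JL IL]])
  qed
  then show ?thesis by (simp add: J_def)
qed

end

section \<open>Distributional controls\<close>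

lemma ext_integral_mono_AE:
  assumes "AE x in M. f x \<le> g x"
  shows "ext_integral M f \<le> ext_integral M g"
proof -
  have "(\<integral>\<^sup>+x. e2ennreal (f x) \<partial>M) \<le> (\<integral>\<^sup>+x. e2ennreal (g x) \<partial>M)"
    by (rule nn_integral_mono_AE, use assms in eventually_elim) (rule e2ennreal_mono)
  moreover have "(\<integral>\<^sup>+x. e2ennreal (- g x) \<partial>M) \<le> (\<integral>\<^sup>+x. e2ennreal (- f x) \<partial>M)"
    by (rule nn_integral_mono_AE, use assms in eventually_elim) (rule e2ennreal_mono, simp)
  ultimately show ?thesis
    unfolding ext_integral_def by (intro ereal_minus_mono) (simp_all add: less_eq_ennreal.rep_eq)
qed

lemma ext_integral_real:
  assumes f: "integrable M f"
  shows "ext_integral M (\<lambda>x. ereal (f x)) = ereal (\<integral>x. f x \<partial>M)"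
proof -
  have *: "(\<integral>\<^sup>+x. ennreal (g x) \<partial>M) < \<infinity>" if "integrable M g" for g :: "'a \<Rightarrow> real"
  proof -
    have "(\<integral>\<^sup>+x. ennreal (g x) \<partial>M) \<le> (\<integral>\<^sup>+x. ennreal (norm (g x)) \<partial>M)"
      by (intro nn_integral_mono ennreal_leI) simp
    also have "\<dots> < \<infinity>" using that by (simp add: integrable_iff_bounded)
    finally show ?thesis .
  qed
  obtain a b where ab: "(\<integral>\<^sup>+x. ennreal (f x) \<partial>M) = ennreal a" "0 \<le> a" "(\<integral>\<^sup>+x. ennreal (- f x) \<partial>M) = ennreal b" "0 \<le> b"
    using *[OF f] *[OF integrable_minus[OF f]]
    by (cases "(\<integral>\<^sup>+x. ennreal (f x) \<partial>M)"; cases "(\<integral>\<^sup>+x. ennreal (- f x) \<partial>M)") auto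
  then have "(\<integral>x. f x \<partial>M) = a - b"
    using real_lebesgue_integral_def[OF f] by simp
  moreover have "(\<integral>\<^sup>+x. e2ennreal (ereal (f x)) \<partial>M) = ennreal a" "(\<integral>\<^sup>+x. e2ennreal (- ereal (f x)) \<partial>M) = ennreal b"
    using ab by (simp_all add: ennreal_def[symmetric])
  ultimately show ?thesis
    using ab by (simp add: ext_integral_def)
qed

text \<open>\<open>K x\<close> may be an infinite measure, and \<open>measure\<close> returns 0 on
  sets of infinite measure. Whether the identity is integrable, and thus whether the Bochner
  integral is more than a default 0, has to be read off from the real numbers
  \<open>measure (K x) B\<close>, the only data assumed measurable in \<open>x\<close>.\<close>

lemma integral_measurable_kernel:
  fixes K :: "'x \<Rightarrow> real measure"
  assumes sets: "\<And>x. x \<in> space A \<Longrightarrow> sets (K x) = sets borel"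
    and m: "\<And>B. B \<in> sets borel \<Longrightarrow> (\<lambda>x. measure (K x) B) \<in> borel_measurable A"
  shows "(\<lambda>x. \<integral>v. v \<partial>K x) \<in> borel_measurable A"
proof -
  \<comment> \<open>Sets bounded away from 0. They have finite measure if the identity is
    integrable, and each nonzero value of a simple function \<open>S n\<close> is taken inside one
    of them.\<close>
  define E :: "nat \<Rightarrow> real set" where "E = (\<lambda>k. {v. inverse (real (Suc k)) \<le> \<bar>v\<bar>})"
  have E: "E k \<in> sets borel" for k unfolding E_def by measurable
  have E_mono: "E j \<subseteq> E k" if "j \<le> k" for j k
  proof -
    have "inverse (real (Suc k)) \<le> inverse (real (Suc j))" using that by simp
    then show ?thesis unfolding E_def using order.trans by blast
  qed
  obtain S where "\<forall>n. simple_function borel (S n)" "\<forall>v. (\<lambda>n. S n v) \<longlonglongrightarrow> v" "\<forall>n v. dist (S n v) 0 \<le> 2 * dist (v :: real) 0"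
    using borel_measurable_implies_sequence_metric[of "\<lambda>v :: real. v" borel 0] by auto
  then have S: "\<And>n. simple_function borel (S n)" "\<And>v. (\<lambda>n. S n v) \<longlonglongrightarrow> v" "\<And>n v. \<bar>S n v\<bar> \<le> 2 * \<bar>v :: real\<bar>"
    by (simp_all add: dist_real_def)
  define R where "R = (\<lambda>n. range (S n))"
  have R: "finite (R n)" for n using S(1)[of n] by (simp add: simple_function_def R_def)
  have B: "S n -` {y} \<in> sets borel" for n y
    using measurable_sets[OF borel_measurable_simple_function[OF S(1)[of n]], of "{y}"] by simp
  have Sm: "S n \<in> borel_measurable borel" for n by (rule borel_measurable_simple_function[OF S(1)])
  have sum: "f (S n v) = (\<Sum>y\<in>R n. f y * indicator (S n -` {y}) v)" for f :: "real \<Rightarrow> real" and n v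
  proof -
    have "(\<Sum>y\<in>R n. f y * indicator (S n -` {y}) v) = (\<Sum>y\<in>R n. if S n v = y then f y else 0)"
      by (intro sum.cong) (auto simp: indicator_def)
    then show ?thesis using R by (simp add: R_def)
  qed
  have BE: "\<exists>k. S n -` {y} \<subseteq> E k" if "y \<noteq> 0" for n y
  proof -
    have "0 < \<bar>y\<bar> / 2" using that by simp
    from reals_Archimedean[OF this] obtain k where k: "inverse (real (Suc k)) < \<bar>y\<bar> / 2" by blast
    have "S n -` {y} \<subseteq> E k"
    proof
      fix v assume "v \<in> S n -` {y}"
      then have "\<bar>y\<bar> \<le> 2 * \<bar>v\<bar>" using S(3)[of n v] by simp
      then show "v \<in> E k" using k unfolding E_def mem_Collect_eq by linarith
    qed
    then show ?thesis ..
  qed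
  define g where "g = (\<lambda>n x. \<Sum>y\<in>R n. y * measure (K x) (S n -` {y}))"
  define G where "G = (\<lambda>n x. \<Sum>y\<in>R n. \<bar>y\<bar> * measure (K x) (S n -` {y}))"
  \<comment> \<open>A nonzero \<open>measure\<close> certifies finite measure, and monotonicity
    passes this on to all larger sets \<open>E k\<close>; if some \<open>E k\<close> were infinite,
    its \<open>measure\<close> would drop to 0. Once all are finite, \<open>G n x\<close> is the
    true integral of \<open>\<bar>S n v\<bar>\<close>, and a finite \<open>liminf\<close> decides
    integrability by Fatou's lemma.\<close>
  define good where "good = (\<lambda>x. (\<exists>k. measure (K x) (E k) \<noteq> 0) \<and> (\<forall>j k. j \<le> k \<longrightarrow> measure (K x) (E j) \<le> measure (K x) (E k)) \<and>
    liminf (\<lambda>n. ennreal (G n x)) < \<infinity>)"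
  have [measurable]: "(\<lambda>x. measure (K x) (E k)) \<in> borel_measurable A" "G n \<in> borel_measurable A" "g n \<in> borel_measurable A" for k n
    unfolding g_def G_def using m E B by auto
  have "(\<lambda>x. if good x then lim (\<lambda>n. g n x) else 0) \<in> borel_measurable A"
    unfolding good_def by measurable
  moreover have "(\<integral>v. v \<partial>K x) = (if good x then lim (\<lambda>n. g n x) else 0)" if x: "x \<in> space A" for x
  proof -
    note sx = sets[OF x]
    have Km: "f \<in> borel_measurable (K x)" if "f \<in> borel_measurable borel" for f :: "real \<Rightarrow> 'z :: topological_space"
      using that sx by (simp cong: measurable_cong_sets)
    have sBE: "S n -` {y} \<in> sets (K x)" "E k \<in> sets (K x)" for n y k using B E sx by auto
    have finB: "emeasure (K x) (S n -` {y}) < \<infinity>" if "\<And>k. emeasure (K x) (E k) < \<infinity>" "y \<noteq> 0" for n y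
      using BE[OF that(2), of n] emeasure_mono[OF _ sBE(2)] that(1) by (metis order.strict_trans1)
    have nnG: "(\<integral>\<^sup>+v. ennreal \<bar>S n v\<bar> \<partial>K x) = ennreal (G n x)" if fin: "\<And>k. emeasure (K x) (E k) < \<infinity>" for n
    proof -
      have "(\<integral>\<^sup>+v. ennreal \<bar>S n v\<bar> \<partial>K x) = (\<integral>\<^sup>+v. (\<Sum>y\<in>R n. ennreal \<bar>y\<bar> * indicator (S n -` {y}) v) \<partial>K x)"
      proof (intro nn_integral_cong)
        fix v
        have "ennreal (\<Sum>y\<in>R n. \<bar>y\<bar> * indicator (S n -` {y}) v) = (\<Sum>y\<in>R n. ennreal (\<bar>y\<bar> * indicator (S n -` {y}) v))"
          by (rule sum_ennreal[symmetric]) simp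
        also have "\<dots> = (\<Sum>y\<in>R n. ennreal \<bar>y\<bar> * indicator (S n -` {y}) v)"
          by (intro sum.cong refl) (simp add: indicator_def)
        finally show "ennreal \<bar>S n v\<bar> = (\<Sum>y\<in>R n. ennreal \<bar>y\<bar> * indicator (S n -` {y}) v)" by (simp only: sum[of abs])
      qed
      also have "\<dots> = (\<Sum>y\<in>R n. ennreal \<bar>y\<bar> * emeasure (K x) (S n -` {y}))"
        using sBE by (subst nn_integral_sum) (auto simp: nn_integral_cmult_indicator)
      also have "\<dots> = (\<Sum>y\<in>R n. ennreal (\<bar>y\<bar> * measure (K x) (S n -` {y})))"
      proof (intro sum.cong refl)
        fix y
        show "ennreal \<bar>y\<bar> * emeasure (K x) (S n -` {y}) = ennreal (\<bar>y\<bar> * measure (K x) (S n -` {y}))"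
          using finB[OF fin, of y n] by (cases "y = 0") (simp_all add: emeasure_eq_ennreal_measure less_top ennreal_mult)
      qed
      finally show ?thesis unfolding G_def by (subst sum_ennreal[symmetric]) auto
    qed
    show ?thesis
    proof (cases "integrable (K x) (\<lambda>v. v)")
      case int: True
      have bnd: "(\<integral>\<^sup>+v. ennreal (c * \<bar>v\<bar>) \<partial>K x) < \<infinity>" if "0 \<le> c" for c
      proof -
        have "integrable (K x) (\<lambda>v. c * \<bar>v\<bar>)" using int by (intro integrable_mult_right integrable_abs)
        then have "(\<integral>\<^sup>+v. ennreal (norm (c * \<bar>v\<bar>)) \<partial>K x) < \<infinity>" unfolding integrable_iff_bounded by blast
        moreover have "norm (c * \<bar>v\<bar>) = c * \<bar>v\<bar>" for v using that by simp
        ultimately show ?thesis by (simp only:)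
      qed
      have fin: "emeasure (K x) (E k) < \<infinity>" for k
      proof -
        have "emeasure (K x) (E k) = (\<integral>\<^sup>+v. indicator (E k) v \<partial>K x)" using sBE by simp
        also have "\<dots> \<le> (\<integral>\<^sup>+v. ennreal (real (Suc k) * \<bar>v\<bar>) \<partial>K x)"
        proof (intro nn_integral_mono)
          fix v
          have "1 \<le> real (Suc k) * \<bar>v\<bar>" if "v \<in> E k"
            using that mult_left_mono[of "inverse (real (Suc k))" "\<bar>v\<bar>" "real (Suc k)"] by (simp add: E_def)
          then show "indicator (E k) v \<le> ennreal (real (Suc k) * \<bar>v\<bar>)"
            by (auto simp: indicator_def simp flip: ennreal_1 intro!: ennreal_leI)
        qed
        also have "\<dots> < \<infinity>"
          by (rule bnd) simp
        finally show ?thesis .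
      qed
      have mono: "measure (K x) (E j) \<le> measure (K x) (E k)" if "j \<le> k" for j k
        using fin[of k] sBE E_mono[OF that] by (intro measure_mono_fmeasurable) (auto simp: fmeasurable_def)
      have "liminf (\<lambda>n. ennreal (G n x)) \<le> (\<integral>\<^sup>+v. ennreal (2 * \<bar>v\<bar>) \<partial>K x)"
        unfolding nnG[OF fin, symmetric]
        by (rule Liminf_le[OF trivial_limit_sequentially], rule always_eventually, rule allI, rule nn_integral_mono, rule ennreal_leI, rule S(3))
      also have "\<dots> < \<infinity>"
        by (rule bnd) simp
      finally have lim: "liminf (\<lambda>n. ennreal (G n x)) < \<infinity>" .
      have gi: "(\<integral>v. S n v \<partial>K x) = g n x" for n
      proof -
        have i: "integrable (K x) (\<lambda>v. y * indicator (S n -` {y}) v)" for y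
        proof (cases "y = 0")
          case False
          show ?thesis
            by (rule integrable_mult_right, rule integrable_real_indicator[OF sBE(1) finB[OF fin False]])
        qed simp
        have "(\<integral>v. S n v \<partial>K x) = (\<integral>v. (\<Sum>y\<in>R n. y * indicator (S n -` {y}) v) \<partial>K x)"
          by (rule Bochner_Integration.integral_cong[OF refl sum[of "\<lambda>y. y"]])
        also have "\<dots> = (\<Sum>y\<in>R n. \<integral>v. y * indicator (S n -` {y}) v \<partial>K x)"
          by (rule Bochner_Integration.integral_sum) (rule i)
        also have "\<dots> = g n x"
          unfolding g_def using sBE(1) by (intro sum.cong refl) simp
        finally show ?thesis .
      qed
      have "(\<lambda>n. \<integral>v. S n v \<partial>K x) \<longlonglongrightarrow> (\<integral>v. v \<partial>K x)"
      proof (rule integral_dominated_convergence[where w="\<lambda>v. 2 * \<bar>v\<bar>"])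
        show "(\<lambda>v. v) \<in> borel_measurable (K x)" "S n \<in> borel_measurable (K x)" for n
          by (rule Km, simp)+ (rule Km[OF Sm])
        show "integrable (K x) (\<lambda>v. 2 * \<bar>v\<bar>)" using int by (intro integrable_mult_right integrable_abs)
        show "AE v in K x. (\<lambda>n. S n v) \<longlonglongrightarrow> v" by (rule AE_I2) (rule S(2))
        show "AE v in K x. norm (S n v) \<le> 2 * \<bar>v\<bar>" for n by (rule AE_I2) (use S(3) in simp)
      qed
      then have limg: "lim (\<lambda>n. g n x) = (\<integral>v. v \<partial>K x)" unfolding gi by (rule limI)
      show ?thesis
      \<comment> \<open>If all these measures vanish although the identity is integrable, then
        \<open>K x\<close> lives at 0 and the integral is 0, the value assigned to points that are
        not \<open>good\<close>.\<close>
      proof (cases "\<exists>k. measure (K x) (E k) \<noteq> 0")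
        case True
        then show ?thesis using mono lim limg by (simp add: good_def)
      next
        case False
        then have "E k \<in> null_sets (K x)" for k
          using fin[of k] sBE(2)[of k] by (intro null_setsI) (auto simp: emeasure_eq_ennreal_measure less_top)
        then have "(\<Union>k. E k) \<in> null_sets (K x)" by auto
        then have "AE v in K x. v = 0"
        proof (rule AE_I')
          show "{v \<in> space (K x). v \<noteq> 0} \<subseteq> (\<Union>k. E k)"
          proof
            fix v assume "v \<in> {v \<in> space (K x). v \<noteq> 0}"
            then have "0 < \<bar>v\<bar>" by simp
            from reals_Archimedean[OF this] obtain k where "inverse (real (Suc k)) < \<bar>v\<bar>" by blast
            then have "v \<in> E k" unfolding E_def mem_Collect_eq by linarith
            then show "v \<in> (\<Union>k. E k)" by blast
          qed
        qed
        then have "(\<integral>v. v \<partial>K x) = 0" by (rule integral_eq_zero_AE)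
        then show ?thesis using False by (simp add: good_def)
      qed
    next
      case nint: False
      have "\<not> good x"
      proof
        assume good: "good x"
        then obtain k0 where k0: "measure (K x) (E k0) \<noteq> 0" by (auto simp: good_def)
        have fin: "emeasure (K x) (E k) < \<infinity>" for k
        proof -
          have "0 < measure (K x) (E (max k k0))"
          proof (rule less_le_trans)
            show "0 < measure (K x) (E k0)" using k0 by (simp add: less_le)
            show "measure (K x) (E k0) \<le> measure (K x) (E (max k k0))"
              using good max.cobounded2[of k0 k] unfolding good_def by blast
          qed
          then have "emeasure (K x) (E (max k k0)) \<noteq> \<infinity>" by (auto simp: measure_def)
          then have "emeasure (K x) (E (max k k0)) < \<infinity>" by (simp add: less_top)
          then show ?thesis by (rule order.strict_trans1[OF emeasure_mono[OF E_mono[OF max.cobounded1] sBE(2)]])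
        qed
        have "(\<integral>\<^sup>+v. ennreal \<bar>v\<bar> \<partial>K x) = (\<integral>\<^sup>+v. liminf (\<lambda>n. ennreal \<bar>S n v\<bar>) \<partial>K x)"
        proof (intro nn_integral_cong)
          fix v
          have "(\<lambda>n. ennreal \<bar>S n v\<bar>) \<longlonglongrightarrow> ennreal \<bar>v\<bar>" by (intro tendsto_ennrealI tendsto_rabs S(2))
          then show "ennreal \<bar>v\<bar> = liminf (\<lambda>n. ennreal \<bar>S n v\<bar>)"
            by (rule lim_imp_Liminf[OF trivial_limit_sequentially, symmetric])
        qed
        also have "\<dots> \<le> liminf (\<lambda>n. \<integral>\<^sup>+v. ennreal \<bar>S n v\<bar> \<partial>K x)"
          using Km[OF Sm] by (intro nn_integral_liminf) auto
        also have "\<dots> < \<infinity>" unfolding nnG[OF fin] using good by (simp add: good_def)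
        finally have "integrable (K x) (\<lambda>v. v)" using Km[of "\<lambda>v. v"] by (simp add: integrable_iff_bounded)
        with nint show False by simp
      qed
      then show ?thesis using nint by (simp add: not_integrable_integral_eq)
    qed
  qed
  ultimately show ?thesis by (rule measurable_cong[THEN iffD2, rotated])
qed

section \<open>Moments of distributional controls\<close>

context brownian_motion
begin

text \<open>A control is a probability measure only almost surely at each time. Exceptional values
  become the point mass at 0, and since total mass 1 is a measurable condition, the result is a
  measurable kernel.\<close>

definition proper_control :: "(real \<Rightarrow> 'a \<Rightarrow> real measure) \<Rightarrow> real \<Rightarrow> 'a \<Rightarrow> real measure" where
  "proper_control U s \<omega> = (if measure (U s \<omega>) UNIV = 1 then U s \<omega> else return borel 0)"

definition control_mean :: "(real \<Rightarrow> 'a \<Rightarrow> real measure) \<Rightarrow> real \<Rightarrow> 'a \<Rightarrow> real" where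
  "control_mean U s \<omega> = (\<integral>u. u \<partial>proper_control U s \<omega>)"

definition control_square :: "(real \<Rightarrow> 'a \<Rightarrow> real measure) \<Rightarrow> real \<Rightarrow> 'a \<Rightarrow> real" where
  "control_square U s \<omega> = (\<integral>u. u\<^sup>2 \<partial>proper_control U s \<omega>)"

lemma measure_UNIV_eq_1:
  assumes "sets P = sets (borel :: real measure)"
  shows "measure P UNIV = 1 \<longleftrightarrow> real_distribution P"
proof
  assume "measure P UNIV = 1"
  then have "emeasure P (space P) = 1"
    using sets_eq_imp_space_eq[OF assms]
    by (cases "emeasure P UNIV" rule: ennreal_cases) (auto simp: measure_def)
  then show "real_distribution P"
    using assms by (auto simp: real_distribution_def real_distribution_axioms_def intro: prob_spaceI)
next
  assume "real_distribution P"
  then interpret D: real_distribution P .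
  show "measure P UNIV = 1" using D.prob_space by (simp add: D.space_eq_univ)
qed

context
  fixes U t
  assumes t: "0 \<le> t" "t \<le> T" and U: "distributional_control M F T t U"
begin

lemma control_sets: "s \<in> {t..T} \<Longrightarrow> \<omega> \<in> space M \<Longrightarrow> sets (U s \<omega>) = sets borel"
  using U by (simp add: distributional_control_def)

lemma proper_control_measurable:
  assumes u: "u \<in> {t..T}"
  shows "(\<lambda>(s, \<omega>). proper_control U s \<omega>) \<in> restrict_space borel {t..u} \<Otimes>\<^sub>M F u \<rightarrow>\<^sub>M subprob_algebra borel"
proof (rule measurable_subprob_algebra)
  have u': "0 \<le> u" "u \<le> T" using u t by auto
  have pm: "(\<lambda>(s, \<omega>). measure (U s \<omega>) A) \<in> borel_measurable (restrict_space borel {t..u} \<Otimes>\<^sub>M F u)" if "A \<in> sets borel" for A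
    using U u that by (simp add: distributional_control_def progressive_def)
  have sp: "fst a \<in> {t..T} \<and> snd a \<in> space M" if "a \<in> space (restrict_space borel {t..u} \<Otimes>\<^sub>M F u)" for a
    using that u by (auto simp: space_pair_measure space_restrict_space space_F[OF u'])
  have rd: "real_distribution (proper_control U (fst a) (snd a))" if "a \<in> space (restrict_space borel {t..u} \<Otimes>\<^sub>M F u)" for a
    using control_sets[of "fst a" "snd a"] sp[OF that] measure_UNIV_eq_1[of "U (fst a) (snd a)"]
      prob_space_return[of 0 "borel :: real measure"]
    by (auto simp: proper_control_def real_distribution_def real_distribution_axioms_def)
  fix a assume a: "a \<in> space (restrict_space borel {t..u} \<Otimes>\<^sub>M F u)"
  interpret D: real_distribution "proper_control U (fst a) (snd a)" by (rule rd[OF a])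
  show "subprob_space (case a of (s, \<omega>) \<Rightarrow> proper_control U s \<omega>)"
    using prob_space_imp_subprob_space[OF D.prob_space_axioms] by (simp add: case_prod_beta)
  show "sets (case a of (s, \<omega>) \<Rightarrow> proper_control U s \<omega>) = sets borel" by (simp add: case_prod_beta D.events_eq_borel)
next
  fix A :: "real set" assume A: "A \<in> sets borel"
  have pm: "(\<lambda>(s, \<omega>). measure (U s \<omega>) A) \<in> borel_measurable (restrict_space borel {t..u} \<Otimes>\<^sub>M F u)" if "A \<in> sets borel" for A
    using U u that by (simp add: distributional_control_def progressive_def)
  have "(\<lambda>p. if (case p of (s, \<omega>) \<Rightarrow> measure (U s \<omega>) UNIV) = 1 then ennreal (case p of (s, \<omega>) \<Rightarrow> measure (U s \<omega>) A) else indicator A 0)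
      \<in> borel_measurable (restrict_space borel {t..u} \<Otimes>\<^sub>M F u)"
    using pm[OF A] pm[of UNIV] by (intro measurable_If measurable_compose[OF _ measurable_ennreal]) auto
  then show "(\<lambda>a. emeasure (case a of (s, \<omega>) \<Rightarrow> proper_control U s \<omega>) A) \<in> borel_measurable (restrict_space borel {t..u} \<Otimes>\<^sub>M F u)"
  proof (rule measurable_cong[THEN iffD1, rotated])
    have u': "0 \<le> u" "u \<le> T" using u t by auto
    fix a assume a: "a \<in> space (restrict_space borel {t..u} \<Otimes>\<^sub>M F u)"
    then have sp: "fst a \<in> {t..T} \<and> snd a \<in> space M"
      using u by (auto simp: space_pair_measure space_restrict_space space_F[OF u'])
    show "(if (case a of (s, \<omega>) \<Rightarrow> measure (U s \<omega>) UNIV) = 1 then ennreal (case a of (s, \<omega>) \<Rightarrow> measure (U s \<omega>) A) else indicator A 0) =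
      emeasure (case a of (s, \<omega>) \<Rightarrow> proper_control U s \<omega>) A"
    proof (cases "measure (U (fst a) (snd a)) UNIV = 1")
      case True
      then interpret D: real_distribution "U (fst a) (snd a)"
        using measure_UNIV_eq_1[OF control_sets] sp by simp
      show ?thesis using True by (simp add: case_prod_beta proper_control_def D.emeasure_eq_measure)
    qed (use A in \<open>simp add: case_prod_beta proper_control_def\<close>)
  qed
qed

lemma control_mean_progressive:
  assumes u: "u \<in> {t..T}"
  shows "(\<lambda>(s, \<omega>). control_mean U s \<omega>) \<in> borel_measurable (restrict_space borel {t..u} \<Otimes>\<^sub>M F u)"
    and "(\<lambda>(s, \<omega>). control_square U s \<omega>) \<in> borel_measurable (restrict_space borel {t..u} \<Otimes>\<^sub>M F u)"
    and "(\<lambda>(s, \<omega>). \<integral>\<^sup>+v. ennreal (v\<^sup>2) \<partial>proper_control U s \<omega>) \<in> borel_measurable (restrict_space borel {t..u} \<Otimes>\<^sub>M F u)"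
proof -
  note m = proper_control_measurable[OF u]
  show "(\<lambda>(s, \<omega>). control_mean U s \<omega>) \<in> borel_measurable (restrict_space borel {t..u} \<Otimes>\<^sub>M F u)"
    using measurable_compose[OF m integral_measurable_subprob_algebra[of "\<lambda>v. v"]]
    by (simp add: control_mean_def case_prod_beta)
  show "(\<lambda>(s, \<omega>). control_square U s \<omega>) \<in> borel_measurable (restrict_space borel {t..u} \<Otimes>\<^sub>M F u)"
    using measurable_compose[OF m integral_measurable_subprob_algebra[of "\<lambda>v. v\<^sup>2"]]
    by (simp add: control_square_def case_prod_beta)
  show "(\<lambda>(s, \<omega>). \<integral>\<^sup>+v. ennreal (v\<^sup>2) \<partial>proper_control U s \<omega>) \<in> borel_measurable (restrict_space borel {t..u} \<Otimes>\<^sub>M F u)"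
    using measurable_compose[OF m nn_integral_measurable_subprob_algebra[of "\<lambda>v. ennreal (v\<^sup>2)"]]
    by (simp add: case_prod_beta)
qed

lemma progressive_section:
  assumes u: "u \<in> {t..T}" and f: "(\<lambda>(s, \<omega>). f s \<omega>) \<in> measurable (restrict_space borel {t..u} \<Otimes>\<^sub>M F u) B"
  shows "f u \<in> measurable (F u) B"
proof -
  have "(\<lambda>\<omega>. (u, \<omega>)) \<in> F u \<rightarrow>\<^sub>M restrict_space borel {t..u} \<Otimes>\<^sub>M F u"
    using u by (intro measurable_Pair1') (simp add: space_restrict_space)
  from measurable_compose[OF this f] show ?thesis by simp
qed

text \<open>Progressive measurability speaks of times in \<open>{t..T}\<close>; composing with this
  retraction extends it to all real times, as the product with \<open>lborel\<close>
  requires.\<close>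

definition clamp :: "real \<Rightarrow> real" where "clamp s = max t (min T s)"

lemma progressive_joint:
  assumes f: "(\<lambda>(s, \<omega>). f s \<omega>) \<in> measurable (restrict_space borel {t..T} \<Otimes>\<^sub>M F T) B"
  shows "(\<lambda>p. f (clamp (snd p)) (fst p)) \<in> measurable N B"
proof -
  have "(\<lambda>p. (clamp (snd p), fst p)) \<in> N \<rightarrow>\<^sub>M restrict_space borel {t..T} \<Otimes>\<^sub>M F T"
  proof (rule measurable_Pair)
    have "(\<lambda>p. clamp (snd p)) \<in> borel_measurable N" unfolding clamp_def by measurable
    then show "(\<lambda>p. clamp (snd p)) \<in> N \<rightarrow>\<^sub>M restrict_space borel {t..T}"
      by (rule measurable_restrict_space2[rotated]) (use t in \<open>auto simp: clamp_def\<close>)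
    have "(\<lambda>\<omega>. \<omega>) \<in> M \<rightarrow>\<^sub>M F T"
      using measurable_from_subalg[OF subalgebra_F[of T] measurable_ident] t by (simp add: id_def)
    then show "fst \<in> N \<rightarrow>\<^sub>M F T" using measurable_compose[OF measurable_fst] by blast
  qed
  from measurable_compose[OF this f] show ?thesis by simp
qed

lemma proper_control_eq: "real_distribution (U s \<omega>) \<Longrightarrow> proper_control U s \<omega> = U s \<omega>"
  using measure_UNIV_eq_1[of "U s \<omega>"] real_distribution.events_eq_borel[of "U s \<omega>"]
  by (simp add: proper_control_def)

text \<open>The exceptional outcomes form a null set for each fixed time. Joint measurability of the
  total mass allows Fubini to exchange the two quantifiers.\<close>

lemma control_AE: "AE \<omega> in M. AE r in lborel. r \<in> {t..T} \<longrightarrow> real_distribution (U r \<omega>)"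
proof -
  interpret pair_sigma_finite M lborel by (rule pair_sigma_finite_N)
  have "(\<lambda>(s, \<omega>). measure (U s \<omega>) UNIV) \<in> borel_measurable (restrict_space borel {t..T} \<Otimes>\<^sub>M F T)"
    using U t by (auto simp: distributional_control_def progressive_def)
  from progressive_joint[OF this]
  have [measurable]: "(\<lambda>p. measure (U (clamp (snd p)) (fst p)) UNIV) \<in> borel_measurable N" .
  have m: "{p \<in> space N. snd p \<in> {t..T} \<longrightarrow> measure (U (clamp (snd p)) (fst p)) UNIV = 1} \<in> sets N"
    by measurable
  have cl: "clamp r = r" if "r \<in> {t..T}" for r using that by (simp add: clamp_def)
  have "AE \<omega> in M. r \<in> {t..T} \<longrightarrow> measure (U (clamp r) \<omega>) UNIV = 1" for r
  proof (cases "r \<in> {t..T}")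
    case True
    then have "AE \<omega> in M. prob_space (U r \<omega>)" using U by (simp add: distributional_control_def)
    then show ?thesis
      using AE_space
    proof eventually_elim
      case (elim \<omega>)
      have "space (U r \<omega>) = UNIV" using sets_eq_imp_space_eq[OF control_sets[OF True elim(2)]] by simp
      then show ?case using prob_space.prob_space[OF elim(1)] by (simp add: cl[OF True])
    qed
  next
    case False
    then show ?thesis by (intro always_eventually) blast
  qed
  then have "AE r in lborel. AE \<omega> in M. r \<in> {t..T} \<longrightarrow> measure (U (clamp r) \<omega>) UNIV = 1" by simp
  then have "AE \<omega> in M. AE r in lborel. r \<in> {t..T} \<longrightarrow> measure (U (clamp r) \<omega>) UNIV = 1"
    using AE_commute[OF m] by simp
  then show ?thesis
    using AE_space
  proof eventually_elim
    case (elim \<omega>)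
    from elim(1) show ?case
      by eventually_elim (use measure_UNIV_eq_1[OF control_sets[OF _ elim(2)]] cl in auto)
  qed
qed

lemma control_square_nonneg: "0 \<le> control_square U s \<omega>"
  by (simp add: control_square_def)

lemma control_measurable_N:
  "(\<lambda>p. indicator {t..T} (snd p) * control_mean U (snd p) (fst p)) \<in> borel_measurable N"
  "(\<lambda>p. indicator {t..T} (snd p) * control_square U (snd p) (fst p)) \<in> borel_measurable N"
  "(\<lambda>p. (\<integral>\<^sup>+v. ennreal (v\<^sup>2) \<partial>proper_control U (snd p) (fst p)) * indicator {t..T} (snd p)) \<in> borel_measurable N"
proof -
  have T: "T \<in> {t..T}" using t by simp
  note m = control_mean_progressive[OF T, THEN progressive_joint]
  have [measurable]: "(\<lambda>p. indicator {t..T} (snd p) :: real) \<in> borel_measurable N"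
    "(\<lambda>p. indicator {t..T} (snd p) :: ennreal) \<in> borel_measurable N" by measurable
  have "(\<lambda>p. indicator {t..T} (snd p) * control_mean U (snd p) (fst p)) = (\<lambda>p. indicator {t..T} (snd p) * control_mean U (clamp (snd p)) (fst p))"
    "(\<lambda>p. indicator {t..T} (snd p) * control_square U (snd p) (fst p)) = (\<lambda>p. indicator {t..T} (snd p) * control_square U (clamp (snd p)) (fst p))"
    "(\<lambda>p. (\<integral>\<^sup>+v. ennreal (v\<^sup>2) \<partial>proper_control U (snd p) (fst p)) * indicator {t..T} (snd p)) =
      (\<lambda>p. (\<integral>\<^sup>+v. ennreal (v\<^sup>2) \<partial>proper_control U (clamp (snd p)) (fst p)) * indicator {t..T} (snd p))"
    by (auto simp: fun_eq_iff indicator_def clamp_def)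
  with m show "(\<lambda>p. indicator {t..T} (snd p) * control_mean U (snd p) (fst p)) \<in> borel_measurable N"
    "(\<lambda>p. indicator {t..T} (snd p) * control_square U (snd p) (fst p)) \<in> borel_measurable N"
    "(\<lambda>p. (\<integral>\<^sup>+v. ennreal (v\<^sup>2) \<partial>proper_control U (snd p) (fst p)) * indicator {t..T} (snd p)) \<in> borel_measurable N"
    by simp_all
qed

lemma control_second_moment:
  "(\<integral>\<^sup>+p. (\<integral>\<^sup>+v. ennreal (v\<^sup>2) \<partial>proper_control U (snd p) (fst p)) * indicator {t..T} (snd p) \<partial>N) < \<infinity>"
proof -
  have "(\<integral>\<^sup>+p. (\<integral>\<^sup>+v. ennreal (v\<^sup>2) \<partial>proper_control U (snd p) (fst p)) * indicator {t..T} (snd p) \<partial>N) =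
    (\<integral>\<^sup>+\<omega>. \<integral>\<^sup>+r. (\<integral>\<^sup>+v. ennreal (v\<^sup>2) \<partial>proper_control U r \<omega>) * indicator {t..T} r \<partial>lborel \<partial>M)"
    by (subst nn_integral_N[OF control_measurable_N(3)]) simp
  also have "\<dots> = (\<integral>\<^sup>+\<omega>. (\<integral>\<^sup>+r\<in>{t..T}. (\<integral>\<^sup>+v. ennreal (v\<^sup>2) \<partial>U r \<omega>) \<partial>lborel) \<partial>M)"
  proof (rule nn_integral_cong_AE)
    show "AE \<omega> in M. (\<integral>\<^sup>+r. (\<integral>\<^sup>+v. ennreal (v\<^sup>2) \<partial>proper_control U r \<omega>) * indicator {t..T} r \<partial>lborel) =
      (\<integral>\<^sup>+r\<in>{t..T}. (\<integral>\<^sup>+v. ennreal (v\<^sup>2) \<partial>U r \<omega>) \<partial>lborel)"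
      using control_AE
    proof eventually_elim
      case (elim \<omega>)
      show ?case
        by (rule nn_integral_cong_AE, use elim in eventually_elim) (auto simp: proper_control_eq indicator_def)
    qed
  qed
  also have "\<dots> < \<infinity>" using U by (simp add: distributional_control_def)
  finally show ?thesis .
qed

text \<open>The finite total second moment makes the second moment finite for almost every pair of
  outcome and time. There Jensen's inequality bounds the squared mean, and the measurable versions
  agree with \<open>dist_mean\<close> and \<open>dist_var\<close>.\<close>

lemma control_data:
  shows "integrable N (\<lambda>p. indicator {t..T} (snd p) * control_square U (snd p) (fst p))"
    and "L2 N (\<lambda>p. indicator {t..T} (snd p) * control_mean U (snd p) (fst p))"
    and "AE \<omega> in M. AE r in lborel. r \<in> {t..T} \<longrightarrow> real_distribution (U r \<omega>) \<and> integrable (U r \<omega>) (\<lambda>u. u\<^sup>2) \<and>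
      dist_mean (U r \<omega>) = control_mean U r \<omega> \<and> (dist_mean (U r \<omega>))\<^sup>2 + dist_var (U r \<omega>) = control_square U r \<omega>"
    and "AE p in N. (indicator {t..T} (snd p) * control_mean U (snd p) (fst p))\<^sup>2 \<le> indicator {t..T} (snd p) * control_square U (snd p) (fst p)"
proof -
  interpret pair_sigma_finite M lborel by (rule pair_sigma_finite_N)
  define q where "q = (\<lambda>p. (\<integral>\<^sup>+v. ennreal (v\<^sup>2) \<partial>proper_control U (snd p) (fst p)) * indicator {t..T} (snd p))"
  have fin: "AE p in N. q p \<noteq> \<infinity>"
    using control_second_moment control_measurable_N(3) by (intro nn_integral_PInf_AE) (auto simp: q_def)
  have T: "T \<in> {t..T}" using t by simp
  have sub: "sets (proper_control U s \<omega>) = sets borel" "prob_space (proper_control U s \<omega>)" if "s \<in> {t..T}" "\<omega> \<in> space M" for s \<omega>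
    using measure_UNIV_eq_1[OF control_sets[OF that]] control_sets[OF that] prob_space_return[of 0 "borel :: real measure"]
    by (auto simp: proper_control_def real_distribution_def)
  have good: "integrable (proper_control U s \<omega>) (\<lambda>u. u\<^sup>2) \<and> (control_mean U s \<omega>)\<^sup>2 \<le> control_square U s \<omega> \<and> q (\<omega>, s) = ennreal (control_square U s \<omega>)"
    if s: "s \<in> {t..T}" "\<omega> \<in> space M" "q (\<omega>, s) \<noteq> \<infinity>" for s \<omega>
  proof -
    have m: "(\<lambda>u. u) \<in> borel_measurable (proper_control U s \<omega>)"
      using sub(1)[OF s(1,2)] by (simp cong: measurable_cong_sets)
    have L: "L2 (proper_control U s \<omega>) (\<lambda>u. u)"
      using s by (intro L2I m) (simp add: q_def less_top)
    from prob_space.square_integral_ge[OF sub(2)[OF s(1,2)] L] L2_square[OF L] L2_nn_integral[OF L] s show ?thesis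
      by (simp add: control_mean_def control_square_def q_def)
  qed
  have AEg: "AE p in N. snd p \<in> {t..T} \<longrightarrow> integrable (proper_control U (snd p) (fst p)) (\<lambda>u. u\<^sup>2) \<and>
      (control_mean U (snd p) (fst p))\<^sup>2 \<le> control_square U (snd p) (fst p) \<and> q p = ennreal (control_square U (snd p) (fst p))"
    using fin AE_space
  proof eventually_elim
    case (elim p)
    then show ?case using good[of "snd p" "fst p"] by (auto simp: space_pair_measure)
  qed
  show *: "AE p in N. (indicator {t..T} (snd p) * control_mean U (snd p) (fst p))\<^sup>2 \<le> indicator {t..T} (snd p) * control_square U (snd p) (fst p)"
    using AEg by eventually_elim (auto simp: indicator_def)
  show i: "integrable N (\<lambda>p. indicator {t..T} (snd p) * control_square U (snd p) (fst p))"
  proof (rule integrableI_bounded[OF control_measurable_N(2)])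
    have "(\<integral>\<^sup>+p. ennreal (norm (indicator {t..T} (snd p) * control_square U (snd p) (fst p))) \<partial>N) = (\<integral>\<^sup>+p. q p \<partial>N)"
      by (rule nn_integral_cong_AE, use AEg in eventually_elim) (auto simp: q_def indicator_def control_square_nonneg)
    then show "(\<integral>\<^sup>+p. ennreal (norm (indicator {t..T} (snd p) * control_square U (snd p) (fst p))) \<partial>N) < \<infinity>"
      using control_second_moment by (simp add: q_def)
  qed
  show "L2 N (\<lambda>p. indicator {t..T} (snd p) * control_mean U (snd p) (fst p))"
    unfolding L2_def
  proof (intro conjI control_measurable_N(1) Bochner_Integration.integrable_bound[OF i] borel_measurable_power)
    show "AE p in N. norm ((indicator {t..T} (snd p) * control_mean U (snd p) (fst p))\<^sup>2) \<le> norm (indicator {t..T} (snd p) * control_square U (snd p) (fst p))"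
      using * by eventually_elim auto
  qed
  have AEi: "AE \<omega> in M. AE r in lborel. r \<in> {t..T} \<longrightarrow> integrable (proper_control U r \<omega>) (\<lambda>u. u\<^sup>2)"
    using AE_pair[OF AEg] by (simp add: eventually_mono)
  show "AE \<omega> in M. AE r in lborel. r \<in> {t..T} \<longrightarrow> real_distribution (U r \<omega>) \<and> integrable (U r \<omega>) (\<lambda>u. u\<^sup>2) \<and>
      dist_mean (U r \<omega>) = control_mean U r \<omega> \<and> (dist_mean (U r \<omega>))\<^sup>2 + dist_var (U r \<omega>) = control_square U r \<omega>"
    using control_AE AEi
  proof eventually_elim
    case (elim \<omega>)
    from elim show ?case
    proof eventually_elim
      case (elim r)
      then show ?case
        using proper_control_eq[of r \<omega>] by (auto simp: dist_mean_def dist_var_def control_mean_def control_square_def)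
    qed
  qed
qed

text \<open>The integral over \<open>s\<close> of the mean of \<open>U s \<omega>\<close> is a Bochner integral for the non-complete measure
  \<open>lborel\<close>, so it matters that the mean is Borel even at times when \<open>U s \<omega>\<close> is no probability measure.\<close>

lemma dist_mean_section:
  assumes \<omega>: "\<omega> \<in> space M"
  shows "(\<lambda>s. dist_mean (U (clamp s) \<omega>)) \<in> borel_measurable borel"
proof -
  have cl: "clamp \<in> borel \<rightarrow>\<^sub>M restrict_space borel {t..T}"
    unfolding clamp_def[abs_def]
  proof (rule measurable_restrict_space2)
    show "(\<lambda>s. max t (min T s)) \<in> borel_measurable borel" by measurable
  qed (use t in auto)
  have "(\<lambda>s. \<integral>v. v \<partial>U s \<omega>) \<in> borel_measurable (restrict_space borel {t..T})"
  proof (rule integral_measurable_kernel)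
    show "sets (U s \<omega>) = sets borel" if "s \<in> space (restrict_space borel {t..T})" for s
      using control_sets[OF _ \<omega>] that by (simp add: space_restrict_space)
    fix B :: "real set" assume "B \<in> sets borel"
    then have "(\<lambda>(s, \<omega>). measure (U s \<omega>) B) \<in> borel_measurable (restrict_space borel {t..T} \<Otimes>\<^sub>M F T)"
      using U t by (simp add: distributional_control_def progressive_def)
    from measurable_compose[OF measurable_Pair2' this, of \<omega>]
    show "(\<lambda>s. measure (U s \<omega>) B) \<in> borel_measurable (restrict_space borel {t..T})"
      using \<omega> space_F[of T] t by simp
  qed
  from measurable_compose[OF cl this] show ?thesis by (simp add: dist_mean_def)
qed

text \<open>The energy identity with drift \<rho>\<sigma> times the mean and squared volatility
  \<open>\<sigma>\<^sup>2\<close> times the second moment, both taken from the measurable versions,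
  after the Ito integral of the wealth equation has been carried over to them.\<close>

lemma control_energy:
  assumes wealth: "wealth_process M F W T \<rho> \<sigma> t x U X"
  defines "e \<equiv> \<lambda>\<kappa> w p. indicator {t..T} (snd p) * (exp (\<kappa> * (T - snd p)) *
        (- \<kappa> * (X (snd p) (fst p) - w)\<^sup>2 + 2 * (\<rho> * \<sigma> * control_mean U (snd p) (fst p)) * (X (snd p) (fst p) - w)
          + \<sigma>\<^sup>2 * control_square U (snd p) (fst p)))"
  shows "integrable N (e \<kappa> w)" and "L2 M (\<lambda>\<omega>. X T \<omega> - w)"
    and "expectation (\<lambda>\<omega>. (X T \<omega> - w)\<^sup>2) = exp (\<kappa> * (T - t)) * (x - w)\<^sup>2 + (\<integral>p. e \<kappa> w p \<partial>N)"
proof -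
  define d where "d = (\<lambda>s \<omega>. \<rho> * \<sigma> * control_mean U s \<omega>)"
  define H where "H = (\<lambda>s \<omega>. \<sigma> * sqrt (control_square U s \<omega>))"
  have X: "\<And>s. s \<in> {t..T} \<Longrightarrow> X s \<in> borel_measurable (F s)"
    and cont: "\<And>\<omega>. \<omega> \<in> space M \<Longrightarrow> continuous_on {t..T} (\<lambda>s. X s \<omega>)"
    and Ito: "\<And>u. u \<in> {t..T} \<Longrightarrow> has_Ito_integral M F W t u
        (\<lambda>s \<omega>. \<sigma> * sqrt ((dist_mean (U s \<omega>))\<^sup>2 + dist_var (U s \<omega>)))
        (\<lambda>\<omega>. X u \<omega> - x - (LBINT s:{t..u}. \<rho> * \<sigma> * dist_mean (U s \<omega>)))"
    using wealth by (auto simp: wealth_process_def)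
  have dL: "L2 N (\<lambda>p. indicator {t..T} (snd p) * d (snd p) (fst p))"
    using L2_cmult[OF control_data(2), of "\<rho> * \<sigma>"] by (simp add: d_def mult.left_commute)
  have dF: "d s \<in> borel_measurable (F s)" if "s \<in> {t..T}" for s
    using progressive_section[OF that control_mean_progressive(1)[OF that]] by (auto simp: d_def)
  have ito: "ito t u H (\<lambda>\<omega>. X u \<omega> - x - (\<integral>s. indicator {t..u} s * d s \<omega> \<partial>lborel))" if u: "u \<in> {t..T}" for u
  proof (rule ito_cong_AE)
    have u': "0 \<le> t" "t \<le> u" "u \<le> T" using u t by auto
    show "ito t u H (\<lambda>\<omega>. X u \<omega> - x - (LBINT s:{t..u}. \<rho> * \<sigma> * dist_mean (U s \<omega>)))"
    proof (rule ito_of_has_Ito_integral[OF Ito[OF u] u'])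
      have "(\<lambda>p. indicator {t..u} (snd p) * (\<sigma> * sqrt (indicator {t..T} (snd p) * control_square U (snd p) (fst p)))) \<in> borel_measurable N"
      proof (intro borel_measurable_times borel_measurable_const)
        show "(\<lambda>p. indicator {t..u} (snd p) :: real) \<in> borel_measurable N" by measurable
        show "(\<lambda>p. sqrt (indicator {t..T} (snd p) * control_square U (snd p) (fst p))) \<in> borel_measurable N"
          by (rule measurable_compose[OF control_measurable_N(2) borel_measurable_sqrt])
      qed
      also have "(\<lambda>p. indicator {t..u} (snd p) * (\<sigma> * sqrt (indicator {t..T} (snd p) * control_square U (snd p) (fst p)))) =
        (\<lambda>p. indicator {t..u} (snd p) * H (snd p) (fst p))"
        using u' by (auto simp: H_def indicator_def fun_eq_iff)
      finally show "(\<lambda>p. indicator {t..u} (snd p) * H (snd p) (fst p)) \<in> borel_measurable N" .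
      show "AE \<omega> in M. AE r in lborel. r \<in> {t..u} \<longrightarrow> \<sigma> * sqrt ((dist_mean (U r \<omega>))\<^sup>2 + dist_var (U r \<omega>)) = H r \<omega>"
        using control_data(3)
      proof eventually_elim
        case (elim \<omega>)
        then show ?case by eventually_elim (use u' in \<open>auto simp: H_def\<close>)
      qed
    qed
    have dm: "(\<lambda>p. indicator {t..u} (snd p) * d (snd p) (fst p)) \<in> borel_measurable N"
    proof -
      have "(\<lambda>p. indicator {t..u} (snd p) * (indicator {t..T} (snd p) * d (snd p) (fst p))) \<in> borel_measurable N"
      proof (rule borel_measurable_times[OF _ L2_measurable[OF dL]])
        show "(\<lambda>p. indicator {t..u} (snd p) :: real) \<in> borel_measurable N" by measurable
      qed
      also have "(\<lambda>p. indicator {t..u} (snd p) * (indicator {t..T} (snd p) * d (snd p) (fst p))) = (\<lambda>p. indicator {t..u} (snd p) * d (snd p) (fst p))"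
        using u' by (auto simp: indicator_def fun_eq_iff)
      finally show ?thesis .
    qed
    have "(\<lambda>\<omega>. \<integral>s. indicator {t..u} s * d s \<omega> \<partial>lborel) \<in> borel_measurable M"
      by (rule lborel.borel_measurable_lebesgue_integral) (use dm in \<open>simp add: case_prod_beta\<close>)
    then show "(\<lambda>\<omega>. X u \<omega> - x - (\<integral>s. indicator {t..u} s * d s \<omega> \<partial>lborel)) \<in> borel_measurable M"
      using measurable_F_M[OF _ _ X[OF u]] u' by (intro borel_measurable_diff) auto
    show "AE \<omega> in M. X u \<omega> - x - (LBINT s:{t..u}. \<rho> * \<sigma> * dist_mean (U s \<omega>)) =
      X u \<omega> - x - (\<integral>s. indicator {t..u} s * d s \<omega> \<partial>lborel)"
      using control_data(3) AE_space
    proof eventually_elim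
      case (elim \<omega>)
      have dms: "(\<lambda>s. indicator {t..u} s * d s \<omega>) \<in> borel_measurable lborel"
        using measurable_compose[OF measurable_Pair1' dm, of \<omega>] elim(2) by simp
      have "(LBINT s:{t..u}. \<rho> * \<sigma> * dist_mean (U s \<omega>)) = (\<integral>s. indicator {t..u} s * d s \<omega> \<partial>lborel)"
        unfolding set_lebesgue_integral_def real_scaleR_def
      proof (rule integral_cong_AE[OF _ dms])
        have "(\<lambda>s. indicator {t..u} s * (\<rho> * \<sigma> * dist_mean (U (clamp s) \<omega>))) \<in> borel_measurable lborel"
          using dist_mean_section[OF elim(2)] by simp
        also have "(\<lambda>s. indicator {t..u} s * (\<rho> * \<sigma> * dist_mean (U (clamp s) \<omega>))) = (\<lambda>s. indicator {t..u} s * (\<rho> * \<sigma> * dist_mean (U s \<omega>)))"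
          using u' by (auto simp: clamp_def indicator_def fun_eq_iff)
        finally show "(\<lambda>s. indicator {t..u} s * (\<rho> * \<sigma> * dist_mean (U s \<omega>))) \<in> borel_measurable lborel" .
        show "AE s in lborel. indicator {t..u} s * (\<rho> * \<sigma> * dist_mean (U s \<omega>)) = indicator {t..u} s * d s \<omega>"
          using elim(1) by eventually_elim (use u' in \<open>auto simp: d_def indicator_def\<close>)
      qed
      then show ?case by simp
    qed
  qed
  note en = energy_identity[OF t X cont dL dF ito]
  have e: "e \<kappa> w = (\<lambda>p. indicator {t..T} (snd p) * (exp (\<kappa> * (T - snd p)) *
        (- \<kappa> * (X (snd p) (fst p) - w)\<^sup>2 + 2 * d (snd p) (fst p) * (X (snd p) (fst p) - w) + (H (snd p) (fst p))\<^sup>2)))"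
    by (simp add: e_def d_def H_def power_mult_distrib control_square_nonneg)
  show "integrable N (e \<kappa> w)" unfolding e by (rule en(1))
  show "L2 M (\<lambda>\<omega>. X T \<omega> - w)" by (rule en(2))
  show "expectation (\<lambda>\<omega>. (X T \<omega> - w)\<^sup>2) = exp (\<kappa> * (T - t)) * (x - w)\<^sup>2 + (\<integral>p. e \<kappa> w p \<partial>N)"
    unfolding e by (rule en(3))
qed

end

end

section \<open>Costs\<close>

lemma ext_integral_cong_AE:
  assumes "AE x in M. f x = g x"
  shows "ext_integral M f = ext_integral M g"
proof (rule antisym)
  show "ext_integral M f \<le> ext_integral M g"
    by (rule ext_integral_mono_AE, use assms in eventually_elim) simp
  show "ext_integral M g \<le> ext_integral M f"
    by (rule ext_integral_mono_AE, use assms in eventually_elim) simp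
qed

lemma ext_integral_interval:
  fixes f :: "real \<Rightarrow> real"
  assumes "integrable lborel (\<lambda>s. indicator {t..T} s * f s)"
  shows "ext_integral (restrict_space lborel {t..T}) (\<lambda>s. ereal (f s)) = ereal (\<integral>s. indicator {t..T} s * f s \<partial>lborel)"
proof -
  have "integrable (restrict_space lborel {t..T}) f"
    using assms by (subst integrable_restrict_space) simp_all
  from ext_integral_real[OF this] show ?thesis
    by (subst (asm) integral_restrict_space) simp_all
qed

lemma integrable_indicator_continuous:
  fixes f :: "real \<Rightarrow> real"
  assumes "continuous_on {t..T} f"
  shows "integrable lborel (\<lambda>s. indicator {t..T} s * f s)"
  using borel_integrable_atLeastAtMost'[OF assms] by (simp add: set_integrable_def)

context brownian_motion
begin

text \<open>\<open>c s\<close> bounds \<open>lam\<close> times the regularizer minus the weighted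
  variance cost, uniformly over distributions. Subtracting that cost from the energy integrand for
  \<open>\<kappa> = - \<rho>\<^sup>2\<close> leaves a weighted square, so the expectation is bounded
  below.\<close>

lemma cost_lower_bound:
  assumes t: "0 \<le> t" "t \<le> T" and U: "distributional_control M F T t U"
    and wealth: "wealth_process M F W T \<rho> \<sigma> t x U X" and lam: "0 < lam"
    and c: "continuous_on {t..T} c"
    and R: "\<And>s P. s \<in> {t..T} \<Longrightarrow> real_distribution P \<Longrightarrow> integrable P (\<lambda>u. u\<^sup>2) \<Longrightarrow>
      R P \<le> ereal ((exp (- \<rho>\<^sup>2 * (T - s)) * \<sigma>\<^sup>2 * dist_var P + c s) / lam)"
  shows "ereal (exp (- \<rho>\<^sup>2 * (T - t)) * (x - w)\<^sup>2 - (\<integral>s. indicator {t..T} s * c s \<partial>lborel))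
    \<le> expected_cost M T lam R t w U X"
proof -
  define k where "k = (\<lambda>s. exp (- \<rho>\<^sup>2 * (T - s)))"
  define C where "C = (\<integral>s. indicator {t..T} s * c s \<partial>lborel)"
  define m where "m = (\<lambda>p. indicator {t..T} (snd p) * control_mean U (snd p) (fst p))"
  define q where "q = (\<lambda>p. indicator {t..T} (snd p) * control_square U (snd p) (fst p))"
  define Y where "Y = (\<lambda>p. X (snd p) (fst p) - w)"
  define v where "v = (\<lambda>p. k (snd p) * \<sigma>\<^sup>2 * (q p - (m p)\<^sup>2))"
  define e where "e = (\<lambda>p. indicator {t..T} (snd p) * (exp (- \<rho>\<^sup>2 * (T - snd p)) *
        (- (- \<rho>\<^sup>2) * (X (snd p) (fst p) - w)\<^sup>2 + 2 * (\<rho> * \<sigma> * control_mean U (snd p) (fst p)) * (X (snd p) (fst p) - w)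
          + \<sigma>\<^sup>2 * control_square U (snd p) (fst p))))"
  have e: "integrable N e" and XT: "L2 M (\<lambda>\<omega>. X T \<omega> - w)"
    and E: "expectation (\<lambda>\<omega>. (X T \<omega> - w)\<^sup>2) = k t * (x - w)\<^sup>2 + (\<integral>p. e p \<partial>N)"
    unfolding e_def k_def by (rule control_energy[OF t U wealth])+
  have q: "integrable N q" and m: "L2 N m" unfolding q_def m_def by (rule control_data[OF t U])+
  have v: "integrable N v"
  proof (rule Bochner_Integration.integrable_bound)
    show "integrable N (\<lambda>p. \<sigma>\<^sup>2 * (q p - (m p)\<^sup>2))"
      using q L2_square[OF m] by (intro integrable_mult_right Bochner_Integration.integrable_diff)
    show "v \<in> borel_measurable N"
      unfolding v_def k_def using borel_measurable_integrable[OF q] L2_measurable[OF m] by measurable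
    show "AE p in N. norm (v p) \<le> norm (\<sigma>\<^sup>2 * (q p - (m p)\<^sup>2))"
    proof (rule AE_I2)
      fix p :: "'a \<times> real"
      show "norm (v p) \<le> norm (\<sigma>\<^sup>2 * (q p - (m p)\<^sup>2))"
      proof (cases "snd p \<in> {t..T}")
        case True
        then have "k (snd p) \<le> 1" "0 \<le> k (snd p)" by (auto simp: k_def)
        then show ?thesis
          using mult_right_mono[of "k (snd p)" 1 "\<bar>\<sigma>\<^sup>2 * (q p - (m p)\<^sup>2)\<bar>"] by (simp add: v_def abs_mult mult.assoc)
      qed (simp add: v_def q_def m_def)
    qed
  qed
  note vN = integral_N[OF v]
  have cI: "integrable lborel (\<lambda>s. indicator {t..T} s * c s)" by (rule integrable_indicator_continuous[OF c])
  have run: "AE \<omega> in M. ext_integral (restrict_space lborel {t..T}) (\<lambda>s. R (U s \<omega>)) \<le>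
      ereal (((\<integral>s. v (\<omega>, s) \<partial>lborel) + C) / lam)"
    using control_data(3)[OF t U] vN(5)
  proof eventually_elim
    case (elim \<omega>)
    have eq: "indicator {t..T} s * ((v (\<omega>, s) + c s) / lam) = (v (\<omega>, s) + indicator {t..T} s * c s) / lam" for s
      by (simp add: v_def q_def m_def indicator_def)
    have "ext_integral (restrict_space lborel {t..T}) (\<lambda>s. R (U s \<omega>)) \<le>
        ext_integral (restrict_space lborel {t..T}) (\<lambda>s. ereal ((v (\<omega>, s) + c s) / lam))"
    proof (rule ext_integral_mono_AE)
      have "AE s in lborel. s \<in> {t..T} \<longrightarrow> R (U s \<omega>) \<le> ereal ((v (\<omega>, s) + c s) / lam)"
        using elim(1)
      proof eventually_elim
        case (elim s)
        show ?case
        proof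
          assume s: "s \<in> {t..T}"
          have var: "dist_var (U s \<omega>) = control_square U s \<omega> - (control_mean U s \<omega>)\<^sup>2"
            using elim s by (auto simp: algebra_simps)
          have "R (U s \<omega>) \<le> ereal ((exp (- \<rho>\<^sup>2 * (T - s)) * \<sigma>\<^sup>2 * dist_var (U s \<omega>) + c s) / lam)"
            using elim s by (intro R) auto
          then show "R (U s \<omega>) \<le> ereal ((v (\<omega>, s) + c s) / lam)"
            using s by (simp add: var v_def k_def q_def m_def)
        qed
      qed
      then show "AE s in restrict_space lborel {t..T}. R (U s \<omega>) \<le> ereal ((v (\<omega>, s) + c s) / lam)"
        by (subst AE_restrict_space_iff) simp_all
    qed
    also have "\<dots> = ereal (\<integral>s. indicator {t..T} s * ((v (\<omega>, s) + c s) / lam) \<partial>lborel)"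
    proof (rule ext_integral_interval)
      show "integrable lborel (\<lambda>s. indicator {t..T} s * ((v (\<omega>, s) + c s) / lam))"
        unfolding eq using elim(2) cI by (intro integrable_divide Bochner_Integration.integrable_add)
    qed
    also have "(\<integral>s. indicator {t..T} s * ((v (\<omega>, s) + c s) / lam) \<partial>lborel) = ((\<integral>s. v (\<omega>, s) \<partial>lborel) + C) / lam"
      unfolding eq C_def using Bochner_Integration.integral_add[OF elim(2) cI] by simp
    finally show ?case .
  qed
  have I: "integrable M (\<lambda>\<omega>. (X T \<omega> - w)\<^sup>2 - ((\<integral>s. v (\<omega>, s) \<partial>lborel) + C))"
    by (intro Bochner_Integration.integrable_diff L2_square[OF XT] Bochner_Integration.integrable_add vN(3) integrable_const)
  have "ereal (k t * (x - w)\<^sup>2 - C) \<le> ereal (\<integral>\<omega>. (X T \<omega> - w)\<^sup>2 - ((\<integral>s. v (\<omega>, s) \<partial>lborel) + C) \<partial>M)"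
  proof -
    have "(\<integral>\<omega>. (X T \<omega> - w)\<^sup>2 - ((\<integral>s. v (\<omega>, s) \<partial>lborel) + C) \<partial>M) =
        expectation (\<lambda>\<omega>. (X T \<omega> - w)\<^sup>2) - ((\<integral>p. v p \<partial>N) + C)"
      using L2_square[OF XT] vN(3) by (simp add: vN(1) prob_space)
    also have "\<dots> = k t * (x - w)\<^sup>2 + (\<integral>p. e p - v p \<partial>N) - C"
      using Bochner_Integration.integral_diff[OF e v] by (simp add: E)
    finally have *: "(\<integral>\<omega>. (X T \<omega> - w)\<^sup>2 - ((\<integral>s. v (\<omega>, s) \<partial>lborel) + C) \<partial>M) = k t * (x - w)\<^sup>2 + (\<integral>p. e p - v p \<partial>N) - C" .
    have "0 \<le> (\<integral>p. e p - v p \<partial>N)"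
    proof (rule Bochner_Integration.integral_nonneg)
      fix p :: "'a \<times> real"
      \<comment> \<open>Completing the square: the three remaining terms are those of
        \<open>(\<rho> * Y p + \<sigma> * m p)\<^sup>2\<close>.\<close>
      have "e p - v p = indicator {t..T} (snd p) * (k (snd p) * (\<rho> * Y p + \<sigma> * m p)\<^sup>2)"
        by (simp add: e_def v_def k_def Y_def m_def q_def power2_eq_square algebra_simps indicator_def)
      also have "\<dots> \<ge> 0" by (simp add: k_def indicator_def)
      finally show "0 \<le> e p - v p" .
    qed
    then show ?thesis unfolding * by simp
  qed
  also have "\<dots> = ext_integral M (\<lambda>\<omega>. ereal ((X T \<omega> - w)\<^sup>2 - ((\<integral>s. v (\<omega>, s) \<partial>lborel) + C)))"
    by (rule ext_integral_real[OF I, symmetric])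
  also have "\<dots> \<le> expected_cost M T lam R t w U X"
    unfolding expected_cost_def
  proof (rule ext_integral_mono_AE, use run in eventually_elim)
    fix \<omega>
    let ?I = "ext_integral (restrict_space lborel {t..T}) (\<lambda>s. R (U s \<omega>))"
    assume "?I \<le> ereal (((\<integral>s. v (\<omega>, s) \<partial>lborel) + C) / lam)"
    then have "ereal lam * ?I \<le> ereal lam * ereal (((\<integral>s. v (\<omega>, s) \<partial>lborel) + C) / lam)"
      using lam by (intro ereal_mult_left_mono) auto
    also have "\<dots> = ereal ((\<integral>s. v (\<omega>, s) \<partial>lborel) + C)" using lam by simp
    finally have "ereal ((X T \<omega> - w)\<^sup>2) - ereal ((\<integral>s. v (\<omega>, s) \<partial>lborel) + C) \<le> ereal ((X T \<omega> - w)\<^sup>2) - ereal lam * ?I"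
      by (intro ereal_minus_mono) auto
    then show "ereal ((X T \<omega> - w)\<^sup>2 - ((\<integral>s. v (\<omega>, s) \<partial>lborel) + C)) \<le> ereal ((X T \<omega> - w)\<^sup>2) - ereal lam * ?I" by simp
  qed
  finally show ?thesis by (simp add: k_def C_def)
qed

text \<open>\<kappa> is the value for which \<open>- \<kappa> + 2 * \<rho> * \<sigma> * \<alpha> +
  \<sigma>\<^sup>2 * \<alpha>\<^sup>2\<close> vanishes, so the wealth drops out of the energy
  integrand. The cost is then the same for every solution \<open>X\<close>.\<close>

lemma feedback_cost:
  assumes t: "0 \<le> t" "t \<le> T" and U: "distributional_control M F T t U"
    and wealth: "wealth_process M F W T \<rho> \<sigma> t x U X"
    and P: "\<And>s \<omega>. s \<in> {t..T} \<Longrightarrow> \<omega> \<in> space M \<Longrightarrow> real_distribution (U s \<omega>)"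
    and mean: "\<And>s \<omega>. s \<in> {t..T} \<Longrightarrow> \<omega> \<in> space M \<Longrightarrow> dist_mean (U s \<omega>) = \<alpha> * (X s \<omega> - w)"
    and var: "\<And>s \<omega>. s \<in> {t..T} \<Longrightarrow> \<omega> \<in> space M \<Longrightarrow> dist_var (U s \<omega>) = v s"
    and R: "\<And>s \<omega>. s \<in> {t..T} \<Longrightarrow> \<omega> \<in> space M \<Longrightarrow> R (U s \<omega>) = ereal (r s)"
    and vc: "continuous_on {t..T} v" and rc: "continuous_on {t..T} r"
  defines "\<kappa> \<equiv> 2 * \<rho> * \<sigma> * \<alpha> + \<sigma>\<^sup>2 * \<alpha>\<^sup>2"
  shows "expected_cost M T lam R t w U X = ereal (exp (\<kappa> * (T - t)) * (x - w)\<^sup>2 +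
    (\<integral>s. indicator {t..T} s * (exp (\<kappa> * (T - s)) * \<sigma>\<^sup>2 * v s - lam * r s) \<partial>lborel))"
proof -
  define e where "e = (\<lambda>p. indicator {t..T} (snd p) * (exp (\<kappa> * (T - snd p)) *
        (- \<kappa> * (X (snd p) (fst p) - w)\<^sup>2 + 2 * (\<rho> * \<sigma> * control_mean U (snd p) (fst p)) * (X (snd p) (fst p) - w)
          + \<sigma>\<^sup>2 * control_square U (snd p) (fst p))))"
  have e: "integrable N e" and XT: "L2 M (\<lambda>\<omega>. X T \<omega> - w)"
    and E: "expectation (\<lambda>\<omega>. (X T \<omega> - w)\<^sup>2) = exp (\<kappa> * (T - t)) * (x - w)\<^sup>2 + (\<integral>p. e p \<partial>N)"
    unfolding e_def by (rule control_energy[OF t U wealth])+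
  define Rr where "Rr = (\<integral>s. indicator {t..T} s * r s \<partial>lborel)"
  have e_eq: "e (\<omega>, s) = indicator {t..T} s * (exp (\<kappa> * (T - s)) * \<sigma>\<^sup>2 * v s)" if \<omega>: "\<omega> \<in> space M" for \<omega> s
  proof (cases "s \<in> {t..T}")
    case True
    have pc: "proper_control U s \<omega> = U s \<omega>" by (rule proper_control_eq[OF t U P[OF True \<omega>]])
    have cm: "control_mean U s \<omega> = \<alpha> * (X s \<omega> - w)"
      using mean[OF True \<omega>] by (simp add: control_mean_def pc dist_mean_def)
    have cs: "control_square U s \<omega> = v s + (\<alpha> * (X s \<omega> - w))\<^sup>2"
      using var[OF True \<omega>] mean[OF True \<omega>] by (simp add: control_square_def pc dist_var_def)
    show ?thesis using True by (simp add: e_def cm cs \<kappa>_def power2_eq_square algebra_simps)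
  qed (simp add: e_def)
  have "(\<integral>p. e p \<partial>N) = (\<integral>\<omega>. \<integral>s. e (\<omega>, s) \<partial>lborel \<partial>M)" by (rule integral_N(1)[OF e])
  also have "\<dots> = (\<integral>\<omega>. (\<integral>s. indicator {t..T} s * (exp (\<kappa> * (T - s)) * \<sigma>\<^sup>2 * v s) \<partial>lborel) \<partial>M)"
    by (rule Bochner_Integration.integral_cong[OF refl]) (simp add: e_eq)
  also have "\<dots> = (\<integral>s. indicator {t..T} s * (exp (\<kappa> * (T - s)) * \<sigma>\<^sup>2 * v s) \<partial>lborel)" by (simp add: prob_space)
  finally have eN: "(\<integral>p. e p \<partial>N) = (\<integral>s. indicator {t..T} s * (exp (\<kappa> * (T - s)) * \<sigma>\<^sup>2 * v s) \<partial>lborel)" .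
  have run: "ext_integral (restrict_space lborel {t..T}) (\<lambda>s. R (U s \<omega>)) = ereal Rr" if \<omega>: "\<omega> \<in> space M" for \<omega>
  proof -
    have "ext_integral (restrict_space lborel {t..T}) (\<lambda>s. R (U s \<omega>)) = ext_integral (restrict_space lborel {t..T}) (\<lambda>s. ereal (r s))"
      by (rule ext_integral_cong_AE, rule AE_I2) (simp add: space_restrict_space R \<omega>)
    then show ?thesis using ext_integral_interval[OF integrable_indicator_continuous[OF rc]] by (simp add: Rr_def)
  qed
  have "expected_cost M T lam R t w U X = ext_integral M (\<lambda>\<omega>. ereal ((X T \<omega> - w)\<^sup>2 - lam * Rr))"
    unfolding expected_cost_def by (rule ext_integral_cong_AE, rule AE_I2) (simp add: run)
  also have "\<dots> = ereal (\<integral>\<omega>. (X T \<omega> - w)\<^sup>2 - lam * Rr \<partial>M)"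
    using L2_square[OF XT] by (intro ext_integral_real) simp
  also have "(\<integral>\<omega>. (X T \<omega> - w)\<^sup>2 - lam * Rr \<partial>M) = exp (\<kappa> * (T - t)) * (x - w)\<^sup>2 +
      ((\<integral>s. indicator {t..T} s * (exp (\<kappa> * (T - s)) * \<sigma>\<^sup>2 * v s) \<partial>lborel) - lam * Rr)"
    using L2_square[OF XT] by (simp add: E eN prob_space)
  also have "(\<integral>s. indicator {t..T} s * (exp (\<kappa> * (T - s)) * \<sigma>\<^sup>2 * v s) \<partial>lborel) - lam * Rr =
      (\<integral>s. indicator {t..T} s * (exp (\<kappa> * (T - s)) * \<sigma>\<^sup>2 * v s) - lam * (indicator {t..T} s * r s) \<partial>lborel)"
  proof -
    have "integrable lborel (\<lambda>s. indicator {t..T} s * (exp (\<kappa> * (T - s)) * \<sigma>\<^sup>2 * v s))"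
      by (intro integrable_indicator_continuous continuous_intros vc)
    from Bochner_Integration.integral_diff[OF this integrable_mult_right[OF integrable_indicator_continuous[OF rc], of lam]]
    show ?thesis by (simp add: Rr_def)
  qed
  also have "\<dots> = (\<integral>s. indicator {t..T} s * (exp (\<kappa> * (T - s)) * \<sigma>\<^sup>2 * v s - lam * r s) \<partial>lborel)"
    by (rule Bochner_Integration.integral_cong[OF refl]) (simp add: algebra_simps)
  finally show ?thesis .
qed

end

section \<open>Closed-loop wealth\<close>

lemma exp_lipschitz:
  fixes a b C :: real
  assumes "a \<le> C" "b \<le> C"
  shows "\<bar>exp a - exp b\<bar> \<le> exp C * \<bar>a - b\<bar>"
proof -
  have *: "exp a - exp b \<le> exp C * \<bar>a - b\<bar>" if "a \<le> C" for a b :: real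
  proof -
    have "exp a - exp b = exp a * (1 - exp (b - a))" by (simp add: right_diff_distrib flip: exp_add)
    also have "\<dots> \<le> exp a * (a - b)"
    proof (rule mult_left_mono)
      show "1 - exp (b - a) \<le> a - b" using exp_ge_add_one_self[of "b - a"] by linarith
    qed simp
    also have "\<dots> \<le> exp a * \<bar>a - b\<bar>" by (intro mult_left_mono) auto
    also have "\<dots> \<le> exp C * \<bar>a - b\<bar>" using that by (intro mult_right_mono) auto
    finally show ?thesis .
  qed
  show ?thesis using *[OF assms(1), of b] *[OF assms(2), of a] by (simp add: abs_minus_commute abs_le_iff)
qed

text \<open>The reverse triangle inequality of the Euclidean norm. It makes the volatility Lipschitz
  although the square root itself is not Lipschitz at 0.\<close>

lemma sqrt_sum_squares_lipschitz:
  "\<bar>sqrt (a\<^sup>2 + b\<^sup>2) - sqrt (a'\<^sup>2 + b'\<^sup>2)\<bar> \<le> \<bar>a - a'\<bar> + \<bar>b - b'\<bar>"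
proof -
  have *: "sqrt (a\<^sup>2 + b\<^sup>2) - sqrt (a'\<^sup>2 + b'\<^sup>2) \<le> \<bar>a - a'\<bar> + \<bar>b - b'\<bar>" for a b a' b' :: real
    using real_sqrt_sum_squares_triangle_ineq[of "a - a'" a' "b - b'" b'] sqrt_sum_squares_le_sum_abs[of "a - a'" "b - b'"]
    by simp
  show ?thesis using *[of a b a' b'] *[of a' b' a b] by (simp add: abs_minus_commute abs_le_iff)
qed

lemma has_Ito_integral_cong:
  assumes H: "\<And>s \<omega>. s \<in> {t..u} \<Longrightarrow> \<omega> \<in> space M \<Longrightarrow> H s \<omega> = H' s \<omega>"
    and J: "\<And>\<omega>. \<omega> \<in> space M \<Longrightarrow> J \<omega> = J' \<omega>"
    and Ito: "has_Ito_integral M F W t u H J"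
  shows "has_Ito_integral M F W t u H' J'"
proof -
  have 1: "(\<integral>\<^sup>+\<omega>. (\<integral>\<^sup>+s\<in>{t..u}. ennreal ((H s \<omega> - \<phi> s \<omega>)\<^sup>2) \<partial>lborel) \<partial>M) =
      (\<integral>\<^sup>+\<omega>. (\<integral>\<^sup>+s\<in>{t..u}. ennreal ((H' s \<omega> - \<phi> s \<omega>)\<^sup>2) \<partial>lborel) \<partial>M)" for \<phi>
    by (intro nn_integral_cong) (auto simp: H indicator_def)
  have 2: "(\<integral>\<^sup>+\<omega>. ennreal ((J \<omega> - \<psi> \<omega>)\<^sup>2) \<partial>M) = (\<integral>\<^sup>+\<omega>. ennreal ((J' \<omega> - \<psi> \<omega>)\<^sup>2) \<partial>M)" for \<psi>
    by (intro nn_integral_cong) (simp add: J)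
  have 3: "J \<in> borel_measurable M \<longleftrightarrow> J' \<in> borel_measurable M" by (rule measurable_cong) (rule J)
  show ?thesis using Ito unfolding has_Ito_integral_def 1 2 3 .
qed

text \<open>The probability of \<open>A\<close> is an integral over the level \<open>q\<close> of a
  function measurable in level and parameters jointly. Inserting the wealth and the scale then gives
  progressive measurability of the generated control.\<close>

lemma (in distortion) measure_location_scale_measurable:
  assumes A: "A \<in> sets borel"
  shows "(\<lambda>p. measure (distr unif borel (\<lambda>q. fst p + snd p * D (1 - q))) A) \<in> borel_measurable (borel \<Otimes>\<^sub>M borel)"
proof -
  interpret U: prob_space unif by (rule prob_space_unif)
  note [measurable] = L2_measurable[OF D_reflect_L2]
  have "measure (distr unif borel (\<lambda>q. fst p + snd p * D (1 - q))) A = (\<integral>q. indicator A (fst p + snd p * D (1 - q)) \<partial>unif)" for p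
  proof -
    have m: "(\<lambda>q. fst p + snd p * D (1 - q)) \<in> borel_measurable unif" by measurable
    interpret P: prob_space "distr unif borel (\<lambda>q. fst p + snd p * D (1 - q))" by (rule U.prob_space_distr[OF m])
    have "measure (distr unif borel (\<lambda>q. fst p + snd p * D (1 - q))) A = (\<integral>v. indicator A v \<partial>distr unif borel (\<lambda>q. fst p + snd p * D (1 - q)))"
      using A by simp
    also have "\<dots> = (\<integral>q. indicator A (fst p + snd p * D (1 - q)) \<partial>unif)"
      using A by (intro integral_distr m) simp
    finally show ?thesis .
  qed
  moreover have "(\<lambda>p. \<integral>q. indicator A (fst p + snd p * D (1 - q)) \<partial>unif :: real) \<in> borel_measurable (borel \<Otimes>\<^sub>M borel)"
  proof (rule U.borel_measurable_lebesgue_integral)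
    have "(\<lambda>z. fst (fst z) + snd (fst z) * D (1 - snd z)) \<in> borel_measurable ((borel \<Otimes>\<^sub>M borel) \<Otimes>\<^sub>M unif)" by measurable
    from measurable_compose[OF this, of "indicator A :: real \<Rightarrow> real" borel] A
    show "(\<lambda>(p, q). indicator A (fst p + snd p * D (1 - q)) :: real) \<in> borel_measurable ((borel \<Otimes>\<^sub>M borel) \<Otimes>\<^sub>M unif)"
      by (simp add: case_prod_beta)
  qed
  ultimately show ?thesis by simp
qed

locale exploratory_market = brownian_motion M F T W + distortion h
  for M :: "'a measure" and F :: "real \<Rightarrow> 'a measure" and T :: real
    and W :: "real \<Rightarrow> 'a \<Rightarrow> real" and h :: "real \<Rightarrow> real" +
  fixes \<rho> \<sigma> lam z :: real
  assumes \<sigma>: "0 < \<sigma>" and lam: "0 < lam" and nontrivial: "\<exists>p\<in>{0..1}. h p \<noteq> 0"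
begin

text \<open>In this family the mean is affine in the wealth and the standard deviation is a
  deterministic function of time, so drift and volatility are Lipschitz and the Euler limit is a
  closed-loop wealth process.\<close>

lemma closed_loop_exists:
  assumes t: "0 \<le> t" "t \<le> T" and fb: "feedback_control T P"
    and q: "\<And>s y. s \<in> {0..T} \<Longrightarrow> has_quantile_function (P s y w)
      (\<lambda>p. \<alpha> * (y - w) + c * exp (d * (T - s)) * D (1 - p))"
  shows "\<exists>X. distributional_control M F T t (generated_control P w X) \<and>
    wealth_process M F W T \<rho> \<sigma> t x (generated_control P w X) X"
proof -
  define n where "n = deriv_norm2 h"
  \<comment> \<open>The Lipschitz condition is required for all real times, while the exponential is
    Lipschitz on bounded sets only; clamping to \<open>{0..T}\<close> reconciles the two.\<close>
  define cl where "cl = (\<lambda>s. max 0 (min T s))"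
  define k where "k = (\<lambda>s. c * exp (d * (T - cl s)))"
  define b where "b = (\<lambda>(s::real) y. \<rho> * \<sigma> * \<alpha> * (y - w))"
  define g where "g = (\<lambda>s y. \<sigma> * sqrt ((\<alpha> * (y - w))\<^sup>2 + (k s * n)\<^sup>2))"
  \<comment> \<open>Lipschitz constant of the scale \<open>k\<close>: the exponent is at most
    \<open>\<bar>d\<bar> * T\<close> and changes at rate at most
    \<open>\<bar>d\<bar>\<close>.\<close>
  define Lc where "Lc = \<bar>c\<bar> * (exp (\<bar>d\<bar> * T) * \<bar>d\<bar>)"
  define L where "L = \<bar>\<rho> * \<sigma> * \<alpha>\<bar> + \<sigma> * \<bar>\<alpha>\<bar> + \<sigma> * (Lc * \<bar>n\<bar>)"
  have T0: "0 \<le> T" using t by simp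
  have k_lip: "\<bar>k s - k s'\<bar> \<le> Lc * \<bar>s - s'\<bar>" for s s'
  proof -
    have bd: "d * (T - cl s) \<le> \<bar>d\<bar> * T" for s
    proof -
      have "d * (T - cl s) \<le> \<bar>d\<bar> * (T - cl s)" using T0 by (intro mult_right_mono) (auto simp: cl_def)
      also have "\<dots> \<le> \<bar>d\<bar> * T" by (intro mult_left_mono) (auto simp: cl_def)
      finally show ?thesis .
    qed
    have "\<bar>exp (d * (T - cl s)) - exp (d * (T - cl s'))\<bar> \<le> exp (\<bar>d\<bar> * T) * \<bar>d * (T - cl s) - d * (T - cl s')\<bar>"
      by (rule exp_lipschitz[OF bd bd])
    also have "\<bar>d * (T - cl s) - d * (T - cl s')\<bar> = \<bar>d\<bar> * \<bar>cl s - cl s'\<bar>"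
      by (simp add: abs_minus_commute flip: right_diff_distrib abs_mult)
    also have "exp (\<bar>d\<bar> * T) * (\<bar>d\<bar> * \<bar>cl s - cl s'\<bar>) \<le> exp (\<bar>d\<bar> * T) * (\<bar>d\<bar> * \<bar>s - s'\<bar>)"
      by (intro mult_left_mono) (auto simp: cl_def)
    finally have "\<bar>c\<bar> * \<bar>exp (d * (T - cl s)) - exp (d * (T - cl s'))\<bar> \<le> \<bar>c\<bar> * (exp (\<bar>d\<bar> * T) * (\<bar>d\<bar> * \<bar>s - s'\<bar>))"
      by (intro mult_left_mono) auto
    then show ?thesis by (simp add: k_def Lc_def mult.assoc flip: right_diff_distrib abs_mult)
  qed
  have Lc0: "0 \<le> Lc" by (simp add: Lc_def)
  have nonneg: "0 \<le> \<bar>\<rho> * \<sigma> * \<alpha>\<bar>" "0 \<le> \<sigma> * \<bar>\<alpha>\<bar>" "0 \<le> \<sigma> * (Lc * \<bar>n\<bar>)" using \<sigma> Lc0 by simp_all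
  have b_lip: "\<bar>b s y - b s' y'\<bar> \<le> L * (\<bar>s - s'\<bar> + \<bar>y - y'\<bar>)" for s s' y y'
  proof -
    have "\<bar>b s y - b s' y'\<bar> = \<bar>\<rho> * \<sigma> * \<alpha>\<bar> * \<bar>y - y'\<bar>" by (simp add: b_def flip: right_diff_distrib abs_mult)
    also have "\<dots> \<le> L * (\<bar>s - s'\<bar> + \<bar>y - y'\<bar>)" using nonneg by (intro mult_mono) (auto simp: L_def)
    finally show ?thesis .
  qed
  have g_lip: "\<bar>g s y - g s' y'\<bar> \<le> L * (\<bar>s - s'\<bar> + \<bar>y - y'\<bar>)" for s s' y y'
  proof -
    have "\<bar>g s y - g s' y'\<bar> = \<sigma> * \<bar>sqrt ((\<alpha> * (y - w))\<^sup>2 + (k s * n)\<^sup>2) - sqrt ((\<alpha> * (y' - w))\<^sup>2 + (k s' * n)\<^sup>2)\<bar>"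
      using \<sigma> by (simp add: g_def abs_mult flip: right_diff_distrib)
    also have "\<dots> \<le> \<sigma> * (\<bar>\<alpha> * (y - w) - \<alpha> * (y' - w)\<bar> + \<bar>k s * n - k s' * n\<bar>)"
      using \<sigma> by (intro mult_left_mono sqrt_sum_squares_lipschitz) auto
    also have "\<bar>\<alpha> * (y - w) - \<alpha> * (y' - w)\<bar> = \<bar>\<alpha>\<bar> * \<bar>y - y'\<bar>" by (simp flip: right_diff_distrib abs_mult)
    also have "\<bar>k s * n - k s' * n\<bar> = \<bar>k s - k s'\<bar> * \<bar>n\<bar>" by (simp flip: left_diff_distrib abs_mult)
    also have "\<sigma> * (\<bar>\<alpha>\<bar> * \<bar>y - y'\<bar> + \<bar>k s - k s'\<bar> * \<bar>n\<bar>) \<le> \<sigma> * (\<bar>\<alpha>\<bar> * \<bar>y - y'\<bar> + (Lc * \<bar>s - s'\<bar>) * \<bar>n\<bar>)"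
      using \<sigma> by (intro mult_left_mono add_left_mono mult_right_mono k_lip) auto
    also have "\<dots> = \<sigma> * \<bar>\<alpha>\<bar> * \<bar>y - y'\<bar> + \<sigma> * (Lc * \<bar>n\<bar>) * \<bar>s - s'\<bar>" by (simp add: algebra_simps)
    also have "\<dots> \<le> L * \<bar>y - y'\<bar> + L * \<bar>s - s'\<bar>"
      using nonneg by (intro add_mono mult_right_mono) (auto simp: L_def)
    finally show ?thesis by (simp add: algebra_simps)
  qed
  interpret S: lipschitz_sde M F T W b g t x L
    using t nonneg b_lip g_lip by unfold_locales (auto simp: L_def)
  obtain X where "sde_limit M F T W b g t x L X" using S.sde_limit_exists ..
  then interpret S: sde_limit M F T W b g t x L X .
  define U where "U = generated_control P w X"
  have data: "real_distribution (U s \<omega>)" "U s \<omega> = distr unif borel (\<lambda>q. \<alpha> * (X s \<omega> - w) + k s * D (1 - q))"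
    "integrable (U s \<omega>) (\<lambda>u. u\<^sup>2)" "dist_mean (U s \<omega>) = \<alpha> * (X s \<omega> - w)" "dist_var (U s \<omega>) = (k s)\<^sup>2 * n\<^sup>2"
    if "s \<in> {t..T}" for s \<omega>
  proof -
    have s: "s \<in> {0..T}" "cl s = s" using that t by (auto simp: cl_def)
    show rd: "real_distribution (U s \<omega>)" using fb s by (simp add: U_def generated_control_def feedback_control_def)
    have "has_quantile_function (U s \<omega>) (\<lambda>p. \<alpha> * (X s \<omega> - w) + k s * D (1 - p))"
      using q[OF s(1), of "X s \<omega>"] s(2) by (simp add: U_def generated_control_def k_def)
    from location_scale[OF rd this]
    show "U s \<omega> = distr unif borel (\<lambda>q. \<alpha> * (X s \<omega> - w) + k s * D (1 - q))"
      "integrable (U s \<omega>) (\<lambda>u. u\<^sup>2)" "dist_mean (U s \<omega>) = \<alpha> * (X s \<omega> - w)" "dist_var (U s \<omega>) = (k s)\<^sup>2 * n\<^sup>2"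
      by (simp_all add: n_def)
  qed
  have g_eq: "\<sigma> * sqrt ((dist_mean (U s \<omega>))\<^sup>2 + dist_var (U s \<omega>)) = g s (X s \<omega>)" if "s \<in> {t..T}" for s \<omega>
    using data(4,5)[OF that] by (simp add: g_def power_mult_distrib)
  have km: "k \<in> borel_measurable borel" unfolding k_def cl_def by measurable
  have prog: "progressive F t T (\<lambda>s \<omega>. measure (U s \<omega>) A)" if A: "A \<in> sets borel" for A
    unfolding progressive_def
  proof
    fix u assume u: "u \<in> {t..T}"
    have spF: "space (F u) = space M" using u t by (intro space_F) auto
    have XF: "X s \<in> borel_measurable (F u)" if "s \<in> {t..u}" for s
      using measurable_F_mono[OF _ _ _ S.X_adapted] that u t by auto
    have "(\<lambda>p. indicator {t..u} (snd p) * X (snd p) (fst p)) \<in> borel_measurable (F u \<Otimes>\<^sub>M borel)"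
    proof (rule jointly_measurable_continuous[OF XF])
      fix \<omega> assume "\<omega> \<in> space (F u)"
      then have "continuous_on {t..T} (\<lambda>s. X s \<omega>)" using spF S.X_continuous by simp
      then show "continuous_on {t..u} (\<lambda>s. X s \<omega>)" by (rule continuous_on_subset) (use u in auto)
    qed
    moreover have s1: "fst \<in> restrict_space borel {t..u} \<Otimes>\<^sub>M F u \<rightarrow>\<^sub>M (borel :: real measure)"
      by (rule measurable_compose[OF measurable_fst]) (simp add: measurable_restrict_space1)
    then have "(\<lambda>p. (snd p, fst p)) \<in> restrict_space borel {t..u} \<Otimes>\<^sub>M F u \<rightarrow>\<^sub>M F u \<Otimes>\<^sub>M borel"
      by (intro measurable_Pair measurable_snd)
    ultimately have "(\<lambda>p. indicator {t..u} (fst p) * X (fst p) (snd p)) \<in> borel_measurable (restrict_space borel {t..u} \<Otimes>\<^sub>M F u)"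
      by (auto dest: measurable_compose[rotated])
    then have "(\<lambda>p. (\<alpha> * (indicator {t..u} (fst p) * X (fst p) (snd p) - w), k (fst p))) \<in> restrict_space borel {t..u} \<Otimes>\<^sub>M F u \<rightarrow>\<^sub>M borel \<Otimes>\<^sub>M borel"
      using measurable_compose[OF s1 km] by (intro measurable_Pair) auto
    from measurable_compose[OF this measure_location_scale_measurable[OF A]]
    show "(\<lambda>(s, \<omega>). measure (U s \<omega>) A) \<in> borel_measurable (restrict_space borel {t..u} \<Otimes>\<^sub>M F u)"
    proof (rule measurable_cong[THEN iffD1, rotated])
      fix p assume "p \<in> space (restrict_space borel {t..u} \<Otimes>\<^sub>M F u)"
      then have "fst p \<in> {t..u}" by (auto simp: space_pair_measure space_restrict_space)
      then show "measure (distr unif borel (\<lambda>q. fst (\<alpha> * (indicator {t..u} (fst p) * X (fst p) (snd p) - w), k (fst p)) +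
          snd (\<alpha> * (indicator {t..u} (fst p) * X (fst p) (snd p) - w), k (fst p)) * D (1 - q))) A =
        (case p of (s, \<omega>) \<Rightarrow> measure (U s \<omega>) A)"
        using data(2)[of "fst p" "snd p"] u by (simp add: case_prod_beta)
    qed
  qed
  \<comment> \<open>The second moment of the control is the squared volatility divided by
    \<open>\<sigma>\<^sup>2\<close>, so the required finiteness is the square-integrability of
    \<open>path_coeff g\<close>.\<close>
  have "(\<integral>\<^sup>+\<omega>. (\<integral>\<^sup>+s\<in>{t..T}. (\<integral>\<^sup>+u. ennreal (u\<^sup>2) \<partial>U s \<omega>) \<partial>lborel) \<partial>M) =
      (\<integral>\<^sup>+\<omega>. (\<integral>\<^sup>+s. ennreal ((inverse \<sigma> * S.path_coeff g (\<omega>, s))\<^sup>2) \<partial>lborel) \<partial>M)"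
  proof (intro nn_integral_cong)
    fix \<omega> s
    show "(\<integral>\<^sup>+u. ennreal (u\<^sup>2) \<partial>U s \<omega>) * indicator {t..T} s = ennreal ((inverse \<sigma> * S.path_coeff g (\<omega>, s))\<^sup>2)"
    proof (cases "s \<in> {t..T}")
      case True
      have "(\<integral>\<^sup>+u. ennreal (u\<^sup>2) \<partial>U s \<omega>) = ennreal (\<integral>u. u\<^sup>2 \<partial>U s \<omega>)"
        by (rule nn_integral_eq_integral[OF data(3)[OF True]]) simp
      also have "(\<integral>u. u\<^sup>2 \<partial>U s \<omega>) = (dist_mean (U s \<omega>))\<^sup>2 + dist_var (U s \<omega>)" by (simp add: dist_var_def)
      also have "\<dots> = (inverse \<sigma> * g s (X s \<omega>))\<^sup>2"
        using data(4,5)[OF True] \<sigma> by (simp add: g_def power_mult_distrib power_inverse)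
      finally show ?thesis using True by (simp add: S.path_coeff_def)
    qed (simp add: S.path_coeff_def)
  qed
  also have "\<dots> = (\<integral>\<^sup>+p. ennreal ((inverse \<sigma> * S.path_coeff g p)\<^sup>2) \<partial>N)"
    by (rule nn_integral_N[symmetric], rule measurable_compose[OF _ measurable_ennreal], rule borel_measurable_power,
        rule L2_measurable[OF L2_cmult[OF S.coeff_g_L2]])
  also have "\<dots> < \<infinity>"
    using L2_nn_integral[OF L2_cmult[OF S.coeff_g_L2]] by simp
  finally have fin: "(\<integral>\<^sup>+\<omega>. (\<integral>\<^sup>+s\<in>{t..T}. (\<integral>\<^sup>+u. ennreal (u\<^sup>2) \<partial>U s \<omega>) \<partial>lborel) \<partial>M) < \<infinity>" .
  have control: "distributional_control M F T t U"
    unfolding distributional_control_def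
  proof (intro conjI ballI fin prog)
    fix s assume s: "s \<in> {t..T}"
    show "sets (U s \<omega>) = sets borel" for \<omega> using real_distribution.events_eq_borel[OF data(1)[OF s]] .
    show "AE \<omega> in M. prob_space (U s \<omega>)" using data(1)[OF s] by (auto simp: real_distribution_def)
  qed
  have "wealth_process M F W T \<rho> \<sigma> t x U X"
    unfolding wealth_process_def
  proof (intro conjI ballI S.X_adapted S.X_continuous)
    fix u assume u: "u \<in> {t..T}"
    show "has_Ito_integral M F W t u (\<lambda>s \<omega>. \<sigma> * sqrt ((dist_mean (U s \<omega>))\<^sup>2 + dist_var (U s \<omega>)))
      (\<lambda>\<omega>. X u \<omega> - x - (LBINT s:{t..u}. \<rho> * \<sigma> * dist_mean (U s \<omega>)))"
    proof (rule has_Ito_integral_cong[OF _ _ S.has_Ito[OF u]])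
      show "g s (X s \<omega>) = \<sigma> * sqrt ((dist_mean (U s \<omega>))\<^sup>2 + dist_var (U s \<omega>))" if "s \<in> {t..u}" for s \<omega>
        using g_eq[of s \<omega>] that u by simp
      have "(\<integral>r. indicator {t..u} r * b r (X r \<omega>) \<partial>lborel) = (LBINT s:{t..u}. \<rho> * \<sigma> * dist_mean (U s \<omega>))" for \<omega>
        unfolding set_lebesgue_integral_def
        by (rule Bochner_Integration.integral_cong[OF refl]) (use data(4) u in \<open>auto simp: indicator_def b_def\<close>)
      then show "X u \<omega> - x - (\<integral>r. indicator {t..u} r * b r (X r \<omega>) \<partial>lborel) =
          X u \<omega> - x - (LBINT s:{t..u}. \<rho> * \<sigma> * dist_mean (U s \<omega>))" for \<omega> by simp
    qed
  qed
  with control show ?thesis unfolding U_def by blast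
qed

end

section \<open>Policy iteration\<close>

lemma derivatives_quadratic:
  "dx (\<lambda>y. ereal (A * (y - w)\<^sup>2 + B)) x = 2 * A * (x - w)"
  "dxx (\<lambda>y. ereal (A * (y - w)\<^sup>2 + B)) x = 2 * A"
proof -
  have dx: "dx (\<lambda>y. ereal (A * (y - w)\<^sup>2 + B)) = (\<lambda>x. 2 * A * (x - w))"
    unfolding dx_def by (rule ext, rule DERIV_imp_deriv) (auto intro!: derivative_eq_intros)
  then show "dx (\<lambda>y. ereal (A * (y - w)\<^sup>2 + B)) x = 2 * A * (x - w)" by simp
  show "dxx (\<lambda>y. ereal (A * (y - w)\<^sup>2 + B)) x = 2 * A"
    unfolding dxx_def dx by (rule DERIV_imp_deriv) (auto intro!: derivative_eq_intros)
qed

context exploratory_market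
begin

lemma norm_pos: "0 < deriv_norm2 h"
  by (rule deriv_norm2_pos[OF nontrivial])

definition location_scale_feedback ::
    "(real \<Rightarrow> real \<Rightarrow> real \<Rightarrow> real measure) \<Rightarrow> real \<Rightarrow> real \<Rightarrow> real \<Rightarrow> bool" where
  "location_scale_feedback P \<alpha> c d \<longleftrightarrow> feedback_control T P \<and>
    (\<forall>s\<in>{0..T}. \<forall>y w. has_quantile_function (P s y w) (\<lambda>p. \<alpha> * (y - w) + c * exp (d * (T - s)) * D (1 - p)))"

text \<open>The regularizer \<open>R\<close> sees only the scale of a distribution in the location-scale family of \<open>h\<close>.\<close>

definition scale_regularizer :: "(real measure \<Rightarrow> ereal) \<Rightarrow> (real \<Rightarrow> real) \<Rightarrow> bool" where
  "scale_regularizer R r \<longleftrightarrow> continuous_on {0<..} r \<and>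
    (\<forall>P m k. 0 < k \<longrightarrow> real_distribution P \<longrightarrow> has_quantile_function P (\<lambda>p. m + k * D (1 - p)) \<longrightarrow> R P = ereal (r k))"

lemma scale_regularizer_choquet: "scale_regularizer (choquet h) (\<lambda>k. k * (deriv_norm2 h)\<^sup>2)"
  unfolding scale_regularizer_def
proof (intro conjI allI impI)
  show "continuous_on {0<..} (\<lambda>k. k * (deriv_norm2 h)\<^sup>2)" by (intro continuous_intros)
qed (rule location_scale(5))

lemma scale_regularizer_log_choquet: "scale_regularizer (log_choquet h) (\<lambda>k. ln (k * (deriv_norm2 h)\<^sup>2))"
  unfolding scale_regularizer_def
proof (intro conjI allI impI)
  show "continuous_on {0<..} (\<lambda>k. ln (k * (deriv_norm2 h)\<^sup>2))"
    using norm_pos by (intro continuous_intros) auto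
  fix P m and k :: real
  assume k: "0 < k" and P: "real_distribution P" "has_quantile_function P (\<lambda>p. m + k * D (1 - p))"
  \<comment> \<open>Positivity of the Choquet value selects the finite branch of
    \<open>ext_log\<close>.\<close>
  have "0 < k * (deriv_norm2 h)\<^sup>2" using k norm_pos by simp
  then show "log_choquet h P = ereal (ln (k * (deriv_norm2 h)\<^sup>2))"
    unfolding log_choquet_def location_scale(5)[OF P] ext_log_def by (simp add: not_le)
qed

text \<open>The description operator is resolved by \<open>closed_loop_exists\<close>, which
  supplies a solution, and \<open>feedback_cost\<close>, which gives every solution the same
  value.\<close>

lemma feedback_value_eq:
  fixes \<alpha> c d t x w :: real
  assumes t: "0 \<le> t" "t \<le> T" and P: "location_scale_feedback P \<alpha> c d" and c: "0 < c"
    and R: "scale_regularizer R r"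
  defines "\<kappa> \<equiv> 2 * \<rho> * \<sigma> * \<alpha> + \<sigma>\<^sup>2 * \<alpha>\<^sup>2"
  defines "v \<equiv> exp (\<kappa> * (T - t)) * (x - w)\<^sup>2 +
    (\<integral>s. indicator {t..T} s * (exp (\<kappa> * (T - s)) * \<sigma>\<^sup>2 * ((c * exp (d * (T - s)))\<^sup>2 * (deriv_norm2 h)\<^sup>2)
      - lam * r (c * exp (d * (T - s)))) \<partial>lborel)"
  shows "feedback_value M F W T \<rho> \<sigma> lam z R P t x w = ereal (v - (w - z)\<^sup>2)"
    and "\<exists>X. admissible M F W T \<rho> \<sigma> lam R t x w (generated_control P w X) X \<and>
      control_value M T lam z R t w (generated_control P w X) X = ereal (v - (w - z)\<^sup>2)"
proof -
  have fb: "feedback_control T P"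
    and q: "\<And>s y. s \<in> {0..T} \<Longrightarrow> has_quantile_function (P s y w) (\<lambda>p. \<alpha> * (y - w) + c * exp (d * (T - s)) * D (1 - p))"
    using P by (auto simp: location_scale_feedback_def)
  have cost: "expected_cost M T lam R t w (generated_control P w X) X = ereal v"
    if U: "distributional_control M F T t (generated_control P w X)"
      and wealth: "wealth_process M F W T \<rho> \<sigma> t x (generated_control P w X) X" for X
    unfolding v_def \<kappa>_def
  proof (rule feedback_cost[OF t U wealth])
    fix s \<omega> assume "s \<in> {t..T}"
    then have s: "s \<in> {0..T}" using t by auto
    have k: "0 < c * exp (d * (T - s))" using c by simp
    have rd: "real_distribution (P s (X s \<omega>) w)" using fb s by (simp add: feedback_control_def)
    note ls = location_scale[OF rd q[OF s]]
    show "real_distribution (generated_control P w X s \<omega>)" using rd by (simp add: generated_control_def)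
    show "dist_mean (generated_control P w X s \<omega>) = \<alpha> * (X s \<omega> - w)" using ls(3) by (simp add: generated_control_def)
    show "dist_var (generated_control P w X s \<omega>) = (c * exp (d * (T - s)))\<^sup>2 * (deriv_norm2 h)\<^sup>2"
      using ls(4) by (simp add: generated_control_def)
    show "R (generated_control P w X s \<omega>) = ereal (r (c * exp (d * (T - s))))"
      using R k rd q[OF s] unfolding scale_regularizer_def generated_control_def by blast
  next
    show "continuous_on {t..T} (\<lambda>s. (c * exp (d * (T - s)))\<^sup>2 * (deriv_norm2 h)\<^sup>2)" by (intro continuous_intros)
    have "continuous_on {0<..} r" using R by (simp add: scale_regularizer_def)
    then show "continuous_on {t..T} (\<lambda>s. r (c * exp (d * (T - s))))"
      by (rule continuous_on_compose2) (use c in \<open>auto intro!: continuous_intros\<close>)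
  qed
  obtain X where X: "distributional_control M F T t (generated_control P w X)"
      "wealth_process M F W T \<rho> \<sigma> t x (generated_control P w X) X"
    using closed_loop_exists[OF t fb q, of x] by blast
  show "feedback_value M F W T \<rho> \<sigma> lam z R P t x w = ereal (v - (w - z)\<^sup>2)"
    unfolding feedback_value_def
    by (rule the_equality) (use X cost in \<open>auto simp: control_value_def\<close>)
  show "\<exists>X. admissible M F W T \<rho> \<sigma> lam R t x w (generated_control P w X) X \<and>
      control_value M T lam z R t w (generated_control P w X) X = ereal (v - (w - z)\<^sup>2)"
    using X cost[OF X] by (auto simp: admissible_def control_value_def)
qed

text \<open>With \<open>\<alpha> = - \<rho> / \<sigma>\<close> the quadratic term of the value decays at the rate \<open>\<rho>\<^sup>2\<close> whatever the scale of
  the control, so only the scale of the first iterate depends on the initial control.\<close>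

lemma policy_iteration:
  fixes f :: "real \<Rightarrow> real"
  assumes fb: "\<And>n. feedback_control T (P n)" and R: "scale_regularizer R r"
    and V: "\<And>n t x w. V n t x w = feedback_value M F W T \<rho> \<sigma> lam z R (P n) t x w"
    and c1: "0 < c1" and init: "\<And>t x w. t \<in> {0..T} \<Longrightarrow> has_quantile_function (P 0 t x w)
        (\<lambda>p. a * (x - w) + c1 * exp (c2 * (T - t)) * D (1 - p))"
    and update: "\<And>n t x w. t \<in> {0..T} \<Longrightarrow> has_quantile_function (P (Suc n) t x w)
        (\<lambda>p. - (\<rho> / \<sigma>) * (dx (\<lambda>y. V n t y w) x / dxx (\<lambda>y. V n t y w) x)
             + f (dxx (\<lambda>y. V n t y w) x) * D (1 - p))"
    and f: "0 < f 2" "\<And>u. f (2 * exp u) = f 2 * exp (- (e * u))"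
  shows "location_scale_feedback (P (Suc (Suc n))) (- (\<rho> / \<sigma>)) (f 2) (e * \<rho>\<^sup>2)"
proof -
  \<comment> \<open>The value of the current iterate is quadratic in the wealth, so the quotient of
    derivatives is \<open>x - w\<close> whatever its coefficient. The second derivative is
    \<open>2 * exp (\<kappa> * (T - t))\<close>, and the scaling law of \<open>f\<close> turns it
    into the exponential scale of the next iterate.\<close>
  have step: "location_scale_feedback (P (Suc n)) (- (\<rho> / \<sigma>)) (f 2) (- (e * (2 * \<rho> * \<sigma> * \<alpha> + \<sigma>\<^sup>2 * \<alpha>\<^sup>2)))"
    if Pn: "location_scale_feedback (P n) \<alpha> c d" and c: "0 < c" for n \<alpha> c d
    unfolding location_scale_feedback_def
  proof (intro conjI ballI allI fb)
    fix t x w assume t: "t \<in> {0..T}"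
    define \<kappa> where "\<kappa> = 2 * \<rho> * \<sigma> * \<alpha> + \<sigma>\<^sup>2 * \<alpha>\<^sup>2"
    obtain B where "\<And>y. V n t y w = ereal (exp (\<kappa> * (T - t)) * (y - w)\<^sup>2 + B)"
    proof
      show "V n t y w = ereal (exp (\<kappa> * (T - t)) * (y - w)\<^sup>2 +
          ((\<integral>s. indicator {t..T} s * (exp (\<kappa> * (T - s)) * \<sigma>\<^sup>2 * ((c * exp (d * (T - s)))\<^sup>2 * (deriv_norm2 h)\<^sup>2)
            - lam * r (c * exp (d * (T - s)))) \<partial>lborel) - (w - z)\<^sup>2))" for y
        using feedback_value_eq(1)[OF _ _ Pn c R, of t y w] t by (simp add: V \<kappa>_def)
    qed
    then have V: "(\<lambda>y. V n t y w) = (\<lambda>y. ereal (exp (\<kappa> * (T - t)) * (y - w)\<^sup>2 + B))" by auto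
    have 1: "dx (\<lambda>y. V n t y w) x / dxx (\<lambda>y. V n t y w) x = x - w"
      unfolding V derivatives_quadratic by simp
    have 2: "f (dxx (\<lambda>y. V n t y w) x) = f 2 * exp (- (e * \<kappa>) * (T - t))"
      unfolding V derivatives_quadratic using f(2)[of "\<kappa> * (T - t)"] by (simp add: mult.assoc)
    show "has_quantile_function (P (Suc n) t x w)
        (\<lambda>p. - (\<rho> / \<sigma>) * (x - w) + f 2 * exp (- (e * (2 * \<rho> * \<sigma> * \<alpha> + \<sigma>\<^sup>2 * \<alpha>\<^sup>2)) * (T - t)) * D (1 - p))"
      using update[OF t, of n x w] unfolding 1 2 \<kappa>_def .
  qed
  have \<kappa>: "- (e * (2 * \<rho> * \<sigma> * (- (\<rho> / \<sigma>)) + \<sigma>\<^sup>2 * (- (\<rho> / \<sigma>))\<^sup>2)) = e * \<rho>\<^sup>2"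
    using \<sigma> by (simp add: power2_eq_square)
  have P0: "location_scale_feedback (P 0) a c1 c2"
    using fb init by (auto simp: location_scale_feedback_def)
  \<comment> \<open>After one update the slope and the factor \<open>f 2\<close> are final, while
    the rate \<open>d\<close> still depends on the initial slope; its mere existence suffices for
    the next update.\<close>
  have "\<exists>d. location_scale_feedback (P (Suc n)) (- (\<rho> / \<sigma>)) (f 2) d" for n
  proof (induction n)
    case 0
    then show ?case using step[OF P0 c1] by blast
  next
    case (Suc n)
    then show ?case using step[OF _ f(1)] by blast
  qed
  then obtain d where "location_scale_feedback (P (Suc n)) (- (\<rho> / \<sigma>)) (f 2) d" by blast
  from step[OF this f(1)] show ?thesis unfolding \<kappa> .
qed

text \<open>The quantile function determines the distribution as an image of the uniform law, so
  iterates with equal parameters coincide as measures.\<close>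

lemma location_scale_feedback_unique:
  assumes "location_scale_feedback P \<alpha> c d" "location_scale_feedback P' \<alpha> c d" "s \<in> {0..T}"
  shows "P s y w = P' s y w"
  using assms location_scale(1)[of "P s y w" "\<alpha> * (y - w)" "c * exp (d * (T - s))"]
    location_scale(1)[of "P' s y w" "\<alpha> * (y - w)" "c * exp (d * (T - s))"]
  by (simp add: location_scale_feedback_def feedback_control_def)

text \<open>By \<open>bound\<close>, \<open>- C s\<close> lies below the running cost of any
  distribution at time \<open>s\<close>; by \<open>attained\<close>, the control \<open>P\<close>
  reaches it. Hence the lower bound for all controls is the value of \<open>P\<close>.\<close>

lemma verification:
  fixes c d t x w :: real
  assumes t: "0 \<le> t" "t \<le> T" and P: "location_scale_feedback P (- (\<rho> / \<sigma>)) c d" and c: "0 < c"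
    and R: "scale_regularizer R r" and C: "continuous_on {t..T} C"
    and bound: "\<And>s P. s \<in> {t..T} \<Longrightarrow> real_distribution P \<Longrightarrow> integrable P (\<lambda>u. u\<^sup>2) \<Longrightarrow>
      R P \<le> ereal ((exp (- \<rho>\<^sup>2 * (T - s)) * \<sigma>\<^sup>2 * dist_var P + C s) / lam)"
    and attained: "\<And>s. s \<in> {t..T} \<Longrightarrow> exp (- \<rho>\<^sup>2 * (T - s)) * \<sigma>\<^sup>2 * ((c * exp (d * (T - s)))\<^sup>2 * (deriv_norm2 h)\<^sup>2)
      - lam * r (c * exp (d * (T - s))) = - C s"
  defines "v \<equiv> ereal (exp (- \<rho>\<^sup>2 * (T - t)) * (x - w)\<^sup>2 - (\<integral>s. indicator {t..T} s * C s \<partial>lborel) - (w - z)\<^sup>2)"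
  shows "feedback_value M F W T \<rho> \<sigma> lam z R P t x w = v"
    and "optimal_value M F W T \<rho> \<sigma> lam z R t x w = v"
    and "optimal_feedback M F W T \<rho> \<sigma> lam z R P t x w"
proof -
  have \<kappa>: "2 * \<rho> * \<sigma> * (- (\<rho> / \<sigma>)) + \<sigma>\<^sup>2 * (- (\<rho> / \<sigma>))\<^sup>2 = - \<rho>\<^sup>2"
    using \<sigma> by (simp add: power2_eq_square)
  have "indicator {t..T} s * (exp (- \<rho>\<^sup>2 * (T - s)) * \<sigma>\<^sup>2 * ((c * exp (d * (T - s)))\<^sup>2 * (deriv_norm2 h)\<^sup>2)
      - lam * r (c * exp (d * (T - s)))) = - (indicator {t..T} s * C s)" for s
    using attained[of s] by (cases "s \<in> {t..T}") simp_all
  then have int: "(\<integral>s. indicator {t..T} s * (exp (- \<rho>\<^sup>2 * (T - s)) * \<sigma>\<^sup>2 * ((c * exp (d * (T - s)))\<^sup>2 * (deriv_norm2 h)\<^sup>2)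
      - lam * r (c * exp (d * (T - s)))) \<partial>lborel) = - (\<integral>s. indicator {t..T} s * C s \<partial>lborel)"
    by simp
  note fv = feedback_value_eq[OF t P c R, of x w, unfolded \<kappa> int]
  show "feedback_value M F W T \<rho> \<sigma> lam z R P t x w = v" using fv(1) by (simp add: v_def)
  obtain X where X: "admissible M F W T \<rho> \<sigma> lam R t x w (generated_control P w X) X"
    "control_value M T lam z R t w (generated_control P w X) X = v"
    using fv(2) by (auto simp: v_def)
  show opt: "optimal_value M F W T \<rho> \<sigma> lam z R t x w = v"
    unfolding optimal_value_def
  proof (rule antisym)
    show "Inf {control_value M T lam z R t w U X |U X. admissible M F W T \<rho> \<sigma> lam R t x w U X} \<le> v"
      using X by (intro Inf_lower) auto
    show "v \<le> Inf {control_value M T lam z R t w U X |U X. admissible M F W T \<rho> \<sigma> lam R t x w U X}"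
    proof (rule Inf_greatest)
      fix u assume "u \<in> {control_value M T lam z R t w U X |U X. admissible M F W T \<rho> \<sigma> lam R t x w U X}"
      then obtain U X where u: "u = control_value M T lam z R t w U X"
        and U: "distributional_control M F T t U" "wealth_process M F W T \<rho> \<sigma> t x U X"
        by (auto simp: admissible_def)
      have "v = ereal (exp (- \<rho>\<^sup>2 * (T - t)) * (x - w)\<^sup>2 - (\<integral>s. indicator {t..T} s * C s \<partial>lborel)) - ereal ((w - z)\<^sup>2)"
        by (simp add: v_def)
      also have "\<dots> \<le> u"
        unfolding u control_value_def
        by (intro ereal_minus_mono cost_lower_bound[OF t U lam C] bound) auto
      finally show "v \<le> u" .
    qed
  qed
  show "optimal_feedback M F W T \<rho> \<sigma> lam z R P t x w"
    using X unfolding optimal_feedback_def opt by blast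
qed

lemma choquet_verification:
  fixes t x w :: real
  assumes t: "0 \<le> t" "t \<le> T" and P: "location_scale_feedback P (- (\<rho> / \<sigma>)) (lam / (2 * \<sigma>\<^sup>2)) (\<rho>\<^sup>2)"
    and \<rho>: "\<rho> \<noteq> 0"
  defines "v \<equiv> ereal ((x - w)\<^sup>2 * exp (- \<rho>\<^sup>2 * (T - t))
            - lam\<^sup>2 * (deriv_norm2 h)\<^sup>2 / (4 * \<rho>\<^sup>2 * \<sigma>\<^sup>2) * (exp (\<rho>\<^sup>2 * (T - t)) - 1) - (w - z)\<^sup>2)"
  shows "feedback_value M F W T \<rho> \<sigma> lam z (choquet h) P t x w = v"
    and "optimal_value M F W T \<rho> \<sigma> lam z (choquet h) t x w = v"
    and "optimal_feedback M F W T \<rho> \<sigma> lam z (choquet h) P t x w"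
proof -
  \<comment> \<open>The maximum over \<open>v\<close> of \<open>lam * deriv_norm2 h * sqrt v\<close>
    minus the weighted variance cost
    \<open>exp (- \<rho>\<^sup>2 * (T - s)) * \<sigma>\<^sup>2 * v\<close>.\<close>
  define C where "C = (\<lambda>s. lam\<^sup>2 * (deriv_norm2 h)\<^sup>2 / (4 * \<sigma>\<^sup>2) * exp (\<rho>\<^sup>2 * (T - s)))"
  have c: "0 < lam / (2 * \<sigma>\<^sup>2)" using lam \<sigma> by simp
  have cont: "continuous_on {t..T} C" unfolding C_def by (intro continuous_intros)
  have bound: "choquet h P \<le> ereal ((exp (- \<rho>\<^sup>2 * (T - s)) * \<sigma>\<^sup>2 * dist_var P + C s) / lam)"
    if P: "real_distribution P" "integrable P (\<lambda>u. u\<^sup>2)" for s P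
  proof -
    \<comment> \<open>\<open>y\<close> is the root of the weighted variance cost, and
      \<open>y'\<close> is its partner for which \<open>2 * y * y'\<close> is the Cauchy-Schwarz
      bound on \<open>lam\<close> times the Choquet value; then \<open>y'\<^sup>2\<close> has to be
      \<open>C s\<close>.\<close>
    define y where "y = exp (- \<rho>\<^sup>2 * (T - s) / 2) * \<sigma> * sqrt (dist_var P)"
    define y' where "y' = exp (\<rho>\<^sup>2 * (T - s) / 2) * lam * deriv_norm2 h / (2 * \<sigma>)"
    have e: "exp (u / 2) * exp (u / 2) = exp u" "exp (- u / 2) * exp (u / 2) = 1" for u :: real
      by (simp_all flip: exp_add)
    have "2 * y * y' = (exp (- (\<rho>\<^sup>2 * (T - s)) / 2) * exp (\<rho>\<^sup>2 * (T - s) / 2)) * (lam * (deriv_norm2 h * sqrt (dist_var P)))"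
      using \<sigma> by (simp add: y_def y'_def)
    then have yy': "2 * y * y' = lam * (deriv_norm2 h * sqrt (dist_var P))" unfolding e by simp
    have y2: "y\<^sup>2 = exp (- \<rho>\<^sup>2 * (T - s)) * \<sigma>\<^sup>2 * dist_var P"
      using e(1)[of "- \<rho>\<^sup>2 * (T - s)"] choquet_le(2)[OF P]
      by (simp add: y_def power_mult_distrib power2_eq_square[of "exp _"])
    have y'2: "y'\<^sup>2 = C s"
      using e(1)[of "\<rho>\<^sup>2 * (T - s)"]
      by (simp add: y'_def C_def power_mult_distrib power_divide power2_eq_square[of "exp _"])
    have "2 * y * y' \<le> y\<^sup>2 + y'\<^sup>2" by (rule sum_squares_bound)
    then have "deriv_norm2 h * sqrt (dist_var P) \<le> (exp (- \<rho>\<^sup>2 * (T - s)) * \<sigma>\<^sup>2 * dist_var P + C s) / lam"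
      using lam unfolding yy' y2 y'2 by (simp add: field_simps)
    then show ?thesis using choquet_le(1)[OF P] by (meson ereal_less_eq(3) order.trans)
  qed
  have attained: "exp (- \<rho>\<^sup>2 * (T - s)) * \<sigma>\<^sup>2 * ((lam / (2 * \<sigma>\<^sup>2) * exp (\<rho>\<^sup>2 * (T - s)))\<^sup>2 * (deriv_norm2 h)\<^sup>2)
      - lam * (lam / (2 * \<sigma>\<^sup>2) * exp (\<rho>\<^sup>2 * (T - s)) * (deriv_norm2 h)\<^sup>2) = - C s" for s
  proof -
    have e: "exp (- \<rho>\<^sup>2 * (T - s)) * (exp (\<rho>\<^sup>2 * (T - s)))\<^sup>2 = exp (\<rho>\<^sup>2 * (T - s))"
      by (simp add: power2_eq_square flip: exp_add)
    have "exp (- \<rho>\<^sup>2 * (T - s)) * \<sigma>\<^sup>2 * ((lam / (2 * \<sigma>\<^sup>2) * exp (\<rho>\<^sup>2 * (T - s)))\<^sup>2 * (deriv_norm2 h)\<^sup>2) =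
        (exp (- \<rho>\<^sup>2 * (T - s)) * (exp (\<rho>\<^sup>2 * (T - s)))\<^sup>2) * \<sigma>\<^sup>2 * (lam / (2 * \<sigma>\<^sup>2))\<^sup>2 * (deriv_norm2 h)\<^sup>2"
      by (simp only: power_mult_distrib mult_ac)
    also have "\<dots> = exp (\<rho>\<^sup>2 * (T - s)) * \<sigma>\<^sup>2 * (lam / (2 * \<sigma>\<^sup>2))\<^sup>2 * (deriv_norm2 h)\<^sup>2" unfolding e ..
    finally have "exp (- \<rho>\<^sup>2 * (T - s)) * \<sigma>\<^sup>2 * ((lam / (2 * \<sigma>\<^sup>2) * exp (\<rho>\<^sup>2 * (T - s)))\<^sup>2 * (deriv_norm2 h)\<^sup>2) =
        exp (\<rho>\<^sup>2 * (T - s)) * \<sigma>\<^sup>2 * (lam / (2 * \<sigma>\<^sup>2))\<^sup>2 * (deriv_norm2 h)\<^sup>2" .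
    then show ?thesis using \<sigma> by (simp add: C_def field_simps power2_eq_square)
  qed
  \<comment> \<open>An antiderivative of \<open>C\<close>; dividing by the rate
    \<open>\<rho>\<^sup>2\<close> is where \<open>\<rho> \<noteq> 0\<close> enters.\<close>
  define G where "G = (\<lambda>s. - (lam\<^sup>2 * (deriv_norm2 h)\<^sup>2 / (4 * \<rho>\<^sup>2 * \<sigma>\<^sup>2) * exp (\<rho>\<^sup>2 * (T - s))))"
  have "(\<integral>s. C s * indicator {t..T} s \<partial>lborel) = G T - G t"
  proof (rule integral_FTC_Icc_real[OF t(2)])
    show "(G has_real_derivative C s) (at s)" for s
      unfolding G_def C_def using \<rho> \<sigma> by (auto intro!: derivative_eq_intros simp: field_simps power2_eq_square power4_eq_xxxx)
    show "isCont C s" for s unfolding C_def by (intro continuous_intros)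
  qed
  also have "\<dots> = lam\<^sup>2 * (deriv_norm2 h)\<^sup>2 / (4 * \<rho>\<^sup>2 * \<sigma>\<^sup>2) * (exp (\<rho>\<^sup>2 * (T - t)) - 1)"
    by (simp add: G_def right_diff_distrib)
  finally have int: "(\<integral>s. indicator {t..T} s * C s \<partial>lborel) = lam\<^sup>2 * (deriv_norm2 h)\<^sup>2 / (4 * \<rho>\<^sup>2 * \<sigma>\<^sup>2) * (exp (\<rho>\<^sup>2 * (T - t)) - 1)"
    by (simp add: mult.commute)
  have v: "v = ereal (exp (- \<rho>\<^sup>2 * (T - t)) * (x - w)\<^sup>2 - (\<integral>s. indicator {t..T} s * C s \<partial>lborel) - (w - z)\<^sup>2)"
    unfolding int by (simp add: v_def mult.commute)
  show "feedback_value M F W T \<rho> \<sigma> lam z (choquet h) P t x w = v"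
    "optimal_value M F W T \<rho> \<sigma> lam z (choquet h) t x w = v"
    "optimal_feedback M F W T \<rho> \<sigma> lam z (choquet h) P t x w"
    unfolding v by (rule verification[OF t P c scale_regularizer_choquet cont bound attained], assumption+)+
qed

lemma log_choquet_verification:
  fixes t x w :: real
  assumes t: "0 \<le> t" "t \<le> T"
    and P: "location_scale_feedback P (- (\<rho> / \<sigma>)) (sqrt (lam / (2 * \<sigma>\<^sup>2 * (deriv_norm2 h)\<^sup>2))) (1 / 2 * \<rho>\<^sup>2)"
  defines "v \<equiv> ereal ((x - w)\<^sup>2 * exp (- \<rho>\<^sup>2 * (T - t)) + lam * \<rho>\<^sup>2 / 4 * (T\<^sup>2 - t\<^sup>2)
    - lam / 2 * (\<rho>\<^sup>2 * T + ln (lam * (deriv_norm2 h)\<^sup>2 / (2 * exp 1 * \<sigma>\<^sup>2))) * (T - t) - (w - z)\<^sup>2)"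
  shows "feedback_value M F W T \<rho> \<sigma> lam z (log_choquet h) P t x w = v"
    and "optimal_value M F W T \<rho> \<sigma> lam z (log_choquet h) t x w = v"
    and "optimal_feedback M F W T \<rho> \<sigma> lam z (log_choquet h) P t x w"
proof -
  define c where "c = sqrt (lam / (2 * \<sigma>\<^sup>2 * (deriv_norm2 h)\<^sup>2))"
  \<comment> \<open>The square of the optimal Choquet value at time \<open>T\<close>; at time
    \<open>s\<close> it is multiplied by \<open>exp (\<rho>\<^sup>2 * (T - s))\<close>. The optimal
    variance cost is always \<open>lam / 2\<close>, which is the origin of the summand -1 in
    \<open>C\<close>.\<close>
  define A where "A = lam * (deriv_norm2 h)\<^sup>2 / (2 * \<sigma>\<^sup>2)"
  define C where "C = (\<lambda>s. lam / 2 * (ln A + \<rho>\<^sup>2 * (T - s) - 1))"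
  note n = norm_pos
  have A: "0 < A" using lam \<sigma> n by (simp add: A_def)
  have c: "0 < c" using lam \<sigma> n by (simp add: c_def)
  have c2: "c\<^sup>2 = lam / (2 * \<sigma>\<^sup>2 * (deriv_norm2 h)\<^sup>2)" using lam \<sigma> n by (simp add: c_def)
  have cont: "continuous_on {t..T} C" unfolding C_def by (intro continuous_intros)
  have bound: "log_choquet h P \<le> ereal ((exp (- \<rho>\<^sup>2 * (T - s)) * \<sigma>\<^sup>2 * dist_var P + C s) / lam)"
    if P: "real_distribution P" "integrable P (\<lambda>u. u\<^sup>2)" for s P
  proof (cases "choquet h P \<le> 0")
    \<comment> \<open>The regularizer is minus infinity here, below every real bound.\<close>
    case True
    then show ?thesis by (simp add: log_choquet_def ext_log_def)
  next
    case False
    then obtain y where y: "choquet h P = ereal y" "0 < y" "y \<le> deriv_norm2 h * sqrt (dist_var P)"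
      using choquet_le(1)[OF P] by (cases "choquet h P") auto
    \<comment> \<open>The squared Choquet value at the optimum. The logarithm is compared with its
      tangent there, that is, \<open>ln u \<le> u - 1\<close> is used at
      \<open>u = y\<^sup>2 / a\<close>.\<close>
    define a where "a = A * exp (\<rho>\<^sup>2 * (T - s))"
    have a: "0 < a" using A by (simp add: a_def)
    have la: "ln a = ln A + \<rho>\<^sup>2 * (T - s)" using A by (simp add: a_def ln_mult)
    have "y\<^sup>2 \<le> (deriv_norm2 h * sqrt (dist_var P))\<^sup>2" using y by (intro power_mono) auto
    then have "y\<^sup>2 \<le> (deriv_norm2 h)\<^sup>2 * dist_var P" using choquet_le(2)[OF P] by (simp add: power_mult_distrib)
    then have "y\<^sup>2 / a \<le> (deriv_norm2 h)\<^sup>2 * dist_var P / a" using a by (simp add: divide_right_mono)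
    also have "\<dots> = 2 * (exp (- \<rho>\<^sup>2 * (T - s)) * \<sigma>\<^sup>2 * dist_var P) / lam"
    proof -
      define E where "E = exp (\<rho>\<^sup>2 * (T - s))"
      have E: "0 < E" "exp (- \<rho>\<^sup>2 * (T - s)) = 1 / E" by (simp_all add: E_def exp_minus inverse_eq_divide)
      show ?thesis unfolding a_def A_def E(2) E_def[symmetric] using n lam \<sigma> E(1) by (simp add: field_simps)
    qed
    finally have u: "y\<^sup>2 / a \<le> 2 * (exp (- \<rho>\<^sup>2 * (T - s)) * \<sigma>\<^sup>2 * dist_var P) / lam" .
    have "ln (y\<^sup>2 / a) \<le> y\<^sup>2 / a - 1" using y(2) a by (intro ln_le_minus_one) simp
    moreover have "ln (y\<^sup>2 / a) = 2 * ln y - ln a" using y(2) a by (simp add: ln_div ln_realpow)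
    ultimately have "2 * ln y \<le> 2 * (exp (- \<rho>\<^sup>2 * (T - s)) * \<sigma>\<^sup>2 * dist_var P) / lam + (ln A + \<rho>\<^sup>2 * (T - s) - 1)"
      using u la by linarith
    then have "ln y \<le> (exp (- \<rho>\<^sup>2 * (T - s)) * \<sigma>\<^sup>2 * dist_var P + C s) / lam"
      using lam by (simp add: C_def field_simps)
    then show ?thesis using y by (simp add: log_choquet_def ext_log_def)
  qed
  have attained: "exp (- \<rho>\<^sup>2 * (T - s)) * \<sigma>\<^sup>2 * ((c * exp (1 / 2 * \<rho>\<^sup>2 * (T - s)))\<^sup>2 * (deriv_norm2 h)\<^sup>2)
      - lam * ln (c * exp (1 / 2 * \<rho>\<^sup>2 * (T - s)) * (deriv_norm2 h)\<^sup>2) = - C s" for s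
  proof -
    have "exp (- \<rho>\<^sup>2 * (T - s)) * (exp (1 / 2 * \<rho>\<^sup>2 * (T - s)))\<^sup>2 = 1"
      by (simp add: power2_eq_square flip: exp_add)
    then have "exp (- \<rho>\<^sup>2 * (T - s)) * \<sigma>\<^sup>2 * ((c * exp (1 / 2 * \<rho>\<^sup>2 * (T - s)))\<^sup>2 * (deriv_norm2 h)\<^sup>2) =
        1 * \<sigma>\<^sup>2 * c\<^sup>2 * (deriv_norm2 h)\<^sup>2"
      by (simp only: power_mult_distrib mult_ac)
    also have "\<dots> = lam / 2" using \<sigma> n by (simp add: c2)
    finally have 1: "exp (- \<rho>\<^sup>2 * (T - s)) * \<sigma>\<^sup>2 * ((c * exp (1 / 2 * \<rho>\<^sup>2 * (T - s)))\<^sup>2 * (deriv_norm2 h)\<^sup>2) = lam / 2" .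
    have "(c * (deriv_norm2 h)\<^sup>2)\<^sup>2 = A"
      unfolding power_mult_distrib c2 A_def using n \<sigma> by (simp add: power2_eq_square)
    then have l1: "ln A = 2 * ln (c * (deriv_norm2 h)\<^sup>2)" using c n ln_realpow[of "c * (deriv_norm2 h)\<^sup>2" 2] by simp
    have l2: "ln (c * exp (1 / 2 * \<rho>\<^sup>2 * (T - s)) * (deriv_norm2 h)\<^sup>2) = ln (c * (deriv_norm2 h)\<^sup>2) + 1 / 2 * \<rho>\<^sup>2 * (T - s)"
      using c n by (simp add: ln_mult)
    show ?thesis unfolding 1 l2 C_def l1 by (simp add: field_simps)
  qed
  define G where "G = (\<lambda>s. lam / 2 * ((ln A + \<rho>\<^sup>2 * T - 1) * s - \<rho>\<^sup>2 * s\<^sup>2 / 2))"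
  have "(\<integral>s. C s * indicator {t..T} s \<partial>lborel) = G T - G t"
  proof (rule integral_FTC_Icc_real[OF t(2)])
    show "(G has_real_derivative C s) (at s)" for s
      unfolding G_def C_def by (auto intro!: derivative_eq_intros simp: algebra_simps)
    show "isCont C s" for s unfolding C_def by (intro continuous_intros)
  qed
  \<comment> \<open>The factor \<open>exp 1\<close> in the closed formula absorbs the summand -1 of
    \<open>C\<close>.\<close>
  moreover have "ln (lam * (deriv_norm2 h)\<^sup>2 / (2 * exp 1 * \<sigma>\<^sup>2)) = ln A - 1"
  proof -
    have "lam * (deriv_norm2 h)\<^sup>2 / (2 * exp 1 * \<sigma>\<^sup>2) = A / exp 1" by (simp add: A_def)
    then show ?thesis using A by (simp add: ln_div)
  qed
  ultimately have v: "v = ereal (exp (- \<rho>\<^sup>2 * (T - t)) * (x - w)\<^sup>2 - (\<integral>s. indicator {t..T} s * C s \<partial>lborel) - (w - z)\<^sup>2)"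
    by (simp add: v_def G_def mult.commute[of "indicator _ _"]) (simp add: field_simps power2_eq_square)
  show "feedback_value M F W T \<rho> \<sigma> lam z (log_choquet h) P t x w = v"
    "optimal_value M F W T \<rho> \<sigma> lam z (log_choquet h) t x w = v"
    "optimal_feedback M F W T \<rho> \<sigma> lam z (log_choquet h) P t x w"
    unfolding v by (rule verification[OF t P[folded c_def] c scale_regularizer_log_choquet cont bound attained], assumption+)+
qed

end

theorem theorem5p2:
  fixes M :: "'a measure" and F :: "real \<Rightarrow> 'a measure" and W :: "real \<Rightarrow> 'a \<Rightarrow> real"
    and T z lam mu_S \<sigma> r \<rho> a c1 c2 :: real
    and h :: "real \<Rightarrow> real"
    and P P_hat :: "nat \<Rightarrow> real \<Rightarrow> real \<Rightarrow> real \<Rightarrow> real measure"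
    and P_opt P_hat_opt :: "real \<Rightarrow> real \<Rightarrow> real \<Rightarrow> real measure"
    and V V_hat :: "nat \<Rightarrow> real \<Rightarrow> real \<Rightarrow> real \<Rightarrow> ereal"
    and V_opt V_hat_opt :: "real \<Rightarrow> real \<Rightarrow> real \<Rightarrow> ereal"
  assumes brownian: "brownian_motion M F T W"
    and params: "0 < T" "0 < lam" "0 < \<sigma>" "0 < r" "\<rho> = (mu_S - r) / \<sigma>" "\<rho> \<noteq> 0"
    and h: "h \<in> distortions" "continuous_on {0..1} h" "\<exists>p\<in>{0..1}. h p \<noteq> 0"
      "deriv_square_integrable h"
    and c1: "0 < c1"
    and feedback: "\<And>n. feedback_control T (P n)" "\<And>n. feedback_control T (P_hat n)"
      "feedback_control T P_opt" "feedback_control T P_hat_opt"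
    and V: "\<And>n t x w. V n t x w =
        feedback_value M F W T \<rho> \<sigma> lam z (choquet h) (P n) t x w"
    and V_hat: "\<And>n t x w. V_hat n t x w =
        feedback_value M F W T \<rho> \<sigma> lam z (log_choquet h) (P_hat n) t x w"
    and V_opt: "\<And>t x w. V_opt t x w =
        optimal_value M F W T \<rho> \<sigma> lam z (choquet h) t x w"
    and V_hat_opt: "\<And>t x w. V_hat_opt t x w =
        optimal_value M F W T \<rho> \<sigma> lam z (log_choquet h) t x w"
    and init: "\<And>t x w. t \<in> {0..T} \<Longrightarrow> has_quantile_function (P 0 t x w)
        (\<lambda>p. a * (x - w) + c1 * exp (c2 * (T - t)) * right_deriv h (1 - p))"
    and init_hat: "\<And>t x w. t \<in> {0..T} \<Longrightarrow> has_quantile_function (P_hat 0 t x w)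
        (\<lambda>p. a * (x - w) + c1 * exp (c2 * (T - t)) * right_deriv h (1 - p))"
    and update: "\<And>n t x w. t \<in> {0..T} \<Longrightarrow> has_quantile_function (P (Suc n) t x w)
        (\<lambda>p. - (\<rho> / \<sigma>) * (dx (\<lambda>y. V n t y w) x / dxx (\<lambda>y. V n t y w) x)
             + lam / (\<sigma>\<^sup>2 * dxx (\<lambda>y. V n t y w) x) * right_deriv h (1 - p))"
    and update_hat: "\<And>n t x w. t \<in> {0..T} \<Longrightarrow> has_quantile_function (P_hat (Suc n) t x w)
        (\<lambda>p. - (\<rho> / \<sigma>) * (dx (\<lambda>y. V_hat n t y w) x / dxx (\<lambda>y. V_hat n t y w) x)
             + sqrt (lam / (\<sigma>\<^sup>2 * (deriv_norm2 h)\<^sup>2 * dxx (\<lambda>y. V_hat n t y w) x))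
               * right_deriv h (1 - p))"
    and opt: "\<And>t x w. t \<in> {0..T} \<Longrightarrow> has_quantile_function (P_opt t x w)
        (\<lambda>p. - (\<rho> / \<sigma>) * (x - w)
             + lam * right_deriv h (1 - p) / (2 * \<sigma>\<^sup>2) * exp (\<rho>\<^sup>2 * (T - t)))"
    and opt_hat: "\<And>t x w. t \<in> {0..T} \<Longrightarrow> has_quantile_function (P_hat_opt t x w)
        (\<lambda>p. - (\<rho> / \<sigma>) * (x - w)
             + sqrt (lam / (2 * \<sigma>\<^sup>2 * (deriv_norm2 h)\<^sup>2)) * exp (1 / 2 * \<rho>\<^sup>2 * (T - t))
               * right_deriv h (1 - p))"
  shows
    "(\<forall>t\<in>{0..T}. \<forall>x w.
        weak_conv_m (\<lambda>n. P n t x w) (P_opt t x w) \<and>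
        weak_conv_m (\<lambda>n. P_hat n t x w) (P_hat_opt t x w)) \<and>
     (\<forall>t\<in>{0..<T}. \<forall>x w.
        (\<lambda>n. V n t x w) \<longlonglongrightarrow> V_opt t x w \<and>
        (\<lambda>n. V_hat n t x w) \<longlonglongrightarrow> V_hat_opt t x w) \<and>
     (\<forall>t\<in>{0..T}. \<forall>x w.
        optimal_feedback M F W T \<rho> \<sigma> lam z (choquet h) P_opt t x w \<and>
        optimal_feedback M F W T \<rho> \<sigma> lam z (log_choquet h) P_hat_opt t x w \<and>
        V_opt t x w = ereal
          ((x - w)\<^sup>2 * exp (- \<rho>\<^sup>2 * (T - t))
            - lam\<^sup>2 * (deriv_norm2 h)\<^sup>2 / (4 * \<rho>\<^sup>2 * \<sigma>\<^sup>2) * (exp (\<rho>\<^sup>2 * (T - t)) - 1)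
            - (w - z)\<^sup>2) \<and>
        V_hat_opt t x w = ereal
          ((x - w)\<^sup>2 * exp (- \<rho>\<^sup>2 * (T - t))
            + lam * \<rho>\<^sup>2 / 4 * (T\<^sup>2 - t\<^sup>2)
            - lam / 2 * (\<rho>\<^sup>2 * T + ln (lam * (deriv_norm2 h)\<^sup>2 / (2 * exp 1 * \<sigma>\<^sup>2))) * (T - t)
            - (w - z)\<^sup>2))"
proof -
  interpret B: brownian_motion M F T W by (rule brownian)
  interpret exploratory_market M F T W h \<rho> \<sigma> lam z
    using params h by unfold_locales auto
  have n: "0 < deriv_norm2 h" by (rule norm_pos)
  \<comment> \<open>The update scale is homogeneous of degree -1 in the second derivative, hence
    \<open>e = 1\<close>; for the logarithmic regularizer the degree is -1/2.\<close>
  have P: "location_scale_feedback (P (Suc (Suc k))) (- (\<rho> / \<sigma>)) (lam / (2 * \<sigma>\<^sup>2)) (\<rho>\<^sup>2)" for k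
  proof -
    have "location_scale_feedback (P (Suc (Suc k))) (- (\<rho> / \<sigma>)) (lam / (\<sigma>\<^sup>2 * 2)) (1 * \<rho>\<^sup>2)"
      by (rule policy_iteration[where f="\<lambda>y. lam / (\<sigma>\<^sup>2 * y)", OF feedback(1) scale_regularizer_choquet V c1 init update])
         (use params in \<open>simp_all add: exp_minus field_simps\<close>)
    then show ?thesis by (simp add: mult.commute)
  qed
  have P_hat: "location_scale_feedback (P_hat (Suc (Suc k))) (- (\<rho> / \<sigma>)) (sqrt (lam / (2 * \<sigma>\<^sup>2 * (deriv_norm2 h)\<^sup>2))) (1 / 2 * \<rho>\<^sup>2)" for k
  proof -
    have e: "sqrt (exp u) = exp (1 / 2 * u)" for u :: real
      by (rule real_sqrt_unique) (simp_all add: power2_eq_square flip: exp_add)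
    have "location_scale_feedback (P_hat (Suc (Suc k))) (- (\<rho> / \<sigma>)) (sqrt (lam / (\<sigma>\<^sup>2 * (deriv_norm2 h)\<^sup>2 * 2))) (1 / 2 * \<rho>\<^sup>2)"
    proof (rule policy_iteration[where f="\<lambda>y. sqrt (lam / (\<sigma>\<^sup>2 * (deriv_norm2 h)\<^sup>2 * y))", OF feedback(2) scale_regularizer_log_choquet V_hat c1 init_hat update_hat])
      show "0 < sqrt (lam / (\<sigma>\<^sup>2 * (deriv_norm2 h)\<^sup>2 * 2))" using params n by simp
      show "sqrt (lam / (\<sigma>\<^sup>2 * (deriv_norm2 h)\<^sup>2 * (2 * exp u))) = sqrt (lam / (\<sigma>\<^sup>2 * (deriv_norm2 h)\<^sup>2 * 2)) * exp (- (1 / 2 * u))" for u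
      proof -
        have "sqrt (lam / (\<sigma>\<^sup>2 * (deriv_norm2 h)\<^sup>2 * (2 * exp u))) = sqrt (lam / (\<sigma>\<^sup>2 * (deriv_norm2 h)\<^sup>2 * 2) * exp (- u))"
          by (simp add: exp_minus field_simps)
        then show ?thesis by (simp only: real_sqrt_mult e) simp
      qed
    qed
    then show ?thesis by (simp add: mult_ac)
  qed
  have Po: "location_scale_feedback P_opt (- (\<rho> / \<sigma>)) (lam / (2 * \<sigma>\<^sup>2)) (\<rho>\<^sup>2)"
    using feedback(3) opt by (simp add: location_scale_feedback_def mult_ac)
  have Pho: "location_scale_feedback P_hat_opt (- (\<rho> / \<sigma>)) (sqrt (lam / (2 * \<sigma>\<^sup>2 * (deriv_norm2 h)\<^sup>2))) (1 / 2 * \<rho>\<^sup>2)"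
    using feedback(4) opt_hat by (simp add: location_scale_feedback_def)
  \<comment> \<open>From index 2 on the iterates coincide with the optimal control, so distribution
    functions and values are eventually constant sequences.\<close>
  have ev: "f \<longlonglongrightarrow> l" if "\<And>k. f (Suc (Suc k)) = l" for f :: "nat \<Rightarrow> 'z :: topological_space" and l
  proof -
    have "(\<lambda>k. f (k + 2)) \<longlonglongrightarrow> l" using that by simp
    then show ?thesis by (rule LIMSEQ_offset)
  qed
  show ?thesis
  proof (intro conjI ballI allI)
    fix t x w assume t: "t \<in> {0..T}"
    have eq: "P (Suc (Suc k)) t x w = P_opt t x w" "P_hat (Suc (Suc k)) t x w = P_hat_opt t x w" for k
      by (rule location_scale_feedback_unique[OF P Po t], rule location_scale_feedback_unique[OF P_hat Pho t])
    show "weak_conv_m (\<lambda>n. P n t x w) (P_opt t x w)" "weak_conv_m (\<lambda>n. P_hat n t x w) (P_hat_opt t x w)"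
      unfolding weak_conv_m_def weak_conv_def by (intro allI impI ev; simp add: eq)+
    from t have t': "0 \<le> t" "t \<le> T" by auto
    show "optimal_feedback M F W T \<rho> \<sigma> lam z (choquet h) P_opt t x w"
      by (rule choquet_verification(3)[OF t' Po params(6)])
    show "optimal_feedback M F W T \<rho> \<sigma> lam z (log_choquet h) P_hat_opt t x w"
      by (rule log_choquet_verification(3)[OF t' Pho])
    show "V_opt t x w = ereal ((x - w)\<^sup>2 * exp (- \<rho>\<^sup>2 * (T - t))
            - lam\<^sup>2 * (deriv_norm2 h)\<^sup>2 / (4 * \<rho>\<^sup>2 * \<sigma>\<^sup>2) * (exp (\<rho>\<^sup>2 * (T - t)) - 1) - (w - z)\<^sup>2)"
      unfolding V_opt by (rule choquet_verification(2)[OF t' Po params(6)])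
    show "V_hat_opt t x w = ereal ((x - w)\<^sup>2 * exp (- \<rho>\<^sup>2 * (T - t)) + lam * \<rho>\<^sup>2 / 4 * (T\<^sup>2 - t\<^sup>2)
            - lam / 2 * (\<rho>\<^sup>2 * T + ln (lam * (deriv_norm2 h)\<^sup>2 / (2 * exp 1 * \<sigma>\<^sup>2))) * (T - t) - (w - z)\<^sup>2)"
      unfolding V_hat_opt by (rule log_choquet_verification(2)[OF t' Pho])
  next
    fix t x w assume "t \<in> {0..<T}"
    then have t': "0 \<le> t" "t \<le> T" by auto
    show "(\<lambda>n. V n t x w) \<longlonglongrightarrow> V_opt t x w"
      by (rule ev) (simp only: V V_opt choquet_verification(1,2)[OF t' P params(6)])
    show "(\<lambda>n. V_hat n t x w) \<longlonglongrightarrow> V_hat_opt t x w"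
      by (rule ev) (simp only: V_hat V_hat_opt log_choquet_verification(1,2)[OF t' P_hat])
  qed
qed

end
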